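(* Let $u^\epsilon$ be the weak solution of the thin-domain diffusion problem and $u_i^\epsilon$ ($i=1,\dots,m$), $u_N^\epsilon$ its transformations to the reference domains $E_{\mathrm{ref}}$, $N_{\mathrm{ref}}$. Let $u_i^0\in H^1((0,L)^2)$, $u_N^0\in L^2(N)$ be limits along a sequence $\epsilon\to0$ (which exist up to a subsequence), i.e., regarding $u_i^0$ as a function of $(x_1,x_2)$ on $E_{\mathrm{ref}}$ and $u_N^0$ as a function of $x_1$ on $N_{\mathrm{ref}}$: $u_i^\epsilon\to u_i^0$ strongly and $\nabla u_i^\epsilon\rightharpoonup\nabla u_i^0$ weakly in $L^2(E_{\mathrm{ref}})$, $u_N^\epsilon\rightharpoonup u_N^0$ weakly in $L^2(N_{\mathrm{ref}})$, $\nabla_\perp u_N^\epsilon\to0$ strongly in $L^2(N_{\mathrm{ref}})$ and $\partial_3u_i^\epsilon\to0$ strongly in $L^2(E_{\mathrm{ref}})$. Define $u^0$ on the hypergraph by $$u^0(x)=u_i^0\Bigl(x_1,\tfrac{L}{L_i}(R_ix)_2\Bigr)\quad\text{for a.e. }x\in E_i,\ i=1,\dots,m .$$ Then $u^0\in\mathcal H$, $u^0|_{E_m}=0$ on $N_{m,e}$, and $u^0$ is the unique such function satisfying $$\sum_{i=1}^md_i\int_{E_i}\kappa_i\nabla_{E_i}u^0\cdot\nabla_{E_i}\phi\,dx=\int_Ng(x_1,0,0)\,\phi|_N\,dx_1+\sum_{i=1}^md_i\int_{E_i}f_i\,\phi\,dx$$ for all $\phi\in\mathcal H$ with $\phi|_{E_m}=0$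 on $N_{m,e}$.
   Context: Geometry: $m\ge1$ rectangles $E_1,\dots,E_m$ in $\mathbb R^3$ meet in the common side $N=\{se_1:s\in(0,L)\}$ (identified with $(0,L)$), $L>0$. $E_i$ has side lengths $L$ and $L_i>0$: with pairwise distinct unit vectors $\tau_i\in\mathbb R^2$, $E_i=\{(x_1,s\tau_i):x_1\in(0,L),\,s\in(0,L_i)\}$. $N_{i,e}=\{(x_1,L_i\tau_i):x_1\in(0,L)\}$ is the side of $E_i$ opposite to $N$. Let $n_i\in\mathbb R^2$ be a unit vector orthogonal to $\tau_i$, $\nu_i=(0,n_i)$, $d_i>0$, and let $R_i\in\mathbb R^{3\times3}$ be the rotation about the $x_1$-axis (orientation of $n_i$ chosen accordingly) with $R_i(0,\tau_i)=e_2$, $R_i\nu_i=e_3$. With a fixed $\alpha>0$ (independent of $\epsilon$) put $E_i^\epsilon=\{(x_1,s\tau_i+tn_i):x_1\in(0,L),\ \alpha\epsilon<s<L_i,\ |t|<d_i\epsilon/2\}$, $S_i^\epsilon=\{(x_1,\alpha\epsilon\tau_i+tn_i):x_1\in(0,L),\ |t|<d_i\epsilon/2\}$, and let $N^\epsilon$ be the interior of the convex hull of $\overline N,\overline{S_1^\epsilon},\dots,\overline{S_m^\epsilon}$, so $N^\epsilon=(0,L)\times\epsilon\omega$ with $\omega\subset\mathbb R^2$ independent of $\epsilon$. $\alpha$ is chosen such that for small $\epsilon$ the sets $E_1^\epsilon,\dots,E_m^\epsilon,N^\epsilon$ do not overlap; only such small $\epsilon>0$ (with $\alpha\epsilon<\min_iL_i$)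 are considered. The thin domain is $\Omega^\epsilon=N^\epsilon\cup\bigcup_{i=1}^m(E_i^\epsilon\cup S_i^\epsilon)$. The Dirichlet face $S_D^\epsilon$ is the face of $E_m^\epsilon$ opposite to $S_m^\epsilon$ (where $s=L_m$). Problem: $-\nabla\cdot(\kappa^\epsilon\nabla u^\epsilon)=f^\epsilon$ in $\Omega^\epsilon$, $u^\epsilon=0$ on $S_D^\epsilon$, $-\kappa^\epsilon\nabla u^\epsilon\cdot\nu=0$ on $\partial\Omega^\epsilon\setminus S_D^\epsilon$. Its weak solution is the unique $u^\epsilon\in H^1_D(\Omega^\epsilon)=\{u\in H^1(\Omega^\epsilon):u|_{S_D^\epsilon}=0\}$ with $\int_{\Omega^\epsilon}\kappa^\epsilon\nabla u^\epsilon\cdot\nabla\phi\,dx=\int_{\Omega^\epsilon}f^\epsilon\phi\,dx$ for all $\phi\in H^1_D(\Omega^\epsilon)$. Here $\kappa^\epsilon=\kappa_i$ on $E_i^\epsilon$ and $\kappa^\epsilon=\kappa_N$ on $N^\epsilon$ with constants $\kappa_i,\kappa_N>0$; $f^\epsilon=f_i$ on $E_i^\epsilon$ with $f_i\in C^0(\mathbb R^3)$, and $f^\epsilon=\frac1{\epsilon|\omega|}g$ on $N^\epsilon$ with $g\in C^0(\mathbb R^3)$; all of $\kappa_i,\kappa_N,f_i,g$ are independent of $\epsilon$. Transformation: $E_{\mathrm{ref}}=(0,L)\times(0,L)\times(-\tfrac12,\tfrac12)$, $N_{\mathrm{ref}}=(0,L)\times\omega$. $\Phi_N^\epsilon:N^\epsilon\to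 N_{\mathrm{ref}}$, $\Phi_N^\epsilon(x)=(x_1,\epsilon^{-1}x_2,\epsilon^{-1}x_3)$; $\Phi_i^\epsilon:E_i^\epsilon\to E_{\mathrm{ref}}$, $\Phi_i^\epsilon(x)=A_i^\epsilon R_ix+a_i^\epsilon$ with $A_i^\epsilon=\mathrm{diag}\bigl(1,\tfrac{L}{L_i-\alpha\epsilon},\tfrac1{d_i\epsilon}\bigr)$, $a_i^\epsilon=\bigl(0,-\tfrac{L\alpha\epsilon}{L_i-\alpha\epsilon},0\bigr)^T$. Then $u_i^\epsilon=u^\epsilon\circ(\Phi_i^\epsilon)^{-1}$ on $E_{\mathrm{ref}}$ and $u_N^\epsilon=u^\epsilon\circ(\Phi_N^\epsilon)^{-1}$ on $N_{\mathrm{ref}}$. Notation: $\nabla_\perp=(\partial_2,\partial_3)^T$. Limit space: $\mathcal H$ is the set of $u\in\bigoplus_{i=1}^mH^1(E_i)$ such that the traces on $N$ of $u|_{E_1},\dots,u|_{E_m}$ all coincide; this common trace is written $u|_N$. $\nabla_{E_i}$ is the tangential gradient on the planar rectangle $E_i$, and $dx$ on $E_i$ is its two-dimensional surface measure. *)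

theory Defs
  imports "HOL-Analysis.Analysis"
begin

section \<open>Lebesgue and Sobolev spaces\<close>

text \<open>Functions stand for their equivalence classes modulo equality almost everywhere on
  the domain; their values outside the domain are irrelevant.\<close>

definition L2 :: "'a::euclidean_space set \<Rightarrow> ('a \<Rightarrow> 'b::euclidean_space) \<Rightarrow> bool" where
  "L2 \<Omega> u \<longleftrightarrow> u \<in> borel_measurable (lebesgue_on \<Omega>) \<and>
     integrable (lebesgue_on \<Omega>) (\<lambda>x. (norm (u x))\<^sup>2)"

definition L2_tendsto ::
  "'a::euclidean_space set \<Rightarrow> (nat \<Rightarrow> 'a \<Rightarrow> 'b::euclidean_space) \<Rightarrow> ('a \<Rightarrow> 'b) \<Rightarrow> bool" where
  "L2_tendsto \<Omega> us u \<longleftrightarrow> (\<forall>k. L2 \<Omega> (us k)) \<and> L2 \<Omega> u \<and>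
     (\<lambda>k. LINT x|lebesgue_on \<Omega>. (norm (us k x - u x))\<^sup>2) \<longlonglongrightarrow> 0"

definition L2_weak_tendsto ::
  "'a::euclidean_space set \<Rightarrow> (nat \<Rightarrow> 'a \<Rightarrow> 'b::euclidean_space) \<Rightarrow> ('a \<Rightarrow> 'b) \<Rightarrow> bool" where
  "L2_weak_tendsto \<Omega> us u \<longleftrightarrow> (\<forall>k. L2 \<Omega> (us k)) \<and> L2 \<Omega> u \<and>
     (\<forall>\<psi>. L2 \<Omega> \<psi> \<longrightarrow>
        (\<lambda>k. LINT x|lebesgue_on \<Omega>. us k x \<bullet> \<psi> x) \<longlonglongrightarrow> (LINT x|lebesgue_on \<Omega>. u x \<bullet> \<psi> x))"

primrec C_k :: "nat \<Rightarrow> ('a::euclidean_space \<Rightarrow> real) \<Rightarrow> bool" where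
  "C_k 0 f \<longleftrightarrow> continuous_on UNIV f"
| "C_k (Suc k) f \<longleftrightarrow> (\<forall>x. f differentiable (at x)) \<and>
     (\<forall>b\<in>Basis. C_k k (\<lambda>x. frechet_derivative f (at x) b))"

definition smooth :: "('a::euclidean_space \<Rightarrow> real) \<Rightarrow> bool" where
  "smooth f \<longleftrightarrow> (\<forall>k. C_k k f)"

definition test_function :: "'a::euclidean_space set \<Rightarrow> ('a \<Rightarrow> real) \<Rightarrow> bool" where
  "test_function \<Omega> \<phi> \<longleftrightarrow> smooth \<phi> \<and> (\<exists>K. compact K \<and> K \<subseteq> \<Omega> \<and> (\<forall>x. x \<notin> K \<longrightarrow> \<phi> x = 0))"

definition is_weak_grad :: "'a::euclidean_space set \<Rightarrow> ('a \<Rightarrow> real) \<Rightarrow> ('a \<Rightarrow> 'a) \<Rightarrow> bool" where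
  "is_weak_grad \<Omega> u v \<longleftrightarrow> L2 \<Omega> v \<and>
     (\<forall>\<phi>. test_function \<Omega> \<phi> \<longrightarrow> (\<forall>b\<in>Basis.
        (LINT x|lebesgue_on \<Omega>. u x * frechet_derivative \<phi> (at x) b) =
        - (LINT x|lebesgue_on \<Omega>. (v x \<bullet> b) * \<phi> x)))"

definition H1 :: "'a::euclidean_space set \<Rightarrow> ('a \<Rightarrow> real) \<Rightarrow> bool" where
  "H1 \<Omega> u \<longleftrightarrow> L2 \<Omega> u \<and> (\<exists>v. is_weak_grad \<Omega> u v)"

text \<open>For \<open>u\<close> in $H^1$ of an open set, the weak gradient is determined almost everywhere.\<close>

definition wgrad :: "'a::euclidean_space set \<Rightarrow> ('a \<Rightarrow> real) \<Rightarrow> 'a \<Rightarrow> 'a" where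
  "wgrad \<Omega> u = (SOME v. is_weak_grad \<Omega> u v)"

definition H1_tendsto ::
  "'a::euclidean_space set \<Rightarrow> (nat \<Rightarrow> 'a \<Rightarrow> real) \<Rightarrow> ('a \<Rightarrow> real) \<Rightarrow> bool" where
  "H1_tendsto \<Omega> us u \<longleftrightarrow> (\<forall>k. H1 \<Omega> (us k)) \<and> H1 \<Omega> u \<and> L2_tendsto \<Omega> us u \<and>
     L2_tendsto \<Omega> (\<lambda>k. wgrad \<Omega> (us k)) (wgrad \<Omega> u)"

text \<open>\<open>has_trace \<Omega> \<gamma> T u h\<close>: the trace of \<open>u\<close> on the flat piece \<open>\<gamma> ` T\<close> of the boundary of
  the bounded Lipschitz domain \<open>\<Omega>\<close> is \<open>h\<close>, where \<open>\<gamma>\<close> is an affine isometry on \<open>T\<close> and the trace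
  is expressed in the coordinates of \<open>T\<close>. This is the graph of the continuous extension to
  $H^1(\Omega)$ of the restriction map on functions that are smooth up to the boundary.\<close>

definition has_trace ::
  "'a::euclidean_space set \<Rightarrow> ('b::euclidean_space \<Rightarrow> 'a) \<Rightarrow> 'b set \<Rightarrow>
     ('a \<Rightarrow> real) \<Rightarrow> ('b \<Rightarrow> real) \<Rightarrow> bool" where
  "has_trace \<Omega> \<gamma> T u h \<longleftrightarrow>
     (\<exists>us. (\<forall>k. smooth (us k)) \<and> H1_tendsto \<Omega> us u \<and> L2_tendsto T (\<lambda>k. us k \<circ> \<gamma>) h)"

section \<open>Geometry\<close>

definition pt :: "real \<Rightarrow> real^2 \<Rightarrow> real^3" where
  "pt a y = vector [a, y $ 1, y $ 2]"

definition pt2 :: "real \<Rightarrow> real \<Rightarrow> real^2" where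
  "pt2 a b = vector [a, b]"

definition diag :: "real^'n \<Rightarrow> real^'n^'n" where
  "diag v = (\<chi> i j. if i = j then v $ i else 0)"

text \<open>The rectangles are indexed by \<open>i \<in> {1..num G}\<close>. In the notation of the mathematics the
  fields are $m$, $L$, $L_i$, $\tau_i$, $n_i$, $R_i$, $d_i$ and $\alpha$.\<close>

record hypergraph =
  num :: nat
  len :: real
  width :: "nat \<Rightarrow> real"
  dir :: "nat \<Rightarrow> real^2"
  nrm :: "nat \<Rightarrow> real^2"
  rot :: "nat \<Rightarrow> real^3^3"
  thick :: "nat \<Rightarrow> real"
  alpha :: real

definition N_line :: "hypergraph \<Rightarrow> (real^3) set" where
  "N_line G = {pt x1 0 |x1. x1 \<in> {0<..<len G}}"

definition E_rect :: "hypergraph \<Rightarrow> nat \<Rightarrow> (real^3) set" where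
  "E_rect G i = {pt x1 (s *\<^sub>R dir G i) |x1 s. x1 \<in> {0<..<len G} \<and> s \<in> {0<..<width G i}}"

definition E_thin :: "hypergraph \<Rightarrow> real \<Rightarrow> nat \<Rightarrow> (real^3) set" where
  "E_thin G \<epsilon> i = {pt x1 (s *\<^sub>R dir G i + t *\<^sub>R nrm G i) |x1 s t.
     x1 \<in> {0<..<len G} \<and> s \<in> {alpha G * \<epsilon><..<width G i} \<and> \<bar>t\<bar> < thick G i * \<epsilon> / 2}"

definition S_thin :: "hypergraph \<Rightarrow> real \<Rightarrow> nat \<Rightarrow> (real^3) set" where
  "S_thin G \<epsilon> i = {pt x1 ((alpha G * \<epsilon>) *\<^sub>R dir G i + t *\<^sub>R nrm G i) |x1 t.
     x1 \<in> {0<..<len G} \<and> \<bar>t\<bar> < thick G i * \<epsilon> / 2}"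

definition N_thin :: "hypergraph \<Rightarrow> real \<Rightarrow> (real^3) set" where
  "N_thin G \<epsilon> =
     interior (convex hull (closure (N_line G) \<union> (\<Union>i\<in>{1..num G}. closure (S_thin G \<epsilon> i))))"

definition omega :: "hypergraph \<Rightarrow> (real^2) set" where
  "omega G = interior (convex hull
     ({0} \<union> (\<Union>i\<in>{1..num G}. {alpha G *\<^sub>R dir G i + t *\<^sub>R nrm G i |t. \<bar>t\<bar> \<le> thick G i / 2})))"

definition Omega_thin :: "hypergraph \<Rightarrow> real \<Rightarrow> (real^3) set" where
  "Omega_thin G \<epsilon> = N_thin G \<epsilon> \<union> (\<Union>i\<in>{1..num G}. E_thin G \<epsilon> i \<union> S_thin G \<epsilon> i)"

definition non_overlapping :: "hypergraph \<Rightarrow> real \<Rightarrow> bool" where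
  "non_overlapping G \<epsilon> \<longleftrightarrow>
     disjoint_family_on (E_thin G \<epsilon>) {1..num G} \<and>
     (\<forall>i\<in>{1..num G}. E_thin G \<epsilon> i \<inter> N_thin G \<epsilon> = {})"

definition admissible_eps :: "hypergraph \<Rightarrow> real \<Rightarrow> bool" where
  "admissible_eps G \<epsilon> \<longleftrightarrow> 0 < \<epsilon> \<and> (\<forall>i\<in>{1..num G}. alpha G * \<epsilon> < width G i) \<and>
     non_overlapping G \<epsilon>"

definition hypergraph_geometry :: "hypergraph \<Rightarrow> bool" where
  "hypergraph_geometry G \<longleftrightarrow>
     num G \<ge> 1 \<and> len G > 0 \<and> alpha G > 0 \<and>
     (\<forall>i\<in>{1..num G}. width G i > 0 \<and> thick G i > 0) \<and>
     (\<forall>i\<in>{1..num G}. norm (dir G i) = 1 \<and> norm (nrm G i) = 1 \<and> dir G i \<bullet> nrm G i = 0) \<and>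
     inj_on (dir G) {1..num G} \<and>
     (\<forall>i\<in>{1..num G}. rotation_matrix (rot G i) \<and>
        rot G i *v axis 1 1 = axis 1 1 \<and>
        rot G i *v pt 0 (dir G i) = axis 2 1 \<and>
        rot G i *v pt 0 (nrm G i) = axis 3 1) \<and>
     (\<exists>\<epsilon>0>0. \<forall>\<epsilon>. 0 < \<epsilon> \<and> \<epsilon> < \<epsilon>0 \<longrightarrow> non_overlapping G \<epsilon>)"

lemma linear_pt: "linear (\<lambda>(a, y). pt a y)"
  by (rule linearI) (auto simp: pt_def vec_eq_iff forall_3)

lemma bij_pt: "bij (\<lambda>(a, y). pt a y)"
proof (rule bijI)
  show "inj (\<lambda>(a, y). pt a y)"
    by (auto simp: inj_def pt_def vec_eq_iff forall_3 forall_2)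
  show "surj (\<lambda>(a, y). pt a y)"
  proof (rule surjI)
    show "(\<lambda>(a, y). pt a y) (x $ 1, vector [x $ 2, x $ 3]) = x" for x
      by (auto simp: pt_def vec_eq_iff forall_3)
  qed
qed

lemma closure_seg:
  fixes a n :: "real^2"
  assumes "n \<noteq> 0" "r > 0"
  shows "closure {a + t *\<^sub>R n |t. \<bar>t\<bar> < r} = {a + t *\<^sub>R n |t. \<bar>t\<bar> \<le> r}"
proof -
  have e: "{a + t *\<^sub>R n |t. \<bar>t\<bar> < r} = (+) a ` (\<lambda>t. t *\<^sub>R n) ` {-r<..<r}"
    by (auto simp: image_iff abs_less_iff) (metis abs_less_iff minus_less_iff greaterThanLessThan_iff)
  have e2: "{a + t *\<^sub>R n |t. \<bar>t\<bar> \<le> r} = (+) a ` (\<lambda>t. t *\<^sub>R n) ` {-r..r}"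
    by (auto simp: image_iff abs_le_iff) (metis abs_le_iff minus_le_iff atLeastAtMost_iff)
  have "closure ((\<lambda>t. t *\<^sub>R n) ` {-r<..<r}) = (\<lambda>t. t *\<^sub>R n) ` closure {-r<..<r}"
    using assms by (intro closure_injective_linear_image [symmetric]) (auto simp: inj_on_def intro!: linearI scaleR_add_left)
  then show ?thesis
    using assms by (simp add: e e2 closure_translation)
qed

lemma N_thin_eq:
  assumes "hypergraph_geometry G" "0 < \<epsilon>"
  shows "N_thin G \<epsilon> = {pt x1 (\<epsilon> *\<^sub>R y) |x1 y. x1 \<in> {0<..<len G} \<and> y \<in> omega G}"
proof -
  let ?P = "\<lambda>(a, y). pt a y"
  let ?A = "\<lambda>i. {alpha G *\<^sub>R dir G i + t *\<^sub>R nrm G i |t. \<bar>t\<bar> \<le> thick G i / 2}"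
  let ?U = "{0} \<union> (\<Union>i\<in>{1..num G}. ?A i)"
  have L: "len G > 0" and i1: "num G \<ge> 1"
    and n1: "\<forall>i\<in>{1..num G}. norm (nrm G i) = 1 \<and> thick G i > 0"
    using assms(1) unfolding hypergraph_geometry_def by blast+
  have n: "nrm G i \<noteq> 0 \<and> thick G i > 0" if "i \<in> {1..num G}" for i
    using bspec [OF n1 that] by auto
  have inj: "inj ?P" using bij_pt by (rule bij_is_inj)
  have cl: "closure (?P ` S) = ?P ` closure S" for S
    by (rule closure_injective_linear_image [OF linear_pt inj, symmetric])
  have cN: "closure (N_line G) = ?P ` ({0..len G} \<times> {0})"
  proof -
    have "N_line G = ?P ` ({0<..<len G} \<times> {0})" by (auto simp: N_line_def)
    then show ?thesis using L by (simp only: cl closure_Times) simp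
  qed
  have cS: "closure (S_thin G \<epsilon> i) = ?P ` ({0..len G} \<times> ((*\<^sub>R) \<epsilon> ` ?A i))"
    if i: "i \<in> {1..num G}" for i
  proof -
    let ?T = "{(alpha G * \<epsilon>) *\<^sub>R dir G i + t *\<^sub>R nrm G i |t. \<bar>t\<bar> < thick G i * \<epsilon> / 2}"
    have "S_thin G \<epsilon> i = ?P ` ({0<..<len G} \<times> ?T)" by (force simp: S_thin_def)
    then have "closure (S_thin G \<epsilon> i) = ?P ` ({0..len G} \<times> closure ?T)"
      using L by (simp only: cl closure_Times) simp
    also have "closure ?T =
        {(alpha G * \<epsilon>) *\<^sub>R dir G i + t *\<^sub>R nrm G i |t. \<bar>t\<bar> \<le> thick G i * \<epsilon> / 2}"
      using n[OF i] assms(2) by (intro closure_seg) auto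
    also have "\<dots> = (*\<^sub>R) \<epsilon> ` ?A i"
    proof (intro equalityI subsetI)
      fix y assume "y \<in> {(alpha G * \<epsilon>) *\<^sub>R dir G i + t *\<^sub>R nrm G i |t. \<bar>t\<bar> \<le> thick G i * \<epsilon> / 2}"
      then obtain t where t: "y = (alpha G * \<epsilon>) *\<^sub>R dir G i + t *\<^sub>R nrm G i" "\<bar>t\<bar> \<le> thick G i * \<epsilon> / 2"
        by blast
      have "y = \<epsilon> *\<^sub>R (alpha G *\<^sub>R dir G i + (t / \<epsilon>) *\<^sub>R nrm G i)"
        using assms(2) t(1) by (simp add: scaleR_add_right mult.commute)
      moreover have "\<bar>t / \<epsilon>\<bar> \<le> thick G i / 2"
        using assms(2) t(2) by (simp add: field_simps)
      ultimately show "y \<in> (*\<^sub>R) \<epsilon> ` ?A i" by blast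
    next
      fix y assume "y \<in> (*\<^sub>R) \<epsilon> ` ?A i"
      then obtain t where t: "y = \<epsilon> *\<^sub>R (alpha G *\<^sub>R dir G i + t *\<^sub>R nrm G i)" "\<bar>t\<bar> \<le> thick G i / 2"
        by blast
      have "y = (alpha G * \<epsilon>) *\<^sub>R dir G i + (\<epsilon> * t) *\<^sub>R nrm G i"
        using t(1) by (simp add: scaleR_add_right mult.commute)
      moreover have "\<bar>\<epsilon> * t\<bar> \<le> thick G i * \<epsilon> / 2"
        using assms(2) t(2) by (simp add: abs_mult mult.commute)
      ultimately show "y \<in> {(alpha G * \<epsilon>) *\<^sub>R dir G i + t *\<^sub>R nrm G i |t. \<bar>t\<bar> \<le> thick G i * \<epsilon> / 2}"
        by blast
    qed
    finally show ?thesis .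
  qed
  have "closure (N_line G) \<union> (\<Union>i\<in>{1..num G}. closure (S_thin G \<epsilon> i)) =
      ?P ` ({0..len G} \<times> ((*\<^sub>R) \<epsilon> ` ?U))"
  proof -
    have "(\<Union>i\<in>{1..num G}. closure (S_thin G \<epsilon> i)) =
        (\<Union>i\<in>{1..num G}. ?P ` ({0..len G} \<times> ((*\<^sub>R) \<epsilon> ` ?A i)))"
      using cS by simp
    also have "\<dots> = ?P ` ({0..len G} \<times> ((*\<^sub>R) \<epsilon> ` (\<Union>i\<in>{1..num G}. ?A i)))"
      by blast
    finally show ?thesis
      unfolding cN by (simp only: image_Un Sigma_Un_distrib2 image_insert image_empty scaleR_zero_right)
  qed
  then have "N_thin G \<epsilon> = interior (convex hull (?P ` ({0..len G} \<times> ((*\<^sub>R) \<epsilon> ` ?U))))"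
    by (simp add: N_thin_def)
  also have "\<dots> = ?P ` interior ({0..len G} \<times> ((*\<^sub>R) \<epsilon> ` (convex hull ?U)))"
  proof -
    have "convex hull (?P ` ({0..len G} \<times> ((*\<^sub>R) \<epsilon> ` ?U))) =
        ?P ` ((convex hull {0..len G}) \<times> (convex hull ((*\<^sub>R) \<epsilon> ` ?U)))"
      by (simp only: convex_hull_linear_image [OF linear_pt, symmetric] convex_hull_Times)
    also have "convex hull {0..len G} = {0..len G}" by (simp add: hull_same)
    also have "convex hull ((*\<^sub>R) \<epsilon> ` ?U) = (*\<^sub>R) \<epsilon> ` (convex hull ?U)"
      by (rule convex_hull_scaling)
    finally show ?thesis
      by (simp only: interior_bijective_linear_image [OF linear_pt bij_pt])
  qed
  also have "interior ({0..len G} \<times> ((*\<^sub>R) \<epsilon> ` (convex hull ?U))) =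
      {0<..<len G} \<times> ((*\<^sub>R) \<epsilon> ` omega G)"
    using assms(2) by (simp add: interior_Times omega_def interior_injective_linear_image inj_on_def linear_scaleR)
  finally show ?thesis by force
qed

section \<open>The thin-domain problem\<close>

text \<open>The fields are $\kappa_i$, $\kappa_N$, $f_i$ and $g$.\<close>

record coefficients =
  kap :: "nat \<Rightarrow> real"
  kapN :: real
  src :: "nat \<Rightarrow> real^3 \<Rightarrow> real"
  srcN :: "real^3 \<Rightarrow> real"

definition admissible_coefficients :: "hypergraph \<Rightarrow> coefficients \<Rightarrow> bool" where
  "admissible_coefficients G D \<longleftrightarrow> kapN D > 0 \<and> continuous_on UNIV (srcN D) \<and>
     (\<forall>i\<in>{1..num G}. kap D i > 0 \<and> continuous_on UNIV (src D i))"

text \<open>The sets in the following two sums are disjoint, and they cover the thin domain up to the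
  null sets \<open>S_thin G \<epsilon> i\<close>.\<close>

definition kap_thin :: "hypergraph \<Rightarrow> coefficients \<Rightarrow> real \<Rightarrow> real^3 \<Rightarrow> real" where
  "kap_thin G D \<epsilon> x = (\<Sum>i\<in>{1..num G}. indicator (E_thin G \<epsilon> i) x * kap D i) +
     indicator (N_thin G \<epsilon>) x * kapN D"

definition src_thin :: "hypergraph \<Rightarrow> coefficients \<Rightarrow> real \<Rightarrow> real^3 \<Rightarrow> real" where
  "src_thin G D \<epsilon> x = (\<Sum>i\<in>{1..num G}. indicator (E_thin G \<epsilon> i) x * src D i x) +
     indicator (N_thin G \<epsilon>) x * (1 / (\<epsilon> * measure lebesgue (omega G)) * srcN D x)"

text \<open>The Dirichlet face is parametrised by \<open>(x\<^sub>1, t)\<close>.\<close>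

definition H1_D :: "hypergraph \<Rightarrow> real \<Rightarrow> (real^3 \<Rightarrow> real) \<Rightarrow> bool" where
  "H1_D G \<epsilon> u \<longleftrightarrow> H1 (Omega_thin G \<epsilon>) u \<and>
     (let m = num G in
      has_trace (Omega_thin G \<epsilon>)
        (\<lambda>y::real^2. pt (y $ 1) (width G m *\<^sub>R dir G m + (y $ 2) *\<^sub>R nrm G m))
        {y. y $ 1 \<in> {0<..<len G} \<and> \<bar>y $ 2\<bar> < thick G m * \<epsilon> / 2}
        u (\<lambda>_. 0))"

definition thin_weak_solution ::
  "hypergraph \<Rightarrow> coefficients \<Rightarrow> real \<Rightarrow> (real^3 \<Rightarrow> real) \<Rightarrow> bool" where
  "thin_weak_solution G D \<epsilon> u \<longleftrightarrow> H1_D G \<epsilon> u \<and>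
     (let \<Omega> = Omega_thin G \<epsilon> in
      \<forall>\<phi>. H1_D G \<epsilon> \<phi> \<longrightarrow>
        (LINT x|lebesgue_on \<Omega>. kap_thin G D \<epsilon> x * (wgrad \<Omega> u x \<bullet> wgrad \<Omega> \<phi> x)) =
        (LINT x|lebesgue_on \<Omega>. src_thin G D \<epsilon> x * \<phi> x))"

section \<open>Transformation to the reference domains\<close>

definition E_ref :: "hypergraph \<Rightarrow> (real^3) set" where
  "E_ref G = {x. x $ 1 \<in> {0<..<len G} \<and> x $ 2 \<in> {0<..<len G} \<and> x $ 3 \<in> {-1/2<..<1/2}}"

definition N_ref :: "hypergraph \<Rightarrow> (real^3) set" where
  "N_ref G = {pt x1 y |x1 y. x1 \<in> {0<..<len G} \<and> y \<in> omega G}"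

definition Phi_E :: "hypergraph \<Rightarrow> real \<Rightarrow> nat \<Rightarrow> real^3 \<Rightarrow> real^3" where
  "Phi_E G \<epsilon> i x =
     diag (vector [1, len G / (width G i - alpha G * \<epsilon>), 1 / (thick G i * \<epsilon>)]) *v (rot G i *v x)
     + vector [0, - (len G * alpha G * \<epsilon> / (width G i - alpha G * \<epsilon>)), 0]"

definition Phi_N :: "real \<Rightarrow> real^3 \<Rightarrow> real^3" where
  "Phi_N \<epsilon> x = vector [x $ 1, inverse \<epsilon> * x $ 2, inverse \<epsilon> * x $ 3]"

text \<open>For admissible \<open>\<epsilon>\<close> both maps are affine bijections of the whole space.\<close>

definition to_E_ref :: "hypergraph \<Rightarrow> real \<Rightarrow> nat \<Rightarrow> (real^3 \<Rightarrow> real) \<Rightarrow> real^3 \<Rightarrow> real" where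
  "to_E_ref G \<epsilon> i u = u \<circ> inv (Phi_E G \<epsilon> i)"

definition to_N_ref :: "real \<Rightarrow> (real^3 \<Rightarrow> real) \<Rightarrow> real^3 \<Rightarrow> real" where
  "to_N_ref \<epsilon> u = u \<circ> inv (Phi_N \<epsilon>)"

section \<open>The limit problem on the hypergraph\<close>

text \<open>The planar rectangle \<open>E_rect G i\<close> is the isometric image of \<open>E_dom G i\<close> under \<open>chart G i\<close>;
  Sobolev spaces, traces and surface integrals on it are those of the chart. As the rectangles
  are pairwise disjoint, a family of functions on them is a single function on space.\<close>

definition E_dom :: "hypergraph \<Rightarrow> nat \<Rightarrow> (real^2) set" where
  "E_dom G i = {y. y $ 1 \<in> {0<..<len G} \<and> y $ 2 \<in> {0<..<width G i}}"

definition chart :: "hypergraph \<Rightarrow> nat \<Rightarrow> real^2 \<Rightarrow> real^3" where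
  "chart G i y = pt (y $ 1) ((y $ 2) *\<^sub>R dir G i)"

definition surf_integral :: "hypergraph \<Rightarrow> nat \<Rightarrow> (real^3 \<Rightarrow> real) \<Rightarrow> real" where
  "surf_integral G i h = (LINT y|lebesgue_on (E_dom G i). h (chart G i y))"

definition AE_on_E :: "hypergraph \<Rightarrow> nat \<Rightarrow> (real^3 \<Rightarrow> bool) \<Rightarrow> bool" where
  "AE_on_E G i P \<longleftrightarrow> (AE y in lebesgue_on (E_dom G i). P (chart G i y))"

definition H1_E :: "hypergraph \<Rightarrow> nat \<Rightarrow> (real^3 \<Rightarrow> real) \<Rightarrow> bool" where
  "H1_E G i u \<longleftrightarrow> H1 (E_dom G i) (u \<circ> chart G i)"

definition tgrad :: "hypergraph \<Rightarrow> nat \<Rightarrow> (real^3 \<Rightarrow> real) \<Rightarrow> real^3 \<Rightarrow> real^3" where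
  "tgrad G i u x = (let v = wgrad (E_dom G i) (u \<circ> chart G i) (inv_into (E_dom G i) (chart G i) x)
     in pt (v $ 1) ((v $ 2) *\<^sub>R dir G i))"

definition trace_on_N :: "hypergraph \<Rightarrow> nat \<Rightarrow> (real^3 \<Rightarrow> real) \<Rightarrow> (real \<Rightarrow> real) \<Rightarrow> bool" where
  "trace_on_N G i u h \<longleftrightarrow>
     has_trace (E_dom G i) (\<lambda>x1. pt2 x1 0) {0<..<len G} (u \<circ> chart G i) h"

definition trace_on_Ne :: "hypergraph \<Rightarrow> nat \<Rightarrow> (real^3 \<Rightarrow> real) \<Rightarrow> (real \<Rightarrow> real) \<Rightarrow> bool" where
  "trace_on_Ne G i u h \<longleftrightarrow>
     has_trace (E_dom G i) (\<lambda>x1. pt2 x1 (width G i)) {0<..<len G} (u \<circ> chart G i) h"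

definition limit_space :: "hypergraph \<Rightarrow> (real^3 \<Rightarrow> real) set" where
  "limit_space G = {u. (\<forall>i\<in>{1..num G}. H1_E G i u) \<and>
     (\<exists>h. \<forall>i\<in>{1..num G}. trace_on_N G i u h)}"

definition common_trace :: "hypergraph \<Rightarrow> (real^3 \<Rightarrow> real) \<Rightarrow> real \<Rightarrow> real" where
  "common_trace G u = (SOME h. \<forall>i\<in>{1..num G}. trace_on_N G i u h)"

definition limit_equation ::
  "hypergraph \<Rightarrow> coefficients \<Rightarrow> (real^3 \<Rightarrow> real) \<Rightarrow> (real^3 \<Rightarrow> real) \<Rightarrow> bool" where
  "limit_equation G D u \<phi> \<longleftrightarrow>
     (\<Sum>i\<in>{1..num G}. thick G i *
        surf_integral G i (\<lambda>x. kap D i * (tgrad G i u x \<bullet> tgrad G i \<phi> x))) =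
     (LINT x1|lebesgue_on {0<..<len G}. srcN D (vector [x1, 0, 0]) * common_trace G \<phi> x1) +
     (\<Sum>i\<in>{1..num G}. thick G i * surf_integral G i (\<lambda>x. src D i x * \<phi> x))"

definition limit_weak_solution ::
  "hypergraph \<Rightarrow> coefficients \<Rightarrow> (real^3 \<Rightarrow> real) \<Rightarrow> bool" where
  "limit_weak_solution G D u \<longleftrightarrow>
     u \<in> limit_space G \<and> trace_on_Ne G (num G) u (\<lambda>_. 0) \<and>
     (\<forall>\<phi>\<in>limit_space G. trace_on_Ne G (num G) \<phi> (\<lambda>_. 0) \<longrightarrow> limit_equation G D u \<phi>)"

end

(* Traces are detected by Green's formula in a rectangle.  Testing the weak gradient of u^eps with a
   field that equals zeta(x_1) B(s) b(t) in one plate and decays inside the junction gives in the limit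
   Green's formula for u_i^0 with the same boundary function u_N^0 on N for every i, so all traces on N
   coincide; the same idea at the Dirichlet face gives the trace 0 on N_{m,e}.  Smooth functions on the
   plates that agree near N are glued by cutoffs to test functions of the thin problem.  The junction has
   volume of order eps^2 and its cross-sectional gradient tends to 0, but the longitudinal derivative of
   u_N is not controlled: this term is integrated by parts in x_1 before passing to the limit.  These
   test functions are dense in the limit space because functions whose traces tend to 0 can be cut off
   in a thin strip at small cost.  Uniqueness follows from the energy and the trace inequality. *)

theory Submission
  imports Defs
begin

text \<open>Dividing by \<epsilon> fixes every balance. Inside the junction the test field has a
  derivative of order 1/\<epsilon> on a set of volume of order \<epsilon>^2, so the values of u
  there weigh as much as those in a plate, whose volume has order \<epsilon>; the gradient terms of
  the junction keep a factor \<epsilon>. The weight of u_N^0 that results is a cross-section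
  integral depending on the cutoffs; it is not computed but read off by inserting the constant
  function 1 into the same identity. The integration by parts in x_1 leaves no boundary terms only
  if the common values h on N have h' compactly supported in (0,L), and gluing needs plate functions
  that do not depend on s near N. Both are reached by composing with smooth retractions of the
  coordinates whose first derivatives stay bounded. A trace is encoded by a sequence of smooth
  approximations, and such a sequence serves one side of the rectangle only; on the plate m two
  sequences are blended before values on N are matched. Plates of the thin domain are shorter than
  the limit rectangles, whence the dilation \<open>mu\<close>, which tends to 1.\<close>

abbreviation leb :: "'a::euclidean_space set \<Rightarrow> 'a measure" where "leb \<equiv> lebesgue_on"
abbreviation mbl :: "'a::euclidean_space set \<Rightarrow> ('a \<Rightarrow> 'b::topological_space) set" where "mbl S \<equiv> borel_measurable (leb S)"

section \<open>Calculus of smooth functions\<close>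

text \<open>Riesz representative of the Frechet derivative: a vector field, as the weak gradients
  are, so that both kinds can be subtracted and compared in L2.\<close>

definition grad :: "('a::euclidean_space \<Rightarrow> real) \<Rightarrow> 'a \<Rightarrow> 'a" where
  "grad f x = (\<Sum>b\<in>Basis. frechet_derivative f (at x) b *\<^sub>R b)"

declare C_k.simps(2) [simp del]

text \<open>\<open>C_k\<close> is stated with \<open>frechet_derivative\<close>; uniqueness of
  derivatives lets any explicit formula stand in for it.\<close>

lemma C_k_SucI:
  assumes "\<And>x. (f has_derivative f' x) (at x)" "\<And>b. b \<in> Basis \<Longrightarrow> C_k k (\<lambda>x. f' x b)"
  shows "C_k (Suc k) f"
proof -
  have "frechet_derivative f (at x) = f' x" for x
    using frechet_derivative_at[OF assms(1)] by simp
  then show ?thesis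
    using assms by (auto simp: differentiable_def C_k.simps(2))
qed

lemma C_k_Suc_derivative:
  assumes "C_k (Suc k) f"
  shows "(f has_derivative frechet_derivative f (at x)) (at x)"
  using assms by (simp add: frechet_derivative_works[symmetric] C_k.simps(2))

lemma C_k_SucD: "C_k (Suc k) f \<Longrightarrow> C_k k f"
proof (induction k arbitrary: f)
  case 0
  then show ?case
    by (auto simp: C_k.simps(2) continuous_on_eq_continuous_at intro: differentiable_imp_continuous_within)
next
  case (Suc k)
  then show ?case by (metis C_k.simps(2))
qed

lemma C_k_continuous: "C_k k f \<Longrightarrow> continuous_on UNIV f"
  by (induction k) (auto dest: C_k_SucD)

lemma C_k_const [simp]: "C_k k (\<lambda>x. c)"
proof (induction k arbitrary: c)
  case (Suc k)
  show ?case by (rule C_k_SucI[where f' = "\<lambda>x h. 0"]) (auto intro: Suc)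
qed simp

lemma C_k_linear: "bounded_linear f \<Longrightarrow> C_k k f"
proof (cases k)
  case 0
  then show "bounded_linear f \<Longrightarrow> C_k k f"
    by (auto intro: linear_continuous_on)
next
  case (Suc k')
  then show "bounded_linear f \<Longrightarrow> C_k k f"
    by (auto intro!: C_k_SucI[where f' = "\<lambda>x. f"] bounded_linear_imp_has_derivative simp del: C_k.simps)
qed

lemma C_k_add: "C_k k f \<Longrightarrow> C_k k g \<Longrightarrow> C_k k (\<lambda>x. f x + g x)"
proof (induction k arbitrary: f g)
  case (Suc k)
  show ?case
    by (rule C_k_SucI[OF has_derivative_add[OF C_k_Suc_derivative[OF Suc.prems(1)] C_k_Suc_derivative[OF Suc.prems(2)]]])
       (use Suc in \<open>auto simp: C_k.simps(2)\<close>)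
qed (auto intro: continuous_intros)

lemma C_k_mult: "C_k k f \<Longrightarrow> C_k k g \<Longrightarrow> C_k k (\<lambda>x. f x * g x)"
proof (induction k arbitrary: f g)
  case (Suc k)
  show ?case
    by (rule C_k_SucI[OF has_derivative_mult[OF C_k_Suc_derivative[OF Suc.prems(1)] C_k_Suc_derivative[OF Suc.prems(2)]]])
       (use Suc.prems in \<open>auto simp: C_k.simps(2) intro!: C_k_add Suc.IH C_k_SucD[of k f] C_k_SucD[of k g]\<close>)
qed (auto intro: continuous_intros)

lemma C_k_sum: "(\<And>i. i \<in> I \<Longrightarrow> C_k k (f i)) \<Longrightarrow> C_k k (\<lambda>x. \<Sum>i\<in>I. f i x)"
  by (induction I rule: infinite_finite_induct) (auto intro: C_k_add)

lemma C_k_prod: "(\<And>i. i \<in> I \<Longrightarrow> C_k k (f i)) \<Longrightarrow> C_k k (\<lambda>x. \<Prod>i\<in>I. f i x)"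
  by (induction I rule: infinite_finite_induct) (auto intro: C_k_mult)

lemma C_k_inverse: "C_k k f \<Longrightarrow> (\<And>x. f x \<noteq> 0) \<Longrightarrow> C_k k (\<lambda>x. inverse (f x))"
proof (induction k arbitrary: f)
  case (Suc k)
  note IH = Suc.IH[OF C_k_SucD[OF Suc.prems(1)] Suc.prems(2)]
  show ?case
  proof (rule C_k_SucI)
    show "((\<lambda>x. inverse (f x)) has_derivative
        (\<lambda>h. - (inverse (f x) * frechet_derivative f (at x) h * inverse (f x)))) (at x)" for x
      by (rule Deriv.has_derivative_inverse[OF Suc.prems(2) C_k_Suc_derivative[OF Suc.prems(1)]])
    show "C_k k (\<lambda>x. - (inverse (f x) * frechet_derivative f (at x) b * inverse (f x)))"
      if "b \<in> Basis" for b
    proof -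
      have "C_k k (\<lambda>x. (-1) * (inverse (f x) * frechet_derivative f (at x) b * inverse (f x)))"
        using Suc.prems that by (intro C_k_mult IH C_k_const) (auto simp: C_k.simps(2))
      then show ?thesis by simp
    qed
  qed
qed (auto intro: continuous_intros)

text \<open>Induction on \<open>k\<close> with \<open>f\<close> generalised and \<open>g\<close>
  fixed: by the chain rule a first partial derivative of the composition is a sum of products of
  partial derivatives of the components of \<open>g\<close> with partial derivatives of
  \<open>f\<close> composed with \<open>g\<close>, and the induction hypothesis covers the latter.
  No higher-order chain rule is involved.\<close>

lemma C_k_compose:
  fixes f :: "'b::euclidean_space \<Rightarrow> real" and g :: "'a::euclidean_space \<Rightarrow> 'b"
  shows "C_k k f \<Longrightarrow> (\<And>b. b \<in> Basis \<Longrightarrow> C_k k (\<lambda>x. g x \<bullet> b)) \<Longrightarrow> C_k k (\<lambda>x. f (g x))"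
proof (induction k arbitrary: f)
  case 0
  then have "continuous_on UNIV g" by (subst continuous_on_componentwise) auto
  then show ?case using 0 by (auto intro: continuous_on_compose2)
next
  case (Suc k)
  define g' where "g' x h = (\<Sum>c\<in>Basis. frechet_derivative (\<lambda>x. g x \<bullet> c) (at x) h *\<^sub>R c)" for x h
  have g: "(g has_derivative g' x) (at x)" for x
  proof (subst has_derivative_componentwise_within, intro ballI)
    fix c :: 'b assume c: "c \<in> Basis"
    have "g' x h \<bullet> c = frechet_derivative (\<lambda>x. g x \<bullet> c) (at x) h" for h
      using c by (simp add: g'_def inner_sum_left inner_Basis if_distrib sum.delta cong: if_cong)
    then show "((\<lambda>x. g x \<bullet> c) has_derivative (\<lambda>h. g' x h \<bullet> c)) (at x)"
      using C_k_Suc_derivative[OF Suc.prems(2)[OF c]] by simp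
  qed
  show ?case
  proof (rule C_k_SucI)
    show "((\<lambda>x. f (g x)) has_derivative (\<lambda>h. frechet_derivative f (at (g x)) (g' x h))) (at x)" for x
      by (rule has_derivative_compose[OF g C_k_Suc_derivative[OF Suc.prems(1)]])
    fix b :: 'a assume b: "b \<in> Basis"
    have lin: "linear (frechet_derivative f (at y))" for y
      using C_k_Suc_derivative[OF Suc.prems(1)] has_derivative_linear by blast
    have "frechet_derivative f (at (g x)) (g' x b) = (\<Sum>c\<in>Basis.
        frechet_derivative (\<lambda>x. g x \<bullet> c) (at x) b * frechet_derivative f (at (g x)) c)" for x
      by (simp add: g'_def linear_sum[OF lin] linear_scale[OF lin])
    moreover have "C_k k (\<lambda>x. \<Sum>c\<in>Basis. frechet_derivative (\<lambda>x. g x \<bullet> c) (at x) b *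
        frechet_derivative f (at (g x)) c)"
    proof (intro C_k_sum C_k_mult)
      fix c :: 'b assume c: "c \<in> Basis"
      show "C_k k (\<lambda>x. frechet_derivative (\<lambda>x. g x \<bullet> c) (at x) b)"
        using Suc.prems(2)[OF c] b by (simp add: C_k.simps(2))
      show "C_k k (\<lambda>x. frechet_derivative f (at (g x)) c)"
      proof (rule Suc.IH[of "\<lambda>y. frechet_derivative f (at y) c"])
        show "C_k k (\<lambda>y. frechet_derivative f (at y) c)" using Suc.prems(1) c by (simp add: C_k.simps(2))
      qed (rule C_k_SucD[OF Suc.prems(2)])
    qed
    ultimately show "C_k k (\<lambda>x. frechet_derivative f (at (g x)) (g' x b))" by simp
  qed
qed

lemma smooth_const [simp]: "smooth (\<lambda>x. c)" by (simp add: smooth_def)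
lemma smooth_linear: "bounded_linear f \<Longrightarrow> smooth f" by (simp add: smooth_def C_k_linear)
lemma smooth_add: "smooth f \<Longrightarrow> smooth g \<Longrightarrow> smooth (\<lambda>x. f x + g x)"
  by (simp add: smooth_def C_k_add)
lemma smooth_mult: "smooth f \<Longrightarrow> smooth g \<Longrightarrow> smooth (\<lambda>x. f x * g x)"
  by (simp add: smooth_def C_k_mult)
lemma smooth_cmult: "smooth f \<Longrightarrow> smooth (\<lambda>x. c * f x)"
  by (rule smooth_mult) simp_all
lemma smooth_minus: "smooth f \<Longrightarrow> smooth (\<lambda>x. - f x)"
  using smooth_cmult[of f "-1"] by simp
lemma smooth_diff: "smooth f \<Longrightarrow> smooth g \<Longrightarrow> smooth (\<lambda>x. f x - g x)"
  using smooth_add[OF _ smooth_minus, of f g] by simp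
lemma smooth_sum: "(\<And>i. i \<in> I \<Longrightarrow> smooth (f i)) \<Longrightarrow> smooth (\<lambda>x. \<Sum>i\<in>I. f i x)"
  by (simp add: smooth_def C_k_sum)
lemma smooth_prod: "(\<And>i. i \<in> I \<Longrightarrow> smooth (f i)) \<Longrightarrow> smooth (\<lambda>x. \<Prod>i\<in>I. f i x)"
  by (simp add: smooth_def C_k_prod)
lemma smooth_inverse: "smooth f \<Longrightarrow> (\<And>x. f x \<noteq> 0) \<Longrightarrow> smooth (\<lambda>x. inverse (f x))"
  by (simp add: smooth_def C_k_inverse)
lemma smooth_compose:
  fixes g :: "'a::euclidean_space \<Rightarrow> 'b::euclidean_space"
  shows "smooth f \<Longrightarrow> (\<And>b. b \<in> Basis \<Longrightarrow> smooth (\<lambda>x. g x \<bullet> b)) \<Longrightarrow> smooth (\<lambda>x. f (g x))"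
  by (simp add: smooth_def C_k_compose)
lemma smooth_compose_real:
  fixes g :: "'a::euclidean_space \<Rightarrow> real"
  shows "smooth f \<Longrightarrow> smooth g \<Longrightarrow> smooth (\<lambda>x. f (g x))"
  by (rule smooth_compose) auto
lemma smooth_affine:
  fixes T :: "'a::euclidean_space \<Rightarrow> 'b::euclidean_space"
  assumes "smooth f" "linear T"
  shows "smooth (\<lambda>x. f (T x + a))"
proof (rule smooth_compose[OF assms(1)])
  fix b :: 'b
  have "bounded_linear (\<lambda>x. T x \<bullet> b)"
    using assms(2) by (simp add: linear_conv_bounded_linear bounded_linear_inner_left_comp)
  then have "smooth (\<lambda>x. T x \<bullet> b + a \<bullet> b)" by (intro smooth_add smooth_linear smooth_const)
  then show "smooth (\<lambda>x. (T x + a) \<bullet> b)" by (simp add: inner_add_left)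
qed
lemma smooth_inner: "smooth (\<lambda>x. x \<bullet> a)" 
  by (rule smooth_linear) (rule bounded_linear_inner_left)
lemma smooth_id [simp]: "smooth (\<lambda>x::real. x)" 
  by (rule smooth_linear) (rule bounded_linear_ident)
lemma smooth_continuous: "smooth f \<Longrightarrow> continuous_on S f"
  using C_k_continuous continuous_on_subset smooth_def by blast

lemma smooth_isCont: "smooth f \<Longrightarrow> isCont f x"
  using smooth_continuous[of f UNIV] by (simp add: continuous_on_eq_continuous_at)

lemma smooth_has_frechet: "smooth f \<Longrightarrow> (f has_derivative frechet_derivative f (at x)) (at x)"
  using C_k_Suc_derivative smooth_def by blast

lemma grad_inner:
  assumes "f differentiable (at x)" shows "grad f x \<bullet> v = frechet_derivative f (at x) v"
proof -
  have lin: "linear (frechet_derivative f (at x))" using assms by (rule linear_frechet_derivative)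
  have "frechet_derivative f (at x) (\<Sum>b\<in>Basis. (v \<bullet> b) *\<^sub>R b) = grad f x \<bullet> v"
    unfolding grad_def linear_sum[OF lin]
    by (simp add: linear_scale[OF lin] inner_sum_left inner_sum_right inner_commute mult.commute)
  then show ?thesis by (simp add: euclidean_representation)
qed

lemma smooth_differentiable: "smooth f \<Longrightarrow> f differentiable (at x)"
  using smooth_has_frechet differentiable_def by blast

lemma frechet_grad: "smooth f \<Longrightarrow> frechet_derivative f (at x) v = grad f x \<bullet> v"
  by (simp add: grad_inner smooth_differentiable)

lemma smooth_has_grad: "smooth f \<Longrightarrow> (f has_derivative (\<lambda>v. grad f x \<bullet> v)) (at x)"
  using smooth_has_frechet[of f x] by (simp add: ext[OF frechet_grad])

lemma grad_eqI:
  assumes "(f has_derivative (\<lambda>v. g \<bullet> v)) (at x)" shows "grad f x = g"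
proof -
  have "frechet_derivative f (at x) = (\<lambda>v. g \<bullet> v)" using frechet_derivative_at[OF assms] by simp
  then show ?thesis by (simp add: grad_def euclidean_representation)
qed

lemma smooth_grad: assumes "smooth f" shows "smooth (\<lambda>x. grad f x \<bullet> v)"
proof -
  have b: "smooth (\<lambda>x. frechet_derivative f (at x) b)" if "b \<in> Basis" for b
    using assms that by (metis C_k.simps(2) smooth_def)
  have "smooth (\<lambda>x. \<Sum>b\<in>Basis. (b \<bullet> v) * frechet_derivative f (at x) b)"
    by (intro smooth_sum smooth_cmult b)
  then show ?thesis by (simp add: grad_def inner_sum_left mult.commute)
qed

lemma continuous_grad: "smooth f \<Longrightarrow> continuous_on S (grad f)"
  by (subst continuous_on_componentwise) (auto intro: smooth_continuous smooth_grad)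

lemma grad_add: "smooth f \<Longrightarrow> smooth g \<Longrightarrow> grad (\<lambda>x. f x + g x) x = grad f x + grad g x"
  by (rule grad_eqI) (auto intro!: derivative_eq_intros smooth_has_grad simp: inner_add_left)
lemma grad_diff: "smooth f \<Longrightarrow> smooth g \<Longrightarrow> grad (\<lambda>x. f x - g x) x = grad f x - grad g x"
  by (rule grad_eqI) (auto intro!: derivative_eq_intros smooth_has_grad simp: inner_diff_left)
lemma grad_mult: "smooth f \<Longrightarrow> smooth g \<Longrightarrow>
    grad (\<lambda>x. f x * g x) x = f x *\<^sub>R grad g x + g x *\<^sub>R grad f x"
  by (rule grad_eqI) (auto intro!: derivative_eq_intros smooth_has_grad simp: inner_add_left)
lemma grad_const [simp]: "grad (\<lambda>x. c) x = 0"
  by (rule grad_eqI) (auto intro!: derivative_eq_intros)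
lemma grad_cmult: "smooth f \<Longrightarrow> grad (\<lambda>x. c * f x) x = c *\<^sub>R grad f x"
  by (simp add: grad_mult)

lemma grad_affine:
  assumes "smooth f" "linear T"
  shows "grad (\<lambda>x. f (T x + a)) x \<bullet> v = grad f (T x + a) \<bullet> T v"
proof -
  have T: "((\<lambda>x. T x + a) has_derivative T) (at x)"
    using assms(2) by (auto intro!: derivative_eq_intros linear_imp_has_derivative)
  have "((\<lambda>x. f (T x + a)) has_derivative (\<lambda>v. grad f (T x + a) \<bullet> T v)) (at x)"
    using has_derivative_compose[OF T smooth_has_grad[OF assms(1)]] by simp
  from fun_cong[OF frechet_derivative_at[OF this], of v]
  show ?thesis by (simp add: frechet_grad[OF smooth_affine[OF assms]])
qed

text \<open>The candidates for the derivative are the same for both functions, so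
  \<open>frechet_derivative\<close> makes the same choice even where neither is
  differentiable.\<close>

lemma grad_eq_on_open:
  assumes "open S" "x \<in> S" "\<And>y. y \<in> S \<Longrightarrow> f y = g y"
  shows "grad f x = grad g x"
proof -
  have "(f has_derivative D) (at x) \<longleftrightarrow> (g has_derivative D) (at x)" for D
    using assms has_derivative_transform_within_open[of f D x UNIV S g]
      has_derivative_transform_within_open[of g D x UNIV S f] by auto
  then show ?thesis by (simp add: grad_def frechet_derivative_def)
qed

subsection \<open>Functions of one real variable\<close>

lemma grad_DERIV: "(f has_real_derivative d) (at x) \<Longrightarrow> grad f x = d"
  by (rule grad_eqI) (simp add: has_field_derivative_def)

lemma smooth_grad_real: "smooth f \<Longrightarrow> smooth (\<lambda>x::real. grad f x)"
  using smooth_grad[of f 1] by simp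

lemma grad_compose_real:
  fixes g :: "'a::euclidean_space \<Rightarrow> real"
  assumes "smooth f" "smooth g" shows "grad (\<lambda>x. f (g x)) x = grad f (g x) *\<^sub>R grad g x"
  by (rule grad_eqI) (use has_derivative_compose[OF smooth_has_grad[OF assms(2)] smooth_has_grad[OF assms(1)]] in \<open>simp add: algebra_simps\<close>)

text \<open>The classical flat function exp(-1/x) together with its multiples by powers of 1/x.
  Derivatives of members are linear combinations of members, so smoothness across 0 is a plain
  induction.\<close>

definition flat :: "nat \<Rightarrow> real \<Rightarrow> real" where
  "flat n x = (if x \<le> 0 then 0 else inverse x ^ n * exp (- inverse x))"

lemma flat_tendsto_0: "(flat n \<longlongrightarrow> 0) (at_right 0)"
proof -
  have "((\<lambda>y. y ^ n / exp y) \<longlongrightarrow> (0::real)) at_top" by (rule tendsto_power_div_exp_0)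
  then have "((\<lambda>x. inverse x ^ n / exp (inverse x)) \<longlongrightarrow> (0::real)) (at_right 0)"
    by (rule filterlim_compose[OF _ filterlim_inverse_at_top_right])
  moreover have "\<forall>\<^sub>F x in at_right 0. inverse x ^ n / exp (inverse x) = flat n x"
    by (auto simp: eventually_at_right_field flat_def exp_minus field_simps intro: exI[of _ 1])
  ultimately show ?thesis by (rule Lim_transform_eventually)
qed

lemma flat_DERIV: "(flat n has_real_derivative (flat (n + 2) x - of_nat n * flat (n + 1) x)) (at x)"
proof -
  let ?tA = "(\<lambda>h. flat n h / h) \<longlongrightarrow> 0"
  consider "x < 0" | "x = 0" | "x > 0" by linarith
  then show ?thesis
  proof cases
    case 1
    have "((\<lambda>x. 0) has_real_derivative 0) (at x)" by simp
    then have "(flat n has_real_derivative 0) (at x)"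
      by (rule has_field_derivative_transform_within_open[where S = "{..<0}"])
         (use 1 in \<open>auto simp: flat_def\<close>)
    then show ?thesis using 1 by (simp add: flat_def)
  next
    case 2
    \<comment> \<open>For h > 0 the quotient \<open>flat n h / h\<close> is
      \<open>flat (Suc n) h\<close>, which tends to 0; for h < 0 it is 0.\<close>
    have "?tA (at_right 0)"
      by (rule Lim_transform_eventually[OF flat_tendsto_0[of "Suc n"]])
         (auto simp: eventually_at_right_field flat_def field_simps intro: exI[of _ 1])
    moreover have "?tA (at_left 0)"
      by (rule Lim_transform_eventually[OF tendsto_const])
         (auto simp: eventually_at_left_field flat_def intro: exI[of _ "-1"])
    ultimately have "?tA (at 0)" by (simp add: filterlim_split_at)
    then show ?thesis by (simp add: 2 DERIV_def flat_def)
  next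
    case 3
    have "((\<lambda>x. inverse x ^ n * exp (- inverse x)) has_real_derivative
        flat (n + 2) x - of_nat n * flat (n + 1) x) (at x)"
      using 3 by (auto intro!: derivative_eq_intros simp: flat_def field_simps power2_eq_square)
         (cases n; simp add: field_simps)
    then show ?thesis
      by (rule has_field_derivative_transform_within_open[where S = "{0<..}"])
         (use 3 in \<open>auto simp: flat_def\<close>)
  qed
qed

lemma smooth_flat: "smooth (flat n)"
proof -
  have "C_k k (flat n)" for k n
  proof (induction k arbitrary: n)
    case 0
    then show ?case
      by (auto simp: continuous_on_eq_continuous_at intro!: DERIV_isCont flat_DERIV)
  next
    case (Suc k)
    show ?case
    proof (rule C_k_SucI)
      show "(flat n has_derivative (\<lambda>h. (flat (n + 2) x - of_nat n * flat (n + 1) x) * h)) (at x)" for x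
        using flat_DERIV by (simp add: has_field_derivative_def)
      have "C_k k (\<lambda>x. flat (n + 2) x + (- of_nat n) * flat (n + 1) x)"
        by (intro C_k_add C_k_mult C_k_const Suc.IH)
      then show "C_k k (\<lambda>x. (flat (n + 2) x - of_nat n * flat (n + 1) x) * b)" if "b \<in> Basis" for b
        using that by simp
    qed
  qed
  then show ?thesis by (simp add: smooth_def)
qed

text \<open>The standard smooth transition from 0 on x <= 0 to 1 on x >= 1. Later cutoffs compose it
  with simple rescalings, so the values 0 and 1 of its argument mark where a cutoff begins and
  ends.\<close>

definition step :: "real \<Rightarrow> real" where
  "step x = flat 0 x * inverse (flat 0 x + flat 0 (1 - x))"

lemma flat0_pos: "0 < x \<Longrightarrow> 0 < flat 0 x" and flat0_nonneg: "0 \<le> flat 0 x"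
  by (auto simp: flat_def)

lemma flat0_sum_pos: "0 < flat 0 x + flat 0 (1 - x)"
  by (cases "0 < x") (use flat0_pos[of x] flat0_nonneg[of x] flat0_nonneg[of "1 - x"] flat0_pos[of "1 - x"] in auto)

lemma smooth_step: "smooth step"
proof -
  have "smooth (\<lambda>x::real. 1 - x)" by (intro smooth_diff) auto
  then have "smooth (\<lambda>x. flat 0 x + flat 0 (1 - x))"
    by (rule smooth_add[OF smooth_flat smooth_compose_real[OF smooth_flat]])
  then have "smooth (\<lambda>x. flat 0 x * inverse (flat 0 x + flat 0 (1 - x)))"
    using flat0_sum_pos by (intro smooth_mult[OF smooth_flat smooth_inverse]) (auto simp: less_le)
  then show ?thesis by (simp add: step_def[abs_def])
qed

lemma step_0: "x \<le> 0 \<Longrightarrow> step x = 0" and step_1: "1 \<le> x \<Longrightarrow> step x = 1"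
  by (auto simp: step_def flat_def)

lemma step_bounds: "0 \<le> step x" "step x \<le> 1"
  using flat0_sum_pos[of x] flat0_nonneg[of x] flat0_nonneg[of "1 - x"]
  by (auto simp: step_def field_simps)

lemma step_pos: "0 < x \<Longrightarrow> 0 < step x"
  using flat0_sum_pos[of x] flat0_pos[of x] by (auto simp: step_def)

lemma grad_step_0: "x \<le> 0 \<or> 1 \<le> x \<Longrightarrow> grad step x = 0"
proof -
  have 1: "grad step x = 0" if "x < 0" for x
    using grad_eq_on_open[of "{..<0}" x step "\<lambda>_. 0"] that by (simp add: step_0)
  have 2: "grad step x = 0" if "x > 1" for x
    using grad_eq_on_open[of "{1<..}" x step "\<lambda>_. 1"] that by (simp add: step_1)
  have c: "isCont (grad step) x" for x
    using smooth_isCont[OF smooth_grad_real[OF smooth_step]] by simp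
  \<comment> \<open>Local constancy gives the derivative only away from the endpoints; at 0 and 1 it
    follows from the continuity of the derivative and one-sided limits.\<close>
  have "(grad step \<longlongrightarrow> grad step 0) (at_left 0)" "(grad step \<longlongrightarrow> grad step 1) (at_right 1)"
    using c[of 0] c[of 1] by (auto simp: isCont_def intro: filterlim_at_split[THEN iffD1, THEN conjunct1] filterlim_at_split[THEN iffD1, THEN conjunct2])
  moreover have "(grad step \<longlongrightarrow> 0) (at_left 0)" "(grad step \<longlongrightarrow> 0) (at_right 1)"
    by (rule Lim_transform_eventually[OF tendsto_const]; 
        auto simp: eventually_at_left_field eventually_at_right_field 1 2 intro: exI[of _ "-1"] exI[of _ 2])+
  ultimately have "grad step 0 = 0" "grad step 1 = 0"
    using tendsto_unique[OF trivial_limit_at_left_real] tendsto_unique[OF trivial_limit_at_right_real] by auto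
  then show "x \<le> 0 \<or> 1 \<le> x \<Longrightarrow> grad step x = 0"
    using 1 2 by (metis linorder_less_linear order_le_less)
qed

lemma grad_step_bounded: obtains C where "C \<ge> 0" "\<And>x. \<bar>grad step x\<bar> \<le> C"
proof -
  have "compact (grad step ` {0..1})"
    using smooth_continuous[OF smooth_grad_real[OF smooth_step]] by (intro compact_continuous_image) auto
  then obtain C where C: "\<And>x. x \<in> {0..1} \<Longrightarrow> \<bar>grad step x\<bar> \<le> C"
    using compact_imp_bounded[of "grad step ` {0..1}"] by (auto simp: bounded_iff simp del: atLeastAtMost_iff)
  have "\<bar>grad step x\<bar> \<le> \<bar>C\<bar>" for x
    using C[of x] grad_step_0[of x] by (cases "x \<in> {0..1}") auto
  then show ?thesis by (intro that[of "\<bar>C\<bar>"]) auto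
qed

subsection \<open>Test functions\<close>

lemma test_function_smooth: "test_function S f \<Longrightarrow> smooth f" by (simp add: test_function_def)

lemma test_function_mono: "test_function S f \<Longrightarrow> S \<subseteq> T \<Longrightarrow> test_function T f"
  by (force simp: test_function_def)

text \<open>Each factor switches on at one face of the box, so the function is positive exactly in
  the open box.\<close>

definition bump :: "'a::euclidean_space \<Rightarrow> 'a \<Rightarrow> 'a \<Rightarrow> real" where
  "bump a b x = (\<Prod>i\<in>Basis. step (x \<bullet> i - a \<bullet> i) * step (b \<bullet> i - x \<bullet> i))"

lemma smooth_bump: "smooth (bump a b)"
  unfolding bump_def[abs_def]
  by (intro smooth_prod smooth_mult smooth_compose_real[OF smooth_step] smooth_diff smooth_inner smooth_const)

lemma bump_pos: "x \<in> box a b \<Longrightarrow> 0 < bump a b x"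
  unfolding bump_def by (intro prod_pos) (auto simp: mem_box intro!: mult_pos_pos step_pos)

lemma bump_nonneg: "0 \<le> bump a b x"
  unfolding bump_def by (intro prod_nonneg mult_nonneg_nonneg step_bounds)

lemma bump_0: "x \<notin> box a b \<Longrightarrow> bump a b x = 0"
  by (fastforce simp: bump_def mem_box not_less intro!: prod_zero step_0)

text \<open>Cover \<open>K\<close> by finitely many open boxes whose closures lie in
  \<open>U\<close>. The sum of their bumps is bounded below by some c > 0 on \<open>K\<close>, and
  \<open>step\<close> applied to the sum divided by c turns this into the value 1.\<close>

lemma smooth_Urysohn:
  fixes K :: "'a::euclidean_space set"
  assumes K: "compact K" and U: "open U" and KU: "K \<subseteq> U"
  obtains f where "test_function U f" "\<And>x. 0 \<le> f x" "\<And>x. f x \<le> 1" "\<And>x. x \<in> K \<Longrightarrow> f x = 1"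
proof -
  define F where "F = {(a, b). cbox a b \<subseteq> U}"
  have "K \<subseteq> (\<Union>(a,b)\<in>F. box a b)"
  proof
    fix x assume "x \<in> K"
    then obtain a b where "x \<in> box a b" "cbox a b \<subseteq> U"
      using open_contains_cbox[OF U, of x] KU by (metis subsetD)
    then show "x \<in> (\<Union>(a,b)\<in>F. box a b)" by (auto simp: F_def)
  qed
  then obtain F' where F': "F' \<subseteq> F" "finite F'" "K \<subseteq> (\<Union>(a,b)\<in>F'. box a b)"
    using compactE_image[OF K, of F "\<lambda>(a,b). box a b"] by (auto simp: case_prod_beta)
  define s where "s x = (\<Sum>(a,b)\<in>F'. bump a b x)" for x
  have s: "smooth s" unfolding s_def[abs_def] by (intro smooth_sum) (auto simp: smooth_bump)
  have s_pos: "0 < s x" if x: "x \<in> K" for x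
  proof -
    obtain a b where "(a,b) \<in> F'" "x \<in> box a b" using F'(3) x by auto
    then show ?thesis unfolding s_def
      by (intro sum_pos2[OF F'(2)]) (auto simp: bump_pos bump_nonneg)
  qed
  obtain c where c: "0 < c" "\<And>x. x \<in> K \<Longrightarrow> c \<le> s x"
  proof (cases "K = {}")
    case True then show ?thesis using that[of 1] by simp
  next
    case False
    then obtain x where "x \<in> K" "\<forall>y\<in>K. s x \<le> s y"
      using continuous_attains_inf[OF K False smooth_continuous[OF s]] by blast
    then show ?thesis using that[of "s x"] s_pos by blast
  qed
  define f where "f x = step ((1/c) * s x)" for x
  have "smooth f" unfolding f_def[abs_def] by (rule smooth_compose_real[OF smooth_step smooth_cmult[OF s]])
  moreover have "compact (\<Union>(a,b)\<in>F'. cbox a b)" using F'(2) by (intro compact_UN) auto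
  moreover have "(\<Union>(a,b)\<in>F'. cbox a b) \<subseteq> U" using F'(1) by (auto simp: F_def)
  moreover have "f x = 0" if x: "x \<notin> (\<Union>(a,b)\<in>F'. cbox a b)" for x
  proof -
    have "s x = 0" unfolding s_def using x box_subset_cbox by (intro sum.neutral) (fastforce intro: bump_0)
    then show ?thesis by (simp add: f_def step_0)
  qed
  ultimately have "test_function U f" unfolding test_function_def by blast
  then show ?thesis
  proof (rule that)
    show "f x = 1" if "x \<in> K" for x
      unfolding f_def using c(1) c(2)[OF that] by (intro step_1) (auto simp: field_simps)
  qed (auto simp: f_def step_bounds)
qed

section \<open>The space $L^2$\<close>

text \<open>Meaningful only together with \<open>L2\<close>: the integral of a non-integrable square
  is 0 by convention.\<close>

definition l2n :: "'a::euclidean_space set \<Rightarrow> ('a \<Rightarrow> 'b::euclidean_space) \<Rightarrow> real" where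
  "l2n S f = sqrt (LINT x|leb S. (norm (f x))\<^sup>2)"

lemma L2_meas: "L2 S f \<Longrightarrow> f \<in> mbl S" by (simp add: L2_def)
lemma L2_int: "L2 S f \<Longrightarrow> integrable (leb S) (\<lambda>x. (norm (f x))\<^sup>2)" by (simp add: L2_def)

lemma l2n_nonneg [simp]: "0 \<le> l2n S f" by (simp add: l2n_def)
lemma l2n_power2: "(l2n S f)\<^sup>2 = (LINT x|leb S. (norm (f x))\<^sup>2)" by (simp add: l2n_def)

lemma L2I_bound:
  assumes "f \<in> mbl S" "integrable (leb S) g"
    "AE x in leb S. (norm (f x))\<^sup>2 \<le> g x"
  shows "L2 S f"
  unfolding L2_def
proof
  show "integrable (leb S) (\<lambda>x. (norm (f x))\<^sup>2)"
    by (rule Bochner_Integration.integrable_bound[OF assms(2)])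
       (use assms in \<open>auto elim!: eventually_mono\<close>)
qed fact

lemma L2_integrable_inner:
  assumes "L2 S f" "L2 S g" shows "integrable (leb S) (\<lambda>x. f x \<bullet> g x)"
proof (rule Bochner_Integration.integrable_bound)
  show "integrable (leb S) (\<lambda>x. (norm (f x))\<^sup>2 + (norm (g x))\<^sup>2)"
    using L2_int[OF assms(1)] L2_int[OF assms(2)] by simp
  show "(\<lambda>x. f x \<bullet> g x) \<in> mbl S"
    using assms L2_meas by (intro borel_measurable_inner)
  have "\<bar>a \<bullet> b\<bar> \<le> (norm a)\<^sup>2 + (norm b)\<^sup>2" for a b :: 'b
    using Cauchy_Schwarz_ineq2[of a b] sum_squares_bound[of "norm a" "norm b"]
      mult_nonneg_nonneg[OF norm_ge_zero[of a] norm_ge_zero[of b]] by linarith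
  then show "AE x in leb S. norm (f x \<bullet> g x) \<le> norm ((norm (f x))\<^sup>2 + (norm (g x))\<^sup>2)"
    by simp
qed

lemma L2_integrable_mult:
  fixes f g :: "'a::euclidean_space \<Rightarrow> real"
  shows "L2 S f \<Longrightarrow> L2 S g \<Longrightarrow> integrable (leb S) (\<lambda>x. f x * g x)"
  using L2_integrable_inner[of S f g] by simp

lemma L2_add: assumes "L2 S f" "L2 S g" shows "L2 S (\<lambda>x. f x + g x)"
proof (rule L2I_bound)
  show "(\<lambda>x. f x + g x) \<in> mbl S"
    using assms L2_meas by (intro borel_measurable_add)
  show "integrable (leb S) (\<lambda>x. 2 * (norm (f x))\<^sup>2 + 2 * (norm (g x))\<^sup>2)"
    using L2_int[OF assms(1)] L2_int[OF assms(2)] by simp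
  have "(norm (a + b))\<^sup>2 \<le> 2 * (norm a)\<^sup>2 + 2 * (norm b)\<^sup>2" for a b :: 'b
  proof -
    have "(norm (a + b))\<^sup>2 \<le> (norm a + norm b)\<^sup>2" by (intro power_mono norm_triangle_ineq) auto
    also have "\<dots> \<le> 2 * (norm a)\<^sup>2 + 2 * (norm b)\<^sup>2"
      using sum_squares_bound[of "norm a" "norm b"] by (simp add: power2_sum)
    finally show ?thesis .
  qed
  then show "AE x in leb S. (norm (f x + g x))\<^sup>2 \<le> 2 * (norm (f x))\<^sup>2 + 2 * (norm (g x))\<^sup>2"
    by simp
qed

lemma L2_scaleR: assumes "L2 S f" shows "L2 S (\<lambda>x. c *\<^sub>R f x)"
proof (rule L2I_bound)
  show "integrable (leb S) (\<lambda>x. c\<^sup>2 * (norm (f x))\<^sup>2)" using assms L2_int by auto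
qed (use L2_meas[OF assms] in \<open>auto simp: power_mult_distrib\<close>)

lemma L2_cmult: "L2 S f \<Longrightarrow> L2 S (\<lambda>x. c * f x)" for f :: "'a::euclidean_space \<Rightarrow> real"
  using L2_scaleR[of S f c] by simp

lemma L2_minus: "L2 S f \<Longrightarrow> L2 S (\<lambda>x. - f x)" using L2_scaleR[of S f "-1"] by simp
lemma L2_diff: "L2 S f \<Longrightarrow> L2 S g \<Longrightarrow> L2 S (\<lambda>x. f x - g x)"
  using L2_add[OF _ L2_minus, of S f g] by simp
lemma L2_zero [simp]: "L2 S (\<lambda>x. 0)" by (simp add: L2_def)
lemma L2_mult_bounded:
  fixes m :: "'a::euclidean_space \<Rightarrow> real"
  assumes "L2 S f" "m \<in> mbl S" "\<And>x. x \<in> S \<Longrightarrow> \<bar>m x\<bar> \<le> C"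
  shows "L2 S (\<lambda>x. m x *\<^sub>R f x)"
proof (rule L2I_bound)
  show "(\<lambda>x. m x *\<^sub>R f x) \<in> mbl S"
    using assms L2_meas by (intro borel_measurable_scaleR)
  show "integrable (leb S) (\<lambda>x. C\<^sup>2 * (norm (f x))\<^sup>2)" using assms L2_int by auto
  show "AE x in leb S. (norm (m x *\<^sub>R f x))\<^sup>2 \<le> C\<^sup>2 * (norm (f x))\<^sup>2"
  proof (rule AE_I2)
    fix x assume "x \<in> space (leb S)"
    then have "\<bar>m x\<bar>\<^sup>2 \<le> C\<^sup>2" using assms(3)[of x] by (intro power_mono) auto
    then show "(norm (m x *\<^sub>R f x))\<^sup>2 \<le> C\<^sup>2 * (norm (f x))\<^sup>2"
      by (simp add: power_mult_distrib mult_right_mono)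
  qed
qed

lemma L2_bounded:
  assumes "S \<in> lmeasurable" "f \<in> mbl S" "\<And>x. x \<in> S \<Longrightarrow> norm (f x) \<le> C"
  shows "L2 S f"
proof (rule L2I_bound[OF assms(2)])
  interpret finite_measure "leb S" using assms(1) by (rule finite_measure_lebesgue_on)
  show "integrable (leb S) (\<lambda>x. C\<^sup>2)" by simp
  show "AE x in leb S. (norm (f x))\<^sup>2 \<le> C\<^sup>2"
    using assms(3) by (auto intro!: AE_I2 power_mono)
qed

lemma continuous_measurable_lebesgue_on:
  "continuous_on UNIV f \<Longrightarrow> f \<in> mbl S"
  for f :: "'a::euclidean_space \<Rightarrow> 'b::euclidean_space"
proof -
  assume "continuous_on UNIV f"
  then have "f \<in> borel_measurable borel" by (rule borel_measurable_continuous_onI)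
  then show ?thesis by (simp add: measurable_restrict_space1 measurable_completion)
qed

lemma continuous_bounded_on:
  fixes f :: "'a::euclidean_space \<Rightarrow> 'b::euclidean_space"
  assumes "bounded S" "continuous_on UNIV f"
  obtains C where "C \<ge> 0" "\<And>x. x \<in> S \<Longrightarrow> norm (f x) \<le> C"
proof -
  have "compact (f ` closure S)"
    using assms by (intro compact_continuous_image) (auto intro: continuous_on_subset simp: compact_closure)
  then obtain C where "\<And>x. x \<in> closure S \<Longrightarrow> norm (f x) \<le> C"
    using compact_imp_bounded[of "f ` closure S"] by (auto simp: bounded_iff)
  then show ?thesis
    using closure_subset[of S] by (intro that[of "max C 0"]) force+
qed

lemma L2_continuous:
  assumes "bounded S" "S \<in> sets lebesgue" "continuous_on UNIV f"
  shows "L2 S f"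
proof -
  obtain C where "\<And>x. x \<in> S \<Longrightarrow> norm (f x) \<le> C"
    using continuous_bounded_on[OF assms(1,3)] by metis
  then show ?thesis
    using assms bounded_set_imp_lmeasurable
    by (intro L2_bounded[where C = C] continuous_measurable_lebesgue_on) auto
qed

lemma integral_quadratic:
  assumes "L2 S f" "L2 S g"
  shows "(l2n S (\<lambda>x. f x + t *\<^sub>R g x))\<^sup>2 =
    (l2n S f)\<^sup>2 + 2 * t * (LINT x|leb S. f x \<bullet> g x) + t\<^sup>2 * (l2n S g)\<^sup>2"
proof -
  have "(norm (f x + t *\<^sub>R g x))\<^sup>2 = (norm (f x))\<^sup>2 + (2 * t) * (f x \<bullet> g x) + t\<^sup>2 * (norm (g x))\<^sup>2" for x
    unfolding power2_norm_eq_inner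
    using inner_commute[of "f x" "g x"]
    by (simp add: inner_add_left inner_add_right power2_eq_square distrib_left)
  then show ?thesis
    using L2_integrable_inner[OF assms] assms[THEN L2_int]
    by (simp add: l2n_power2)
qed

lemma L2_Cauchy_Schwarz:
  assumes "L2 S f" "L2 S g"
  shows "\<bar>LINT x|leb S. f x \<bullet> g x\<bar> \<le> l2n S f * l2n S g"
proof -
  define I where "I = (LINT x|leb S. f x \<bullet> g x)"
  have q: "0 \<le> (l2n S f)\<^sup>2 + 2 * t * I + t\<^sup>2 * (l2n S g)\<^sup>2" for t
    unfolding I_def integral_quadratic[OF assms, symmetric] by simp
  have "I\<^sup>2 \<le> (l2n S f * l2n S g)\<^sup>2"
  proof (cases "l2n S g = 0")
    case True
    have "I = 0"
    proof (rule ccontr)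
      assume "I \<noteq> 0"
      \<comment> \<open>Without a quadratic term the expression is affine in t; this t gives it the
        value -1.\<close>
      then show False using q[of "- ((l2n S f)\<^sup>2 + 1) / (2 * I)"] True by (simp add: field_simps)
    qed
    then show ?thesis by simp
  next
    case False
    then have G: "(l2n S g)\<^sup>2 > 0" by simp
    \<comment> \<open>The minimum over t of the quadratic polynomial.\<close>
    have "(l2n S f)\<^sup>2 + 2 * (- I / (l2n S g)\<^sup>2) * I + (- I / (l2n S g)\<^sup>2)\<^sup>2 * (l2n S g)\<^sup>2 = (l2n S f)\<^sup>2 - I\<^sup>2 / (l2n S g)\<^sup>2"
      using G by (simp add: field_simps power2_eq_square)
    then have "I\<^sup>2 / (l2n S g)\<^sup>2 \<le> (l2n S f)\<^sup>2" using q[of "- I / (l2n S g)\<^sup>2"] by simp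
    then show ?thesis using G by (simp add: pos_divide_le_eq power_mult_distrib)
  qed
  then show ?thesis unfolding I_def[symmetric]
    by (metis abs_le_square_iff abs_of_nonneg l2n_nonneg mult_nonneg_nonneg)
qed

lemma L2_Cauchy_Schwarz_real:
  fixes f g :: "'a::euclidean_space \<Rightarrow> real"
  assumes "L2 S f" "L2 S g"
  shows "\<bar>LINT x|leb S. f x * g x\<bar> \<le> l2n S f * l2n S g"
  using L2_Cauchy_Schwarz[OF assms] by simp

lemma l2n_triangle:
  assumes "L2 S f" "L2 S g" shows "l2n S (\<lambda>x. f x + g x) \<le> l2n S f + l2n S g"
proof (rule power2_le_imp_le)
  have "(l2n S (\<lambda>x. f x + g x))\<^sup>2 = (l2n S f)\<^sup>2 + 2 * (LINT x|leb S. f x \<bullet> g x) + (l2n S g)\<^sup>2"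
    using integral_quadratic[OF assms, of 1] by simp
  also have "\<dots> \<le> (l2n S f + l2n S g)\<^sup>2"
    using L2_Cauchy_Schwarz[OF assms] by (simp add: power2_sum)
  finally show "(l2n S (\<lambda>x. f x + g x))\<^sup>2 \<le> (l2n S f + l2n S g)\<^sup>2" .
qed simp

lemma l2n_scaleR: "l2n S (\<lambda>x. c *\<^sub>R f x) = \<bar>c\<bar> * l2n S f"
  by (simp add: l2n_def power_mult_distrib real_sqrt_mult)
lemma l2n_minus [simp]: "l2n S (\<lambda>x. - f x) = l2n S f" by (simp add: l2n_def)
lemma l2n_zero [simp]: "l2n S (\<lambda>x. 0) = 0" by (simp add: l2n_def)
lemma l2n_minus_commute: "l2n S (\<lambda>x. f x - g x) = l2n S (\<lambda>x. g x - f x)"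
  by (simp add: l2n_def norm_minus_commute)

lemma l2n_triangle3:
  assumes "L2 S f" "L2 S g" "L2 S h"
  shows "l2n S (\<lambda>x. f x - h x) \<le> l2n S (\<lambda>x. f x - g x) + l2n S (\<lambda>x. g x - h x)"
  using l2n_triangle[OF L2_diff[OF assms(1,2)] L2_diff[OF assms(2,3)]] by simp

lemma l2n_le_bound:
  assumes "L2 S f" "L2 S g" "0 \<le> C" "AE x in leb S. norm (f x) \<le> C * norm (g x)"
  shows "l2n S f \<le> C * l2n S g"
proof (rule power2_le_imp_le)
  have "(l2n S f)\<^sup>2 \<le> (LINT x|leb S. C\<^sup>2 * (norm (g x))\<^sup>2)"
    unfolding l2n_power2
  proof (rule integral_mono_AE)
    show "AE x in leb S. (norm (f x))\<^sup>2 \<le> C\<^sup>2 * (norm (g x))\<^sup>2"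
      using assms(4) by eventually_elim (simp add: power_mult_distrib[symmetric] power_mono)
  qed (use assms L2_int in auto)
  then show "(l2n S f)\<^sup>2 \<le> (C * l2n S g)\<^sup>2" by (simp add: power_mult_distrib l2n_power2)
qed (use assms in auto)

lemma l2n_cong_AE:
  assumes "AE x in leb S. f x = g x"
    "f \<in> mbl S" "g \<in> mbl S"
  shows "l2n S f = l2n S g"
  unfolding l2n_def using assms by (intro arg_cong[of _ _ sqrt] integral_cong_AE) auto

text \<open>Lebesgue measure is complete, so a change on a null set preserves measurability.\<close>

lemma measurable_lebesgue_on_AE:
  fixes f g :: "'a::euclidean_space \<Rightarrow> 'b::euclidean_space"
  assumes "S \<in> sets lebesgue" "f \<in> mbl S" "AE x in leb S. f x = g x"
  shows "g \<in> mbl S"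
proof -
  have "AE x in lebesgue. x \<in> S \<longrightarrow> f x = g x"
    using assms(1,3) by (simp add: AE_restrict_space_iff)
  then have "AE x in lebesgue. (if x \<in> S then f x else 0) = (if x \<in> S then g x else 0)" by auto
  moreover have "(\<lambda>x. if x \<in> S then f x else 0) \<in> borel_measurable lebesgue"
    using assms by (simp add: borel_measurable_if)
  ultimately have "(\<lambda>x. if x \<in> S then g x else 0) \<in> borel_measurable lebesgue"
    by (rule borel_measurable_AE [rotated])
  then show ?thesis using assms(1) by (simp add: borel_measurable_if)
qed

lemma L2_cong_AE:
  assumes "S \<in> sets lebesgue" "AE x in leb S. f x = g x" "L2 S f"
  shows "L2 S g"
proof (rule L2I_bound)
  show "g \<in> mbl S"
    using assms measurable_lebesgue_on_AE L2_meas by blast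
  show "integrable (leb S) (\<lambda>x. (norm (f x))\<^sup>2)" using assms L2_int by auto
qed (use assms(2) in auto)

lemma L2_cong: "(\<And>x. x \<in> S \<Longrightarrow> f x = g x) \<Longrightarrow> L2 S f = L2 S g"
  unfolding L2_def by (intro conj_cong measurable_cong Bochner_Integration.integrable_cong) auto

lemma l2n_cong: "(\<And>x. x \<in> S \<Longrightarrow> f x = g x) \<Longrightarrow> l2n S f = l2n S g"
  unfolding l2n_def by (intro arg_cong[of _ _ sqrt] Bochner_Integration.integral_cong) auto

lemma LINT_cong: "(\<And>x. x \<in> S \<Longrightarrow> f x = g x) \<Longrightarrow> (LINT x|leb S. f x) = (LINT x|leb S. g x)"
  by (intro Bochner_Integration.integral_cong) auto

lemma l2n_eq_0:
  assumes "L2 S f" "l2n S f = 0" shows "AE x in leb S. f x = 0"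
proof -
  have "(LINT x|leb S. (norm (f x))\<^sup>2) = 0" using assms(2) by (simp add: l2n_def)
  then have "AE x in leb S. (norm (f x))\<^sup>2 = 0"
    using integral_nonneg_eq_0_iff_AE[OF L2_int[OF assms(1)]] by simp
  then show ?thesis by simp
qed

lemma L2_tendsto_iff:
  "L2_tendsto S us u \<longleftrightarrow> (\<forall>k. L2 S (us k)) \<and> L2 S u \<and> (\<lambda>k. l2n S (\<lambda>x. us k x - u x)) \<longlonglongrightarrow> 0"
proof -
  let ?tB = "\<lambda>k. l2n S (\<lambda>x. us k x - u x)"
  let ?tA = "\<lambda>k. LINT x|leb S. (norm (us k x - u x))\<^sup>2"
  have "(?tB \<longlonglongrightarrow> 0) \<longleftrightarrow>
    (?tA \<longlonglongrightarrow> 0)"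
  proof
    assume "?tB \<longlonglongrightarrow> 0"
    from tendsto_power[OF this, of 2]
    show "?tA \<longlonglongrightarrow> 0"
      by (simp add: l2n_power2)
  next
    assume "?tA \<longlonglongrightarrow> 0"
    from tendsto_real_sqrt[OF this] show "?tB \<longlonglongrightarrow> 0"
      by (simp add: l2n_def)
  qed
  then show ?thesis by (simp add: L2_tendsto_def)
qed

lemma L2_tendstoD:
  assumes "L2_tendsto S us u"
  shows "L2 S (us k)" "L2 S u" "(\<lambda>k. l2n S (\<lambda>x. us k x - u x)) \<longlonglongrightarrow> 0"
  using assms by (auto simp: L2_tendsto_iff)

lemma L2_tendsto_squeeze:
  assumes "\<And>k. L2 S (us k)" "L2 S u" "\<And>k. l2n S (\<lambda>x. us k x - u x) \<le> e k" "e \<longlonglongrightarrow> 0"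
  shows "L2_tendsto S us u"
  unfolding L2_tendsto_iff
  using assms tendsto_sandwich[of "\<lambda>_. 0" "\<lambda>k. l2n S (\<lambda>x. us k x - u x)" sequentially e 0] by simp

lemma L2_tendsto_const: "L2 S u \<Longrightarrow> L2_tendsto S (\<lambda>k. u) u"
  by (simp add: L2_tendsto_iff)

lemma L2_tendsto_add:
  assumes "L2_tendsto S us u" "L2_tendsto S vs v"
  shows "L2_tendsto S (\<lambda>k x. us k x + vs k x) (\<lambda>x. u x + v x)"
proof (rule L2_tendsto_squeeze)
  note * = L2_tendstoD[OF assms(1)] L2_tendstoD[OF assms(2)]
  show "l2n S (\<lambda>x. us k x + vs k x - (u x + v x)) \<le> l2n S (\<lambda>x. us k x - u x) + l2n S (\<lambda>x. vs k x - v x)" for k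
    using l2n_triangle[OF L2_diff L2_diff, OF *(1,2,4,5), of k k] by (simp add: algebra_simps)
  show "(\<lambda>k. l2n S (\<lambda>x. us k x - u x) + l2n S (\<lambda>x. vs k x - v x)) \<longlonglongrightarrow> 0"
    using tendsto_add[OF *(3,6)] by simp
  show "L2 S (\<lambda>x. us k x + vs k x)" "L2 S (\<lambda>x. u x + v x)" for k
    by (rule L2_add[OF *(1,4)], rule L2_add[OF *(2,5)])
qed

lemma L2_tendsto_bounded_linear:
  fixes T :: "'b::euclidean_space \<Rightarrow> 'c::euclidean_space"
  assumes T: "bounded_linear T" and us: "L2_tendsto S us u"
  shows "L2_tendsto S (\<lambda>k x. T (us k x)) (\<lambda>x. T (u x))"
    and "L2 S u \<Longrightarrow> L2 S (\<lambda>x. T (u x))"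
proof -
  obtain C where C: "0 \<le> C" "\<And>x. norm (T x) \<le> C * norm x"
    using bounded_linear.nonneg_bounded[OF T] by (metis mult.commute)
  have L: "L2 S (\<lambda>x. T (f x))" if "L2 S f" for f
  proof (rule L2I_bound)
    show "(\<lambda>x. T (f x)) \<in> mbl S"
      using measurable_compose[OF L2_meas[OF that] borel_measurable_continuous_onI[OF linear_continuous_on[OF T]]] by simp
    show "integrable (leb S) (\<lambda>x. C\<^sup>2 * (norm (f x))\<^sup>2)" using that L2_int by auto
    show "AE x in leb S. (norm (T (f x)))\<^sup>2 \<le> C\<^sup>2 * (norm (f x))\<^sup>2"
      using C(2) by (auto simp: power_mult_distrib[symmetric] intro!: power_mono)
  qed
  then show "L2 S u \<Longrightarrow> L2 S (\<lambda>x. T (u x))" .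
  note * = L2_tendstoD[OF us]
  show "L2_tendsto S (\<lambda>k x. T (us k x)) (\<lambda>x. T (u x))"
  proof (rule L2_tendsto_squeeze)
    show "l2n S (\<lambda>x. T (us k x) - T (u x)) \<le> C * l2n S (\<lambda>x. us k x - u x)" for k
      using C * by (intro l2n_le_bound L2_diff L) (auto simp: linear_diff[OF bounded_linear.linear[OF T], symmetric])
    show "(\<lambda>k. C * l2n S (\<lambda>x. us k x - u x)) \<longlonglongrightarrow> 0" using tendsto_mult_left[OF *(3), of C] by simp
  qed (rule L[OF *(1)], rule L[OF *(2)])
qed

lemma L2_bounded_linear:
  fixes T :: "'b::euclidean_space \<Rightarrow> 'c::euclidean_space"
  shows "bounded_linear T \<Longrightarrow> L2 S u \<Longrightarrow> L2 S (\<lambda>x. T (u x))"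
  by (rule L2_tendsto_bounded_linear(2)[OF _ L2_tendsto_const]) auto

lemma L2_component: "L2 S u \<Longrightarrow> L2 S (\<lambda>x. u x \<bullet> b)"
  by (rule L2_bounded_linear[OF bounded_linear_inner_left])

lemma L2_tendsto_component: "L2_tendsto S us u \<Longrightarrow> L2_tendsto S (\<lambda>k x. us k x \<bullet> b) (\<lambda>x. u x \<bullet> b)"
  by (rule L2_tendsto_bounded_linear[OF bounded_linear_inner_left])

lemma L2_vec_nth: "L2 S u \<Longrightarrow> L2 S (\<lambda>x. u x $ j)" for u :: "_ \<Rightarrow> real^'n"
  by (rule L2_bounded_linear[OF bounded_linear_vec_nth])

lemma L2_tendsto_vec_nth: "L2_tendsto S us u \<Longrightarrow> L2_tendsto S (\<lambda>k x. us k x $ j) (\<lambda>x. u x $ j)"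
  for u :: "_ \<Rightarrow> real^'n"
  by (rule L2_tendsto_bounded_linear[OF bounded_linear_vec_nth])

lemma L2_tendsto_scaleR: "L2_tendsto S us u \<Longrightarrow> L2_tendsto S (\<lambda>k x. c *\<^sub>R us k x) (\<lambda>x. c *\<^sub>R u x)"
  by (rule L2_tendsto_bounded_linear[OF bounded_linear_scaleR_right])

lemma L2_tendsto_minus: "L2_tendsto S us u \<Longrightarrow> L2_tendsto S (\<lambda>k x. - us k x) (\<lambda>x. - u x)"
  using L2_tendsto_scaleR[of S us u "-1"] by simp

lemma L2_tendsto_diff:
  assumes "L2_tendsto S us u" "L2_tendsto S vs v"
  shows "L2_tendsto S (\<lambda>k x. us k x - vs k x) (\<lambda>x. u x - v x)"
  using L2_tendsto_add[OF assms(1) L2_tendsto_minus[OF assms(2)]] by simp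

lemma L2_tendsto_sum:
  assumes "\<And>i. i \<in> I \<Longrightarrow> L2_tendsto S (us i) (u i)"
  shows "L2_tendsto S (\<lambda>k x. \<Sum>i\<in>I. us i k x) (\<lambda>x. \<Sum>i\<in>I. u i x)"
  using assms by (induction I rule: infinite_finite_induct) (auto intro: L2_tendsto_add L2_tendsto_const)

lemma L2_tendsto_componentwise:
  assumes "\<And>b. b \<in> Basis \<Longrightarrow> L2_tendsto S (\<lambda>k x. us k x \<bullet> b) (\<lambda>x. u x \<bullet> b)"
  shows "L2_tendsto S us u"
proof -
  have "L2_tendsto S (\<lambda>k x. \<Sum>b\<in>Basis. (us k x \<bullet> b) *\<^sub>R b) (\<lambda>x. \<Sum>b\<in>Basis. (u x \<bullet> b) *\<^sub>R b)"
    by (intro L2_tendsto_sum L2_tendsto_bounded_linear[OF bounded_linear_scaleR_left] assms)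
  then show ?thesis by (simp add: euclidean_representation)
qed

lemma L2_tendsto_mult_bounded:
  fixes m :: "'a::euclidean_space \<Rightarrow> real"
  assumes "L2_tendsto S us u" "m \<in> mbl S" "\<And>x. x \<in> S \<Longrightarrow> \<bar>m x\<bar> \<le> C"
  shows "L2_tendsto S (\<lambda>k x. m x *\<^sub>R us k x) (\<lambda>x. m x *\<^sub>R u x)"
proof (rule L2_tendsto_squeeze)
  note * = L2_tendstoD[OF assms(1)]
  show 1: "L2 S (\<lambda>x. m x *\<^sub>R us k x)" for k using L2_mult_bounded[OF *(1) assms(2,3)] .
  show 2: "L2 S (\<lambda>x. m x *\<^sub>R u x)" using L2_mult_bounded[OF *(2) assms(2,3)] .
  show "l2n S (\<lambda>x. m x *\<^sub>R us k x - m x *\<^sub>R u x) \<le> \<bar>C\<bar> * l2n S (\<lambda>x. us k x - u x)" for k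
  proof (rule l2n_le_bound)
    show "AE x in leb S. norm (m x *\<^sub>R us k x - m x *\<^sub>R u x) \<le> \<bar>C\<bar> * norm (us k x - u x)"
      using assms(3) by (intro AE_I2) (force simp: scaleR_diff_right[symmetric] intro!: mult_right_mono)
  qed (use 1 2 * in \<open>auto intro!: L2_diff\<close>)
  show "(\<lambda>k. \<bar>C\<bar> * l2n S (\<lambda>x. us k x - u x)) \<longlonglongrightarrow> 0" using tendsto_mult_left[OF *(3)] by force
qed

lemma L2_tendsto_cong_AE:
  assumes "S \<in> sets lebesgue" "L2_tendsto S us u"
    "\<And>k. AE x in leb S. us k x = vs k x" "AE x in leb S. u x = v x"
  shows "L2_tendsto S vs v"
proof -
  note * = L2_tendstoD[OF assms(2)]
  have v: "L2 S (vs k)" "L2 S v" for k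
    using L2_cong_AE[OF assms(1,3) *(1)] L2_cong_AE[OF assms(1,4) *(2)] by auto
  have "l2n S (\<lambda>x. us k x - u x) = l2n S (\<lambda>x. vs k x - v x)" for k
    using assms(3)[of k] assms(4)
    by (intro l2n_cong_AE L2_meas L2_diff * v) auto
  then show ?thesis using * v by (simp add: L2_tendsto_iff)
qed

lemma L2_tendsto_cong:
  assumes "\<And>k x. x \<in> S \<Longrightarrow> us k x = vs k x" "\<And>x. x \<in> S \<Longrightarrow> u x = v x"
  shows "L2_tendsto S us u = L2_tendsto S vs v"
proof -
  have "L2 S (us k) = L2 S (vs k)" "L2 S u = L2 S v" for k
    using assms by (auto intro!: L2_cong)
  moreover have "l2n S (\<lambda>x. us k x - u x) = l2n S (\<lambda>x. vs k x - v x)" for k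
    using assms by (auto intro!: l2n_cong)
  ultimately show ?thesis by (simp add: L2_tendsto_iff)
qed

lemma L2_tendsto_inner:
  assumes "L2_tendsto S us u" "L2_tendsto S vs v"
  shows "(\<lambda>k. LINT x|leb S. us k x \<bullet> vs k x) \<longlonglongrightarrow> (LINT x|leb S. u x \<bullet> v x)"
proof -
  note u = L2_tendstoD[OF assms(1)] and v = L2_tendstoD[OF assms(2)]
  let ?d = "\<lambda>k. l2n S (\<lambda>x. us k x - u x)" and ?e = "\<lambda>k. l2n S (\<lambda>x. vs k x - v x)"
  have "(LINT x|leb S. us k x \<bullet> vs k x) - (LINT x|leb S. u x \<bullet> v x) =
    (LINT x|leb S. (us k x - u x) \<bullet> (vs k x - v x)) + (LINT x|leb S. (us k x - u x) \<bullet> v x)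
    + (LINT x|leb S. u x \<bullet> (vs k x - v x))" (is "?A k = ?B k + ?C k + ?D k") for k
    using L2_integrable_inner[OF u(1) v(1)] L2_integrable_inner[OF u(1) v(2)]
      L2_integrable_inner[OF u(2) v(1)] L2_integrable_inner[OF u(2) v(2)]
    by (simp add: inner_diff_left inner_diff_right)
  then have eq: "?A k = ?B k + ?C k + ?D k" for k by blast
  have "\<bar>?A k\<bar> \<le> ?d k * ?e k + ?d k * l2n S v + l2n S u * ?e k" for k
  proof -
    have *: "\<bar>A\<bar> \<le> x + y + z" if "A = B + C + D" "\<bar>B\<bar> \<le> x" "\<bar>C\<bar> \<le> y" "\<bar>D\<bar> \<le> z" for A B C D x y z :: real
      using that by linarith
    show ?thesis
      by (rule *[OF eq L2_Cauchy_Schwarz[OF L2_diff[OF u(1,2)] L2_diff[OF v(1,2)]]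
          L2_Cauchy_Schwarz[OF L2_diff[OF u(1,2)] v(2)] L2_Cauchy_Schwarz[OF u(2) L2_diff[OF v(1,2)]]])
  qed
  moreover have "(\<lambda>k. ?d k * ?e k + ?d k * l2n S v + l2n S u * ?e k) \<longlonglongrightarrow> 0 * 0 + 0 * l2n S v + l2n S u * 0"
    by (rule tendsto_add[OF tendsto_add[OF tendsto_mult[OF u(3) v(3)] tendsto_mult_right[OF u(3)]] tendsto_mult_left[OF v(3)]])
  ultimately have "(\<lambda>k. (LINT x|leb S. us k x \<bullet> vs k x) - (LINT x|leb S. u x \<bullet> v x)) \<longlonglongrightarrow> 0"
    by (rule_tac Lim_null_comparison[OF always_eventually]) (simp_all add: real_norm_def)
  then show ?thesis by (simp add: LIM_zero_iff)
qed

lemma L2_tendsto_mult: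
  fixes u v :: "'a::euclidean_space \<Rightarrow> real"
  assumes "L2_tendsto S us u" "L2_tendsto S vs v"
  shows "(\<lambda>k. LINT x|leb S. us k x * vs k x) \<longlonglongrightarrow> (LINT x|leb S. u x * v x)"
  using L2_tendsto_inner[OF assms] by simp

lemma L2_tendsto_norm: assumes "L2_tendsto S us u" shows "(\<lambda>k. l2n S (us k)) \<longlonglongrightarrow> l2n S u"
proof -
  have "(\<lambda>k. sqrt (LINT x|leb S. us k x \<bullet> us k x)) \<longlonglongrightarrow> sqrt (LINT x|leb S. u x \<bullet> u x)"
    by (intro tendsto_real_sqrt L2_tendsto_inner assms)
  then show ?thesis by (simp add: l2n_def power2_norm_eq_inner)
qed

lemma L2_tendsto_dominated:
  fixes us :: "nat \<Rightarrow> 'a::euclidean_space \<Rightarrow> 'b::euclidean_space"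
  assumes "L2 S w" "\<And>k. us k \<in> mbl S" "u \<in> mbl S"
    "\<And>k x. x \<in> S \<Longrightarrow> norm (us k x) \<le> norm (w x)" "AE x in leb S. (\<lambda>k. us k x) \<longlonglongrightarrow> u x"
  shows "L2_tendsto S us u"
proof -
  have w: "integrable (leb S) (\<lambda>x. (norm (w x))\<^sup>2)" using assms(1) L2_int by blast
  have us: "L2 S (us k)" for k
    using assms(4) by (intro L2I_bound[OF assms(2) w]) (auto intro!: AE_I2 power_mono)
  have le: "AE x in leb S. norm (u x) \<le> norm (w x)"
    using assms(5) AE_space
  proof eventually_elim
    case (elim x)
    show ?case
      by (rule tendsto_upperbound[OF tendsto_norm[OF elim(1)]]) (use assms(4) elim(2) in auto)
  qed
  have u: "L2 S u"
    using le by (intro L2I_bound[OF assms(3) w]) (auto intro!: power_mono elim!: eventually_mono)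
  have "(\<lambda>k. LINT x|leb S. (norm (us k x - u x))\<^sup>2) \<longlonglongrightarrow> (LINT x|leb S. 0)"
  proof (rule integral_dominated_convergence[where w = "\<lambda>x. 4 * (norm (w x))\<^sup>2"])
    show "AE x in leb S. norm ((norm (us k x - u x))\<^sup>2) \<le> 4 * (norm (w x))\<^sup>2" for k
      using le AE_space
    proof eventually_elim
      case (elim x)
      have "norm (us k x - u x) \<le> 2 * norm (w x)"
        using norm_triangle_ineq4[of "us k x" "u x"] assms(4)[of x k] elim by auto
      from power_mono[OF this, of 2] show ?case by (simp add: power_mult_distrib)
    qed
    show "AE x in leb S. (\<lambda>k. (norm (us k x - u x))\<^sup>2) \<longlonglongrightarrow> 0"
      using assms(5) by eventually_elim (auto intro!: tendsto_eq_intros simp: LIM_zero)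
  qed (use assms(2,3) w in auto)
  then show ?thesis using us u by (simp add: L2_tendsto_def)
qed

lemma L2_tendsto_bounded_convergence:
  fixes us :: "nat \<Rightarrow> 'a::euclidean_space \<Rightarrow> 'b::euclidean_space"
  assumes "S \<in> lmeasurable" "\<And>k. us k \<in> mbl S" "u \<in> mbl S"
    "\<And>k x. x \<in> S \<Longrightarrow> norm (us k x) \<le> C" "AE x in leb S. (\<lambda>k. us k x) \<longlonglongrightarrow> u x"
  shows "L2_tendsto S us u"
  by (rule L2_tendsto_dominated[where w = "\<lambda>x. C", OF L2_bounded[OF assms(1), where C = "\<bar>C\<bar>"]])
     (use assms in \<open>auto intro: order_trans[OF _ abs_ge_self]\<close>)

lemma L2_subset:
  assumes "S \<subseteq> T" "S \<in> sets lebesgue" "T \<in> sets lebesgue" "L2 T f"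
  shows "L2 S f"
  unfolding L2_def
proof
  show "f \<in> mbl S"
    using measurable_restrict_mono[OF L2_meas[OF assms(4)] assms(1)] .
  have "integrable lebesgue (\<lambda>x. if x \<in> T then (norm (f x))\<^sup>2 else 0)"
    by (subst Lebesgue_Measure.integrable_restrict_UNIV[OF assms(3)]) (rule L2_int[OF assms(4)])
  then have "integrable lebesgue (\<lambda>x. indicator S x *\<^sub>R (if x \<in> T then (norm (f x))\<^sup>2 else 0))"
    using assms(2) by (intro integrable_mult_indicator) auto
  moreover have "(\<lambda>x. indicator S x *\<^sub>R (if x \<in> T then (norm (f x))\<^sup>2 else 0)) =
      (\<lambda>x. if x \<in> S then (norm (f x))\<^sup>2 else 0)"
    using assms(1) by (auto simp: fun_eq_iff indicator_def)
  ultimately show "integrable (leb S) (\<lambda>x. (norm (f x))\<^sup>2)"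
    using assms(2) by (simp add: Lebesgue_Measure.integrable_restrict_UNIV)
qed

lemma LINT_subset:
  fixes f :: "'a::euclidean_space \<Rightarrow> 'b::euclidean_space"
  assumes "S \<subseteq> T" "S \<in> sets lebesgue" "T \<in> sets lebesgue" "\<And>x. x \<in> T - S \<Longrightarrow> f x = 0"
  shows "(LINT x|leb T. f x) = (LINT x|leb S. f x)"
  unfolding Lebesgue_Measure.integral_restrict[OF assms(1-3), symmetric]
  using assms(4) by (intro LINT_cong) auto

lemma l2n_subset:
  assumes "S \<subseteq> T" "S \<in> sets lebesgue" "T \<in> sets lebesgue" "L2 T f"
  shows "l2n S f \<le> l2n T f"
proof -
  have "(LINT x|leb S. (norm (f x))\<^sup>2) = (LINT x|leb T. (if x \<in> S then (norm (f x))\<^sup>2 else 0))"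
    by (rule Lebesgue_Measure.integral_restrict[OF assms(1-3), symmetric])
  also have "\<dots> \<le> (LINT x|leb T. (norm (f x))\<^sup>2)"
  proof (rule integral_mono_AE)
    show i: "integrable (leb T) (\<lambda>x. (norm (f x))\<^sup>2)" by (rule L2_int[OF assms(4)])
    show "integrable (leb T) (\<lambda>x. if x \<in> S then (norm (f x))\<^sup>2 else 0)"
    proof (rule Bochner_Integration.integrable_bound[OF i])
      show "(\<lambda>x. if x \<in> S then (norm (f x))\<^sup>2 else 0) \<in> mbl T"
        using L2_meas[OF L2_subset[OF assms]] by (subst borel_measurable_if_lebesgue_on[OF assms(2,3,1)]) auto
    qed auto
  qed auto
  finally show ?thesis by (simp add: l2n_def)
qed

lemma L2_tendsto_subset:
  assumes "S \<subseteq> T" "S \<in> sets lebesgue" "T \<in> sets lebesgue" "L2_tendsto T us u"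
  shows "L2_tendsto S us u"
proof (rule L2_tendsto_squeeze)
  note * = L2_tendstoD[OF assms(4)]
  show "L2 S (us k)" "L2 S u" for k by (rule L2_subset[OF assms(1-3)], rule *)+
  show "l2n S (\<lambda>x. us k x - u x) \<le> l2n T (\<lambda>x. us k x - u x)" for k
    by (rule l2n_subset[OF assms(1-3) L2_diff[OF *(1,2)]])
qed (rule L2_tendstoD(3)[OF assms(4)])

lemma sets_lebesgue_on_iff: "S \<in> sets lebesgue \<Longrightarrow> A \<in> sets (leb S) \<longleftrightarrow> A \<in> sets lebesgue \<and> A \<subseteq> S"
  by (subst sets_restrict_space_iff) auto

lemma test_function_L2:
  assumes "test_function T f" "S \<in> sets lebesgue" shows "L2 S f"
proof -
  obtain K where K: "compact K" "\<And>x. x \<notin> K \<Longrightarrow> f x = 0" using assms by (auto simp: test_function_def)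
  have c: "continuous_on UNIV f" using assms by (auto simp: test_function_def intro: smooth_continuous)
  have m: "K \<in> sets lebesgue" using K(1) by (simp add: compact_imp_closed)
  have "L2 K f" using K(1) c m compact_imp_bounded by (intro L2_continuous) auto
  then have "integrable lebesgue (\<lambda>x. if x \<in> K then (norm (f x))\<^sup>2 else 0)"
    by (subst Lebesgue_Measure.integrable_restrict_UNIV[OF m]) (rule L2_int)
  moreover have "(\<lambda>x. if x \<in> K then (norm (f x))\<^sup>2 else 0) = (\<lambda>x. (norm (f x))\<^sup>2)" using K(2) by auto
  ultimately have "L2 UNIV f"
    using c by (auto simp: L2_def lebesgue_on_UNIV_eq intro: continuous_measurable_lebesgue_on[of _ UNIV, unfolded lebesgue_on_UNIV_eq])
  then show ?thesis by (rule L2_subset [rotated 3]) (use assms(2) in auto)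
qed

lemma L2_indicator:
  assumes "A \<in> sets lebesgue" "bounded A" "S \<in> sets lebesgue"
  shows "L2 S (indicat_real A)"
proof -
  have "integrable lebesgue (indicat_real A)"
    using bounded_set_imp_lmeasurable[OF assms(2,1)] by (auto simp: fmeasurable_def)
  moreover have "(\<lambda>x. (norm (indicat_real A x))\<^sup>2) = indicat_real A" by (auto simp: indicator_def)
  ultimately have "L2 UNIV (indicat_real A)" using assms(1) by (simp add: L2_def lebesgue_on_UNIV_eq)
  then show ?thesis using assms(3) by (auto intro: L2_subset[of S UNIV])
qed

text \<open>Take K closed inside A and V open around K, both differences having measure below e^2/2;
  K is compact because A is bounded. A Urysohn function for K in the intersection of V and X differs
  from the indicator by at most 1, and only on a set of measure below e^2.\<close>

lemma indicator_approx_test_function: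
  fixes A X :: "'a::euclidean_space set"
  assumes "open X" "A \<in> sets lebesgue" "A \<subseteq> X" "bounded A" "e > 0"
  obtains f where "test_function X f" "l2n X (\<lambda>x. indicator A x - f x) < e"
proof -
  define d where "d = e\<^sup>2 / 2"
  have d: "d > 0" using assms(5) by (simp add: d_def)
  have O: "X \<in> sets lebesgue" using assms(1) by simp
  obtain K where K: "closed K" "K \<subseteq> A" "A - K \<in> lmeasurable" "emeasure lebesgue (A - K) < ennreal d"
    using sets_lebesgue_inner_closed[OF assms(2) d] by metis
  have cK: "compact K" using K assms(4) bounded_subset compact_eq_bounded_closed by blast
  have mK: "K \<in> sets lebesgue" using K(1) by simp
  obtain V where V: "open V" "K \<subseteq> V" "V - K \<in> lmeasurable" "emeasure lebesgue (V - K) < ennreal d"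
    using sets_lebesgue_outer_open[OF mK d] by metis
  obtain f where f: "test_function (V \<inter> X) f" "\<And>x. 0 \<le> f x" "\<And>x. f x \<le> 1" "\<And>x. x \<in> K \<Longrightarrow> f x = 1"
    using smooth_Urysohn[OF cK open_Int[OF V(1) assms(1)]] V(2) K(2) assms(3) by (metis Int_greatest order_trans)
  have f0: "f x = 0" if "x \<notin> V" for x using f(1) that by (auto simp: test_function_def)
  have t: "test_function X f" using f(1) test_function_mono by blast
  define B where "B = (A - K) \<union> ((V - K) \<inter> X)"
  have B: "B \<subseteq> X" "B \<in> lmeasurable"
    using K V assms O by (auto simp: B_def intro!: fmeasurable.Un fmeasurable_Int_fmeasurable)
  have mB: "B \<in> sets lebesgue" using B by blast
  have "emeasure lebesgue B \<le> emeasure lebesgue (A - K) + emeasure lebesgue (V - K)"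
    unfolding B_def using K V O
    by (intro order_trans[OF emeasure_subadditive] add_left_mono emeasure_mono) auto
  also have "\<dots> < ennreal d + ennreal d" using K(4) V(4) by (rule add_strict_mono)
  also have "\<dots> = ennreal (e\<^sup>2)" using d by (simp add: d_def ennreal_plus[symmetric] del: ennreal_plus)
  finally have meas: "measure lebesgue B < e\<^sup>2"
    using B(2) by (simp add: emeasure_eq_measure2 ennreal_less_iff)
  have "(norm (indicator A x - f x))\<^sup>2 \<le> (if x \<in> B then 1 else 0)" if "x \<in> X" for x
  proof (cases "x \<in> B")
    case True
    have "\<bar>indicator A x - f x\<bar> \<le> 1" using f(2)[of x] f(3)[of x] by (auto simp: indicator_def)
    then show ?thesis using True by (simp add: abs_square_le_1)
  next
    case False
    then have "indicator A x - f x = 0"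
      using that f(4)[of x] f0[of x] K(2) V(2) unfolding B_def by (auto simp: indicator_def)
    then show ?thesis using False by simp
  qed
  moreover have iB: "integrable (leb X) (\<lambda>x. if x \<in> B then 1 else (0::real))"
  proof -
    have "integrable lebesgue (\<lambda>x. if x \<in> B then 1 else (0::real))"
      using B(2) Lebesgue_Measure.integrable_restrict_UNIV[OF mB, of "\<lambda>x. 1::real"]
        finite_measure.integrable_const[OF finite_measure_lebesgue_on[OF B(2)], of "1::real"] by simp
    moreover have "(\<lambda>x. if x \<in> X then if x \<in> B then 1 else 0 else 0) = (\<lambda>x. if x \<in> B then 1 else (0::real))"
      using B(1) by (auto simp: fun_eq_iff)
    ultimately show ?thesis
      using Lebesgue_Measure.integrable_restrict_UNIV[OF O, of "\<lambda>x. if x \<in> B then 1 else (0::real)"] by simp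
  qed
  moreover have "L2 X (\<lambda>x. indicator A x - f x)"
  proof (rule L2_diff[OF _ test_function_L2[OF t O]])
    show "L2 X (indicat_real A)" by (rule L2_indicator[OF assms(2,4) O])
  qed
  ultimately have "(l2n X (\<lambda>x. indicator A x - f x))\<^sup>2 \<le> (LINT x|leb X. (if x \<in> B then 1 else 0))"
    unfolding l2n_power2 by (intro integral_mono_AE L2_int AE_I2) simp_all
  also have "\<dots> = measure lebesgue B"
    using Lebesgue_Measure.integral_restrict[OF B(1) mB O, of "\<lambda>x. 1::real"] mB
    by (simp add: measure_restrict_space)
  finally have "l2n X (\<lambda>x. indicator A x - f x) < e"
    using meas assms(5) by (smt (verit) power_mono l2n_nonneg)
  then show ?thesis using t that by blast
qed

lemma test_function_cmult: "test_function S f \<Longrightarrow> test_function S (\<lambda>x. c * f x)"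
  by (force simp: test_function_def intro: smooth_cmult)

lemma test_function_add:
  assumes "test_function S f" "test_function S q" shows "test_function S (\<lambda>x. f x + q x)"
proof -
  obtain K K' where "compact K" "K \<subseteq> S" "\<forall>x. x \<notin> K \<longrightarrow> f x = 0" "compact K'" "K' \<subseteq> S" "\<forall>x. x \<notin> K' \<longrightarrow> q x = 0"
    using assms by (auto simp: test_function_def)
  then show ?thesis using assms by (auto simp: test_function_def smooth_add intro!: exI[of _ "K \<union> K'"])
qed

lemma test_function_0: "test_function S (\<lambda>x. 0)" by (auto simp: test_function_def)

lemma test_function_mult: "test_function S f \<Longrightarrow> smooth q \<Longrightarrow> test_function S (\<lambda>x. q x * f x)"
  by (force simp: test_function_def intro: smooth_mult)

text \<open>The functions approximable by test functions form a linear space that contains the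
  indicators of bounded sets, hence truncated simple functions; these converge to \<open>f\<close>
  with a square integrable majorant.\<close>

lemma test_functions_dense:
  fixes f :: "'a::euclidean_space \<Rightarrow> real"
  assumes O: "open X" and f: "L2 X f"
  obtains q where "\<And>n. test_function X (q n)" "L2_tendsto X q f"
proof -
  define P where "P g \<longleftrightarrow> L2 X g \<and> (\<forall>e>0. \<exists>q. test_function X q \<and> l2n X (\<lambda>x. g x - q x) < e)" for g
  have m: "X \<in> sets lebesgue" using O by simp
  have P_add: "P (\<lambda>x. g x + h x)" if "P g" "P h" for g h
    unfolding P_def
  proof (intro conjI allI impI)
    show "L2 X (\<lambda>x. g x + h x)" using that by (simp add: P_def L2_add)
    fix e :: real assume "e > 0"
    then have e: "e / 2 > 0" by simp
    have ex: "\<exists>q. test_function X q \<and> l2n X (\<lambda>x. g x - q x) < e / 2" if "P g" for g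
      using that e unfolding P_def by blast
    note ex1 = ex[OF that(1)] and ex2 = ex[OF that(2)]
    obtain q p where *: "test_function X q" "l2n X (\<lambda>x. g x - q x) < e/2"
      "test_function X p" "l2n X (\<lambda>x. h x - p x) < e/2"
      using ex1 ex2 by blast
    have "l2n X (\<lambda>x. (g x + h x) - (q x + p x)) < e"
      using l2n_triangle[of X "\<lambda>x. g x - q x" "\<lambda>x. h x - p x"] that * m
      by (simp add: P_def L2_diff test_function_L2 algebra_simps)
    then show "\<exists>q. test_function X q \<and> l2n X (\<lambda>x. g x + h x - q x) < e"
      using test_function_add[OF *(1,3)] by blast
  qed
  have P_cmult: "P (\<lambda>x. c * g x)" if "P g" for c g
    unfolding P_def
  proof (intro conjI allI impI)
    show "L2 X (\<lambda>x. c * g x)" using that by (simp add: P_def L2_cmult)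
    fix e :: real assume e: "e > 0"
    then have "e / (\<bar>c\<bar> + 1) > 0" by simp
    then have "\<exists>q. test_function X q \<and> l2n X (\<lambda>x. g x - q x) < e / (\<bar>c\<bar> + 1)"
      using that unfolding P_def by blast
    then obtain q where *: "test_function X q" "l2n X (\<lambda>x. g x - q x) < e / (\<bar>c\<bar> + 1)" by blast
    have "l2n X (\<lambda>x. c * g x - c * q x) = \<bar>c\<bar> * l2n X (\<lambda>x. g x - q x)"
      using l2n_scaleR[of X c "\<lambda>x. g x - q x"] by (simp add: algebra_simps)
    also have "\<dots> \<le> (\<bar>c\<bar> + 1) * l2n X (\<lambda>x. g x - q x)" by (intro mult_right_mono) auto
    also have "\<dots> < e" using *(2) by (simp add: field_simps)
    finally show "\<exists>q. test_function X q \<and> l2n X (\<lambda>x. c * g x - q x) < e"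
      using test_function_cmult[OF *(1)] by blast
  qed
  have P_ind: "P (\<lambda>x. indicator A x)" if A: "A \<in> sets lebesgue" "A \<subseteq> X" "bounded A" for A
  proof -
    have "L2 X (indicat_real A)" by (rule L2_indicator[OF A(1,3) m])
    then show ?thesis using indicator_approx_test_function[OF O A] unfolding P_def by metis
  qed
  obtain s where s': "\<forall>i. simple_function (leb X) (s i)"
    "\<forall>x\<in>space (leb X). (\<lambda>i. s i x) \<longlonglongrightarrow> f x"
    "\<forall>i. \<forall>x\<in>space (leb X). dist (s i x) 0 \<le> 2 * dist (f x) 0"
    using borel_measurable_implies_sequence_metric[OF L2_meas[OF f], of 0] by blast
  then have s: "\<And>i. simple_function (leb X) (s i)"
    "\<And>x. x \<in> X \<Longrightarrow> (\<lambda>i. s i x) \<longlonglongrightarrow> f x" "\<And>i x. x \<in> X \<Longrightarrow> dist (s i x) 0 \<le> 2 * dist (f x) 0"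
    by simp_all
  \<comment> \<open>\<open>X\<close> may have infinite measure: intersecting the level sets with
    balls makes them bounded, and every point lies in the balls from some index on.\<close>
  define A where "A i y = s i -` {y} \<inter> X \<inter> cball 0 (real i)" for i y
  have A: "A i y \<in> sets lebesgue" "A i y \<subseteq> X" "bounded (A i y)" for i y
  proof -
    have "s i -` {y} \<inter> space (leb X) \<in> sets (leb X)"
      using simple_functionD(2)[OF s(1)] by blast
    then show "A i y \<in> sets lebesgue" using m by (auto simp: A_def sets_lebesgue_on_iff)
  qed (auto simp: A_def bounded_subset[OF bounded_cball])
  define t where "t i x = (\<Sum>y\<in>s i ` X. y * indicator (A i y) x)" for i x
  have fin: "finite (s i ` X)" for i using simple_functionD(1)[OF s(1)] by simp
  have t_eq: "t i x = s i x * indicator (cball 0 (real i)) x" if "x \<in> X" for i x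
  proof -
    have "t i x = (\<Sum>y\<in>s i ` X. if y = s i x then s i x * indicator (cball 0 (real i)) x else 0)"
      unfolding t_def using that by (intro sum.cong) (auto simp: A_def indicator_def)
    then show ?thesis using fin that by (simp add: sum.delta)
  qed
  have P_sum: "P (\<lambda>x. \<Sum>y\<in>Y. y * indicator (A i y) x)" if "finite Y" for Y i
    using that
  proof (induction Y)
    case empty
    show ?case using test_function_0 by (auto simp: P_def intro!: exI[of _ "\<lambda>x. 0"])
  next
    case (insert y Y)
    show ?case unfolding sum.insert[OF insert.hyps] by (rule P_add[OF P_cmult[OF P_ind[OF A]] insert.IH])
  qed
  have Pt: "P (t i)" for i unfolding t_def[abs_def] by (rule P_sum[OF fin])
  have tend: "L2_tendsto X t f"
  proof (rule L2_tendsto_dominated[where w = "\<lambda>x. 2 * f x"])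
    show "L2 X (\<lambda>x. 2 * f x)" using f L2_cmult by blast
    show "t k \<in> mbl X" for k using Pt[of k] by (auto simp: P_def L2_def)
    show "norm (t k x) \<le> norm (2 * f x)" if "x \<in> X" for k x
      using s(3)[OF that, of k] by (simp add: t_eq[OF that] indicator_def abs_mult)
    show "AE x in leb X. (\<lambda>k. t k x) \<longlonglongrightarrow> f x"
    proof (rule AE_I2)
      fix x assume "x \<in> space (leb X)"
      then have x: "x \<in> X" by simp
      have "\<forall>\<^sub>F k in sequentially. s k x = t k x"
        using eventually_ge_at_top[of "nat \<lceil>norm x\<rceil>"]
      proof eventually_elim
        case (elim k)
        then have "norm x \<le> real k" by linarith
        then show ?case by (simp add: t_eq[OF x])
      qed
      then show "(\<lambda>k. t k x) \<longlonglongrightarrow> f x" by (rule Lim_transform_eventually[OF s(2)[OF x]])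
    qed
  qed (rule L2_meas[OF f])
  have "(0::real) < 1 / Suc n" for n by simp
  then have "\<exists>q. test_function X q \<and> l2n X (\<lambda>x. t n x - q x) < 1 / Suc n" for n
    using Pt[of n] unfolding P_def by blast
  then obtain q where q: "\<And>n. test_function X (q n)" "\<And>n. l2n X (\<lambda>x. t n x - q n x) < 1 / Suc n"
    by metis
  have "L2_tendsto X q f"
  proof (rule L2_tendsto_squeeze)
    show 1: "L2 X (q k)" for k using q(1) m test_function_L2 by blast
    show "l2n X (\<lambda>x. q k x - f x) \<le> 1 / Suc k + l2n X (\<lambda>x. t k x - f x)" for k
      using l2n_triangle3[OF 1 _ f, of "t k" k] Pt[of k] q(2)[of k]
      by (simp add: P_def l2n_minus_commute[of _ "q k"])
    show "(\<lambda>k. 1 / Suc k + l2n X (\<lambda>x. t k x - f x)) \<longlonglongrightarrow> 0"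
      using tendsto_add[OF LIMSEQ_inverse_real_of_nat L2_tendstoD(3)[OF tend]] by (simp add: inverse_eq_divide)
  qed (rule f)
  then show ?thesis using q(1) that by blast
qed

text \<open>Test functions tending to \<open>v\<close> itself turn the hypothesis into norm(v)^2 <=
  C norm(v). This extracts an L2 estimate from an integral identity that is known for test functions
  only.\<close>

lemma L2_dual_bound:
  fixes v :: "'a::euclidean_space \<Rightarrow> real"
  assumes "open X" "L2 X v" "0 \<le> C"
    "\<And>f. test_function X f \<Longrightarrow> \<bar>LINT x|leb X. v x * f x\<bar> \<le> C * l2n X f"
  shows "l2n X v \<le> C"
proof -
  obtain f where f: "\<And>n. test_function X (f n)" "L2_tendsto X f v"
    using test_functions_dense[OF assms(1,2)] by blast
  have "(\<lambda>n. \<bar>LINT x|leb X. v x * f n x\<bar>) \<longlonglongrightarrow> \<bar>LINT x|leb X. v x * v x\<bar>"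
    by (intro tendsto_rabs L2_tendsto_mult L2_tendsto_const assms f)
  moreover have "(\<lambda>n. C * l2n X (f n)) \<longlonglongrightarrow> C * l2n X v"
    by (intro tendsto_mult_left L2_tendsto_norm f)
  ultimately have "\<bar>LINT x|leb X. v x * v x\<bar> \<le> C * l2n X v"
    using assms(4) f(1) by (intro LIMSEQ_le) auto
  moreover have "(l2n X v)\<^sup>2 = (LINT x|leb X. v x * v x)"
    by (simp add: l2n_power2) (simp add: power2_eq_square)
  ultimately have "l2n X v * l2n X v \<le> C * l2n X v"
    by (metis abs_of_nonneg power2_eq_square zero_le_power2)
  then show ?thesis using assms(3) by (smt (verit) l2n_nonneg mult_le_cancel_right_pos)
qed

lemma du_Bois_Reymond:
  fixes v :: "'a::euclidean_space \<Rightarrow> real"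
  assumes "open X" "L2 X v" "\<And>f. test_function X f \<Longrightarrow> (LINT x|leb X. v x * f x) = 0"
  shows "AE x in leb X. v x = 0"
  using L2_dual_bound[OF assms(1,2), of 0] assms(3) by (intro l2n_eq_0 assms(2)) (auto intro: antisym)

section \<open>Changes of variables with constant Jacobian\<close>

text \<open>Change of variables with constant Jacobian \<open>c\<close>, possibly between different
  types: affine maps of one space and the coordinate maps from a product such as real^2 x real to
  real^3 are treated alike. The image of a set has \<open>c\<close> times its volume.\<close>

definition scales :: "real \<Rightarrow> ('a::euclidean_space \<Rightarrow> 'b::euclidean_space) \<Rightarrow> bool" where
  "scales c T \<longleftrightarrow> 0 < c \<and> bij T \<and> T \<in> borel \<rightarrow>\<^sub>M borel \<and> inv T \<in> borel \<rightarrow>\<^sub>M borel \<and>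
     lborel = density (distr lborel borel T) (\<lambda>_. ennreal c)"

lemma scales_emeasure:
  assumes "scales c T" "A \<in> sets borel"
  shows "emeasure lborel A = ennreal c * emeasure lborel (T -` A)"
proof -
  have T: "T \<in> borel \<rightarrow>\<^sub>M borel" using assms(1) by (simp add: scales_def)
  have "emeasure lborel A = emeasure (density (distr lborel borel T) (\<lambda>_. ennreal c)) A"
    using assms(1) by (simp add: scales_def)
  also have "\<dots> = ennreal c * emeasure (distr lborel borel T) A"
    using assms(2) by (subst emeasure_density) (auto simp: nn_integral_cmult_indicator)
  also have "emeasure (distr lborel borel T) A = emeasure lborel (T -` A)"
    using assms(2) T by (subst emeasure_distr) auto
  finally show ?thesis .
qed

lemma scales_inv:
  assumes "scales c T" shows "scales (1 / c) (inv T)"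
  unfolding scales_def
proof (intro conjI)
  have c: "0 < c" and b: "bij T" and iT: "inv T \<in> borel \<rightarrow>\<^sub>M borel" using assms by (auto simp: scales_def)
  show "0 < 1 / c" using c by simp
  show "bij (inv T)" using b by (rule bij_imp_bij_inv)
  show "inv (inv T) \<in> borel \<rightarrow>\<^sub>M borel" using assms b by (simp add: scales_def inv_inv_eq)
  show "lborel = density (distr lborel borel (inv T)) (\<lambda>_. ennreal (1 / c))"
  proof (rule measure_eqI)
    fix A :: "'a set" assume "A \<in> sets lborel"
    then have A: "A \<in> sets borel" by simp
    have m: "inv T -` A \<in> sets borel" using measurable_sets[OF iT A] by simp
    have "emeasure (density (distr lborel borel (inv T)) (\<lambda>_. ennreal (1 / c))) A
        = ennreal (1 / c) * emeasure (distr lborel borel (inv T)) A"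
      using A by (subst emeasure_density) (auto simp: nn_integral_cmult_indicator)
    also have "emeasure (distr lborel borel (inv T)) A = emeasure lborel (inv T -` A)"
      using A iT by (subst emeasure_distr) auto
    also have "\<dots> = ennreal c * emeasure lborel (T -` (inv T -` A))"
      by (rule scales_emeasure[OF assms m])
    also have "T -` (inv T -` A) = A" using b by (auto simp: bij_is_inj)
    also have "ennreal (1 / c) * (ennreal c * emeasure lborel A) = emeasure lborel A"
      using c by (simp add: mult.assoc[symmetric] ennreal_mult[symmetric])
    finally show "emeasure lborel A = emeasure (density (distr lborel borel (inv T)) (\<lambda>_. ennreal (1 / c))) A"
      by simp
  qed simp
qed (use assms in \<open>auto simp: scales_def\<close>)

text \<open>The Borel identity passes to the completion because \<open>T\<close> preserves null sets
  in both directions.\<close>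

lemma scales_lebesgue:
  fixes T :: "'a::euclidean_space \<Rightarrow> 'b::euclidean_space"
  assumes "scales c T"
  shows "T \<in> lebesgue \<rightarrow>\<^sub>M lebesgue" "lebesgue = density (distr lebesgue lebesgue T) (\<lambda>_. ennreal c)"
proof -
  have c: "0 < c" and T [measurable]: "T \<in> borel \<rightarrow>\<^sub>M borel" using assms by (auto simp: scales_def)
  have e: "emeasure (distr lebesgue lborel T) A = emeasure lborel (T -` A)" if A: "A \<in> sets borel" for A
  proof -
    have "T -` A \<in> sets borel" using measurable_sets[OF T A] by simp
    then show ?thesis
      using A by (subst emeasure_distr) (auto intro: measurable_completion)
  qed
  have eq: "null_sets lborel = null_sets (distr lebesgue lborel T)"
    using c by (auto simp: null_sets_def e scales_emeasure[OF assms])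
  show "T \<in> lebesgue \<rightarrow>\<^sub>M lebesgue"
    by (simp add: completion.measurable_completion2 eq measurable_completion)
  have "lebesgue = completion (density (distr lborel borel T) (\<lambda>_. ennreal c))"
    using assms by (simp add: scales_def)
  also have "\<dots> = density (completion (distr lebesgue lborel T)) (\<lambda>_. ennreal c)"
    using c by (auto intro!: always_eventually completion_density_eq simp: distr_completion cong: distr_cong)
  also have "\<dots> = density (distr lebesgue lebesgue T) (\<lambda>_. ennreal c)"
    by (subst completion.completion_distr_eq) (auto simp: eq measurable_completion)
  finally show "lebesgue = density (distr lebesgue lebesgue T) (\<lambda>_. ennreal c)" .
qed

lemma scales_vimage_sets:
  assumes "scales c T" "S \<in> sets lebesgue" shows "T -` S \<in> sets lebesgue"
  using measurable_sets[OF scales_lebesgue(1)[OF assms(1)] assms(2)] by simp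

lemma scales_image_sets:
  assumes "scales c T" "S \<in> sets lebesgue" shows "T ` S \<in> sets lebesgue"
proof -
  have "bij T" using assms(1) by (simp add: scales_def)
  then have "T ` S = inv T -` S" by (rule bij_image_Collect_eq[of _ "\<lambda>x. x \<in> S", simplified, unfolded vimage_def[symmetric], THEN trans]) (simp add: vimage_def)
  then show ?thesis using scales_vimage_sets[OF scales_inv[OF assms(1)] assms(2)] by simp
qed

lemma scales_lebesgue_integral:
  fixes f :: "'b::euclidean_space \<Rightarrow> 'c::euclidean_space"
  assumes "scales c T" "f \<in> borel_measurable lebesgue"
  shows "integrable lebesgue f \<longleftrightarrow> integrable lebesgue (\<lambda>x. f (T x))"
    and "integral\<^sup>L lebesgue f = c *\<^sub>R (LINT x|lebesgue. f (T x))"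
proof -
  note T = scales_lebesgue[OF assms(1)]
  have c: "0 < c" using assms(1) by (simp add: scales_def)
  have "integrable lebesgue f \<longleftrightarrow> integrable (density (distr lebesgue lebesgue T) (\<lambda>_. ennreal c)) f"
    by (subst T(2)) simp
  also have "\<dots> \<longleftrightarrow> integrable (distr lebesgue lebesgue T) (\<lambda>x. c *\<^sub>R f x)"
    using assms(2) c by (subst integrable_density) auto
  also have "\<dots> \<longleftrightarrow> integrable lebesgue (\<lambda>x. c *\<^sub>R f (T x))"
    using assms(2) T(1) by (subst integrable_distr_eq) auto
  also have "\<dots> \<longleftrightarrow> integrable lebesgue (\<lambda>x. f (T x))"
  proof
    assume "integrable lebesgue (\<lambda>x. c *\<^sub>R f (T x))"
    then have "integrable lebesgue (\<lambda>x. (1 / c) *\<^sub>R (c *\<^sub>R f (T x)))" by (rule integrable_scaleR_right)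
    then show "integrable lebesgue (\<lambda>x. f (T x))" using c by simp
  qed (rule integrable_scaleR_right)
  finally show "integrable lebesgue f \<longleftrightarrow> integrable lebesgue (\<lambda>x. f (T x))" .
  have "integral\<^sup>L lebesgue f = integral\<^sup>L (density (distr lebesgue lebesgue T) (\<lambda>_. ennreal c)) f"
    by (subst T(2)) simp
  also have "\<dots> = integral\<^sup>L (distr lebesgue lebesgue T) (\<lambda>x. c *\<^sub>R f x)"
    using assms(2) c by (subst integral_density) auto
  also have "\<dots> = (LINT x|lebesgue. c *\<^sub>R f (T x))"
    using assms(2) T(1) by (subst integral_distr) auto
  finally show "integral\<^sup>L lebesgue f = c *\<^sub>R (LINT x|lebesgue. f (T x))" by simp
qed

lemma scales_measurable_UNIV:
  fixes f :: "'b::euclidean_space \<Rightarrow> 'c::euclidean_space"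
  assumes "scales c T"
  shows "f \<in> borel_measurable lebesgue \<longleftrightarrow> (\<lambda>x. f (T x)) \<in> borel_measurable lebesgue"
proof
  assume "f \<in> borel_measurable lebesgue"
  then show "(\<lambda>x. f (T x)) \<in> borel_measurable lebesgue"
    using measurable_compose[OF scales_lebesgue(1)[OF assms]] by blast
next
  assume "(\<lambda>x. f (T x)) \<in> borel_measurable lebesgue"
  from measurable_compose[OF scales_lebesgue(1)[OF scales_inv[OF assms]] this]
  show "f \<in> borel_measurable lebesgue"
    using assms by (simp add: scales_def bij_is_surj surj_f_inv_f)
qed

lemma scales_restrict:
  assumes "scales c T"
  shows "(if T x \<in> T ` S then f (T x) else 0) = (if x \<in> S then f (T x) else 0)"
  using assms by (simp add: scales_def bij_is_inj inj_image_mem_iff)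

lemma scales_measurable:
  fixes f :: "'b::euclidean_space \<Rightarrow> 'c::euclidean_space"
  assumes "scales c T" "S \<in> sets lebesgue"
  shows "f \<in> mbl (T ` S) \<longleftrightarrow> (\<lambda>x. f (T x)) \<in> mbl S"
  using scales_measurable_UNIV[OF assms(1), of "\<lambda>x. if x \<in> T ` S then f x else 0"]
  by (simp add: scales_restrict[OF assms(1)] borel_measurable_if assms scales_image_sets[OF assms])

lemma scales_integrable:
  fixes f :: "'b::euclidean_space \<Rightarrow> 'c::euclidean_space"
  assumes "scales c T" "S \<in> sets lebesgue"
  shows "integrable (leb (T ` S)) f \<longleftrightarrow> integrable (leb S) (\<lambda>x. f (T x))"
proof (cases "f \<in> mbl (T ` S)")
  case True
  then have "(\<lambda>x. if x \<in> T ` S then f x else 0) \<in> borel_measurable lebesgue"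
    by (simp add: borel_measurable_if scales_image_sets[OF assms])
  from scales_lebesgue_integral(1)[OF assms(1) this] show ?thesis
    by (simp add: scales_restrict[OF assms(1)] Lebesgue_Measure.integrable_restrict_UNIV assms scales_image_sets[OF assms])
next
  case False
  then have "\<not> integrable (leb (T ` S)) f" by (auto dest: borel_measurable_integrable)
  moreover have "\<not> integrable (leb S) (\<lambda>x. f (T x))"
    using False unfolding scales_measurable[OF assms] by (auto dest: borel_measurable_integrable)
  ultimately show ?thesis by simp
qed

text \<open>No integrability has to be assumed: \<open>scales_integrable\<close> is an equivalence
  even for non-measurable functions, and when integrability fails both integrals are 0.\<close>

lemma scales_LINT:
  fixes f :: "'b::euclidean_space \<Rightarrow> 'c::euclidean_space"
  assumes "scales c T" "S \<in> sets lebesgue"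
  shows "(LINT x|leb (T ` S). f x) = c *\<^sub>R (LINT x|leb S. f (T x))"
proof (cases "integrable (leb (T ` S)) f")
  case True
  then have "(\<lambda>x. if x \<in> T ` S then f x else 0) \<in> borel_measurable lebesgue"
    by (simp add: borel_measurable_if scales_image_sets[OF assms] borel_measurable_integrable)
  from scales_lebesgue_integral(2)[OF assms(1) this] show ?thesis
    by (simp add: scales_restrict[OF assms(1)] Lebesgue_Measure.integral_restrict_UNIV assms scales_image_sets[OF assms])
next
  case False
  then have "\<not> integrable (leb S) (\<lambda>x. f (T x))" using scales_integrable[OF assms] by blast
  then show ?thesis using False by (simp add: not_integrable_integral_eq)
qed

lemma scales_L2:
  assumes "scales c T" "S \<in> sets lebesgue"
  shows "L2 (T ` S) f \<longleftrightarrow> L2 S (\<lambda>x. f (T x))"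
  unfolding L2_def by (simp add: scales_measurable[OF assms] scales_integrable[OF assms])

lemma scales_L2_tendsto:
  assumes "scales c T" "S \<in> sets lebesgue"
  shows "L2_tendsto (T ` S) us u \<longleftrightarrow> L2_tendsto S (\<lambda>k x. us k (T x)) (\<lambda>x. u (T x))"
proof -
  have "0 < c" using assms(1) by (simp add: scales_def)
  then show ?thesis
    unfolding L2_tendsto_def by (simp add: scales_L2[OF assms] scales_LINT[OF assms] tendsto_mult_left_iff[where l = 0, simplified])
qed

text \<open>Lebesgue measure is determined by its values on boxes; the preimage of a box is bounded,
  and the linear image formula gives its volume.\<close>

lemma scales_affine:
  fixes L :: "real^'n::{finite,wellorder} \<Rightarrow> real^'n::_"
  assumes L: "linear L" and d: "det (matrix L) \<noteq> 0"
  shows "scales \<bar>det (matrix L)\<bar> (\<lambda>x. L x + a)"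
proof -
  let ?tA = "density (distr lborel borel (\<lambda>x. L x + a)) (\<lambda>_. ennreal \<bar>det (matrix L)\<bar>)"
  have inj: "inj L" using L d det_nz_iff_inj by blast
  then obtain h where h: "linear h" "\<And>x. h (L x) = x" "\<And>x. L (h x) = x"
    using linear_injective_isomorphism[OF L inj] by auto
  have inv: "inv (\<lambda>x. L x + a) = (\<lambda>x. h (x - a))"
    by (rule inv_unique_comp) (auto simp: fun_eq_iff h)
  have bij: "bij (\<lambda>x. L x + a)"
    by (rule bij_betw_byWitness[where f' = "\<lambda>x. h (x - a)"]) (auto simp: h)
  have cont: "continuous_on UNIV L" "continuous_on UNIV h"
    using L h(1) by (simp_all add: linear_continuous_on linear_conv_bounded_linear)
  have T: "(\<lambda>x. L x + a) \<in> borel \<rightarrow>\<^sub>M borel"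
    by (intro borel_measurable_continuous_onI continuous_intros cont)
  have iT: "(\<lambda>x. h (x - a)) \<in> borel \<rightarrow>\<^sub>M borel"
    by (intro borel_measurable_continuous_onI continuous_intros continuous_on_compose2[OF cont(2)]) auto
  have "lborel = density (distr lborel borel (\<lambda>x. L x + a)) (\<lambda>_. ennreal \<bar>det (matrix L)\<bar>)"
  proof (rule lborel_eqI)
    fix l u :: "real^'n::_" assume le: "\<And>b. b \<in> Basis \<Longrightarrow> l \<bullet> b \<le> u \<bullet> b"
    define B where "B = (\<lambda>x. L x + a) -` box l u"
    have B_eq: "B = (\<lambda>x. h (x - a)) ` box l u"
      unfolding B_def using h by (auto simp: image_iff) (metis add_diff_cancel)
    have "bounded B"
    proof -
      have "B = h ` ((\<lambda>x. x - a) ` box l u)" unfolding B_eq by (simp add: image_image)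
      then show ?thesis
        using bounded_linear_image[OF bounded_translation_minus[OF bounded_box] h(1) [unfolded linear_conv_bounded_linear]]
        by (simp only:)
    qed
    moreover have mB: "B \<in> sets borel" unfolding B_def using measurable_sets[OF T, of "box l u"] by simp
    ultimately have Bl: "B \<in> lmeasurable" by (intro bounded_set_imp_lmeasurable) auto
    have "measure lebesgue (box l u) = measure lebesgue ((+) a ` (L ` B))"
    proof -
      have "(+) a ` (L ` B) = box l u" unfolding B_eq by (auto simp: image_image h)
      then show ?thesis by simp
    qed
    also have "\<dots> = \<bar>det (matrix L)\<bar> * measure lebesgue B"
      using measure_linear_image[OF L Bl] by (simp add: measure_translation)
    finally have "measure lebesgue (box l u) = \<bar>det (matrix L)\<bar> * measure lebesgue B" .
    moreover have "measure lebesgue (box l u) = (\<Prod>b\<in>Basis. (u - l) \<bullet> b)"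
      using le by (simp add: measure_lborel_box_eq)
    moreover have "emeasure lborel B = ennreal (measure lebesgue B)"
      using Bl mB by (metis emeasure_completion emeasure_eq_measure2 main_part sets_completionI_sets sets_lborel)
    moreover have "emeasure ?tA (box l u)
        = ennreal \<bar>det (matrix L)\<bar> * emeasure lborel B"
      using T by (subst emeasure_density) (auto simp: nn_integral_cmult_indicator emeasure_distr B_def)
    ultimately show "emeasure ?tA (box l u)
        = (\<Prod>b\<in>Basis. (u - l) \<bullet> b)"
      by (simp add: ennreal_mult)
  qed simp
  then show ?thesis using d bij T iT by (simp add: scales_def inv)
qed

section \<open>Weak gradients\<close>

lemma grad_zero_outside:
  assumes "compact K" "\<forall>x. x \<notin> K \<longrightarrow> f x = 0" "x \<notin> K" shows "grad f x = 0"
  using grad_eq_on_open[of "- K" x f "\<lambda>_. 0"] assms by (simp add: compact_imp_closed open_Compl)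

lemma test_function_grad: "test_function S f \<Longrightarrow> test_function S (\<lambda>x. grad f x \<bullet> w)"
proof -
  assume t: "test_function S f"
  then obtain K where K: "compact K" "K \<subseteq> S" "\<forall>x. x \<notin> K \<longrightarrow> f x = 0" by (auto simp: test_function_def)
  then have "\<forall>x. x \<notin> K \<longrightarrow> grad f x \<bullet> w = 0" using grad_zero_outside[OF K(1,3)] by simp
  then show ?thesis using K t by (auto simp: test_function_def smooth_grad)
qed

lemma test_function_bounded:
  assumes "test_function S f" obtains C where "0 \<le> C" "\<And>x. \<bar>f x\<bar> \<le> C"
proof -
  obtain K where K: "compact K" "\<forall>x. x \<notin> K \<longrightarrow> f x = 0" using assms by (auto simp: test_function_def)
  obtain C where C: "C \<ge> 0" "\<And>x. x \<in> K \<Longrightarrow> norm (f x) \<le> C"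
    using continuous_bounded_on[OF compact_imp_bounded[OF K(1)] smooth_continuous[OF test_function_smooth[OF assms]]] by metis
  then show ?thesis using that[of C] K(2) by (metis abs_zero real_norm_def)
qed

lemma test_function_integrable:
  assumes F: "test_function T F" and S: "S \<in> sets lebesgue"
  shows "integrable (leb S) F"
proof -
  obtain K where K: "compact K" "\<forall>x. x \<notin> K \<longrightarrow> F x = 0" using F by (auto simp: test_function_def)
  obtain cut where cut: "test_function UNIV cut" "\<And>x. x \<in> K \<Longrightarrow> cut x = 1"
    using smooth_Urysohn[OF K(1) open_UNIV subset_UNIV] by metis
  have "(\<lambda>x. F x * cut x) = F" using K(2) cut(2) by force
  then show ?thesis
    using L2_integrable_mult[OF test_function_L2[OF F S] test_function_L2[OF cut(1) S]] by simp
qed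

lemma smooth_line_DERIV:
  assumes "smooth F"
  shows "((\<lambda>t. F (x + t *\<^sub>R v)) has_real_derivative grad F (x + t *\<^sub>R v) \<bullet> v) (at t)"
proof -
  have "((\<lambda>t. x + t *\<^sub>R v) has_derivative (\<lambda>h. h *\<^sub>R v)) (at t)"
    by (auto intro!: derivative_eq_intros)
  from has_derivative_compose[OF this smooth_has_grad[OF assms]]
  have "((\<lambda>t. F (x + t *\<^sub>R v)) has_derivative (\<lambda>h. grad F (x + t *\<^sub>R v) \<bullet> h *\<^sub>R v)) (at t)" .
  then show ?thesis by (simp add: has_field_derivative_def mult.commute[of _ "grad F (x + t *\<^sub>R v) \<bullet> v"])
qed

text \<open>The set where the integrand is nonzero is open and nonempty, hence not a null set. This
  makes normalising constants positive.\<close>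

lemma integral_continuous_pos:
  fixes f :: "'a::euclidean_space \<Rightarrow> real"
  assumes S: "open S" and f: "continuous_on UNIV f" "integrable (leb S) f" "\<And>x. 0 \<le> f x" and x: "x \<in> S" "0 < f x"
  shows "0 < (LINT x|leb S. f x)"
proof -
  have m: "S \<in> sets lebesgue" using S by simp
  have "(LINT x|leb S. f x) \<noteq> 0"
  proof
    assume "(LINT x|leb S. f x) = 0"
    then have "AE x in leb S. f x = 0" using integral_nonneg_eq_0_iff_AE[OF f(2) always_eventually[OF allI[OF f(3)]]] by simp
    then have "AE x in lebesgue. x \<in> S \<longrightarrow> f x = 0" using m by (simp add: AE_restrict_space_iff)
    then obtain N where N: "N \<in> null_sets lebesgue" "{x. \<not> (x \<in> S \<longrightarrow> f x = 0)} \<subseteq> N"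
      by (auto simp: eventually_ae_filter)
    have "{x. \<not> (x \<in> S \<longrightarrow> f x = 0)} = S \<inter> {x. f x \<noteq> 0}" by auto
    moreover have "open (S \<inter> {x. f x \<noteq> 0})" by (intro open_Int S open_Collect_neq f continuous_on_const)
    moreover have "S \<inter> {x. f x \<noteq> 0} \<noteq> {}" using x by auto
    ultimately have "\<not> negligible {x. \<not> (x \<in> S \<longrightarrow> f x = 0)}" using open_not_negligible by metis
    then show False using N completion.complete2 by (metis negligible_iff_null_sets)
  qed
  moreover have "0 \<le> (LINT x|leb S. f x)" using f(3) by (intro integral_nonneg_AE) auto
  ultimately show ?thesis by simp
qed

lemma scales_homothety:
  fixes t :: "'a::euclidean_space"
  assumes "c \<noteq> 0" shows "scales (\<bar>c\<bar> ^ DIM('a)) (\<lambda>x. c *\<^sub>R x + t)"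
proof -
  let ?tA = "\<lambda>x. c *\<^sub>R x + t"
  have i: "inv ?tA = (\<lambda>x. (1/c) *\<^sub>R (x - t))"
    by (rule inv_unique_comp) (use assms in \<open>auto simp: fun_eq_iff\<close>)
  have "bij ?tA"
    by (rule bij_betw_byWitness[where f' = "\<lambda>x. (1/c) *\<^sub>R (x - t)"]) (use assms in auto)
  moreover have "?tA \<in> borel \<rightarrow>\<^sub>M borel" "(\<lambda>x. (1/c) *\<^sub>R (x - t)) \<in> borel \<rightarrow>\<^sub>M borel"
    by (intro borel_measurable_continuous_onI continuous_intros)+
  moreover have "lborel = density (distr lborel borel ?tA) (\<lambda>_. ennreal (\<bar>c\<bar> ^ DIM('a)))"
    using lborel_affine[OF assms, of t] by (simp add: add.commute)
  ultimately show ?thesis using assms unfolding scales_def i by simp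
qed

lemma test_function_lipschitz:
  assumes "test_function S f"
  obtains C where "0 \<le> C" "\<And>x h. \<bar>f (x + h) - f x\<bar> \<le> C * norm h"
proof -
  have sm: "smooth f" using assms by (rule test_function_smooth)
  have "\<exists>C\<ge>0. \<forall>x. \<bar>grad f x \<bullet> b\<bar> \<le> C" for b
    using test_function_bounded[OF test_function_grad[OF assms]] by metis
  then obtain c where c: "\<And>b. 0 \<le> c b" "\<And>b x. \<bar>grad f x \<bullet> b\<bar> \<le> c b" by metis
  show ?thesis
  proof (rule that)
    show "0 \<le> (\<Sum>b\<in>Basis. c b)" by (intro sum_nonneg c)
    fix x h
    obtain t where "f (x + 1 *\<^sub>R h) - f (x + 0 *\<^sub>R h) = (1 - 0) * (grad f (x + t *\<^sub>R h) \<bullet> h)"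
      using MVT2[of 0 1 "\<lambda>t. f (x + t *\<^sub>R h)" "\<lambda>t. grad f (x + t *\<^sub>R h) \<bullet> h"] smooth_line_DERIV[OF sm] by auto
    then have "\<bar>f (x + h) - f x\<bar> = \<bar>grad f (x + t *\<^sub>R h) \<bullet> h\<bar>" by simp
    also have "\<dots> \<le> norm (grad f (x + t *\<^sub>R h)) * norm h" by (rule Cauchy_Schwarz_ineq2)
    also have "norm (grad f (x + t *\<^sub>R h)) \<le> (\<Sum>b\<in>Basis. c b)"
      by (rule order_trans[OF norm_le_l1 sum_mono]) (rule c)
    finally show "\<bar>f (x + h) - f x\<bar> \<le> (\<Sum>b\<in>Basis. c b) * norm h" by (simp add: mult_right_mono)
  qed
qed

text \<open>Mean value theorem on the segment, then the Lipschitz bound for each directional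
  derivative, which is again a test function. The constant is uniform in the base point, so the
  remainder can be integrated against any integrable function.\<close>

lemma test_function_taylor:
  assumes "test_function S f"
  obtains C where "0 \<le> C" "\<And>x h. \<bar>f (x + h) - f x - grad f x \<bullet> h\<bar> \<le> C * (norm h)\<^sup>2"
proof -
  have sm: "smooth f" using assms by (rule test_function_smooth)
  have "\<exists>C\<ge>0. \<forall>x h. \<bar>grad f (x + h) \<bullet> b - grad f x \<bullet> b\<bar> \<le> C * norm h" for b
    using test_function_lipschitz[OF test_function_grad[OF assms]] by metis
  then obtain c where c: "\<And>b. 0 \<le> c b" "\<And>b x h. \<bar>grad f (x + h) \<bullet> b - grad f x \<bullet> b\<bar> \<le> c b * norm h" by metis
  show ?thesis
  proof (rule that)
    show "0 \<le> (\<Sum>b\<in>Basis. c b)" by (intro sum_nonneg c)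
    fix x h
    obtain t where t: "0 < t" "t < 1" "f (x + 1 *\<^sub>R h) - f (x + 0 *\<^sub>R h) = (1 - 0) * (grad f (x + t *\<^sub>R h) \<bullet> h)"
      using MVT2[of 0 1 "\<lambda>t. f (x + t *\<^sub>R h)" "\<lambda>t. grad f (x + t *\<^sub>R h) \<bullet> h"] smooth_line_DERIV[OF sm] by auto
    have "\<bar>f (x + h) - f x - grad f x \<bullet> h\<bar> = \<bar>(grad f (x + t *\<^sub>R h) - grad f x) \<bullet> h\<bar>"
      using t(3) by (simp add: inner_diff_left)
    also have "\<dots> \<le> norm (grad f (x + t *\<^sub>R h) - grad f x) * norm h" by (rule Cauchy_Schwarz_ineq2)
    also have "norm (grad f (x + t *\<^sub>R h) - grad f x) \<le> (\<Sum>b\<in>Basis. c b * norm (t *\<^sub>R h))"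
      by (rule order_trans[OF norm_le_l1 sum_mono]) (simp only: inner_diff_left c)
    also have "\<dots> \<le> (\<Sum>b\<in>Basis. c b) * norm h"
      using t c(1) unfolding sum_distrib_right by (intro sum_mono mult_left_mono) (auto simp: mult_left_le_one_le)
    finally show "\<bar>f (x + h) - f x - grad f x \<bullet> h\<bar> \<le> (\<Sum>b\<in>Basis. c b) * (norm h)\<^sup>2"
      by (simp add: mult_right_mono power2_eq_square mult.assoc)
  qed
qed

lemma reflected_measurable:
  fixes K :: "'a::euclidean_space \<Rightarrow> real"
  assumes "smooth K" shows "(\<lambda>y. K (x - y)) \<in> mbl S"
proof -
  have "continuous_on UNIV (\<lambda>y. K (x - y))"
    by (rule continuous_on_compose2[OF smooth_continuous[OF assms]]) (auto intro!: continuous_intros)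
  then show ?thesis by (rule continuous_measurable_lebesgue_on)
qed

lemma convolution_integrable:
  fixes K :: "'a::euclidean_space \<Rightarrow> real"
  assumes K: "test_function UNIV K" and w: "integrable (leb S) w"
  shows "integrable (leb S) (\<lambda>y. K (x - y) * w y)"
proof -
  obtain C where C: "0 \<le> C" "\<And>x. \<bar>K x\<bar> \<le> C" using test_function_bounded[OF K] by metis
  show ?thesis
  proof (rule Bochner_Integration.integrable_bound)
    show "integrable (leb S) (\<lambda>y. C * w y)" using w by simp
    show "(\<lambda>y. K (x - y) * w y) \<in> mbl S"
      using w by (intro borel_measurable_times reflected_measurable test_function_smooth[OF K]) auto
    show "AE y in leb S. norm (K (x - y) * w y) \<le> norm (C * w y)"
      using C by (auto simp: abs_mult intro!: mult_right_mono)
  qed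
qed

text \<open>The quadratic Taylor remainder, uniform in the base point, is integrated against
  \<open>w\<close>; this yields the derivative directly, without dominated convergence.\<close>

lemma convolution_has_derivative:
  fixes K :: "'a::euclidean_space \<Rightarrow> real"
  assumes K: "test_function UNIV K" and w: "integrable (leb S) w"
  shows "((\<lambda>x. LINT y|leb S. K (x - y) * w y) has_derivative
    (\<lambda>h. LINT y|leb S. (grad K (x - y) \<bullet> h) * w y)) (at x)"
proof -
  let ?G = "\<lambda>x. LINT y|leb S. K (x - y) * w y"
  let ?D = "\<lambda>h. LINT y|leb S. (grad K (x - y) \<bullet> h) * w y"
  obtain C where C: "0 \<le> C" "\<And>x h. \<bar>K (x + h) - K x - grad K x \<bullet> h\<bar> \<le> C * (norm h)\<^sup>2"
    using test_function_taylor[OF K] by metis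
  note i0 = convolution_integrable[OF K w] and i1 = convolution_integrable[OF test_function_grad[OF K] w]
  have lin: "linear ?D"
    by (rule linearI) (simp_all add: inner_add_right distrib_right i1 mult.assoc)
  have est: "\<bar>?G z - ?G x - ?D (z - x)\<bar> \<le> C * (norm (z - x))\<^sup>2 * (LINT y|leb S. \<bar>w y\<bar>)" for z
  proof -
    have "\<bar>?G z - ?G x - ?D (z - x)\<bar> = \<bar>LINT y|leb S. (K (x - y + (z - x)) - K (x - y) - grad K (x - y) \<bullet> (z - x)) * w y\<bar>"
      using i0[of z] i0[of x] i1[of x "z - x"] by (simp add: left_diff_distrib)
    also have "\<dots> \<le> (LINT y|leb S. \<bar>(K (x - y + (z - x)) - K (x - y) - grad K (x - y) \<bullet> (z - x)) * w y\<bar>)"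
      by (rule integral_abs_bound)
    also have "\<dots> \<le> (LINT y|leb S. C * (norm (z - x))\<^sup>2 * \<bar>w y\<bar>)"
    proof (rule integral_mono_AE)
      have "integrable (leb S) (\<lambda>y. K (z - y) * w y - K (x - y) * w y - (grad K (x - y) \<bullet> (z - x)) * w y)"
        by (intro Bochner_Integration.integrable_diff i0 i1)
      then show "integrable (leb S) (\<lambda>y. \<bar>(K (x - y + (z - x)) - K (x - y) - grad K (x - y) \<bullet> (z - x)) * w y\<bar>)"
        by (intro integrable_abs) (simp add: left_diff_distrib)
      show "integrable (leb S) (\<lambda>y. C * (norm (z - x))\<^sup>2 * \<bar>w y\<bar>)" using w by simp
      show "AE y in leb S. \<bar>(K (x - y + (z - x)) - K (x - y) - grad K (x - y) \<bullet> (z - x)) * w y\<bar> \<le> C * (norm (z - x))\<^sup>2 * \<bar>w y\<bar>"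
        unfolding abs_mult by (intro AE_I2 mult_right_mono C(2)) auto
    qed
    finally show ?thesis by simp
  qed
  define M where "M = C * (LINT y|leb S. \<bar>w y\<bar>)"
  have "((\<lambda>z. norm (?G z - ?G x - ?D (z - x)) / norm (z - x)) \<longlongrightarrow> 0) (at x)"
  proof (rule Lim_null_comparison)
    show "\<forall>\<^sub>F z in at x. norm (norm (?G z - ?G x - ?D (z - x)) / norm (z - x)) \<le> M * norm (z - x)"
    proof (rule always_eventually, rule allI)
      fix z
      show "norm (norm (?G z - ?G x - ?D (z - x)) / norm (z - x)) \<le> M * norm (z - x)"
      proof (cases "z = x")
        case False
        then have "\<bar>?G z - ?G x - ?D (z - x)\<bar> / norm (z - x) \<le> (C * (norm (z - x))\<^sup>2 * (LINT y|leb S. \<bar>w y\<bar>)) / norm (z - x)"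
          by (intro divide_right_mono est) auto
        also have "\<dots> = M * norm (z - x)" using False by (simp add: M_def power2_eq_square)
        finally show ?thesis by simp
      qed simp
    qed
    have "((\<lambda>z. M * norm (z - x)) \<longlongrightarrow> M * norm (x - x)) (at x)" by (intro tendsto_intros)
    then show "((\<lambda>z. M * norm (z - x)) \<longlongrightarrow> 0) (at x)" by simp
  qed
  then show ?thesis using lin by (simp add: has_derivative_iff_norm linear_conv_bounded_linear)
qed

text \<open>The convolution of a test function with \<open>1\<close> on a large ball is constant near the origin.\<close>

lemma integral_grad_test_function:
  fixes F :: "'a::euclidean_space \<Rightarrow> real"
  assumes F: "test_function UNIV F"
  shows "(LINT x|lebesgue. grad F x \<bullet> v) = 0"
proof -
  obtain K where K: "compact K" "\<forall>x. x \<notin> K \<longrightarrow> F x = 0" using F by (auto simp: test_function_def)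
  obtain R where R: "\<And>x. x \<in> K \<Longrightarrow> norm x \<le> R" using compact_imp_bounded[OF K(1)] by (auto simp: bounded_iff)
  define S where "S = cball (0::'a) (R + 1)"
  have S: "S \<in> sets lebesgue" "S \<in> lmeasurable" by (auto simp: S_def)
  have refl: "(LINT y|leb S. H (x - y)) = (LINT y|lebesgue. H y)"
    if H: "\<And>x. x \<notin> K \<Longrightarrow> H x = 0" and x: "norm x < 1" for H :: "'a \<Rightarrow> real" and x
  proof -
    have "H (x - y) = 0" if "y \<notin> S" for y
      using that x R[of "x - y"] norm_triangle_ineq2[of y x] by (intro H) (auto simp: S_def norm_minus_commute)
    then have "(LINT y|leb UNIV. H (x - y)) = (LINT y|leb S. H (x - y))" using S by (intro LINT_subset) auto
    moreover have "surj (\<lambda>y. (-1) *\<^sub>R y + x)" by (rule surjI[of _ "\<lambda>z. x - z"]) simp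
    ultimately show ?thesis
      using scales_LINT[OF scales_homothety, of "-1" UNIV x H] by (simp add: lebesgue_on_UNIV_eq)
  qed
  have one: "integrable (leb S) (\<lambda>_. 1::real)"
    using finite_measure.integrable_const[OF finite_measure_lebesgue_on[OF S(2)]] .
  have "((\<lambda>x. LINT y|leb S. F (x - y)) has_derivative (\<lambda>h. LINT y|leb S. grad F (0 - y) \<bullet> h)) (at 0)"
    using convolution_has_derivative[OF F one, of 0] by simp
  then have "((\<lambda>x. LINT y|lebesgue. F y) has_derivative (\<lambda>h. LINT y|leb S. grad F (0 - y) \<bullet> h)) (at 0)"
    by (rule has_derivative_transform_within_open[of _ _ _ _ "ball 0 1"]) (use refl K(2) in auto)
  from has_derivative_unique[OF this has_derivative_const]
  have "(LINT y|leb S. grad F (0 - y) \<bullet> v) = 0" by metis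
  then show ?thesis using refl[of "\<lambda>x. grad F x \<bullet> v" 0] grad_zero_outside[OF K] by simp
qed

text \<open>The definition tests basis directions only, while the plates point in arbitrary
  directions; linearity in the direction bridges the gap.\<close>

lemma weak_grad_test:
  assumes "is_weak_grad X u v" "L2 X u" "X \<in> sets lebesgue" "test_function X f"
  shows "(LINT x|leb X. u x * (grad f x \<bullet> w)) = - (LINT x|leb X. (v x \<bullet> w) * f x)"
proof -
  have sm: "smooth f" using assms(4) by (rule test_function_smooth)
  have v: "L2 X v" using assms(1) by (simp add: is_weak_grad_def)
  have 1: "integrable (leb X) (\<lambda>x. u x * (grad f x \<bullet> b))" for b
    by (rule L2_integrable_mult[OF assms(2) test_function_L2[OF test_function_grad[OF assms(4)] assms(3)]])
  have 2: "integrable (leb X) (\<lambda>x. (v x \<bullet> b) * f x)" for b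
    by (rule L2_integrable_mult[OF L2_component[OF v] test_function_L2[OF assms(4,3)]])
  have w: "y \<bullet> w = (\<Sum>b\<in>Basis. (w \<bullet> b) * (y \<bullet> b))" for y
    by (subst euclidean_inner) (simp add: mult.commute)
  have "(LINT x|leb X. u x * (grad f x \<bullet> w)) =
      (LINT x|leb X. (\<Sum>b\<in>Basis. (w \<bullet> b) * (u x * (grad f x \<bullet> b))))"
    by (subst w) (simp add: sum_distrib_left mult.left_commute)
  also have "\<dots> = (\<Sum>b\<in>Basis. (w \<bullet> b) * (LINT x|leb X. u x * (grad f x \<bullet> b)))"
    using 1 by (subst Bochner_Integration.integral_sum) auto
  also have "\<dots> = (\<Sum>b\<in>Basis. (w \<bullet> b) * - (LINT x|leb X. (v x \<bullet> b) * f x))"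
    using assms(1,4) by (intro sum.cong arg_cong2[of _ _ _ _ "(*)"]) (auto simp: is_weak_grad_def frechet_grad[OF sm])
  also have "\<dots> = - (LINT x|leb X. (\<Sum>b\<in>Basis. (w \<bullet> b) * ((v x \<bullet> b) * f x)))"
    using 2 by (subst Bochner_Integration.integral_sum) (auto simp: sum_negf)
  also have "\<dots> = - (LINT x|leb X. (v x \<bullet> w) * f x)"
  proof -
    have "(v x \<bullet> w) * f x = (\<Sum>b\<in>Basis. (w \<bullet> b) * ((v x \<bullet> b) * f x))" for x
      by (subst w) (simp add: sum_distrib_right mult.assoc)
    then show ?thesis by (simp only:)
  qed
  finally show ?thesis .
qed

lemma is_weak_gradI:
  assumes "L2 X v"
    "\<And>f b. test_function X f \<Longrightarrow> b \<in> Basis \<Longrightarrow>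
      (LINT x|leb X. u x * (grad f x \<bullet> b)) = - (LINT x|leb X. (v x \<bullet> b) * f x)"
  shows "is_weak_grad X u v"
  using assms by (auto simp: is_weak_grad_def frechet_grad[OF test_function_smooth])

lemma is_weak_grad_L2: "is_weak_grad X u v \<Longrightarrow> L2 X v" by (simp add: is_weak_grad_def)

lemma L2_smooth: "bounded X \<Longrightarrow> X \<in> sets lebesgue \<Longrightarrow> smooth f \<Longrightarrow> L2 X f"
  by (intro L2_continuous smooth_continuous)

lemma L2_grad: "bounded X \<Longrightarrow> X \<in> sets lebesgue \<Longrightarrow> smooth f \<Longrightarrow> L2 X (grad f)"
  by (intro L2_continuous continuous_grad)

text \<open>The integral of a gradient vanishes for the product of \<open>f\<close> with the test
  function, which is a test function on the whole space although \<open>f\<close> has no compact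
  support.\<close>

lemma smooth_weak_grad:
  fixes X :: "'a::euclidean_space set"
  assumes "bounded X" "X \<in> sets lebesgue" "smooth f"
  shows "is_weak_grad X f (grad f)"
proof (rule is_weak_gradI)
  show "L2 X (grad f)" by (rule L2_grad[OF assms])
  fix q :: "'a \<Rightarrow> real" and b :: 'a assume t: "test_function X q"
  have sm: "smooth q" using t by (rule test_function_smooth)
  obtain K where K: "compact K" "K \<subseteq> X" "\<forall>x. x \<notin> K \<longrightarrow> q x = 0" using t by (auto simp: test_function_def)
  have "test_function UNIV (\<lambda>x. f x * q x)"
    using test_function_mult[OF test_function_mono[OF t subset_UNIV] assms(3)] .
  from integral_grad_test_function[OF this]
  have "0 = (LINT x|lebesgue. f x * (grad q x \<bullet> b) + (grad f x \<bullet> b) * q x)"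
    by (simp add: grad_mult[OF assms(3) sm] inner_add_left) (simp add: mult.commute)
  also have "\<dots> = (LINT x|leb X. f x * (grad q x \<bullet> b) + (grad f x \<bullet> b) * q x)"
    using LINT_subset[of X UNIV "\<lambda>x. f x * (grad q x \<bullet> b) + (grad f x \<bullet> b) * q x"] assms(2) K
      grad_zero_outside[OF K(1,3)]
    by (simp add: lebesgue_on_UNIV_eq subset_iff) (metis add.right_neutral inner_zero_left mult_zero_right)
  also have "\<dots> = (LINT x|leb X. f x * (grad q x \<bullet> b)) + (LINT x|leb X. (grad f x \<bullet> b) * q x)"
    by (intro Bochner_Integration.integral_add L2_integrable_mult L2_component L2_smooth L2_grad
        test_function_L2[OF test_function_grad[OF t]] test_function_L2[OF t] assms)
  finally show "(LINT x|leb X. f x * (grad q x \<bullet> b)) = - (LINT x|leb X. (grad f x \<bullet> b) * q x)"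
    by simp
qed

lemma smooth_H1: "bounded X \<Longrightarrow> X \<in> sets lebesgue \<Longrightarrow> smooth f \<Longrightarrow> H1 X f"
  unfolding H1_def using smooth_weak_grad L2_smooth by blast

lemma weak_grad_wgrad: "H1 X u \<Longrightarrow> is_weak_grad X u (wgrad X u)"
  unfolding H1_def wgrad_def by (metis someI_ex)

lemma H1_L2: "H1 X u \<Longrightarrow> L2 X u" by (simp add: H1_def)

lemma L2_wgrad: "H1 X u \<Longrightarrow> L2 X (wgrad X u)"
  by (rule is_weak_grad_L2[OF weak_grad_wgrad])

text \<open>Each component of the difference is orthogonal to all test functions;
  \<open>du_Bois_Reymond\<close> needs the set to be open.\<close>

lemma weak_grad_unique:
  fixes X :: "'a::euclidean_space set"
  assumes "open X" "is_weak_grad X u v" "is_weak_grad X u w"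
  shows "AE x in leb X. v x = w x"
proof -
  have m: "X \<in> sets lebesgue" using assms(1) by simp
  note L = is_weak_grad_L2[OF assms(2)] is_weak_grad_L2[OF assms(3)]
  have "AE x in leb X. (v x - w x) \<bullet> b = 0" if b: "b \<in> Basis" for b
  proof (rule du_Bois_Reymond[OF assms(1)])
    show "L2 X (\<lambda>x. (v x - w x) \<bullet> b)" by (intro L2_component L2_diff L)
    fix f assume t: "test_function X f"
    have "(LINT x|leb X. (v x \<bullet> b) * f x) = (LINT x|leb X. (w x \<bullet> b) * f x)"
    proof -
      have "- (LINT x|leb X. (v x \<bullet> b) * f x) = - (LINT x|leb X. (w x \<bullet> b) * f x)"
        using assms(2) assms(3) t b unfolding is_weak_grad_def by auto
      then show ?thesis by simp
    qed
    moreover have "integrable (leb X) (\<lambda>x. (v x \<bullet> b) * f x)" "integrable (leb X) (\<lambda>x. (w x \<bullet> b) * f x)"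
      using L by (intro L2_integrable_mult L2_component test_function_L2[OF t m]; simp)+
    ultimately show "(LINT x|leb X. (v x - w x) \<bullet> b * f x) = 0"
      by (simp add: inner_diff_left left_diff_distrib)
  qed
  then have "AE x in leb X. \<forall>b\<in>Basis. (v x - w x) \<bullet> b = 0" by (intro AE_finite_allI) auto
  then show ?thesis by eventually_elim (metis euclidean_all_zero_iff right_minus_eq)
qed

lemma wgrad_AE: "open X \<Longrightarrow> L2 X u \<Longrightarrow> is_weak_grad X u v \<Longrightarrow> AE x in leb X. wgrad X u x = v x"
  by (rule weak_grad_unique[OF _ weak_grad_wgrad]) (auto simp: H1_def)

text \<open>Both sides of the defining identity are L2 pairings with a fixed test function, so the
  weak gradient is a closed operator.\<close>

lemma weak_grad_closed:
  fixes X :: "'a::euclidean_space set"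
  assumes "X \<in> sets lebesgue" "L2_tendsto X us u" "L2_tendsto X vs v" "\<And>k. is_weak_grad X (us k) (vs k)"
  shows "is_weak_grad X u v"
proof (rule is_weak_gradI[OF L2_tendstoD(2)[OF assms(3)]])
  fix f :: "'a \<Rightarrow> real" and b :: 'a assume t: "test_function X f" and b: "b \<in> Basis"
  have "(\<lambda>k. LINT x|leb X. us k x * (grad f x \<bullet> b)) \<longlonglongrightarrow> (LINT x|leb X. u x * (grad f x \<bullet> b))"
    by (intro L2_tendsto_mult assms L2_tendsto_const test_function_L2[OF test_function_grad[OF t]])
  moreover have "(\<lambda>k. - (LINT x|leb X. (vs k x \<bullet> b) * f x)) \<longlonglongrightarrow> - (LINT x|leb X. (v x \<bullet> b) * f x)"
    by (intro tendsto_minus L2_tendsto_mult L2_tendsto_component assms L2_tendsto_const test_function_L2[OF t])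
  moreover have "(LINT x|leb X. us k x * (grad f x \<bullet> b)) = - (LINT x|leb X. (vs k x \<bullet> b) * f x)" for k
    using weak_grad_test[OF assms(4) L2_tendstoD(1)[OF assms(2)] assms(1) t] .
  ultimately show "(LINT x|leb X. u x * (grad f x \<bullet> b)) = - (LINT x|leb X. (v x \<bullet> b) * f x)"
    using LIMSEQ_unique by simp
qed

lemma weak_grad_lincomb:
  fixes X :: "'a::euclidean_space set"
  assumes "X \<in> sets lebesgue" "L2 X u" "L2 X u'" "is_weak_grad X u v" "is_weak_grad X u' v'"
  shows "is_weak_grad X (\<lambda>x. u x + c * u' x) (\<lambda>x. v x + c *\<^sub>R v' x)"
proof (rule is_weak_gradI)
  note L = is_weak_grad_L2[OF assms(4)] is_weak_grad_L2[OF assms(5)]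
  show "L2 X (\<lambda>x. v x + c *\<^sub>R v' x)" by (intro L2_add L2_scaleR L)
  fix f :: "'a \<Rightarrow> real" and b :: 'a assume t: "test_function X f"
  note T = test_function_L2[OF test_function_grad[OF t] assms(1)] test_function_L2[OF t assms(1)]
  have "integrable (leb X) (\<lambda>x. u x * (grad f x \<bullet> b))" "integrable (leb X) (\<lambda>x. u' x * (grad f x \<bullet> b))"
    "integrable (leb X) (\<lambda>x. (v x \<bullet> b) * f x)" "integrable (leb X) (\<lambda>x. (v' x \<bullet> b) * f x)"
    by (rule L2_integrable_mult[OF assms(2) T(1)], rule L2_integrable_mult[OF assms(3) T(1)],
        rule L2_integrable_mult[OF L2_component[OF L(1)] T(2)], rule L2_integrable_mult[OF L2_component[OF L(2)] T(2)])
  then show "(LINT x|leb X. (u x + c * u' x) * (grad f x \<bullet> b)) =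
      - (LINT x|leb X. (v x + c *\<^sub>R v' x) \<bullet> b * f x)"
    using weak_grad_test[OF assms(4,2,1) t, of b] weak_grad_test[OF assms(5,3,1) t, of b]
    by (simp add: inner_add_left distrib_right mult.assoc)
qed

lemma weak_grad_diff:
  assumes "X \<in> sets lebesgue" "L2 X u" "L2 X u'" "is_weak_grad X u v" "is_weak_grad X u' v'"
  shows "is_weak_grad X (\<lambda>x. u x - u' x) (\<lambda>x. v x - v' x)"
  using weak_grad_lincomb[OF assms, of "-1"] by simp

text \<open>Closedness applied to constant sequences, which converge in L2 to every function equal
  to them almost everywhere.\<close>

lemma weak_grad_cong_AE:
  assumes S: "X \<in> sets lebesgue" and uu: "AE x in leb X. u x = u' x" and vv: "AE x in leb X. v x = v' x"
    and u: "L2 X u" and w: "is_weak_grad X u v"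
  shows "is_weak_grad X u' v'"
proof -
  have "L2_tendsto X (\<lambda>k. u) u'"
    by (rule L2_tendsto_cong_AE[OF S L2_tendsto_const[OF u]]) (use uu in auto)
  moreover have "L2_tendsto X (\<lambda>k. v) v'"
    by (rule L2_tendsto_cong_AE[OF S L2_tendsto_const[OF is_weak_grad_L2[OF w]]]) (use vv in auto)
  ultimately show ?thesis by (rule weak_grad_closed[OF S _ _ w])
qed

lemma weak_grad_subset:
  fixes S :: "'a::euclidean_space set"
  assumes "S \<subseteq> T" "S \<in> sets lebesgue" "T \<in> sets lebesgue" "is_weak_grad T u v"
  shows "is_weak_grad S u v"
proof (rule is_weak_gradI)
  show "L2 S v" by (rule L2_subset[OF assms(1-3) is_weak_grad_L2[OF assms(4)]])
  fix f :: "'a \<Rightarrow> real" and b :: 'a assume t: "test_function S f" and b: "b \<in> Basis"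
  obtain K where K: "compact K" "K \<subseteq> S" "\<forall>x. x \<notin> K \<longrightarrow> f x = 0" using t by (auto simp: test_function_def)
  have "(LINT x|leb T. u x * (grad f x \<bullet> b)) = - (LINT x|leb T. (v x \<bullet> b) * f x)"
    unfolding frechet_grad[OF test_function_smooth[OF t], symmetric]
    using assms(4) test_function_mono[OF t assms(1)] b unfolding is_weak_grad_def by auto
  moreover have "(LINT x|leb T. u x * (grad f x \<bullet> b)) = (LINT x|leb S. u x * (grad f x \<bullet> b))"
  proof (rule LINT_subset[OF assms(1-3)])
    fix x assume "x \<in> T - S"
    then have "x \<notin> K" using K(2) by blast
    then show "u x * (grad f x \<bullet> b) = 0" by (simp add: grad_zero_outside[OF K(1,3)])
  qed
  moreover have "(LINT x|leb T. (v x \<bullet> b) * f x) = (LINT x|leb S. (v x \<bullet> b) * f x)"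
    using K by (intro LINT_subset assms) auto
  ultimately show "(LINT x|leb S. u x * (grad f x \<bullet> b)) = - (LINT x|leb S. (v x \<bullet> b) * f x)" by simp
qed

text \<open>Test functions are transported by the inverse affine map; the Jacobian appears on both
  sides and cancels, and moving \<open>L\<close> off the test direction leaves its adjoint on the
  gradient.\<close>

lemma weak_grad_affine:
  fixes L :: "real^'n::{finite,wellorder} \<Rightarrow> real^'n::_"
  assumes L: "linear L" and d: "det (matrix L) \<noteq> 0" and S: "S \<in> sets lebesgue"
    and T: "T = (\<lambda>x. L x + a)" and u: "L2 (T ` S) u" and w: "is_weak_grad (T ` S) u v"
  shows "is_weak_grad S (\<lambda>x. u (T x)) (\<lambda>x. adjoint L (v (T x)))"
proof (rule is_weak_gradI)
  have sc: "scales \<bar>det (matrix L)\<bar> T" unfolding T by (rule scales_affine[OF L d])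
  have v: "L2 (T ` S) v" by (rule is_weak_grad_L2[OF w])
  show "L2 S (\<lambda>x. adjoint L (v (T x)))"
    by (rule L2_bounded_linear[OF adjoint_linear[OF L, unfolded linear_conv_bounded_linear]])
       (use v scales_L2[OF sc S, of v] in simp)
  obtain h where h: "linear h" "\<And>x. h (L x) = x" "\<And>x. L (h x) = x"
    using linear_injective_isomorphism[OF L] L d det_nz_iff_inj by auto
  fix f :: "real^'n::_ \<Rightarrow> real" and b :: "real^'n::_" assume t: "test_function S f"
  have sm: "smooth f" using t by (rule test_function_smooth)
  obtain K where K: "compact K" "K \<subseteq> S" "\<forall>x. x \<notin> K \<longrightarrow> f x = 0" using t by (auto simp: test_function_def)
  define q where "q x = f (h x + (- h a))" for x
  have hT: "h (T x) + (- h a) = x" for x by (simp add: T linear_add[OF h(1)] h)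
  have qT: "q (T x) = f x" for x by (simp only: q_def hT)
  have "test_function (T ` S) q"
    unfolding test_function_def
  proof (intro conjI exI[of _ "T ` K"] allI impI)
    show "smooth q" unfolding q_def[abs_def] by (rule smooth_affine[OF sm h(1)])
    show "compact (T ` K)" unfolding T using L
      by (intro compact_continuous_image K continuous_intros linear_continuous_on) (simp add: linear_conv_bounded_linear)
    fix x assume x: "x \<notin> T ` K"
    have "T (h x + (- h a)) = x" by (simp add: T linear_diff[OF L] h)
    then have "h x + (- h a) \<notin> K" using x by (metis image_eqI)
    then show "q x = 0" using K(3) by (simp add: q_def)
  qed (use K in auto)
  from weak_grad_test[OF w u scales_image_sets[OF sc S] this, of "L b"]
  have "\<bar>det (matrix L)\<bar> * (LINT x|leb S. u (T x) * (grad q (T x) \<bullet> L b)) =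
      \<bar>det (matrix L)\<bar> * - (LINT x|leb S. (v (T x) \<bullet> L b) * q (T x))"
    by (simp add: scales_LINT[OF sc S])
  moreover have "grad q (T x) \<bullet> L b = grad f x \<bullet> b" for x
    unfolding q_def[abs_def] grad_affine[OF sm h(1)] hT h by simp
  moreover have "adjoint L y \<bullet> b = y \<bullet> L b" for y
    using adjoint_works[OF L, of b y] by (simp add: inner_commute)
  ultimately have "\<bar>det (matrix L)\<bar> * (LINT x|leb S. u (T x) * (grad f x \<bullet> b)) =
      \<bar>det (matrix L)\<bar> * - (LINT x|leb S. (adjoint L (v (T x)) \<bullet> b) * f x)"
    by (simp only: qT)
  then show "(LINT x|leb S. u (T x) * (grad f x \<bullet> b)) =
      - (LINT x|leb S. (adjoint L (v (T x)) \<bullet> b) * f x)"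
    using d by (simp only: mult_cancel_left abs_eq_0) simp
qed

lemma H1_tendsto_smoothI:
  assumes O: "open X" "bounded X" and us: "\<And>k. smooth (us k)"
    and "L2_tendsto X us u" "L2_tendsto X (\<lambda>k. grad (us k)) v"
  shows "H1_tendsto X us u" "is_weak_grad X u v"
proof -
  have m: "X \<in> sets lebesgue" using O by simp
  note W = smooth_weak_grad[OF O(2) m us]
  show w: "is_weak_grad X u v" by (rule weak_grad_closed[OF m assms(4,5) W])
  have u: "L2 X u" by (rule L2_tendstoD(2)[OF assms(4)])
  have "L2_tendsto X (\<lambda>k. wgrad X (us k)) (wgrad X u)"
  proof (rule L2_tendsto_cong_AE[OF m assms(5)])
    show "AE x in leb X. grad (us k) x = wgrad X (us k) x" for k
      using wgrad_AE[OF O(1) L2_smooth[OF O(2) m us] W, of k] by auto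
    show "AE x in leb X. v x = wgrad X u x"
      using wgrad_AE[OF O(1) u w] by auto
  qed
  then show "H1_tendsto X us u"
    using smooth_H1[OF O(2) m us] u w assms(4) by (auto simp: H1_tendsto_def H1_def)
qed

text \<open>Weak gradients are unique on open sets, while the thin domain enters merely as a bounded
  measurable set. The comparison of \<open>wgrad\<close> with \<open>grad\<close> is therefore made
  on an open part \<open>S\<close>.\<close>

lemma H1_tendsto_smoothD:
  assumes "X \<in> sets lebesgue" "bounded X" "S \<subseteq> X" "open S" and us: "\<And>k. smooth (us k)" and "H1_tendsto X us u"
  shows "L2_tendsto S us u" "L2_tendsto S (\<lambda>k. grad (us k)) (wgrad X u)"
proof -
  have m: "S \<in> sets lebesgue" using assms(4) by simp
  have b: "bounded S" using assms(2,3) bounded_subset by blast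
  show "L2_tendsto S us u"
    by (rule L2_tendsto_subset[OF assms(3) m assms(1)]) (use assms(6) in \<open>simp add: H1_tendsto_def\<close>)
  have w: "L2_tendsto S (\<lambda>k. wgrad X (us k)) (wgrad X u)"
    by (rule L2_tendsto_subset[OF assms(3) m assms(1)]) (use assms(6) in \<open>simp add: H1_tendsto_def\<close>)
  have "AE x in leb S. wgrad X (us k) x = grad (us k) x" for k
    by (rule weak_grad_unique[OF assms(4) weak_grad_subset[OF assms(3) m assms(1) weak_grad_wgrad[OF smooth_H1[OF assms(2,1) us]]]
        smooth_weak_grad[OF b m us]])
  then show "L2_tendsto S (\<lambda>k. grad (us k)) (wgrad X u)"
    by (intro L2_tendsto_cong_AE[OF m w]) auto
qed

section \<open>Density of smooth functions in $H^1$ of a box\<close>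

text \<open>All derivatives fall on the kernel, and directional derivatives of test functions are
  test functions, so the induction runs over the kernel with \<open>w\<close> fixed.\<close>

lemma convolution_smooth:
  fixes K :: "'a::euclidean_space \<Rightarrow> real"
  assumes "test_function UNIV K" and w: "integrable (leb S) w"
  shows "smooth (\<lambda>x. LINT y|leb S. K (x - y) * w y)"
proof -
  have "C_k k (\<lambda>x. LINT y|leb S. K (x - y) * w y)" if "test_function UNIV K" for k K
    using that
  proof (induction k arbitrary: K)
    case 0
    then show ?case
      using convolution_has_derivative[OF 0 w]
      by (auto simp: continuous_on_eq_continuous_at intro: has_derivative_continuous)
  next
    case (Suc k)
    show ?case
      by (rule C_k_SucI[OF convolution_has_derivative[OF Suc.prems w]])
         (rule Suc.IH[OF test_function_grad[OF Suc.prems]])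
  qed
  then show ?thesis using assms(1) by (simp add: smooth_def)
qed

lemma convolution_grad:
  fixes K :: "'a::euclidean_space \<Rightarrow> real"
  assumes K: "test_function UNIV K" and w: "integrable (leb S) w"
  shows "grad (\<lambda>x. LINT y|leb S. K (x - y) * w y) x \<bullet> h = (LINT y|leb S. (grad K (x - y) \<bullet> h) * w y)"
  using fun_cong[OF frechet_derivative_at[OF convolution_has_derivative[OF K w]], of x h]
  by (simp add: frechet_grad[OF convolution_smooth[OF K w], symmetric])

lemma grad_reflect:
  fixes K :: "'a::euclidean_space \<Rightarrow> real"
  assumes "smooth K" shows "smooth (\<lambda>y. K (x - y))" "grad (\<lambda>y. K (x - y)) y \<bullet> h = - (grad K (x - y) \<bullet> h)"
  using smooth_affine[OF assms, of uminus x] grad_affine[OF assms, of uminus x y h]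
  by (simp_all add: linear_uminus)

lemma L2_integrable:
  fixes w :: "'a::euclidean_space \<Rightarrow> real"
  assumes "S \<in> lmeasurable" "L2 S w" shows "integrable (leb S) w"
proof -
  have "L2 S (\<lambda>x. 1::real)" using assms(1) by (intro L2_bounded[where C = 1]) auto
  from L2_integrable_mult[OF this assms(2)] show ?thesis by simp
qed

context
  fixes a b :: "'a::euclidean_space"
  assumes ab: "\<And>i. i \<in> Basis \<Longrightarrow> a \<bullet> i < b \<bullet> i"
begin

text \<open>Mollification preceded by a contraction. The point \<open>x\<close> is moved towards the
  centre \<open>mc\<close> by the factor \<open>ml n\<close>, which frees a margin of (1 -
  \<open>ml n\<close>) times half of each side; as \<open>mr\<close> is half the shortest side, a
  kernel of half-width \<open>md n\<close> fits into this margin. Approximation up to the boundary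
  is obtained without extending the function beyond the box.\<close>

definition "mc = (1/2) *\<^sub>R (a + b)"
definition "mr = Min ((\<lambda>i. (b \<bullet> i - a \<bullet> i) / 2) ` Basis)"
definition "ml n = 1 - 1 / (real n + 2)"
definition "md n = mr / (real n + 2)"
definition "mk n (z :: 'a) = bump (- One) One ((1 / md n) *\<^sub>R z) / (LINT z|lebesgue. bump (- One) One ((1 / md n) *\<^sub>R z :: 'a))"
definition "mshrink n x = ml n *\<^sub>R x + (1 - ml n) *\<^sub>R mc"
abbreviation "bx \<equiv> box a b"
abbreviation "kr n x y \<equiv> mk n (mshrink n x - y)"

definition "mollify n w x = (LINT y|leb (box a b). mk n (mshrink n x - y) * w y)"

lemma mr: "0 < mr" "i \<in> Basis \<Longrightarrow> mr \<le> (b \<bullet> i - a \<bullet> i) / 2"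
proof -
  show "0 < mr" unfolding mr_def using ab by (simp add: Min_gr_iff)
  show "i \<in> Basis \<Longrightarrow> mr \<le> (b \<bullet> i - a \<bullet> i) / 2" unfolding mr_def by (intro Min_le) auto
qed

lemma md: "0 < md n" using mr(1) by (simp add: md_def)

lemma ml: "1 / 2 \<le> ml n" "ml n < 1" by (auto simp: ml_def field_simps)

lemma mk_raw_test: "test_function UNIV (\<lambda>z::'a. bump (- One) One ((1 / md n) *\<^sub>R z))"
  unfolding test_function_def
proof (intro conjI exI[of _ "(*\<^sub>R) (md n) ` cbox (- One) One"] allI impI)
  show "smooth (\<lambda>z::'a. bump (- One) One ((1 / md n) *\<^sub>R z))"
    using smooth_affine[OF smooth_bump linear_scaleR, of "- One" One "1 / md n" 0] by simp
  show "compact ((*\<^sub>R) (md n) ` cbox (- One) (One::'a))" by (intro compact_scaling compact_cbox)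
  fix z :: 'a assume z: "z \<notin> (*\<^sub>R) (md n) ` cbox (- One) One"
  have "(1 / md n) *\<^sub>R z \<notin> box (- One) One"
  proof
    assume "(1 / md n) *\<^sub>R z \<in> box (- One) One"
    then have "md n *\<^sub>R ((1 / md n) *\<^sub>R z) \<in> (*\<^sub>R) (md n) ` cbox (- One) One" using box_subset_cbox by blast
    then show False using z md[of n] by simp
  qed
  then show "bump (- One) One ((1 / md n) *\<^sub>R z) = 0" by (rule bump_0)
qed simp

lemma mk_pos: "0 < (LINT z|lebesgue. bump (- One) One ((1 / md n) *\<^sub>R z :: 'a))"
proof -
  have "0 < (LINT z|leb UNIV. bump (- One) One ((1 / md n) *\<^sub>R z :: 'a))"
  proof (rule integral_continuous_pos[where x = 0])
    have "(0::'a) \<in> box (- One) One" by (auto simp: mem_box)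
    from bump_pos[OF this] show "0 < bump (- One) (One::'a) ((1 / md n) *\<^sub>R 0)" by simp
  qed (rule open_UNIV UNIV_I bump_nonneg smooth_continuous[OF test_function_smooth[OF mk_raw_test]] test_function_integrable[OF mk_raw_test] | simp)+
  then show ?thesis by (simp add: lebesgue_on_UNIV_eq)
qed

lemma mk_test: "test_function UNIV (mk n)"
  using test_function_cmult[OF mk_raw_test, of "inverse (LINT z|lebesgue. bump (- One) One ((1 / md n) *\<^sub>R z :: 'a))" n]
  by (simp add: mk_def[abs_def] divide_inverse mult.commute)

lemma mk_nonneg: "0 \<le> mk n z"
  unfolding mk_def using mk_pos bump_nonneg by (intro divide_nonneg_pos)

lemma mk_integral: "(LINT z|lebesgue. mk n z) = 1"
  unfolding mk_def using mk_pos[of n] by simp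

lemma mk_zero: "i \<in> Basis \<Longrightarrow> md n \<le> \<bar>z \<bullet> i\<bar> \<Longrightarrow> mk n z = 0"
proof -
  assume i: "i \<in> Basis" and z: "md n \<le> \<bar>z \<bullet> i\<bar>"
  have "(1 / md n) *\<^sub>R z \<notin> box (- One) One"
  proof
    assume "(1 / md n) *\<^sub>R z \<in> box (- One) One"
    then have "\<bar>(1 / md n) * (z \<bullet> i)\<bar> < 1" using i by (auto simp: mem_box)
    then show False using z md[of n] by (simp add: abs_mult field_simps)
  qed
  then show ?thesis by (simp add: mk_def bump_0)
qed

lemma mk_norm: "mk n z \<noteq> 0 \<Longrightarrow> norm z \<le> DIM('a) * md n"
proof -
  assume "mk n z \<noteq> 0"
  then have "\<bar>z \<bullet> i\<bar> \<le> md n" if "i \<in> Basis" for i using mk_zero[OF that, of n z] by linarith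
  then have "(\<Sum>i\<in>Basis. \<bar>z \<bullet> i\<bar>) \<le> (\<Sum>i\<in>(Basis::'a set). md n)" by (intro sum_mono)
  then show ?thesis using norm_le_l1[of z] by simp
qed

lemma mshrink_box:
  assumes "x \<in> bx"
  shows "cbox (mshrink n x - md n *\<^sub>R One) (mshrink n x + md n *\<^sub>R One) \<subseteq> bx"
proof
  fix y assume y: "y \<in> cbox (mshrink n x - md n *\<^sub>R One) (mshrink n x + md n *\<^sub>R One)"
  show "y \<in> bx" unfolding mem_box
  proof
    fix i :: 'a assume i: "i \<in> Basis"
    have 1: "\<bar>y \<bullet> i - mshrink n x \<bullet> i\<bar> \<le> md n"
      using y i by (auto simp: mem_box inner_simps abs_le_iff algebra_simps)
    have md: "md n \<le> (1 - ml n) * ((b \<bullet> i - a \<bullet> i) / 2)"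
      using mult_left_mono[OF mr(2)[OF i], of "1 / (real n + 2)"] by (simp add: md_def ml_def)
    have "mshrink n x \<bullet> i = ml n * (x \<bullet> i) + (1 - ml n) * ((a \<bullet> i + b \<bullet> i) / 2)"
      by (simp add: mshrink_def mc_def inner_simps)
    moreover have "ml n * (a \<bullet> i) < ml n * (x \<bullet> i)" "ml n * (x \<bullet> i) < ml n * (b \<bullet> i)"
      using assms i ml(1)[of n] by (auto simp: mem_box)
    ultimately show "a \<bullet> i < y \<bullet> i \<and> y \<bullet> i < b \<bullet> i"
      using 1 md by (simp add: abs_le_iff field_simps)
  qed
qed

lemma mk_test_box:
  assumes "x \<in> bx" shows "test_function bx (\<lambda>y. kr n x y)"
  unfolding test_function_def
proof (intro conjI exI allI impI)
  show "smooth (\<lambda>y. kr n x y)" by (rule grad_reflect[OF test_function_smooth[OF mk_test]])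
  show "cbox (mshrink n x - md n *\<^sub>R One) (mshrink n x + md n *\<^sub>R One) \<subseteq> bx"
    by (rule mshrink_box[OF assms])
  fix y assume "y \<notin> cbox (mshrink n x - md n *\<^sub>R One) (mshrink n x + md n *\<^sub>R One)"
  then obtain i where i: "i \<in> Basis" and "\<not> (mshrink n x \<bullet> i - md n \<le> y \<bullet> i \<and> y \<bullet> i \<le> mshrink n x \<bullet> i + md n)"
    by (auto simp: mem_box inner_simps)
  then have "md n \<le> \<bar>(mshrink n x - y) \<bullet> i\<bar>" by (auto simp: inner_simps)
  then show "kr n x y = 0" by (rule mk_zero[OF i])
qed (rule compact_cbox)

lemma mk_integral_box:
  assumes "x \<in> bx" shows "(LINT y|leb bx. kr n x y) = 1"
proof -
  have "(LINT y|leb UNIV. kr n x y) = (LINT y|leb bx. kr n x y)"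
    using mk_test_box[OF assms, of n] by (intro LINT_subset) (auto simp: test_function_def)
  moreover have "(LINT z|leb ((\<lambda>y. (-1) *\<^sub>R y + mshrink n x) ` UNIV). mk n z) = \<bar>-1\<bar> ^ DIM('a) *\<^sub>R (LINT y|leb UNIV. mk n ((-1) *\<^sub>R y + mshrink n x))"
    by (rule scales_LINT[OF scales_homothety]) auto
  moreover have "surj (\<lambda>y. (-1) *\<^sub>R y + mshrink n x)" by (rule surjI[of _ "\<lambda>z. mshrink n x - z"]) simp
  ultimately show ?thesis using mk_integral[of n] by (simp only: lebesgue_on_UNIV_eq) simp
qed

text \<open>As a function of \<open>x\<close> the kernel is composed with a homothety of ratio
  \<open>ml n\<close> >= 1/2, so its mass grows by a factor of at most 2 per dimension.\<close>

lemma mk_integral_shift: 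
  "(LINT x|leb bx. kr n x y) \<le> 2 ^ DIM('a)"
proof -
  let ?T = "\<lambda>x. ml n *\<^sub>R x + ((1 - ml n) *\<^sub>R mc - y)"
  have T: "mshrink n x - y = ?T x" for x by (simp add: mshrink_def algebra_simps)
  have l: "ml n \<noteq> 0" "0 < ml n" using ml(1)[of n] by auto
  note sc = scales_homothety[OF l(1), of "(1 - ml n) *\<^sub>R mc - y"]
  have su: "range ?T = UNIV"
    by (rule surjI[of _ "\<lambda>z. (1 / ml n) *\<^sub>R (z - ((1 - ml n) *\<^sub>R mc - y))"]) (use l in simp)
  have i: "integrable lebesgue (\<lambda>x. kr n x y)"
    using scales_integrable[OF sc, of UNIV "mk n"] test_function_integrable[OF mk_test, of UNIV n]
    by (simp only: su T lebesgue_on_UNIV_eq) simp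
  have "1 = ml n ^ DIM('a) * (LINT x|lebesgue. kr n x y)"
    using scales_LINT[OF sc, of UNIV "mk n"] mk_integral[of n] l by (simp add: su T lebesgue_on_UNIV_eq)
  then have "(LINT x|lebesgue. kr n x y) = (1 / ml n) ^ DIM('a)"
    using l by (simp add: power_one_over field_simps)
  also have "\<dots> \<le> 2 ^ DIM('a)" using ml(1)[of n] by (intro power_mono) (auto simp: field_simps)
  finally have "(LINT x|lebesgue. kr n x y) \<le> 2 ^ DIM('a)" .
  moreover have "(LINT x|leb bx. kr n x y) =
      (LINT x|lebesgue. (if x \<in> bx then kr n x y else 0))"
    by (subst Lebesgue_Measure.integral_restrict_UNIV) auto
  moreover have "\<dots> \<le> (LINT x|lebesgue. kr n x y)"
  proof (rule integral_mono_AE[OF _ i])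
    have "integrable lebesgue (\<lambda>x. indicator bx x *\<^sub>R kr n x y)"
      by (rule integrable_mult_indicator[OF _ i]) auto
    moreover have "(\<lambda>x. indicator bx x *\<^sub>R kr n x y) =
        (\<lambda>x. if x \<in> bx then kr n x y else 0)"
      by (auto simp: indicator_def fun_eq_iff)
    ultimately show "integrable lebesgue (\<lambda>x. if x \<in> bx then kr n x y else 0)"
      by simp
  qed (use mk_nonneg in auto)
  ultimately show ?thesis by simp
qed

lemma box_lm: "bx \<in> lmeasurable" "bx \<in> sets lebesgue" by (auto intro: bounded_set_imp_lmeasurable)

lemma mollify_integrable:
  "L2 bx w \<Longrightarrow> integrable (leb bx) (\<lambda>y. kr n x y * w y)"
  by (rule convolution_integrable[OF mk_test L2_integrable[OF box_lm(1)]])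

lemma mollify_smooth: assumes "L2 bx w" shows "smooth (mollify n w)"
  using smooth_affine[OF convolution_smooth[OF mk_test L2_integrable[OF box_lm(1) assms]] linear_scaleR, of n "ml n" "(1 - ml n) *\<^sub>R mc"]
  by (simp add: mollify_def[abs_def] mshrink_def)

text \<open>Thanks to the contraction the kernel is a test function of the box, so its derivative
  may be moved to \<open>u\<close> by the weak gradient; the chain rule for the contraction leaves
  the factor \<open>ml n\<close>.\<close>

lemma mollify_grad:
  assumes u: "L2 bx u" and w: "is_weak_grad bx u v" and x: "x \<in> bx"
  shows "grad (mollify n u) x \<bullet> h = ml n * mollify n (\<lambda>y. v y \<bullet> h) x"
proof -
  note iu = L2_integrable[OF box_lm(1) u]
  define G where "G x = (LINT y|leb bx. mk n (x - y) * u y)" for x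
  have mo: "mollify n u = (\<lambda>x. G (ml n *\<^sub>R x + (1 - ml n) *\<^sub>R mc))"
    by (simp add: mollify_def fun_eq_iff mshrink_def G_def)
  have "smooth G" unfolding G_def[abs_def] by (rule convolution_smooth[OF mk_test iu])
  then have "grad (mollify n u) x \<bullet> h = grad G (mshrink n x) \<bullet> (ml n *\<^sub>R h)"
    unfolding mo mshrink_def by (rule grad_affine) (rule linear_scaleR)
  also have "\<dots> = (LINT y|leb bx. (grad (mk n) (mshrink n x - y) \<bullet> (ml n *\<^sub>R h)) * u y)"
    unfolding G_def[abs_def] by (rule convolution_grad[OF mk_test iu])
  also have "\<dots> = ml n * - (LINT y|leb bx. u y * (grad (\<lambda>y. kr n x y) y \<bullet> h))"
    by (simp add: grad_reflect(2)[OF test_function_smooth[OF mk_test]] mult.assoc mult.commute[of "u _"])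
  also have "(LINT y|leb bx. u y * (grad (\<lambda>y. kr n x y) y \<bullet> h)) = - (LINT y|leb bx. (v y \<bullet> h) * kr n x y)"
    by (rule weak_grad_test[OF w u box_lm(2) mk_test_box[OF x]])
  finally show ?thesis by (simp add: mollify_def[of n "\<lambda>y. v y \<bullet> h"] mult.commute)
qed

text \<open>Jensen's inequality for the probability density \<open>kr n x\<close> in
  \<open>y\<close>, obtained from Cauchy-Schwarz by splitting the kernel into two square
  roots.\<close>

lemma mollify_pointwise:
  assumes w: "L2 bx w" and x: "x \<in> bx"
  shows "integrable (leb bx) (\<lambda>y. kr n x y * (w y)\<^sup>2)"
    "(mollify n w x)\<^sup>2 \<le> (LINT y|leb bx. kr n x y * (w y)\<^sup>2)"
proof -
  let ?k = "\<lambda>y. kr n x y" and ?f = "\<lambda>y. sqrt (kr n x y)"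
  obtain C where C: "0 \<le> C" "\<And>z. \<bar>mk n z\<bar> \<le> C" using test_function_bounded[OF mk_test] by metis
  have km: "?k \<in> mbl bx"
    by (rule reflected_measurable[OF test_function_smooth[OF mk_test]])
  have fm: "?f \<in> mbl bx"
    using measurable_compose[OF km borel_measurable_sqrt] .
  have fb: "\<bar>?f y\<bar> \<le> sqrt C" for y using C(2)[of "mshrink n x - y"] mk_nonneg by simp
  have f: "L2 bx ?f" by (rule L2_bounded[OF box_lm(1) fm]) (use fb in auto)
  have g: "L2 bx (\<lambda>y. ?f y * w y)" using L2_mult_bounded[OF w fm fb] by simp
  show "integrable (leb bx) (\<lambda>y. ?k y * (w y)\<^sup>2)"
    using L2_int[OF g] mk_nonneg by (simp add: power_mult_distrib)
  have "mollify n w x = (LINT y|leb bx. ?f y * (?f y * w y))"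
    unfolding mollify_def using mk_nonneg by (simp add: mult.assoc[symmetric])
  then have "\<bar>mollify n w x\<bar> \<le> l2n bx ?f * l2n bx (\<lambda>y. ?f y * w y)"
    using L2_Cauchy_Schwarz_real[OF f g] by simp
  then have "\<bar>mollify n w x\<bar>\<^sup>2 \<le> (l2n bx ?f * l2n bx (\<lambda>y. ?f y * w y))\<^sup>2" by (rule power_mono) simp
  also have "\<dots> = (LINT y|leb bx. ?k y) * (LINT y|leb bx. ?k y * (w y)\<^sup>2)"
    using mk_nonneg by (simp add: power_mult_distrib l2n_power2)
  finally show "(mollify n w x)\<^sup>2 \<le> (LINT y|leb bx. ?k y * (w y)\<^sup>2)"
    by (simp add: mk_integral_box[OF x])
qed

lemma mollify_L2: "L2 bx w \<Longrightarrow> L2 bx (mollify n w)"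
  by (rule L2_smooth[OF bounded_box box_lm(2) mollify_smooth])

text \<open>Schur test: the kernel has mass 1 in \<open>y\<close> and bounded mass in
  \<open>x\<close>, uniformly in \<open>n\<close>; Tonelli exchanges the two integrations.\<close>

lemma mollify_bound:
  assumes w: "L2 bx w"
  shows "l2n bx (mollify n w) \<le> sqrt (2 ^ DIM('a)) * l2n bx w"
proof -
  let ?M = "leb bx"
  interpret M: finite_measure ?M by (rule finite_measure_lebesgue_on[OF box_lm(1)])
  interpret P: pair_sigma_finite ?M ?M by unfold_locales
  have [measurable]: "mk n \<in> borel_measurable borel"
    by (rule borel_measurable_continuous_onI[OF smooth_continuous[OF test_function_smooth[OF mk_test]]])
  have [measurable]: "w \<in> borel_measurable ?M" by (rule L2_meas[OF w])
  have [measurable]: "mshrink n \<in> borel_measurable ?M" "(\<lambda>x. x) \<in> borel_measurable ?M"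
    by (intro continuous_measurable_lebesgue_on; simp add: mshrink_def[abs_def]; intro continuous_intros)+
  have m: "(\<lambda>(x, y). ennreal (kr n x y * (w y)\<^sup>2)) \<in> borel_measurable (?M \<Otimes>\<^sub>M ?M)"
  proof -
    have 1: "(\<lambda>p. mshrink n (fst p)) \<in> borel_measurable (?M \<Otimes>\<^sub>M ?M)"
      by (rule measurable_compose[OF measurable_fst]) measurable
    have 2: "(\<lambda>p. snd p) \<in> borel_measurable (?M \<Otimes>\<^sub>M ?M)" "(\<lambda>p. w (snd p)) \<in> borel_measurable (?M \<Otimes>\<^sub>M ?M)"
      by (rule measurable_compose[OF measurable_snd, of "\<lambda>x. x"], measurable)
    have "(\<lambda>p. mk n (mshrink n (fst p) - snd p)) \<in> borel_measurable (?M \<Otimes>\<^sub>M ?M)"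
      by (rule measurable_compose[OF borel_measurable_diff[OF 1 2(1)]]) measurable
    then show ?thesis unfolding case_prod_beta
      by (intro measurable_compose[OF _ measurable_ennreal] borel_measurable_times borel_measurable_power 2)
  qed
  have "ennreal ((l2n bx (mollify n w))\<^sup>2) = (\<integral>\<^sup>+x. ennreal ((mollify n w x)\<^sup>2) \<partial>?M)"
    unfolding l2n_power2 using L2_int[OF mollify_L2[OF w]] by (subst nn_integral_eq_integral) auto
  also have "\<dots> \<le> (\<integral>\<^sup>+x. (\<integral>\<^sup>+y. ennreal (kr n x y * (w y)\<^sup>2) \<partial>?M) \<partial>?M)"
  proof (rule nn_integral_mono)
    fix x assume "x \<in> space ?M"
    then have x: "x \<in> bx" by simp
    show "ennreal ((mollify n w x)\<^sup>2) \<le> (\<integral>\<^sup>+y. ennreal (kr n x y * (w y)\<^sup>2) \<partial>?M)"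
      using mollify_pointwise[OF w x, of n] mk_nonneg
      by (subst nn_integral_eq_integral) (auto intro!: ennreal_leI)
  qed
  also have "\<dots> = (\<integral>\<^sup>+y. (\<integral>\<^sup>+x. ennreal (kr n x y * (w y)\<^sup>2) \<partial>?M) \<partial>?M)"
    by (rule P.Fubini'[OF m, symmetric])
  also have "\<dots> \<le> (\<integral>\<^sup>+y. ennreal (2 ^ DIM('a) * (w y)\<^sup>2) \<partial>?M)"
  proof (rule nn_integral_mono)
    fix y
    have sm: "continuous_on UNIV (\<lambda>x. kr n x y)"
      by (rule continuous_on_compose2[OF smooth_continuous[OF test_function_smooth[OF mk_test]], of UNIV])
         (auto simp: mshrink_def intro!: continuous_intros)
    have i: "integrable ?M (\<lambda>x. kr n x y)"
      by (rule L2_integrable[OF box_lm(1) L2_continuous[OF bounded_box box_lm(2) sm]])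
    have "(\<integral>\<^sup>+x. ennreal (kr n x y * (w y)\<^sup>2) \<partial>?M) = ennreal ((LINT x|?M. kr n x y) * (w y)\<^sup>2)"
      using i mk_nonneg by (subst nn_integral_eq_integral) auto
    also have "\<dots> \<le> ennreal (2 ^ DIM('a) * (w y)\<^sup>2)"
      by (intro ennreal_leI mult_right_mono mk_integral_shift) auto
    finally show "(\<integral>\<^sup>+x. ennreal (kr n x y * (w y)\<^sup>2) \<partial>?M) \<le> ennreal (2 ^ DIM('a) * (w y)\<^sup>2)" .
  qed
  also have "\<dots> = ennreal (2 ^ DIM('a) * (l2n bx w)\<^sup>2)"
    unfolding l2n_power2 using L2_int[OF w] by (subst nn_integral_eq_integral) auto
  finally have "(l2n bx (mollify n w))\<^sup>2 \<le> (sqrt (2 ^ DIM('a)) * l2n bx w)\<^sup>2"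
    by (simp add: power_mult_distrib)
  then show ?thesis by (rule power2_le_imp_le) simp
qed

lemma md_ml_tendsto: "md \<longlonglongrightarrow> 0" "ml \<longlonglongrightarrow> 1"
proof -
  have *: "(\<lambda>n. 1 / (real n + 2)) \<longlonglongrightarrow> 0"
    using LIMSEQ_ignore_initial_segment[OF lim_inverse_n', of 2] by (simp add: add.commute)
  from tendsto_mult_right[OF *, of mr] show "md \<longlonglongrightarrow> 0" by (simp add: md_def[abs_def])
  from tendsto_diff[OF tendsto_const[of 1] *] show "ml \<longlonglongrightarrow> 1" by (simp add: ml_def[abs_def])
qed

lemma mollify_test:
  assumes g: "test_function S g"
  shows "L2_tendsto bx (\<lambda>n. mollify n g) g"
proof -
  have gL: "L2 bx g" by (rule test_function_L2[OF g box_lm(2)])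
  obtain C where C: "0 \<le> C" "\<And>x h. \<bar>g (x + h) - g x\<bar> \<le> C * norm h" using test_function_lipschitz[OF g] by metis
  have "bounded ((\<lambda>x. mc - x) ` bx)"
    using bounded_plus[OF bounded_empty] bounded_minus_comp[of "\<lambda>_. mc" "bx" "\<lambda>x. x"] by (simp add: image_constant_conv)
  then obtain R where R: "\<And>x. x \<in> bx \<Longrightarrow> norm (mc - x) \<le> R" by (auto simp: bounded_iff simp del: mem_box)
  \<comment> \<open>Lipschitz constant times the largest displacement: the kernel reaches as far as
    \<open>DIM('a) * md n\<close>, and the contraction moves a point by at most
    \<open>(1 - ml n) * R\<close>.\<close>
  define e where "e n = C * (DIM('a) * md n + (1 - ml n) * R)" for n
  have e0: "e \<longlonglongrightarrow> 0"
  proof -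
    have "e \<longlonglongrightarrow> C * (real DIM('a) * 0 + (1 - 1) * R)"
      unfolding e_def[abs_def] by (intro tendsto_intros md_ml_tendsto)
    then show ?thesis by simp
  qed
  have pt: "\<bar>mollify n g x - g x\<bar> \<le> e n" if x: "x \<in> bx" for n x
  proof -
    have i1: "integrable (leb bx) (\<lambda>y. kr n x y * g y)" by (rule mollify_integrable[OF gL])
    have i2: "integrable (leb bx) (\<lambda>y. kr n x y)"
      by (rule test_function_integrable[OF mk_test_box[OF x] box_lm(2)])
    have "\<bar>mollify n g x - g x\<bar> = \<bar>LINT y|leb bx. kr n x y * g y - kr n x y * g x\<bar>"
      using i1 i2 by (simp add: mollify_def mk_integral_box[OF x])
    also have "\<dots> \<le> (LINT y|leb bx. \<bar>kr n x y * g y - kr n x y * g x\<bar>)"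
      by (rule integral_abs_bound)
    also have "\<dots> \<le> (LINT y|leb bx. kr n x y * e n)"
    proof (rule integral_mono_AE)
      show "AE y in leb bx. \<bar>kr n x y * g y - kr n x y * g x\<bar> \<le> kr n x y * e n"
      proof (rule AE_I2)
        fix y
        show "\<bar>kr n x y * g y - kr n x y * g x\<bar> \<le> kr n x y * e n"
        proof (cases "kr n x y = 0")
          case False
          have "norm (y - x) \<le> norm (mshrink n x - y) + norm (mshrink n x - x)"
            using norm_triangle_ineq4[of "mshrink n x - x" "mshrink n x - y"] by (simp add: algebra_simps)
          also have "mshrink n x - x = (1 - ml n) *\<^sub>R (mc - x)" by (simp add: mshrink_def algebra_simps)
          also have "norm ((1 - ml n) *\<^sub>R (mc - x)) \<le> (1 - ml n) * R"
            using ml(2)[of n] R[OF x] by (simp add: mult_left_mono)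
          also have "norm (mshrink n x - y) \<le> DIM('a) * md n" by (rule mk_norm[OF False])
          finally have "norm (y - x) \<le> DIM('a) * md n + (1 - ml n) * R" by simp
          then have "\<bar>g (x + (y - x)) - g x\<bar> \<le> e n"
            unfolding e_def by (intro order_trans[OF C(2)] mult_left_mono C(1))
          then show ?thesis
            using mult_left_mono[of "\<bar>g y - g x\<bar>" "e n" "kr n x y"] mk_nonneg
            by (simp add: right_diff_distrib[symmetric] abs_mult)
        qed simp
      qed
    qed (use i1 i2 in auto)
    also have "\<dots> = e n" using mk_integral_box[OF x] by simp
    finally show ?thesis .
  qed
  have one: "L2 bx (\<lambda>x. 1::real)" by (rule L2_bounded[OF box_lm(1), where C = 1]) auto
  show ?thesis
  proof (rule L2_tendsto_squeeze[OF mollify_L2[OF gL] gL])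
    show "l2n bx (\<lambda>x. mollify n g x - g x) \<le> \<bar>e n\<bar> * l2n bx (\<lambda>x. 1::real)" for n
      using pt[of _ n]
      by (intro l2n_le_bound L2_diff mollify_L2 gL one AE_I2) (auto intro: order_trans[OF _ abs_ge_self])
    show "(\<lambda>n. \<bar>e n\<bar> * l2n bx (\<lambda>x. 1::real)) \<longlonglongrightarrow> 0"
      using tendsto_mult_right[OF tendsto_rabs[OF e0], of "l2n bx (\<lambda>x. 1::real)"] by simp
  qed
qed

lemma mollify_diff:
  assumes "L2 bx w" "L2 bx g"
  shows "mollify n (\<lambda>x. w x - g x) x = mollify n w x - mollify n g x"
  using mollify_integrable[OF assms(1)] mollify_integrable[OF assms(2)]
  by (simp add: mollify_def right_diff_distrib)

text \<open>Uniformly bounded operators that converge on a dense subspace converge everywhere; on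
  test functions the convergence is even uniform.\<close>

lemma mollify_tendsto:
  assumes w: "L2 bx w"
  shows "L2_tendsto bx (\<lambda>n. mollify n w) w"
  unfolding L2_tendsto_iff
proof (intro conjI allI mollify_L2 w)
  define C where "C = sqrt (2 ^ DIM('a))"
  have C: "0 \<le> C" by (simp add: C_def)
  show "(\<lambda>k. l2n bx (\<lambda>x. mollify k w x - w x)) \<longlonglongrightarrow> 0"
  proof (rule LIMSEQ_I)
    fix r :: real assume r: "0 < r"
    obtain f where f: "\<And>n. test_function bx (f n)" "L2_tendsto bx f w"
      using test_functions_dense[OF open_box w] by metis
    have "r / (2 * (C + 1)) > 0" using r C by simp
    from LIMSEQ_D[OF L2_tendstoD(3)[OF f(2)] this] obtain j where
      j: "l2n bx (\<lambda>x. f j x - w x) < r / (2 * (C + 1))" by auto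
    note g = f(1)[of j] and gL = test_function_L2[OF f(1) box_lm(2), of j]
    obtain N where N: "\<And>n. n \<ge> N \<Longrightarrow> l2n bx (\<lambda>x. mollify n (f j) x - f j x) < r / 2"
      using LIMSEQ_D[OF L2_tendstoD(3)[OF mollify_test[OF g]], of "r / 2"] r by auto
    have "l2n bx (\<lambda>x. mollify n w x - w x) < r" if n: "n \<ge> N" for n
    proof -
      have "l2n bx (\<lambda>x. mollify n w x - mollify n (f j) x) \<le> C * l2n bx (\<lambda>x. w x - f j x)"
        using mollify_bound[OF L2_diff[OF w gL], of n] by (simp add: C_def ext[OF mollify_diff[OF w gL]])
      moreover have "l2n bx (\<lambda>x. w x - f j x) = l2n bx (\<lambda>x. f j x - w x)" by (rule l2n_minus_commute)
      moreover have "l2n bx (\<lambda>x. mollify n w x - w x) \<le> l2n bx (\<lambda>x. mollify n w x - mollify n (f j) x)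
          + (l2n bx (\<lambda>x. mollify n (f j) x - f j x) + l2n bx (\<lambda>x. f j x - w x))"
        using l2n_triangle3[OF mollify_L2[OF w] mollify_L2[OF gL] w, of n n]
          l2n_triangle3[OF mollify_L2[OF gL] gL w, of n] by linarith
      moreover have "(C + 1) * l2n bx (\<lambda>x. f j x - w x) < r / 2"
        using j C by (simp add: field_simps)
      ultimately show ?thesis using N[OF n] by (simp add: distrib_right)
    qed
    then show "\<exists>no. \<forall>n\<ge>no. norm (l2n bx (\<lambda>x. mollify n w x - w x) - 0) < r" by auto
  qed
qed

lemma smooth_dense_box:
  assumes u: "L2 bx u" and w: "is_weak_grad bx u v"
  obtains us where "\<And>k. smooth (us k)" "L2_tendsto bx us u" "L2_tendsto bx (\<lambda>k. grad (us k)) v"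
proof
  show "smooth (mollify k u)" for k by (rule mollify_smooth[OF u])
  show "L2_tendsto bx (\<lambda>k. mollify k u) u" by (rule mollify_tendsto[OF u])
  show "L2_tendsto bx (\<lambda>k. grad (mollify k u)) v"
  proof (rule L2_tendsto_componentwise)
    fix i :: 'a assume "i \<in> Basis"
    have v: "L2 bx (\<lambda>x. v x \<bullet> i)" by (rule L2_component[OF is_weak_grad_L2[OF w]])
    note t = mollify_tendsto[OF v]
    \<comment> \<open>By \<open>mollify_grad\<close> the gradient is \<open>ml k\<close> times the
      mollified weak derivative, and \<open>ml k\<close> tends to 1.\<close>
    have "L2_tendsto bx (\<lambda>k x. ml k * mollify k (\<lambda>x. v x \<bullet> i) x) (\<lambda>x. v x \<bullet> i)"
    proof (rule L2_tendsto_squeeze)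
      show 1: "L2 bx (\<lambda>x. ml k * mollify k (\<lambda>x. v x \<bullet> i) x)" for k by (intro L2_cmult mollify_L2 v)
      show "l2n bx (\<lambda>x. ml k * mollify k (\<lambda>x. v x \<bullet> i) x - v x \<bullet> i) \<le>
          \<bar>ml k\<bar> * l2n bx (\<lambda>x. mollify k (\<lambda>x. v x \<bullet> i) x - v x \<bullet> i) + \<bar>ml k - 1\<bar> * l2n bx (\<lambda>x. v x \<bullet> i)" for k
        using l2n_triangle[OF L2_cmult[OF L2_diff[OF mollify_L2[OF v] v]] L2_cmult[OF v], of "ml k" k "ml k - 1"]
        unfolding l2n_scaleR[where 'b = real, simplified] by (simp add: algebra_simps)
      have "(\<lambda>k. \<bar>ml k\<bar> * l2n bx (\<lambda>x. mollify k (\<lambda>x. v x \<bullet> i) x - v x \<bullet> i) + \<bar>ml k - 1\<bar> * l2n bx (\<lambda>x. v x \<bullet> i))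
          \<longlonglongrightarrow> \<bar>1\<bar> * 0 + \<bar>1 - 1\<bar> * l2n bx (\<lambda>x. v x \<bullet> i)"
        by (intro tendsto_intros md_ml_tendsto L2_tendstoD(3)[OF t])
      then show "(\<lambda>k. \<bar>ml k\<bar> * l2n bx (\<lambda>x. mollify k (\<lambda>x. v x \<bullet> i) x - v x \<bullet> i) + \<bar>ml k - 1\<bar> * l2n bx (\<lambda>x. v x \<bullet> i)) \<longlonglongrightarrow> 0" by simp
    qed (rule v)
    then show "L2_tendsto bx (\<lambda>k x. grad (mollify k u) x \<bullet> i) (\<lambda>x. v x \<bullet> i)"
      by (subst L2_tendsto_cong[where vs = "\<lambda>k x. ml k * mollify k (\<lambda>x. v x \<bullet> i) x" and v = "\<lambda>x. v x \<bullet> i"]) (auto simp: mollify_grad[OF u w])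
  qed
qed

end

section \<open>Iterated integrals\<close>

lemma emeasure_lborel_Times:
  fixes A :: "'a::euclidean_space set" and B :: "'b::euclidean_space set"
  assumes "A \<in> sets borel" "B \<in> sets borel"
  shows "emeasure lborel (A \<times> B) = emeasure lborel A * emeasure lborel B"
  unfolding lborel_prod[symmetric] using assms by (subst lborel.emeasure_pair_measure_Times) auto

text \<open>A linear bijection of the bases maps boxes to boxes with the same side lengths, hence
  preserves Lebesgue measure, also across types.\<close>

lemma scales_permutation:
  fixes T :: "'a::euclidean_space \<Rightarrow> 'b::euclidean_space"
  assumes T: "linear T" and B: "T ` Basis = Basis" and D: "DIM('a) = DIM('b)"
  shows "scales 1 T"
proof -
  have bij: "bij_betw T Basis Basis"
    using B D by (simp add: bij_betw_def eq_card_imp_inj_on)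
  define S where "S y = (\<Sum>b\<in>Basis. (y \<bullet> T b) *\<^sub>R b)" for y
  have TS: "T (S y) = y" for y
    unfolding S_def linear_sum[OF T] linear_scale[OF T]
    by (subst sum.reindex_bij_betw[OF bij, of "\<lambda>c. (y \<bullet> c) *\<^sub>R c"]) (rule euclidean_representation)
  have in_T: "T x \<bullet> T b = x \<bullet> b" if b: "b \<in> Basis" for x b
  proof -
    have "T x = (\<Sum>c\<in>Basis. (x \<bullet> c) *\<^sub>R T c)"
      by (subst euclidean_representation[of x, symmetric]) (simp only: linear_sum[OF T] linear_scale[OF T])
    moreover have "T c \<bullet> T b = (if c = b then 1 else 0)" if "c \<in> Basis" for c
      using that b bij bij_betwE[OF bij] by (auto simp: inner_Basis bij_betw_def inj_on_eq_iff)
    then have "(\<Sum>c\<in>Basis. (x \<bullet> c) * (T c \<bullet> T b)) = (\<Sum>c\<in>Basis. if c = b then x \<bullet> b else 0)"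
      by (intro sum.cong) auto
    ultimately show ?thesis using b by (simp add: inner_sum_left sum.delta)
  qed
  have ST: "S (T x) = x" for x unfolding S_def using in_T by (simp add: euclidean_representation cong: sum.cong)
  have inv: "inv T = S" by (rule inv_unique_comp) (simp_all add: fun_eq_iff ST TS)
  have "bij T" by (rule bij_betw_byWitness[where f' = S]) (auto simp: ST TS)
  moreover have m: "T \<in> borel \<rightarrow>\<^sub>M borel"
    using T by (intro borel_measurable_continuous_onI linear_continuous_on) (simp add: linear_conv_bounded_linear)
  moreover have "S \<in> borel \<rightarrow>\<^sub>M borel"
    unfolding S_def[abs_def] by (intro borel_measurable_continuous_onI continuous_intros)
  moreover have "lborel = density (distr lborel borel T) (\<lambda>_. ennreal 1)"
  proof (rule lborel_eqI)
    fix l u :: 'b assume le: "\<And>b. b \<in> Basis \<Longrightarrow> l \<bullet> b \<le> u \<bullet> b"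
    have Sb: "S y \<bullet> b = y \<bullet> T b" if "b \<in> Basis" for y b using in_T[OF that, of "S y"] by (simp add: TS)
    have TB: "T b \<in> Basis" if "b \<in> Basis" for b using that B by blast
    have "T -` box l u = box (S l) (S u)"
      unfolding box_def B[symmetric] by (auto simp: Sb in_T)
    then have "emeasure lborel (T -` box l u) = (\<Prod>b\<in>Basis. (u - l) \<bullet> T b)"
      using le[OF TB] by (simp add: emeasure_lborel_box_eq Sb inner_diff_left)
    also have "(\<Prod>b\<in>Basis. (u - l) \<bullet> T b) = (\<Prod>b\<in>Basis. (u - l) \<bullet> b)" by (rule prod.reindex_bij_betw[OF bij])
    finally show "emeasure (density (distr lborel borel T) (\<lambda>_. ennreal 1)) (box l u) = (\<Prod>b\<in>Basis. (u - l) \<bullet> b)"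
      using m by (simp add: density_1 emeasure_distr)
  qed simp
  ultimately show ?thesis unfolding scales_def inv by simp
qed

definition c2 :: "real \<times> real \<Rightarrow> real^2" where "c2 p = pt2 (fst p) (snd p)"
text \<open>The three maps into real^3 fix the splittings used for iterated integrals:
  \<open>c3\<close> singles out the coordinate along the plate, \<open>c3l\<close> the one across
  it, \<open>c3p\<close> the longitudinal one.\<close>

definition c3 :: "(real^2) \<times> real \<Rightarrow> real^3" where "c3 p = vector [fst p $ 1, snd p, fst p $ 2]"
definition c3l :: "(real^2) \<times> real \<Rightarrow> real^3" where "c3l p = vector [fst p $ 1, fst p $ 2, snd p]"
definition c3p :: "real \<times> (real^2) \<Rightarrow> real^3" where "c3p p = pt (fst p) (snd p)"

lemma pt2_nth [simp]: "pt2 a b $ 1 = a" "pt2 a b $ 2 = b" by (simp_all add: pt2_def)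
lemma pt_nth [simp]: "pt a y $ 1 = a" "pt a y $ 2 = y $ 1" "pt a y $ 3 = y $ 2" by (simp_all add: pt_def)
lemma c2_nth [simp]: "c2 p $ 1 = fst p" "c2 p $ 2 = snd p" by (simp_all add: c2_def)
lemma c3_nth [simp]: "c3 p $ 1 = fst p $ 1" "c3 p $ 2 = snd p" "c3 p $ 3 = fst p $ 2" by (simp_all add: c3_def)
lemma c3l_nth [simp]: "c3l p $ 1 = fst p $ 1" "c3l p $ 2 = fst p $ 2" "c3l p $ 3 = snd p" by (simp_all add: c3l_def)

lemma linear_coords: "linear c2" "linear c3" "linear c3l" "linear c3p"
  by (auto intro!: linearI simp: vec_eq_iff forall_2 forall_3 c3p_def)

lemma scales_coords: "scales 1 c2" "scales 1 c3" "scales 1 c3l" "scales 1 c3p"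
proof -
  have a: "c2 (1, 0) = axis 1 1" "c2 (0, 1) = axis 2 1"
    "c3 (axis 1 1, 0) = axis 1 1" "c3 (axis 2 1, 0) = axis 3 1" "c3 (0, 1) = axis 2 1"
    "c3l (axis 1 1, 0) = axis 1 1" "c3l (axis 2 1, 0) = axis 2 1" "c3l (0, 1) = axis 3 1"
    "c3p (1, 0) = axis 1 1" "c3p (0, axis 1 1) = axis 2 1" "c3p (0, axis 2 1) = axis 3 1"
    by (simp_all add: vec_eq_iff forall_2 forall_3 axis_def c3p_def)
  note S = Basis_prod_def Basis_vec_def UNIV_2 UNIV_3 image_Un a
  show "scales 1 c2" by (rule scales_permutation[OF linear_coords(1)]; (simp; fail | auto simp: S))
  show "scales 1 c3" by (rule scales_permutation[OF linear_coords(2)]; (simp; fail | auto simp: S))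
  show "scales 1 c3l" by (rule scales_permutation[OF linear_coords(3)]; (simp; fail | auto simp: S))
  show "scales 1 c3p" by (rule scales_permutation[OF linear_coords(4)]; (simp; fail | auto simp: S))
qed

lemma continuous_on_vec: 
  fixes f :: "'a::topological_space \<Rightarrow> real^'n"
  shows "(\<And>i. continuous_on S (\<lambda>x. f x $ i)) \<Longrightarrow> continuous_on S f"
  using continuous_on_vec_lambda[of S "\<lambda>i x. f x $ i"] by simp

text \<open>Iterated integrals are taken with respect to \<open>lborel\<close>, so a Lebesgue
  integrable function is first replaced by a Borel function equal to it almost everywhere.\<close>

lemma borel_representative:
  fixes f :: "'a::euclidean_space \<Rightarrow> real"
  assumes "integrable (leb S) f" "S \<in> sets lebesgue"
  obtains f' where "f' \<in> borel_measurable borel" "integrable lborel f'"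
    "AE x in lborel. (if x \<in> S then f x else 0) = f' x"
    "integral\<^sup>L lborel f' = (LINT x|leb S. f x)"
proof -
  let ?f = "\<lambda>x. if x \<in> S then f x else 0"
  have i: "integrable lebesgue ?f" using assms by (simp add: Lebesgue_Measure.integrable_restrict_UNIV)
  then obtain f' where f': "f' \<in> borel_measurable lborel" "AE x in lborel. ?f x = f' x"
    using completion_ex_borel_measurable_real[OF borel_measurable_integrable[OF i]] by auto
  have ae: "AE x in lebesgue. ?f x = f' x" using f'(2) by (rule AE_completion)
  have m: "f' \<in> borel_measurable lebesgue" using f'(1) by (rule measurable_completion)
  have "integrable lebesgue f'"
    using i integrable_cong_AE[OF borel_measurable_integrable[OF i] m ae] by simp
  then have "integrable lborel f'" using f'(1) by (simp add: integrable_completion)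
  moreover have "integral\<^sup>L lborel f' = (LINT x|leb S. f x)"
    using integral_cong_AE[OF borel_measurable_integrable[OF i] m ae] f'(1) assms(2)
    by (simp add: integral_completion Lebesgue_Measure.integral_restrict_UNIV)
  ultimately show ?thesis using that f' by simp
qed

lemma AE_lborel_fst:
  fixes P :: "'a::euclidean_space \<Rightarrow> bool"
  assumes "AE x in lborel. P x" shows "AE p in (lborel :: ('a \<times> 'b::euclidean_space) measure). P (fst p)"
proof -
  obtain N where N: "{x. \<not> P x} \<subseteq> N" "emeasure lborel N = 0" "N \<in> sets borel"
    using AE_E[OF assms] by auto
  have "emeasure lborel (N \<times> (UNIV :: 'b set)) = 0" using N by (simp add: emeasure_lborel_Times)
  moreover have "N \<times> (UNIV :: 'b set) \<in> sets (borel \<Otimes>\<^sub>M borel)" using N(3) by auto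
  ultimately have "N \<times> (UNIV :: 'b set) \<in> null_sets lborel" unfolding borel_prod by (simp add: null_sets_def)
  then show ?thesis by (rule AE_I') (use N(1) in auto)
qed

lemma AE_lborel_snd:
  fixes P :: "'b::euclidean_space \<Rightarrow> bool"
  assumes "AE x in lborel. P x" shows "AE p in (lborel :: ('a::euclidean_space \<times> 'b) measure). P (snd p)"
proof -
  obtain N where N: "{x. \<not> P x} \<subseteq> N" "emeasure lborel N = 0" "N \<in> sets borel"
    using AE_E[OF assms] by auto
  have "emeasure lborel ((UNIV :: 'a set) \<times> N) = 0" using N by (simp add: emeasure_lborel_Times)
  moreover have "(UNIV :: 'a set) \<times> N \<in> sets (borel \<Otimes>\<^sub>M borel)" using N(3) by auto
  ultimately have "(UNIV :: 'a set) \<times> N \<in> null_sets lborel" unfolding borel_prod by (simp add: null_sets_def)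
  then show ?thesis by (rule AE_I') (use N(1) in auto)
qed

lemma sets_lebesgue_Times:
  fixes A :: "'a::euclidean_space set" and B :: "'b::euclidean_space set"
  assumes "A \<in> sets borel" "B \<in> sets borel" shows "A \<times> B \<in> sets borel"
  using pair_measureI[OF assms] unfolding borel_prod .

text \<open>For a product of functions of separate variables, Borel representatives of the factors
  multiply to one of the product, and the exceptional set is a union of two null cylinders.\<close>

lemma lebesgue_product_function:
  fixes f :: "'a::euclidean_space \<Rightarrow> real" and g :: "'b::euclidean_space \<Rightarrow> real"
  assumes f: "integrable (leb A) f" and g: "integrable (leb B) g"
    and A: "A \<in> sets borel" and B: "B \<in> sets borel"
  shows "integrable (leb (A \<times> B)) (\<lambda>p. f (fst p) * g (snd p))"
    and "(LINT p|leb (A \<times> B). f (fst p) * g (snd p)) = (LINT x|leb A. f x) * (LINT y|leb B. g y)"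
proof -
  let ?tA = "\<lambda>p. if p \<in> A \<times> B then f (fst p) * g (snd p) else 0"
  have S: "A \<in> sets lebesgue" "B \<in> sets lebesgue" "A \<times> B \<in> sets lebesgue"
    using A B sets_lebesgue_Times[OF A B] by auto
  obtain f' where f': "f' \<in> borel_measurable borel" "integrable lborel f'"
    "AE x in lborel. (if x \<in> A then f x else 0) = f' x" "integral\<^sup>L lborel f' = (LINT x|leb A. f x)"
    by (rule borel_representative[OF f S(1)])
  obtain g' where g': "g' \<in> borel_measurable borel" "integrable lborel g'"
    "AE x in lborel. (if x \<in> B then g x else 0) = g' x" "integral\<^sup>L lborel g' = (LINT x|leb B. g x)"
    by (rule borel_representative[OF g S(2)])
  let ?h = "\<lambda>p. f' (fst p) * g' (snd p)"
  have mh: "?h \<in> borel_measurable lborel" using f'(1) g'(1) by (simp add: borel_prod[symmetric])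
  have ih: "integrable (lborel \<Otimes>\<^sub>M lborel) (\<lambda>(x, y). f' x * g' y)"
  proof (rule lborel_pair.Fubini_integrable)
    show "(\<lambda>(x, y). f' x * g' y) \<in> borel_measurable (lborel \<Otimes>\<^sub>M lborel)"
      using f'(1) g'(1) by simp
    show "integrable lborel (\<lambda>x. LINT y|lborel. norm (case (x, y) of (x, y) \<Rightarrow> f' x * g' y))"
      using f'(2) by (simp add: abs_mult)
    show "AE x in lborel. integrable lborel (\<lambda>y. case (x, y) of (x, y) \<Rightarrow> f' x * g' y)"
      using g'(2) by simp
  qed
  have Ih: "(LINT p|lborel. ?h p) = integral\<^sup>L lborel f' * integral\<^sup>L lborel g'"
    using lborel_pair.integral_fst'[OF ih] by (simp add: lborel_prod case_prod_unfold)
  have "AE p in (lborel :: ('a \<times> 'b) measure). (if fst p \<in> A then f (fst p) else 0) = f' (fst p)"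
    by (rule AE_lborel_fst[OF f'(3)])
  moreover have "AE p in (lborel :: ('a \<times> 'b) measure). (if snd p \<in> B then g (snd p) else 0) = g' (snd p)"
    by (rule AE_lborel_snd[OF g'(3)])
  ultimately have "AE p in lborel. ?h p = (?tA p)"
    by eventually_elim (auto simp: mem_Times_iff split: if_splits)
  then have ae: "AE p in lebesgue. ?h p = (?tA p)" by (rule AE_completion)
  have hl: "?h \<in> borel_measurable lebesgue" using mh by (rule measurable_completion)
  have ml: "(\<lambda>p. if p \<in> A \<times> B then f (fst p) * g (snd p) else 0) \<in> borel_measurable lebesgue"
    by (rule borel_measurable_AE[OF hl ae])
  have "integrable lebesgue ?h"
    using ih mh by (simp add: integrable_completion lborel_prod case_prod_unfold)
  then have "integrable lebesgue (\<lambda>p. if p \<in> A \<times> B then f (fst p) * g (snd p) else 0)"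
    using integrable_cong_AE[OF hl ml ae] by simp
  then show "integrable (leb (A \<times> B)) (\<lambda>p. f (fst p) * g (snd p))"
    using S(3) by (simp only: Lebesgue_Measure.integrable_restrict_UNIV)
  have "(LINT p|leb (A \<times> B). f (fst p) * g (snd p)) = (LINT p|lebesgue. (?tA p))"
    using S(3) by (simp only: Lebesgue_Measure.integral_restrict_UNIV)
  also have "\<dots> = (LINT p|lebesgue. ?h p)" using integral_cong_AE[OF hl ml ae] by simp
  also have "\<dots> = (LINT p|lborel. ?h p)" using mh by (simp add: integral_completion)
  finally show "(LINT p|leb (A \<times> B). f (fst p) * g (snd p)) = (LINT x|leb A. f x) * (LINT y|leb B. g y)"
    using Ih f'(4) g'(4) by simp
qed

text \<open>Continuity makes every slice integrable, so that inequalities valid on each line can be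
  integrated over the remaining variable.\<close>

lemma lebesgue_Fubini_continuous:
  fixes f :: "'a::euclidean_space \<times> 'b::euclidean_space \<Rightarrow> real"
  assumes f: "continuous_on UNIV f" and A: "A \<in> sets borel" "bounded A" and B: "B \<in> sets borel" "bounded B"
  shows "integrable (leb (A \<times> B)) f" "integrable (leb A) (\<lambda>x. LINT y|leb B. f (x, y))"
    "(LINT p|leb (A \<times> B). f p) = (LINT x|leb A. (LINT y|leb B. f (x, y)))"
proof -
  have AB: "A \<times> B \<in> sets borel" by (rule sets_lebesgue_Times[OF A(1) B(1)])
  have S: "A \<in> sets lebesgue" "B \<in> sets lebesgue" "A \<times> B \<in> sets lebesgue" using A B AB by auto
  have bd: "bounded (A \<times> B)" using A B by (simp add: bounded_Times)
  have m: "f \<in> borel_measurable borel" using f by (rule borel_measurable_continuous_onI)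
  show i: "integrable (leb (A \<times> B)) f"
    using bd S(3) by (intro L2_integrable L2_continuous f bounded_set_imp_lmeasurable)
  let ?g = "\<lambda>p. if p \<in> A \<times> B then f p else 0"
  have mg: "?g \<in> borel_measurable borel" by (rule measurable_If_set) (use m AB in auto)
  have ig: "integrable lborel ?g"
    using i mg S(3) by (simp add: Lebesgue_Measure.integrable_restrict_UNIV[symmetric] integrable_completion)
  then have ig': "integrable (lborel \<Otimes>\<^sub>M lborel) ?g" by (simp add: lborel_prod)
  have inner: "(LINT y|lborel. ?g (x, y)) = (if x \<in> A then (LINT y|leb B. f (x, y)) else 0)" for x
  proof (cases "x \<in> A")
    case True
    have mx: "(\<lambda>y. if y \<in> B then f (x, y) else 0) \<in> borel_measurable borel"
    proof -
      have "continuous_on UNIV (\<lambda>y. f (x, y))" by (rule continuous_on_compose2[OF f]) (auto intro!: continuous_intros)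
      then show ?thesis using B(1) by (intro measurable_If_set borel_measurable_continuous_onI) auto
    qed
    have "(LINT y|leb B. f (x, y)) = (LINT y|lebesgue. (if y \<in> B then f (x, y) else 0))"
      using S(2) by (simp only: Lebesgue_Measure.integral_restrict_UNIV)
    also have "\<dots> = (LINT y|lborel. (if y \<in> B then f (x, y) else 0))" using mx by (simp add: integral_completion)
    finally show ?thesis using True by simp
  qed simp
  have "integrable lborel (\<lambda>x. LINT y|lborel. ?g (x, y))" by (rule lborel_pair.integrable_fst'[OF ig'])
  then have iA: "integrable lborel (\<lambda>x. if x \<in> A then (LINT y|leb B. f (x, y)) else 0)" by (simp only: inner)
  then have "integrable lebesgue (\<lambda>x. if x \<in> A then (LINT y|leb B. f (x, y)) else 0)"
    using borel_measurable_integrable[OF iA] by (simp add: integrable_completion)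
  then show "integrable (leb A) (\<lambda>x. LINT y|leb B. f (x, y))"
    using S(1) by (simp only: Lebesgue_Measure.integrable_restrict_UNIV)
  have "(LINT p|leb (A \<times> B). f p) = (LINT p|lebesgue. ?g p)"
    using S(3) by (simp only: Lebesgue_Measure.integral_restrict_UNIV)
  also have "\<dots> = (LINT p|lborel. ?g p)" using mg by (simp add: integral_completion)
  also have "\<dots> = (LINT x|lborel. (LINT y|lborel. ?g (x, y)))"
    using lborel_pair.integral_fst'[OF ig'] by (simp add: lborel_prod)
  also have "\<dots> = (LINT x|lborel. (if x \<in> A then (LINT y|leb B. f (x, y)) else 0))" by (simp only: inner)
  also have "\<dots> = (LINT x|lebesgue. (if x \<in> A then (LINT y|leb B. f (x, y)) else 0))"
    using borel_measurable_integrable[OF iA] by (simp add: integral_completion)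
  also have "\<dots> = (LINT x|leb A. (LINT y|leb B. f (x, y)))"
    using S(1) by (simp only: Lebesgue_Measure.integral_restrict_UNIV)
  finally show "(LINT p|leb (A \<times> B). f p) = (LINT x|leb A. (LINT y|leb B. f (x, y)))" .
qed

lemma line_FTC:
  assumes "smooth F" "p \<le> q"
  shows "(LINT s|leb {p<..<q}. grad F (x + s *\<^sub>R e) \<bullet> e) = F (x + q *\<^sub>R e) - F (x + p *\<^sub>R e)"
proof -
  let ?g = "\<lambda>s. grad F (x + s *\<^sub>R e) \<bullet> e"
  have c: "continuous_on UNIV ?g"
    by (rule continuous_on_compose2[OF smooth_continuous[OF smooth_grad[OF assms(1)]], of UNIV]) (auto intro!: continuous_intros)
  have i: "integrable (leb {p<..<q}) ?g"
    by (intro L2_integrable L2_continuous c bounded_set_imp_lmeasurable) auto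
  have "(?g has_integral (F (x + q *\<^sub>R e) - F (x + p *\<^sub>R e))) {p..q}"
    using smooth_line_DERIV[OF assms(1), of x e] assms(2)
    by (intro fundamental_theorem_of_calculus)
       (auto simp: has_real_derivative_iff_has_vector_derivative[symmetric] intro: has_field_derivative_at_within)
  then have "integral {p<..<q} ?g = F (x + q *\<^sub>R e) - F (x + p *\<^sub>R e)"
    by (simp add: has_integral_Icc_iff_Ioo integral_unique)
  then show ?thesis using i by (simp add: lebesgue_integral_eq_integral)
qed

text \<open>Fubini along the lines of direction \<open>e\<close> reduces the integral of a
  directional derivative to the fundamental theorem on each line. The map \<open>T\<close> is a
  reordering of coordinates, for rectangles as well as for plates.\<close>

lemma slice_FTC:
  fixes T :: "'b::euclidean_space \<times> real \<Rightarrow> 'a::euclidean_space"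
  assumes T: "scales 1 T" "continuous_on UNIV T" "\<And>y s. T (y, s) = T (y, 0) + s *\<^sub>R e"
    and F: "smooth F" and D: "D \<in> sets borel" "bounded D" and pq: "p \<le> q"
  shows "(LINT x|leb (T ` (D \<times> {p<..<q})). grad F x \<bullet> e) = (LINT y|leb D. F (T (y, q)) - F (T (y, p)))"
proof -
  have c: "continuous_on UNIV (\<lambda>z. grad F (T z) \<bullet> e)"
    by (rule continuous_on_compose2[OF smooth_continuous[OF smooth_grad[OF F]] T(2)]) auto
  have S: "D \<times> {p<..<q} \<in> sets lebesgue" using sets_lebesgue_Times[OF D(1), of "{p<..<q}"] by auto
  have "(LINT x|leb (T ` (D \<times> {p<..<q})). grad F x \<bullet> e) = (LINT z|leb (D \<times> {p<..<q}). grad F (T z) \<bullet> e)"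
    by (simp add: scales_LINT[OF T(1) S])
  also have "\<dots> = (LINT y|leb D. (LINT s|leb {p<..<q}. grad F (T (y, s)) \<bullet> e))"
    by (rule lebesgue_Fubini_continuous[OF c D]) auto
  also have "\<dots> = (LINT y|leb D. F (T (y, q)) - F (T (y, p)))"
    using line_FTC[OF F pq, of "T (_, 0)" e] by (simp add: T(3)[symmetric])
  finally show ?thesis .
qed

section \<open>Rectangles and traces\<close>

definition rect :: "real \<Rightarrow> real \<Rightarrow> real \<Rightarrow> (real^2) set" where
  "rect L p q = {y. y $ 1 \<in> {0<..<L} \<and> y $ 2 \<in> {p<..<q}}"

abbreviation e2 :: "real^2" where "e2 \<equiv> axis 2 1"

lemma rect_box: "rect L p q = box (pt2 0 p) (pt2 L q)"
  by (auto simp: rect_def mem_box_cart forall_2)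

lemma rect_c2: "rect L p q = c2 ` ({0<..<L} \<times> {p<..<q})"
proof -
  have "y \<in> c2 ` ({0<..<L} \<times> {p<..<q})" if "y \<in> rect L p q" for y
    using that by (intro image_eqI[of _ _ "(y $ 1, y $ 2)"]) (auto simp: rect_def vec_eq_iff forall_2)
  then show ?thesis by (auto simp: rect_def)
qed

lemma rect_simps [simp]: "open (rect L p q)" "bounded (rect L p q)" "rect L p q \<in> sets lebesgue" "rect L p q \<in> lmeasurable"
  unfolding rect_box by (auto intro: bounded_set_imp_lmeasurable)

lemma c2_line: "c2 (y, s) = c2 (y, 0) + s *\<^sub>R e2"
  by (simp add: vec_eq_iff forall_2 axis_def)

lemma c2_continuous: "continuous_on UNIV c2"
proof (rule continuous_on_vec)
  fix i :: 2
  show "continuous_on UNIV (\<lambda>x. c2 x $ i)" using exhaust_2[of i] by (elim disjE) (simp_all add: continuous_intros)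
qed

lemma c2_pt2: "c2 (x, s) = pt2 x s" by (simp add: c2_def)

lemma rect_FTC:
  assumes "smooth F" "p \<le> q"
  shows "(LINT x|leb (rect L p q). grad F x \<bullet> e2) = (LINT x|leb {0<..<L}. F (pt2 x q) - F (pt2 x p))"
  unfolding rect_c2 c2_pt2[symmetric]
  by (rule slice_FTC[OF scales_coords(1) c2_continuous c2_line assms(1) _ _ assms(2)]) auto

lemma rect_Fubini:
  fixes f :: "real^2 \<Rightarrow> real"
  assumes "continuous_on UNIV f"
  shows "(LINT x|leb (rect L p q). f x) = (LINT x|leb {0<..<L}. (LINT s|leb {p<..<q}. f (pt2 x s)))"
    "integrable (leb {0<..<L}) (\<lambda>x. LINT s|leb {p<..<q}. f (pt2 x s))"
proof -
  have c: "continuous_on UNIV (\<lambda>z. f (c2 z))"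
    by (rule continuous_on_compose2[OF assms c2_continuous]) auto
  have S: "{0<..<L} \<times> {p<..<q} \<in> sets lebesgue" using sets_lebesgue_Times[of "{0<..<L}" "{p<..<q}"] by auto
  note F = lebesgue_Fubini_continuous[OF c, of "{0<..<L}" "{p<..<q}", simplified c2_pt2, simplified]
  show "(LINT x|leb (rect L p q). f x) = (LINT x|leb {0<..<L}. (LINT s|leb {p<..<q}. f (pt2 x s)))"
    using F(3) by (simp add: rect_c2 scales_LINT[OF scales_coords(1) S])
  show "integrable (leb {0<..<L}) (\<lambda>x. LINT s|leb {p<..<q}. f (pt2 x s))" by (rule F(2))
qed

lemma continuous_pt2: "continuous_on UNIV (\<lambda>x. pt2 x s)" "continuous_on UNIV (\<lambda>s. pt2 x s)"
  by (rule continuous_on_compose2[OF c2_continuous, of UNIV, unfolded c2_def fst_conv snd_conv, where f = "\<lambda>x. (x, s)", simplified]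
      continuous_on_compose2[OF c2_continuous, of UNIV, unfolded c2_def fst_conv snd_conv, where f = "\<lambda>s. (x, s)", simplified];
      intro continuous_intros)+

text \<open>The fundamental theorem and Cauchy-Schwarz bound the squared increment by q - p times
  the line integral of the squared derivative; then a^2 <= 2 b^2 + 2 (a - b)^2.\<close>

lemma line_square_bound:
  assumes "smooth f" "s \<in> {p..q}" "s0 \<in> {p..q}"
  shows "(f (pt2 x s))\<^sup>2 \<le> 2 * (f (pt2 x s0))\<^sup>2 + 2 * (q - p) * (LINT r|leb {p<..<q}. (grad f (pt2 x r) \<bullet> e2)\<^sup>2)"
proof -
  let ?g = "\<lambda>r. grad f (pt2 x r) \<bullet> e2"
  let ?I = "LINT r|leb {p<..<q}. (grad f (pt2 x r) \<bullet> e2)\<^sup>2"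
  have ptl: "pt2 x r = pt2 x 0 + r *\<^sub>R e2" for r by (simp add: vec_eq_iff forall_2 axis_def)
  have c: "continuous_on UNIV ?g"
    by (rule continuous_on_compose2[OF smooth_continuous[OF smooth_grad[OF assms(1)]] continuous_pt2(2)]) auto
  have *: "(f (pt2 x t) - f (pt2 x r))\<^sup>2 \<le> (q - p) * ?I" if rt: "p \<le> r" "r \<le> t" "t \<le> q" for r t
  proof -
    have L: "L2 {r<..<t} ?g" "L2 {p<..<q} ?g" by (intro L2_continuous c; simp)+
    have one: "L2 {r<..<t} (\<lambda>x. 1::real)" by (intro L2_continuous) auto
    have "f (pt2 x t) - f (pt2 x r) = (LINT u|leb {r<..<t}. 1 * ?g u)"
      using line_FTC[OF assms(1) rt(2), of "pt2 x 0" e2] by (simp add: ptl[symmetric])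
    then have "\<bar>f (pt2 x t) - f (pt2 x r)\<bar> \<le> l2n {r<..<t} (\<lambda>x. 1::real) * l2n {r<..<t} ?g"
      using L2_Cauchy_Schwarz_real[OF one L(1)] by simp
    then have "(f (pt2 x t) - f (pt2 x r))\<^sup>2 \<le> (l2n {r<..<t} (\<lambda>x. 1::real) * l2n {r<..<t} ?g)\<^sup>2"
      by (metis abs_ge_zero power2_abs power_mono)
    also have "\<dots> = (t - r) * (l2n {r<..<t} ?g)\<^sup>2"
      using rt by (simp add: power_mult_distrib l2n_power2 measure_restrict_space)
    also have "\<dots> \<le> (q - p) * (l2n {p<..<q} ?g)\<^sup>2"
      using rt by (intro mult_mono power_mono l2n_subset L) auto
    finally show ?thesis by (simp add: l2n_power2)
  qed
  have "(f (pt2 x s) - f (pt2 x s0))\<^sup>2 \<le> (q - p) * ?I"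
    using *[of s s0] *[of s0 s] assms(2,3) by (cases "s \<le> s0") (auto simp: power2_commute)
  moreover have "(f (pt2 x s))\<^sup>2 \<le> 2 * (f (pt2 x s0))\<^sup>2 + 2 * (f (pt2 x s) - f (pt2 x s0))\<^sup>2"
    using zero_le_power2[of "f (pt2 x s) - 2 * f (pt2 x s0)"] by (simp add: power2_eq_square algebra_simps)
  ultimately show ?thesis by linarith
qed

text \<open>Integrating \<open>line_square_bound\<close> gives a Poincare inequality with a trace
  term; with the two points exchanged it gives the trace inequality. The powers of q - p are kept
  explicit because strips of small width are used later.\<close>

lemma rect_trace_bounds:
  assumes f: "smooth f" and pq: "p \<le> q" and s0: "s0 \<in> {p..q}"
  shows "(l2n (rect L p q) f)\<^sup>2 \<le> 2 * (q - p) * (l2n {0<..<L} (\<lambda>x. f (pt2 x s0)))\<^sup>2 + 2 * (q - p)\<^sup>2 * (l2n (rect L p q) (\<lambda>x. grad f x \<bullet> e2))\<^sup>2"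
    and "(q - p) * (l2n {0<..<L} (\<lambda>x. f (pt2 x s0)))\<^sup>2 \<le> 2 * (l2n (rect L p q) f)\<^sup>2 + 2 * (q - p)\<^sup>2 * (l2n (rect L p q) (\<lambda>x. grad f x \<bullet> e2))\<^sup>2"
proof -
  let ?tA = "l2n (rect L p q) (\<lambda>x. grad f x \<bullet> e2)"
  let ?A = "\<lambda>x. LINT r|leb {p<..<q}. (grad f (pt2 x r) \<bullet> e2)\<^sup>2"
  let ?B = "\<lambda>x. LINT r|leb {p<..<q}. (f (pt2 x r))\<^sup>2"
  let ?t = "\<lambda>x. (f (pt2 x s0))\<^sup>2"
  have cf: "continuous_on UNIV (\<lambda>y. (f y)\<^sup>2)" and cg: "continuous_on UNIV (\<lambda>y. (grad f y \<bullet> e2)\<^sup>2)"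
    by (intro continuous_intros smooth_continuous f smooth_grad)+
  have A: "integrable (leb {0<..<L}) ?A" "?tA\<^sup>2 = (LINT x|leb {0<..<L}. ?A x)"
    using rect_Fubini[OF cg] by (simp_all add: l2n_power2)
  have B: "integrable (leb {0<..<L}) ?B" "(l2n (rect L p q) f)\<^sup>2 = (LINT x|leb {0<..<L}. ?B x)"
    using rect_Fubini[OF cf] by (simp_all add: l2n_power2)
  have ct: "continuous_on UNIV ?t" by (rule continuous_on_compose2[OF cf continuous_pt2(1)]) auto
  have t: "integrable (leb {0<..<L}) ?t"
    by (intro L2_integrable L2_continuous ct bounded_set_imp_lmeasurable) auto
  have T: "(l2n {0<..<L} (\<lambda>x. f (pt2 x s0)))\<^sup>2 = (LINT x|leb {0<..<L}. ?t x)" by (simp add: l2n_power2)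
  have cs: "continuous_on UNIV (\<lambda>r. (f (pt2 x r))\<^sup>2)" for x by (rule continuous_on_compose2[OF cf continuous_pt2(2)]) auto
  have isq: "integrable (leb {p<..<q}) (\<lambda>r. (f (pt2 x r))\<^sup>2)" for x
    by (intro L2_integrable L2_continuous cs bounded_set_imp_lmeasurable) auto
  have ic: "integrable (leb {p<..<q}) (\<lambda>r. c)" "(LINT r|leb {p<..<q}. c) = (q - p) * c" for c :: real
  proof -
    show "integrable (leb {p<..<q}) (\<lambda>r. c)"
      by (intro L2_integrable L2_continuous bounded_set_imp_lmeasurable) auto
    show "(LINT r|leb {p<..<q}. c) = (q - p) * c" using pq by (simp add: measure_restrict_space)
  qed
  have 1: "?B x \<le> 2 * (q - p) * ?t x + 2 * (q - p)\<^sup>2 * ?A x" for x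
  proof -
    have "?B x \<le> (LINT r|leb {p<..<q}. 2 * ?t x + 2 * (q - p) * ?A x)"
      by (rule integral_mono_AE[OF isq ic(1)]) (rule AE_I2, rule line_square_bound[OF f _ s0], simp)
    then show ?thesis by (simp only: ic(2)) (simp add: algebra_simps power2_eq_square)
  qed
  have 2: "(q - p) * ?t x \<le> 2 * ?B x + 2 * (q - p)\<^sup>2 * ?A x" for x
  proof -
    have "(LINT r|leb {p<..<q}. ?t x) \<le> (LINT r|leb {p<..<q}. 2 * (f (pt2 x r))\<^sup>2 + 2 * (q - p) * ?A x)"
    proof (rule integral_mono_AE[OF ic(1)])
      show "integrable (leb {p<..<q}) (\<lambda>r. 2 * (f (pt2 x r))\<^sup>2 + 2 * (q - p) * ?A x)"
        by (intro Bochner_Integration.integrable_add integrable_mult_right isq ic(1))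
      show "AE r in leb {p<..<q}. ?t x \<le> 2 * (f (pt2 x r))\<^sup>2 + 2 * (q - p) * ?A x"
        by (rule AE_I2, rule line_square_bound[OF f s0], simp)
    qed
    also have "\<dots> = 2 * ?B x + (q - p) * (2 * (q - p) * ?A x)"
      by (subst Bochner_Integration.integral_add) (auto simp only: ic integral_mult_right_zero intro!: integrable_mult_right isq)
    finally show ?thesis by (simp only: ic(2)) (simp add: algebra_simps power2_eq_square)
  qed
  have "(LINT x|leb {0<..<L}. ?B x) \<le> (LINT x|leb {0<..<L}. 2 * (q - p) * ?t x + 2 * (q - p)\<^sup>2 * ?A x)"
    by (intro integral_mono_AE AE_I2 1 Bochner_Integration.integrable_add integrable_mult_right A(1) B(1) t)
  also have "\<dots> = 2 * (q - p) * (LINT x|leb {0<..<L}. ?t x) + 2 * (q - p)\<^sup>2 * (LINT x|leb {0<..<L}. ?A x)"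
    using A(1) t by (subst Bochner_Integration.integral_add) (auto intro!: integrable_mult_right)
  finally show "(l2n (rect L p q) f)\<^sup>2 \<le> 2 * (q - p) * (l2n {0<..<L} (\<lambda>x. f (pt2 x s0)))\<^sup>2 + 2 * (q - p)\<^sup>2 * ?tA\<^sup>2"
    unfolding A(2) B(2) T .
  have "(LINT x|leb {0<..<L}. (q - p) * ?t x) \<le> (LINT x|leb {0<..<L}. 2 * ?B x + 2 * (q - p)\<^sup>2 * ?A x)"
    by (intro integral_mono_AE AE_I2 2 Bochner_Integration.integrable_add integrable_mult_right A(1) B(1) t)
  also have "\<dots> = 2 * (LINT x|leb {0<..<L}. ?B x) + 2 * (q - p)\<^sup>2 * (LINT x|leb {0<..<L}. ?A x)"
    using A(1) B(1) by (subst Bochner_Integration.integral_add) (auto intro!: integrable_mult_right)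
  finally show "(q - p) * (l2n {0<..<L} (\<lambda>x. f (pt2 x s0)))\<^sup>2 \<le> 2 * (l2n (rect L p q) f)\<^sup>2 + 2 * (q - p)\<^sup>2 * ?tA\<^sup>2"
    unfolding A(2) B(2) T by simp
qed

section \<open>A weak characterisation of traces\<close>

lemma smooth_nth: "smooth (\<lambda>y::real^'n. y $ i)"
  by (rule smooth_linear) (rule bounded_linear_vec_nth)

lemma smooth_nth_compose: "smooth f \<Longrightarrow> smooth (\<lambda>y::real^'n. f (y $ i))"
  by (rule smooth_compose_real[OF _ smooth_nth])

lemma grad_nth_compose:
  assumes "smooth f" shows "grad (\<lambda>y::real^'n. f (y $ i)) y = grad f (y $ i) *\<^sub>R axis i 1"
proof -
  have "grad (\<lambda>y::real^'n. y $ i) y = axis i 1"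
    by (rule grad_eqI) (use bounded_linear_imp_has_derivative[OF bounded_linear_vec_nth] in \<open>simp add: inner_axis inner_commute\<close>)
  then show ?thesis by (simp add: grad_compose_real[OF assms smooth_nth])
qed

lemma test_function_real_bounded_grad:
  assumes "smooth B" "bounded S"
  obtains C where "0 \<le> C" "\<And>s. s \<in> S \<Longrightarrow> \<bar>B s\<bar> \<le> C" "\<And>s::real. s \<in> S \<Longrightarrow> \<bar>grad B s\<bar> \<le> C"
proof -
  obtain C1 where "0 \<le> C1" "\<And>s. s \<in> S \<Longrightarrow> norm (B s) \<le> C1" using continuous_bounded_on[OF assms(2) smooth_continuous[OF assms(1)]] by metis
  moreover obtain C2 where "0 \<le> C2" "\<And>s. s \<in> S \<Longrightarrow> norm (grad B s) \<le> C2" using continuous_bounded_on[OF assms(2) continuous_grad[OF assms(1)]] by metis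
  ultimately show ?thesis by (intro that[of "max C1 C2"]) (auto simp: le_max_iff_disj)
qed

lemma l2n_fst_rect:
  assumes "smooth z" "p \<le> q"
  shows "l2n (rect L p q) (\<lambda>y. z (y $ 1)) = sqrt (q - p) * l2n {0<..<L} z"
proof -
  have c: "continuous_on UNIV (\<lambda>y::real^2. (z (y $ 1))\<^sup>2)"
    by (intro continuous_intros smooth_continuous smooth_nth_compose assms)
  have "(LINT y|leb (rect L p q). (z (y $ 1))\<^sup>2) = (q - p) * (LINT x|leb {0<..<L}. (z x)\<^sup>2)"
    using rect_Fubini(1)[OF c, of L p q] assms(2) by (simp add: measure_restrict_space)
  then show ?thesis by (simp add: l2n_def real_sqrt_mult)
qed

text \<open>The divergence theorem for the field with second component f r(x_1) B(x_2); the factor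
  \<open>r\<close> is constant along the lines of integration.\<close>

lemma rect_parts:
  assumes f: "smooth f" and z: "smooth r" and B: "smooth B" and pq: "p \<le> q"
  shows "(LINT y|leb (rect L p q). f y * (r (y $ 1) * grad B (y $ 2))) +
    (LINT y|leb (rect L p q). (grad f y \<bullet> e2) * (r (y $ 1) * B (y $ 2))) =
    (LINT x|leb {0<..<L}. (f (pt2 x q) * B q - f (pt2 x p) * B p) * r x)"
proof -
  let ?z = "\<lambda>y::real^2. r (y $ 1)" and ?B = "\<lambda>y::real^2. B (y $ 2)"
  note sz = smooth_nth_compose[OF z, of 1] and sB = smooth_nth_compose[OF B, of 2]
  have F: "smooth (\<lambda>y. f y * (?z y * ?B y))" by (intro smooth_mult f sz sB)
  have g: "grad (\<lambda>y. f y * (?z y * ?B y)) y \<bullet> e2 = f y * (r (y $ 1) * grad B (y $ 2)) + (grad f y \<bullet> e2) * (r (y $ 1) * B (y $ 2))" for y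
    by (simp add: grad_mult[OF f smooth_mult[OF sz sB]] grad_mult[OF sz sB] grad_nth_compose z B inner_add_left inner_axis_axis algebra_simps)
  have "(LINT y|leb (rect L p q). f y * (r (y $ 1) * grad B (y $ 2)) + (grad f y \<bullet> e2) * (r (y $ 1) * B (y $ 2))) =
      (LINT x|leb {0<..<L}. f (pt2 x q) * (r x * B q) - f (pt2 x p) * (r x * B p))"
    using rect_FTC[OF F pq, of L] by (simp add: g)
  also have "\<dots> = (LINT x|leb {0<..<L}. (f (pt2 x q) * B q - f (pt2 x p) * B p) * r x)"
    by (simp add: algebra_simps)
  finally show ?thesis
    by (subst Bochner_Integration.integral_add[symmetric])
       (intro L2_integrable L2_smooth smooth_mult smooth_grad smooth_nth_compose smooth_grad_real f z B rect_simps; simp)+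
qed

text \<open>The sign of the outward normal on the two sides of the rectangle.\<close>

definition side_sign :: "real \<Rightarrow> real \<Rightarrow> real" where "side_sign s0 l = (if s0 = 0 then -1 else 1)"

text \<open>A function \<open>h\<close> is the trace on the side \<open>x\<^sub>2 = s0\<close> as soon as it satisfies Green's formula;
  the bound on the error of the approximating traces is obtained by duality.\<close>

lemma has_trace_rectI:
  assumes l: "0 < l" and s0: "s0 = 0 \<or> s0 = l"
    and u: "L2 (rect L 0 l) u" and w: "is_weak_grad (rect L 0 l) u v" and h: "L2 {0<..<L} h"
    and B: "smooth B" "B 0 = (if s0 = 0 then 1 else 0)" "B l = (if s0 = 0 then 0 else 1)"
    and id: "\<And>q. test_function {0<..<L} q \<Longrightarrow>
      (LINT y|leb (rect L 0 l). u y * (q (y $ 1) * grad B (y $ 2))) +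
      (LINT y|leb (rect L 0 l). (v y \<bullet> e2) * (q (y $ 1) * B (y $ 2))) =
      side_sign s0 l * (LINT x|leb {0<..<L}. h x * q x)"
  shows "has_trace (rect L 0 l) (\<lambda>x. pt2 x s0) {0<..<L} u h"
proof -
  obtain us where us: "\<And>k. smooth (us k)" "L2_tendsto (rect L 0 l) us u" "L2_tendsto (rect L 0 l) (\<lambda>k. grad (us k)) v"
  proof (cases "0 < L")
    case True
    have "\<And>i. i \<in> Basis \<Longrightarrow> pt2 0 0 \<bullet> i < pt2 L l \<bullet> i"
      using True l by (auto simp: Basis_vec_def cart_eq_inner_axis[symmetric]) (metis exhaust_2 pt2_nth)
    from smooth_dense_box[OF this u [unfolded rect_box] w [unfolded rect_box]] that show ?thesis unfolding rect_box by metis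
  next
    \<comment> \<open>Here the rectangle is empty and every sequence converges.\<close>
    case False
    then have "rect L 0 l = {}" by (auto simp: rect_def)
    moreover have "grad (\<lambda>x::real^2. 0) = (\<lambda>x. 0)" by (rule ext) simp
    ultimately have "L2_tendsto (rect L 0 l) (\<lambda>k x. 0) u" "L2_tendsto (rect L 0 l) (\<lambda>k. grad (\<lambda>x. 0)) v"
      using u is_weak_grad_L2[OF w] by (simp_all add: L2_tendsto_def L2_def)
    then show ?thesis by (intro that[of "\<lambda>k x. 0"]) auto
  qed
  have H: "H1_tendsto (rect L 0 l) us u" by (rule H1_tendsto_smoothI[OF _ _ us]) auto
  obtain C where C: "0 \<le> C" "\<And>s. s \<in> {0<..<l} \<Longrightarrow> \<bar>B s\<bar> \<le> C" "\<And>s. s \<in> {0<..<l} \<Longrightarrow> \<bar>grad B s\<bar> \<le> C"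
    using test_function_real_bounded_grad[OF B(1), of "{0<..<l}"] by auto
  have su: "smooth (\<lambda>x. us k (pt2 x s0))" for k
  proof (rule smooth_compose[OF us(1)])
    fix b :: "real^2" assume "b \<in> Basis"
    have "pt2 x s0 \<bullet> b = x * b $ 1 + s0 * b $ 2" for x by (simp add: inner_vec_def sum_2)
    then show "smooth (\<lambda>x. pt2 x s0 \<bullet> b)" by (simp add: smooth_add smooth_mult)
  qed
  have L2us: "L2 {0<..<L} (\<lambda>x. us k (pt2 x s0))" for k by (rule L2_smooth[OF _ _ su]) auto
  let ?e = "\<lambda>k. l2n (rect L 0 l) (\<lambda>y. us k y - u y) + l2n (rect L 0 l) (\<lambda>y. grad (us k) y \<bullet> e2 - v y \<bullet> e2)"
  have L2v: "L2 (rect L 0 l) (\<lambda>y. v y \<bullet> e2)" by (rule L2_component[OF is_weak_grad_L2[OF w]])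
  have L2g: "L2 (rect L 0 l) (\<lambda>y. grad (us k) y \<bullet> e2)" for k by (rule L2_component[OF L2_tendstoD(1)[OF us(3)]])
  have bound: "l2n {0<..<L} (\<lambda>x. us k (pt2 x s0) - h x) \<le> C * sqrt l * ?e k" for k
  proof (rule L2_dual_bound[OF open_greaterThanLessThan L2_diff[OF L2us h]])
    show "0 \<le> C * sqrt l * ?e k" using C(1) l by (intro mult_nonneg_nonneg add_nonneg_nonneg) auto
    fix q assume t: "test_function {0<..<L} q"
    have z: "smooth q" using t by (rule test_function_smooth)
    have zL: "L2 {0<..<L} q" by (rule test_function_L2[OF t]) simp
    let ?zB' = "\<lambda>y::real^2. q (y $ 1) * grad B (y $ 2)" and ?zB = "\<lambda>y::real^2. q (y $ 1) * B (y $ 2)"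
    have s: "smooth ?zB'" "smooth ?zB" by (intro smooth_mult smooth_nth_compose z B smooth_grad_real)+
    note Ls = L2_smooth[OF rect_simps(2,3) s(1), of L 0 l] L2_smooth[OF rect_simps(2,3) s(2), of L 0 l]
    have zr: "L2 (rect L 0 l) (\<lambda>y. q (y $ 1))" by (intro L2_smooth smooth_nth_compose z) auto
    have n: "l2n (rect L 0 l) ?zB' \<le> C * l2n (rect L 0 l) (\<lambda>y. q (y $ 1))" "l2n (rect L 0 l) ?zB \<le> C * l2n (rect L 0 l) (\<lambda>y. q (y $ 1))"
      using C by (intro l2n_le_bound Ls zr AE_I2; simp add: rect_def abs_mult mult.commute[of C] mult_left_mono)+
    have zn: "l2n (rect L 0 l) (\<lambda>y. q (y $ 1)) = sqrt l * l2n {0<..<L} q" using l2n_fst_rect[OF z, of 0 l L] l by simp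
    have i: "integrable (leb (rect L 0 l)) (\<lambda>y. us k y * ?zB' y)" "integrable (leb (rect L 0 l)) (\<lambda>y. u y * ?zB' y)"
       "integrable (leb (rect L 0 l)) (\<lambda>y. (grad (us k) y \<bullet> e2) * ?zB y)" "integrable (leb (rect L 0 l)) (\<lambda>y. (v y \<bullet> e2) * ?zB y)"
      by (rule L2_integrable_mult[OF L2_tendstoD(1)[OF us(2)] Ls(1)], rule L2_integrable_mult[OF u Ls(1)],
          rule L2_integrable_mult[OF L2g Ls(2)], rule L2_integrable_mult[OF L2v Ls(2)])
    have j: "integrable (leb {0<..<L}) (\<lambda>x. us k (pt2 x s0) * q x)" "integrable (leb {0<..<L}) (\<lambda>x. h x * q x)"
      by (rule L2_integrable_mult[OF L2us zL], rule L2_integrable_mult[OF h zL])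
    have "(LINT y|leb (rect L 0 l). us k y * ?zB' y) + (LINT y|leb (rect L 0 l). (grad (us k) y \<bullet> e2) * ?zB y) =
        side_sign s0 l * (LINT x|leb {0<..<L}. us k (pt2 x s0) * q x)"
      using rect_parts[OF us(1) z B(1), of 0 l L k] l s0 B(2,3) by (auto simp: side_sign_def split: if_splits)
    \<comment> \<open>Green's formula for the smooth approximation minus the assumed formula for
      \<open>u\<close>: the error of the trace, paired with \<open>q\<close>, is expressed by errors
      in the interior only.\<close>
    with id[OF t] have eq: "side_sign s0 l * (LINT x|leb {0<..<L}. (us k (pt2 x s0) - h x) * q x) =
        (LINT y|leb (rect L 0 l). (us k y - u y) * ?zB' y) + (LINT y|leb (rect L 0 l). (grad (us k) y \<bullet> e2 - v y \<bullet> e2) * ?zB y)"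
      using i j by (simp add: left_diff_distrib right_diff_distrib)
    have "\<bar>LINT x|leb {0<..<L}. (us k (pt2 x s0) - h x) * q x\<bar> = \<bar>side_sign s0 l * (LINT x|leb {0<..<L}. (us k (pt2 x s0) - h x) * q x)\<bar>"
      by (simp add: side_sign_def abs_mult)
    also have "\<dots> \<le> \<bar>LINT y|leb (rect L 0 l). (us k y - u y) * ?zB' y\<bar> + \<bar>LINT y|leb (rect L 0 l). (grad (us k) y \<bullet> e2 - v y \<bullet> e2) * ?zB y\<bar>"
      unfolding eq by (rule abs_triangle_ineq)
    also have "\<dots> \<le> l2n (rect L 0 l) (\<lambda>y. us k y - u y) * l2n (rect L 0 l) ?zB' + l2n (rect L 0 l) (\<lambda>y. grad (us k) y \<bullet> e2 - v y \<bullet> e2) * l2n (rect L 0 l) ?zB"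
      by (intro add_mono L2_Cauchy_Schwarz_real L2_diff L2_tendstoD(1)[OF us(2)] u L2g L2v Ls)
    also have "\<dots> \<le> l2n (rect L 0 l) (\<lambda>y. us k y - u y) * (C * (sqrt l * l2n {0<..<L} q)) + l2n (rect L 0 l) (\<lambda>y. grad (us k) y \<bullet> e2 - v y \<bullet> e2) * (C * (sqrt l * l2n {0<..<L} q))"
      using n unfolding zn by (intro add_mono mult_left_mono) auto
    finally show "\<bar>LINT x|leb {0<..<L}. (us k (pt2 x s0) - h x) * q x\<bar> \<le> C * sqrt l * ?e k * l2n {0<..<L} q"
      by (simp add: algebra_simps)
  qed
  have "(\<lambda>k. C * sqrt l * ?e k) \<longlonglongrightarrow> C * sqrt l * (0 + 0)"
    by (intro tendsto_mult_left tendsto_add L2_tendstoD(3)[OF us(2)] L2_tendstoD(3)[OF L2_tendsto_component[OF us(3)]])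
  then have "L2_tendsto {0<..<L} (\<lambda>k x. us k (pt2 x s0)) h"
    by (intro L2_tendsto_squeeze[OF L2us h bound]) simp
  then show ?thesis unfolding has_trace_def using us(1) H by (auto simp: o_def)
qed

section \<open>Cylindrical functions\<close>

text \<open>The plate in reference thickness 1; for l = L it is \<open>E_ref\<close>, and the third
  coordinate runs across the plate.\<close>

definition slab :: "real \<Rightarrow> real \<Rightarrow> (real^3) set" where
  "slab L l = {x. x $ 1 \<in> {0<..<L} \<and> x $ 2 \<in> {0<..<l} \<and> x $ 3 \<in> {-1/2<..<1/2}}"

lemma slab_box: "slab L l = box (vector [0, 0, -1/2]) (vector [L, l, 1/2])"
  by (auto simp: slab_def mem_box_cart forall_3)

lemma slab_simps [simp]: "open (slab L l)" "bounded (slab L l)" "slab L l \<in> sets lebesgue" "slab L l \<in> lmeasurable"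
  unfolding slab_box by (auto intro: bounded_set_imp_lmeasurable)

lemma slab_c3l: "slab L l = c3l ` (rect L 0 l \<times> {-1/2<..<1/2})"
proof -
  have "x \<in> c3l ` (rect L 0 l \<times> {-1/2<..<1/2})" if "x \<in> slab L l" for x
    using that by (intro image_eqI[of _ _ "(pt2 (x $ 1) (x $ 2), x $ 3)"]) (auto simp: slab_def rect_def vec_eq_iff forall_3)
  then show ?thesis by (auto simp: slab_def rect_def)
qed

abbreviation proj12 :: "real^3 \<Rightarrow> real^2" where "proj12 x \<equiv> pt2 (x $ 1) (x $ 2)"

lemma pt2_eta: "pt2 (y $ 1) (y $ 2) = y" by (simp add: vec_eq_iff forall_2)

lemma rect_borel: "rect L p q \<in> sets borel" by (simp add: rect_box)

lemma integrable_continuous_interval: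
  "continuous_on UNIV B \<Longrightarrow> integrable (leb {a<..<b::real}) (B :: real \<Rightarrow> real)"
  by (intro L2_integrable L2_continuous bounded_set_imp_lmeasurable) auto

lemma slab_product:
  fixes f :: "real^2 \<Rightarrow> real"
  assumes f: "integrable (leb (rect L 0 l)) f" and b: "continuous_on UNIV B"
  shows "integrable (leb (slab L l)) (\<lambda>x. f (proj12 x) * B (x $ 3))"
    "(LINT x|leb (slab L l). f (proj12 x) * B (x $ 3)) =
      (LINT y|leb (rect L 0 l). f y) * (LINT t|leb {-1/2<..<1/2}. B t)"
proof -
  have S: "rect L 0 l \<times> {-1/2<..<1/2::real} \<in> sets lebesgue"
    using sets_lebesgue_Times[OF rect_borel, of "{-1/2<..<1/2::real}" L 0 l] by auto
  note P = lebesgue_product_function[OF f integrable_continuous_interval[OF b, of "-1/2" "1/2"] rect_borel]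
  show "integrable (leb (slab L l)) (\<lambda>x. f (proj12 x) * B (x $ 3))"
    unfolding slab_c3l scales_integrable[OF scales_coords(3) S] using P(1) by (simp add: pt2_eta)
  show "(LINT x|leb (slab L l). f (proj12 x) * B (x $ 3)) =
      (LINT y|leb (rect L 0 l). f y) * (LINT t|leb {-1/2<..<1/2}. B t)"
    unfolding slab_c3l scales_LINT[OF scales_coords(3) S] using P(2) by (simp add: pt2_eta)
qed

lemma slab_cylinder:
  fixes f :: "real^2 \<Rightarrow> real"
  assumes "integrable (leb (rect L 0 l)) f"
  shows "integrable (leb (slab L l)) (\<lambda>x. f (proj12 x))"
    "(LINT x|leb (slab L l). f (proj12 x)) = (LINT y|leb (rect L 0 l). f y)"
  using slab_product[OF assms, of "\<lambda>_. 1"] by (simp_all add: measure_restrict_space)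

lemma L2_cylinder:
  fixes f :: "real^2 \<Rightarrow> real"
  assumes f: "L2 (rect L 0 l) f"
  shows "L2 (slab L l) (\<lambda>x. f (proj12 x))" "l2n (slab L l) (\<lambda>x. f (proj12 x)) = l2n (rect L 0 l) f"
proof -
  have 1: "integrable (leb (rect L 0 l)) f" by (rule L2_integrable[OF rect_simps(4) f])
  have 2: "integrable (leb (rect L 0 l)) (\<lambda>x. (f x)\<^sup>2)" using L2_int[OF f] by simp
  show "L2 (slab L l) (\<lambda>x. f (proj12 x))"
    using slab_cylinder(1)[OF 1] slab_cylinder(1)[OF 2] by (auto simp: L2_def intro: borel_measurable_integrable)
  show "l2n (slab L l) (\<lambda>x. f (proj12 x)) = l2n (rect L 0 l) f"
    using slab_cylinder(2)[OF 2] by (simp add: l2n_def)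
qed

lemma L2_tendsto_cylinder:
  fixes f :: "real^2 \<Rightarrow> real"
  assumes "L2_tendsto (rect L 0 l) fs f"
  shows "L2_tendsto (slab L l) (\<lambda>k x. fs k (proj12 x)) (\<lambda>x. f (proj12 x))"
proof -
  note * = L2_tendstoD[OF assms]
  show ?thesis unfolding L2_tendsto_iff
    using *(3) L2_cylinder(1)[OF *(1)] L2_cylinder(1)[OF *(2)] L2_cylinder(2)[OF L2_diff[OF *(1,2)]] by simp
qed

lemma linear_proj12: "linear proj12"
  by (rule linearI) (auto simp: vec_eq_iff forall_2)

lemma smooth_cylinder: "smooth f \<Longrightarrow> smooth (\<lambda>x. f (proj12 x))"
  using smooth_affine[OF _ linear_proj12, of f 0] by simp

lemma grad_cylinder:
  assumes "smooth f"
  shows "grad (\<lambda>x. f (proj12 x)) x = vector [grad f (proj12 x) $ 1, grad f (proj12 x) $ 2, 0]"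
proof -
  have a: "grad (\<lambda>x. f (proj12 x)) x \<bullet> v = grad f (proj12 x) \<bullet> proj12 v" for v
    using grad_affine[OF assms linear_proj12, of 0 x v] by simp
  have "grad (\<lambda>x. f (proj12 x)) x $ i = grad f (proj12 x) \<bullet> proj12 (axis i 1)" for i
    unfolding cart_eq_inner_axis[of "grad (\<lambda>x. f (proj12 x)) x"] by (rule a)
  then show ?thesis unfolding vec_eq_iff forall_3 by (simp add: inner_vec_def sum_2 axis_def)
qed

text \<open>Cylindrical extension commutes with gradients of smooth functions, so the claim follows
  from density on the rectangle and closedness, without slicing a test function of three
  variables.\<close>

lemma weak_grad_cylinder:
  assumes L: "0 < L" "0 < l" and u: "L2 (rect L 0 l) u" and w: "is_weak_grad (rect L 0 l) u v"
  shows "is_weak_grad (slab L l) (\<lambda>x. u (proj12 x)) (\<lambda>x. vector [v (proj12 x) $ 1, v (proj12 x) $ 2, 0])"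
proof -
  have "\<And>i. i \<in> Basis \<Longrightarrow> pt2 0 0 \<bullet> i < pt2 L l \<bullet> i"
    using L by (auto simp: Basis_vec_def cart_eq_inner_axis[symmetric]) (metis exhaust_2 pt2_nth)
  then obtain us where us: "\<And>k. smooth (us k)" "L2_tendsto (rect L 0 l) us u" "L2_tendsto (rect L 0 l) (\<lambda>k. grad (us k)) v"
    using smooth_dense_box[of "pt2 0 0" "pt2 L l" u v] u w unfolding rect_box by metis
  show ?thesis
  proof (rule weak_grad_closed[OF slab_simps(3) L2_tendsto_cylinder[OF us(2)]])
    show "is_weak_grad (slab L l) (\<lambda>x. us k (proj12 x)) (\<lambda>x. vector [grad (us k) (proj12 x) $ 1, grad (us k) (proj12 x) $ 2, 0])" for k
      using smooth_weak_grad[OF slab_simps(2,3) smooth_cylinder[OF us(1)], of L l k]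
      by (simp add: ext[OF grad_cylinder[OF us(1)]])
    show "L2_tendsto (slab L l) (\<lambda>k x. vector [grad (us k) (proj12 x) $ 1, grad (us k) (proj12 x) $ 2, 0] :: real^3)
        (\<lambda>x. vector [v (proj12 x) $ 1, v (proj12 x) $ 2, 0])"
    proof (rule L2_tendsto_componentwise)
      fix b :: "real^3" assume "b \<in> Basis"
      have e: "(vector [p, q, 0] :: real^3) \<bullet> b = b $ 1 *\<^sub>R p + b $ 2 *\<^sub>R q" for p q
        by (simp add: inner_vec_def sum_3)
      show "L2_tendsto (slab L l) (\<lambda>k x. (vector [grad (us k) (proj12 x) $ 1, grad (us k) (proj12 x) $ 2, 0] :: real^3) \<bullet> b)
        (\<lambda>x. (vector [v (proj12 x) $ 1, v (proj12 x) $ 2, 0] :: real^3) \<bullet> b)"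
        unfolding e
        by (intro L2_tendsto_add L2_tendsto_scaleR L2_tendsto_cylinder[of L l "\<lambda>k y. grad (us k) y $ j" "\<lambda>y. v y $ j" for j] L2_tendsto_vec_nth us)
    qed
  qed
qed

definition stretch :: "real \<Rightarrow> real^2 \<Rightarrow> real^2" where "stretch c y = pt2 (y $ 1) (c * y $ 2)"

lemma linear_stretch: "linear (stretch c)"
  by (rule linearI) (auto simp: stretch_def vec_eq_iff forall_2 algebra_simps)

lemma det_stretch: "det (matrix (stretch c)) = c"
  by (simp add: det_2 matrix_def axis_def stretch_def)

lemma adjoint_stretch: "adjoint (stretch c) = stretch c"
  by (rule adjoint_unique) (simp add: stretch_def inner_vec_def sum_2)

lemma scales_stretch: "c \<noteq> 0 \<Longrightarrow> scales \<bar>c\<bar> (stretch c)"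
  using scales_affine[OF linear_stretch, of c 0] by (simp add: det_stretch)

lemma stretch_rect:
  assumes "0 < c" shows "stretch c ` rect L 0 l = rect L 0 (c * l)"
proof -
  have "y \<in> stretch c ` rect L 0 l" if "y \<in> rect L 0 (c * l)" for y
    using that assms by (intro image_eqI[of _ _ "pt2 (y $ 1) (y $ 2 / c)"]) (auto simp: rect_def vec_eq_iff forall_2 field_simps stretch_def)
  then show ?thesis using assms by (auto simp: rect_def stretch_def)
qed

lemma weak_grad_stretch:
  assumes "0 < c" "L2 (rect L 0 (c * l)) u" "is_weak_grad (rect L 0 (c * l)) u v"
  shows "is_weak_grad (rect L 0 l) (\<lambda>y. u (stretch c y)) (\<lambda>y. stretch c (v (stretch c y)))"
proof -
  have d: "det (matrix (stretch c)) \<noteq> 0" using assms(1) by (simp add: det_stretch)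
  have T: "stretch c = (\<lambda>x. stretch c x + 0)" by simp
  show ?thesis
    using weak_grad_affine[OF linear_stretch d rect_simps(3) T, of L 0 l u v] assms
    unfolding stretch_rect[OF assms(1)] adjoint_stretch by blast
qed

section \<open>Geometry of the thin domain\<close>

lemma pt_inner: "pt a y \<bullet> pt b z = a * b + y \<bullet> z"
  by (simp add: inner_vec_def sum_3 sum_2)

lemma inner_pt: "x \<bullet> pt b z = x $ 1 * b + x $ 2 * z $ 1 + x $ 3 * z $ 2"
  by (simp add: inner_vec_def sum_3)

lemma inner_2: "y \<bullet> z = y $ 1 * z $ 1 + y $ 2 * z $ 2" for y z :: "real^2"
  by (simp add: inner_vec_def sum_2)

lemma inner_3: "y \<bullet> z = y $ 1 * z $ 1 + y $ 2 * z $ 2 + y $ 3 * z $ 3" for y z :: "real^3"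
  by (simp add: inner_vec_def sum_3)

text \<open>Coordinates in the orthonormal frame of plate \<open>i\<close>: \<open>sco\<close> is
  the position s along the plate, \<open>tco\<close> the position t across it.\<close>

definition sco :: "hypergraph \<Rightarrow> nat \<Rightarrow> real^3 \<Rightarrow> real" where "sco G i x = x \<bullet> pt 0 (dir G i)"
definition tco :: "hypergraph \<Rightarrow> nat \<Rightarrow> real^3 \<Rightarrow> real" where "tco G i x = x \<bullet> pt 0 (nrm G i)"

text \<open>Linear part of the inverse of \<open>Phi_E\<close>, written with the frame of the plate
  instead of the rotation matrix.\<close>

definition plin :: "hypergraph \<Rightarrow> nat \<Rightarrow> real \<Rightarrow> real \<Rightarrow> real^3 \<Rightarrow> real^3" where
  "plin G i \<rho> \<delta> y = pt (y $ 1) ((\<rho> * y $ 2) *\<^sub>R dir G i + (\<delta> * y $ 3) *\<^sub>R nrm G i)"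

text \<open>Ratio of the length of the thin plate to that of the reference plate.\<close>

definition slen :: "hypergraph \<Rightarrow> real \<Rightarrow> nat \<Rightarrow> real" where
  "slen G eps i = (width G i - alpha G * eps) / len G"

definition pmap :: "hypergraph \<Rightarrow> real \<Rightarrow> nat \<Rightarrow> real^3 \<Rightarrow> real^3" where
  "pmap G eps i y = plin G i (slen G eps i) (thick G i * eps) y + pt 0 ((alpha G * eps) *\<^sub>R dir G i)"

definition nmap :: "real \<Rightarrow> real^3 \<Rightarrow> real^3" where "nmap eps y = vector [y $ 1, eps * y $ 2, eps * y $ 3]"

lemma nmap_nth [simp]: "nmap eps y $ 1 = y $ 1" "nmap eps y $ 2 = eps * y $ 2" "nmap eps y $ 3 = eps * y $ 3"
  by (simp_all add: nmap_def)

lemma linear_nmap: "linear (nmap eps)"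
  by (rule linearI) (auto simp: vec_eq_iff forall_3 algebra_simps)

lemma det_nmap: "det (matrix (nmap eps)) = eps\<^sup>2"
  by (simp add: det_3 matrix_def axis_def power2_eq_square)

lemma adjoint_nmap: "adjoint (nmap eps) = nmap eps"
  by (rule adjoint_unique) (simp add: inner_3)

lemma inv_Phi_N: "eps \<noteq> 0 \<Longrightarrow> inv (Phi_N eps) = nmap eps"
  by (rule inv_unique_comp) (auto simp: fun_eq_iff vec_eq_iff forall_3 Phi_N_def)

lemma nmap_pt: "nmap eps (pt a y) = pt a (eps *\<^sub>R y)" by (simp add: vec_eq_iff forall_3)

lemma scales_nmap: "eps \<noteq> 0 \<Longrightarrow> scales (eps\<^sup>2) (nmap eps)"
  using scales_affine[OF linear_nmap, of eps 0] by (simp add: det_nmap)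

lemma linear_plin: "linear (plin G i f d)"
  by (rule linearI) (auto simp: plin_def vec_eq_iff forall_3 algebra_simps)

lemma E_ref_slab: "E_ref G = slab (len G) (len G)" by (simp add: E_ref_def slab_def)

lemma E_dom_rect: "E_dom G i = rect (len G) 0 (width G i)" by (simp add: E_dom_def rect_def)

lemma linear_sco: "linear (sco G i)" "linear (tco G i)"
  unfolding sco_def[abs_def] tco_def[abs_def]
  by (simp_all add: linear_conv_bounded_linear bounded_linear_inner_left)

lemma continuous_on_sco: "continuous_on S (sco G i)" "continuous_on S (tco G i)"
  unfolding sco_def[abs_def] tco_def[abs_def] by (intro continuous_intros)+

locale thin_geometry =
  fixes G :: hypergraph
  assumes geometry: "hypergraph_geometry G"
begin

abbreviation "idx \<equiv> {1..num G}"
abbreviation "I0 \<equiv> {0<..<len G}"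
abbreviation "Er \<equiv> E_ref G"
abbreviation "Nr \<equiv> N_ref G"
abbreviation "Dm \<equiv> E_dom G"
abbreviation "pd i y \<equiv> pt2 ((y::real^3) $ 1) (width G i / len G * y $ 2)"

lemma G_pos: "0 < len G" "0 < alpha G" "1 \<le> num G"
  using geometry by (auto simp: hypergraph_geometry_def)

lemma num_mem: "num G \<in> idx" using G_pos by simp

lemma G_i:
  assumes "i \<in> idx"
  shows "0 < width G i" "0 < thick G i" "norm (dir G i) = 1" "norm (nrm G i) = 1" "dir G i \<bullet> nrm G i = 0"
  using geometry assms by (auto simp: hypergraph_geometry_def)

lemma rot_i:
  assumes "i \<in> idx"
  shows "rot G i *v axis 1 1 = axis 1 1" "rot G i *v pt 0 (dir G i) = axis 2 1" "rot G i *v pt 0 (nrm G i) = axis 3 1"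
  using geometry assms by (auto simp: hypergraph_geometry_def)

lemma inner_i:
  assumes "i \<in> idx"
  shows "dir G i \<bullet> dir G i = 1" "nrm G i \<bullet> nrm G i = 1" "dir G i \<bullet> nrm G i = 0" "nrm G i \<bullet> dir G i = 0"
  using G_i[OF assms] by (auto simp: norm_eq_1 inner_commute)

lemma inner_sq:
  assumes "i \<in> idx"
  shows "dir G i $ 1 * dir G i $ 1 + dir G i $ 2 * dir G i $ 2 = 1" "nrm G i $ 1 * nrm G i $ 1 + nrm G i $ 2 * nrm G i $ 2 = 1"
    "dir G i $ 1 * nrm G i $ 1 + dir G i $ 2 * nrm G i $ 2 = 0"
  using inner_i[OF assms] by (auto simp: inner_2)

text \<open>Determinant of the frame formed by \<open>dir\<close> and \<open>nrm\<close>; its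
  absolute value 1 enters the Jacobians of the plate maps.\<close>

definition "orient i = dir G i $ 1 * nrm G i $ 2 - dir G i $ 2 * nrm G i $ 1"

lemma orient:
  assumes "i \<in> idx"
  shows "nrm G i $ 1 = - orient i * dir G i $ 2" "nrm G i $ 2 = orient i * dir G i $ 1" "orient i * orient i = 1" "\<bar>orient i\<bar> = 1"
proof -
  note s = inner_sq[OF assms]
  show 1: "nrm G i $ 1 = - orient i * dir G i $ 2" unfolding orient_def using s(1,3) by algebra
  show 2: "nrm G i $ 2 = orient i * dir G i $ 1" unfolding orient_def using s(1,3) by algebra
  show 3: "orient i * orient i = 1" using s(1,2) 1 2 by algebra
  then show "\<bar>orient i\<bar> = 1" by (metis abs_mult_self_eq abs_one abs_square_eq_1 power2_eq_square)
qed

lemma decompose_2: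
  assumes "i \<in> idx"
  shows "y = (y \<bullet> dir G i) *\<^sub>R dir G i + (y \<bullet> nrm G i) *\<^sub>R nrm G i"
proof -
  note s = inner_sq(1)[OF assms] orient[OF assms]
  show ?thesis unfolding vec_eq_iff forall_2
  proof
    show "y $ 1 = ((y \<bullet> dir G i) *\<^sub>R dir G i + (y \<bullet> nrm G i) *\<^sub>R nrm G i) $ 1"
      unfolding inner_2 vector_add_component vector_scaleR_component real_scaleR_def s(2,3) using s(1,4) by algebra
    show "y $ 2 = ((y \<bullet> dir G i) *\<^sub>R dir G i + (y \<bullet> nrm G i) *\<^sub>R nrm G i) $ 2"
      unfolding inner_2 vector_add_component vector_scaleR_component real_scaleR_def s(2,3) using s(1,4) by algebra
  qed
qed

lemma sco_pt: "sco G i (pt a y) = y \<bullet> dir G i" "tco G i (pt a y) = y \<bullet> nrm G i"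
  by (simp_all add: sco_def tco_def pt_inner)

lemma decompose:
  assumes "i \<in> idx"
  shows "x = pt (x $ 1) (sco G i x *\<^sub>R dir G i + tco G i x *\<^sub>R nrm G i)"
proof -
  have x: "x = pt (x $ 1) (vector [x $ 2, x $ 3])" by (simp add: vec_eq_iff forall_3)
  show ?thesis by (subst x, subst (2) x, subst (4) x) (simp add: sco_pt decompose_2[OF assms, symmetric], subst x, simp)
qed

lemma sco_plate:
  assumes "i \<in> idx"
  shows "sco G i (pt a (s *\<^sub>R dir G i + t *\<^sub>R nrm G i)) = s" "tco G i (pt a (s *\<^sub>R dir G i + t *\<^sub>R nrm G i)) = t"
  using inner_i[OF assms] by (simp_all add: sco_pt inner_add_left)

lemma pmap_eq:
  "pmap G eps i y = pt (y $ 1) ((alpha G * eps + slen G eps i * y $ 2) *\<^sub>R dir G i + (thick G i * eps * y $ 3) *\<^sub>R nrm G i)"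
  by (simp add: pmap_def plin_def vec_eq_iff forall_3 algebra_simps)

lemma pmap_coords:
  assumes "i \<in> idx"
  shows "pmap G eps i y $ 1 = y $ 1" "sco G i (pmap G eps i y) = alpha G * eps + slen G eps i * y $ 2"
    "tco G i (pmap G eps i y) = thick G i * eps * y $ 3"
  using sco_plate[OF assms] by (simp_all add: pmap_eq)

lemma det_plin:
  assumes "i \<in> idx" shows "det (matrix (plin G i f d)) = f * d * orient i"
  by (simp add: det_3 matrix_def axis_def plin_def orient_def algebra_simps)

text \<open>By the chain rule the transformed gradient is this adjoint applied to the original one,
  which shows how its three components scale.\<close>

lemma adjoint_plin: "adjoint (plin G i f d) v = vector [v $ 1, f * sco G i v, d * tco G i v]"
proof -
  have "adjoint (plin G i f d) = (\<lambda>v. vector [v $ 1, f * sco G i v, d * tco G i v])"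
    by (rule adjoint_unique) (simp add: inner_3 plin_def sco_def tco_def algebra_simps)
  then show ?thesis by simp
qed

lemma diag_mult: "(diag v *v w) $ j = v $ j * w $ j"
  by (simp add: diag_def matrix_vector_mult_def if_distrib[where f = "\<lambda>x. x * _"] sum.delta cong: if_cong)

lemma rot_plate:
  assumes "i \<in> idx"
  shows "rot G i *v pt a (s *\<^sub>R dir G i + t *\<^sub>R nrm G i) = vector [a, s, t]"
proof -
  have eq: "pt a (s *\<^sub>R dir G i + t *\<^sub>R nrm G i) = a *\<^sub>R axis 1 1 + s *\<^sub>R pt 0 (dir G i) + t *\<^sub>R pt 0 (nrm G i)"
    by (simp add: vec_eq_iff forall_3 axis_def)
  show ?thesis
    unfolding eq matrix_vector_right_distrib matrix_vector_mult_scaleR rot_i[OF assms]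
    by (simp add: vec_eq_iff forall_3 axis_def)
qed

lemma rot_chart:
  assumes "i \<in> idx" shows "(rot G i *v chart G i y) $ 2 = y $ 2"
  using rot_plate[OF assms, of "y $ 1" "y $ 2" 0] by (simp add: chart_def)

end

locale thin_domain = thin_geometry +
  fixes eps :: real
  assumes adm: "admissible_eps G eps"
begin

abbreviation "pm \<equiv> pmap G eps"
abbreviation "nm \<equiv> nmap eps"
abbreviation "sl \<equiv> slen G eps"
abbreviation "Et \<equiv> E_thin G eps"
abbreviation "Nt \<equiv> N_thin G eps"

lemma eps_pos: "0 < eps" using adm by (simp add: admissible_eps_def)

lemma slen_pos: "i \<in> idx \<Longrightarrow> 0 < sl i"
  using adm G_pos by (simp add: admissible_eps_def slen_def)

text \<open>In frame coordinates, reached through \<open>decompose\<close>, the map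
  \<open>Phi_E\<close> is diagonal up to a shift, and its inverse can be checked directly.\<close>

lemma inv_Phi_E:
  assumes i: "i \<in> idx" shows "inv (Phi_E G eps i) = pm i"
proof -
  have w: "width G i - alpha G * eps > 0" using adm i by (simp add: admissible_eps_def)
  have d: "thick G i * eps > 0" using G_i[OF i] eps_pos by simp
  note L = G_pos(1)
  have 1: "Phi_E G eps i (pt a (s *\<^sub>R dir G i + t *\<^sub>R nrm G i)) =
      vector [a, len G / (width G i - alpha G * eps) * (s - alpha G * eps), t / (thick G i * eps)]" for a s t
    unfolding Phi_E_def rot_plate[OF i] by (simp add: vec_eq_iff forall_3 diag_mult diff_divide_distrib right_diff_distrib mult.assoc)
  have a: "Phi_E G eps i (pm i y) = y" for y
    unfolding pmap_eq 1 using w G_i(2)[OF i] eps_pos L by (simp add: vec_eq_iff forall_3 slen_def)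
  have b: "pm i (Phi_E G eps i x) = x" for x
  proof -
    obtain a s t where x: "x = pt a (s *\<^sub>R dir G i + t *\<^sub>R nrm G i)" using decompose[OF i, of x] by blast
    show ?thesis unfolding x 1 pmap_eq using w G_i(2)[OF i] eps_pos L by (simp add: slen_def)
  qed
  show ?thesis by (rule inv_unique_comp) (simp_all add: fun_eq_iff a b)
qed

lemma scales_pmap:
  assumes i: "i \<in> idx" shows "scales (sl i * (thick G i * eps)) (pm i)"
proof -
  have "det (matrix (plin G i (sl i) (thick G i * eps))) \<noteq> 0"
    using slen_pos[OF i] eps_pos G_i[OF i] orient(4)[OF i] by (auto simp: det_plin[OF i])
  moreover have "\<bar>det (matrix (plin G i (sl i) (thick G i * eps)))\<bar> = sl i * (thick G i * eps)"
    using slen_pos[OF i] eps_pos G_i[OF i] orient(4)[OF i] by (simp add: det_plin[OF i] abs_mult)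
  ultimately show ?thesis
    using scales_affine[OF linear_plin, of G i "sl i" "thick G i * eps" "pt 0 ((alpha G * eps) *\<^sub>R dir G i)"]
    by (simp add: pmap_def[abs_def])
qed

lemma E_thin_iff:
  assumes i: "i \<in> idx"
  shows "x \<in> Et i \<longleftrightarrow> x $ 1 \<in> I0 \<and> sco G i x \<in> {alpha G * eps<..<width G i} \<and> \<bar>tco G i x\<bar> < thick G i * eps / 2"
proof
  assume "x \<in> Et i"
  then show "x $ 1 \<in> I0 \<and> sco G i x \<in> {alpha G * eps<..<width G i} \<and> \<bar>tco G i x\<bar> < thick G i * eps / 2"
    by (auto simp: E_thin_def sco_plate[OF i])
next
  assume *: "x $ 1 \<in> I0 \<and> sco G i x \<in> {alpha G * eps<..<width G i} \<and> \<bar>tco G i x\<bar> < thick G i * eps / 2"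
  have "x = pt (x $ 1) (sco G i x *\<^sub>R dir G i + tco G i x *\<^sub>R nrm G i)" by (rule decompose[OF i])
  with * show "x \<in> Et i" unfolding E_thin_def by blast
qed

lemma pmap_E_ref:
  assumes i: "i \<in> idx" shows "pm i ` Er = Et i"
proof -
  have d: "thick G i * eps > 0" using G_i[OF i] eps_pos by simp
  have iff: "pm i y \<in> Et i \<longleftrightarrow> y \<in> Er" for y
  proof -
    have "sl i * y $ 2 > 0 \<longleftrightarrow> y $ 2 > 0" using slen_pos[OF i] by (simp add: zero_less_mult_iff)
    moreover have "alpha G * eps + sl i * y $ 2 < width G i \<longleftrightarrow> sl i * y $ 2 < sl i * len G"
    proof -
      have e: "width G i = alpha G * eps + sl i * len G" using G_pos by (simp add: slen_def)
      show ?thesis by (subst e) simp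
    qed
    moreover have "\<bar>thick G i * eps * y $ 3\<bar> < thick G i * eps / 2 \<longleftrightarrow> \<bar>y $ 3\<bar> < 1/2"
      using G_i(2)[OF i] eps_pos by (simp add: abs_mult)
    ultimately show ?thesis
      using slen_pos[OF i] unfolding E_thin_iff[OF i] pmap_coords[OF i] E_ref_def
      by (auto simp: abs_less_iff)
  qed
  have "surj (pm i)" using scales_pmap[OF i] by (simp add: scales_def bij_is_surj)
  then show ?thesis using iff by (auto simp: image_iff) (metis surjD)
qed

lemma N_ref_eq: "Nr = N_thin G 1"
  using N_thin_eq[OF geometry, of 1] by (simp add: N_ref_def)

lemma nmap_N_ref: "nm ` Nr = Nt"
  unfolding N_thin_eq[OF geometry eps_pos] N_ref_def by (force simp: nmap_pt)

lemma open_thin: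
  "i \<in> idx \<Longrightarrow> open (Et i)" "open Nt" "open Nr" "open Er"
proof -
  assume i: "i \<in> idx"
  have "Et i = {x. 0 < x $ 1} \<inter> {x. x $ 1 < len G} \<inter> {x. alpha G * eps < sco G i x} \<inter> {x. sco G i x < width G i} \<inter> {x. \<bar>tco G i x\<bar> < thick G i * eps / 2}"
    by (auto simp: E_thin_iff[OF i])
  then show "open (Et i)"
    by (simp only:) (intro open_Int open_Collect_less continuous_on_sco continuous_intros)
qed (simp_all add: N_ref_eq N_thin_def E_ref_slab)

lemma compact_omega: "compact (convex hull ({0} \<union> (\<Union>i\<in>idx. {alpha G *\<^sub>R dir G i + t *\<^sub>R nrm G i |t. \<bar>t\<bar> \<le> thick G i / 2})))"
proof -
  have "{alpha G *\<^sub>R dir G i + t *\<^sub>R nrm G i |t. \<bar>t\<bar> \<le> thick G i / 2} = (\<lambda>t. alpha G *\<^sub>R dir G i + t *\<^sub>R nrm G i) ` {- (thick G i / 2)..thick G i / 2}" for i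
  proof -
    have "{t. \<bar>t\<bar> \<le> thick G i / 2} = {- (thick G i / 2)..thick G i / 2}" by (auto simp: abs_le_iff)
    then show ?thesis by blast
  qed
  moreover have "compact ((\<lambda>t. alpha G *\<^sub>R dir G i + t *\<^sub>R nrm G i) ` {- (thick G i / 2)..thick G i / 2})" for i
    by (intro compact_continuous_image continuous_intros) auto
  ultimately show ?thesis by (intro compact_convex_hull compact_Un compact_UN) auto
qed

lemma omega_bounded: "bounded (omega G)" "open (omega G)"
  using compact_imp_bounded[OF compact_omega] interior_subset bounded_subset unfolding omega_def by (blast, simp)

lemma bounded_ref: "bounded Nr" "bounded Er"
proof -
  have "Nr = (\<lambda>(a, y). pt a y) ` (I0 \<times> omega G)" unfolding N_ref_def by force
  moreover have "bounded (I0 \<times> omega G)" using omega_bounded by (simp add: bounded_Times)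
  ultimately show "bounded Nr"
    using bounded_linear_image[OF _ linear_pt [unfolded linear_conv_bounded_linear]] by simp
qed (simp add: E_ref_slab)

lemma bounded_thin: "i \<in> idx \<Longrightarrow> bounded (Et i)" "bounded Nt"
proof -
  show "bounded Nt"
    unfolding nmap_N_ref[symmetric] by (rule bounded_linear_image[OF bounded_ref(1) linear_nmap [unfolded linear_conv_bounded_linear]])
  assume i: "i \<in> idx"
  have "pm i ` Er = (+) (pt 0 ((alpha G * eps) *\<^sub>R dir G i)) ` (plin G i (sl i) (thick G i * eps) ` Er)"
    by (auto simp: pmap_def image_image add.commute)
  moreover have "bounded (plin G i (sl i) (thick G i * eps) ` Er)"
    by (rule bounded_linear_image[OF bounded_ref(2) linear_plin [unfolded linear_conv_bounded_linear]])
  ultimately show "bounded (Et i)"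
    unfolding pmap_E_ref[OF i, symmetric] by (metis bounded_translation)
qed

lemma sets_ref [simp]: "Nr \<in> sets lebesgue" "Er \<in> sets lebesgue" "Nt \<in> sets lebesgue" "Nr \<in> lmeasurable" "Er \<in> lmeasurable"
  using open_thin bounded_ref by (auto intro: bounded_set_imp_lmeasurable)

lemma sets_E_thin: "i \<in> idx \<Longrightarrow> Et i \<in> sets lebesgue"
  using open_thin(1) by simp

lemma negligible_S_thin: assumes i: "i \<in> idx" shows "negligible (S_thin G eps i)"
proof (rule negligible_subset)
  have "pt 0 (dir G i) \<bullet> pt 0 (dir G i) = 1" using inner_i[OF i] by (simp add: pt_inner)
  then have "pt 0 (dir G i) \<noteq> 0" by auto
  then show "negligible {x. pt 0 (dir G i) \<bullet> x = alpha G * eps}" by (intro negligible_hyperplane) simp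
  show "S_thin G eps i \<subseteq> {x. pt 0 (dir G i) \<bullet> x = alpha G * eps}"
    using inner_i[OF i] by (auto simp: S_thin_def pt_inner inner_add_right)
qed

abbreviation "Om \<equiv> Omega_thin G eps"

text \<open>Plates and junction are open and the interfaces \<open>S_thin\<close> are null sets;
  measurability of the whole domain suffices because gradients are only compared on the open
  pieces.\<close>

lemma Omega_sets [simp]: "Om \<in> sets lebesgue"
proof -
  have A: "Et i \<union> S_thin G eps i \<in> sets lebesgue" if "i \<in> idx" for i
    using sets_E_thin[OF that] negligible_imp_sets[OF negligible_S_thin[OF that]] by (rule sets.Un)
  show ?thesis unfolding Omega_thin_def
    by (rule sets.Un[OF sets_ref(3) sets.finite_UN[OF finite_atLeastAtMost]]) (rule A)
qed

lemma Omega_bounded: "bounded Om"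
proof -
  have "bounded (S_thin G eps i)" if i: "i \<in> idx" for i
  proof -
    have "S_thin G eps i \<subseteq> pm i ` {x. x $ 1 \<in> {0..len G} \<and> x $ 2 \<in> {0..len G} \<and> x $ 3 \<in> {-1/2..1/2}}"
    proof
      fix x assume "x \<in> S_thin G eps i"
      then obtain a t where x: "x = pt a ((alpha G * eps) *\<^sub>R dir G i + t *\<^sub>R nrm G i)" "a \<in> I0" "\<bar>t\<bar> < thick G i * eps / 2"
        by (auto simp: S_thin_def)
      have d: "thick G i * eps > 0" using G_i[OF i] eps_pos by simp
      have "x = pm i (vector [a, 0, t / (thick G i * eps)])"
        using G_i(2)[OF i] eps_pos by (simp add: x pmap_eq)
      moreover have "- 1 / 2 \<le> t / (thick G i * eps)" "t / (thick G i * eps) \<le> 1 / 2"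
        using x(3) d by (auto simp: field_simps abs_less_iff)
      ultimately show "x \<in> pm i ` {x. x $ 1 \<in> {0..len G} \<and> x $ 2 \<in> {0..len G} \<and> x $ 3 \<in> {-1/2..1/2}}"
        using x(2) by (intro image_eqI[of x "pm i"]) auto
    qed
    moreover have "bounded (pm i ` {x. x $ 1 \<in> {0..len G} \<and> x $ 2 \<in> {0..len G} \<and> x $ 3 \<in> {-1/2..1/2}})"
    proof -
      have eq: "{x::real^3. x $ 1 \<in> {0..len G} \<and> x $ 2 \<in> {0..len G} \<and> x $ 3 \<in> {-1/2..1/2}} = cbox (vector [0, 0, -1/2]) (vector [len G, len G, 1/2])"
        by (auto simp: mem_box_cart forall_3)
      have "continuous_on UNIV (pm i)"
        unfolding pmap_def[abs_def] using linear_plin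
        by (intro continuous_intros linear_continuous_on) (simp add: linear_conv_bounded_linear)
      then show ?thesis unfolding eq
        by (intro compact_imp_bounded compact_continuous_image compact_cbox) (rule continuous_on_subset, auto)
    qed
    ultimately show ?thesis using bounded_subset by blast
  qed
  then show ?thesis unfolding Omega_thin_def using bounded_thin by auto
qed

lemma thin_subset: "i \<in> idx \<Longrightarrow> Et i \<subseteq> Om" "Nt \<subseteq> Om"
  by (auto simp: Omega_thin_def)

lemma disjoint_thin:
  "i \<in> idx \<Longrightarrow> j \<in> idx \<Longrightarrow> i \<noteq> j \<Longrightarrow> Et i \<inter> Et j = {}"
  "i \<in> idx \<Longrightarrow> Et i \<inter> Nt = {}"
  using adm by (auto simp: admissible_eps_def non_overlapping_def disjoint_family_on_def)

text \<open>The interfaces are null sets, and the remaining pieces are disjoint by admissibility of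
  \<open>eps\<close>.\<close>

lemma integral_Omega:
  fixes F :: "real^3 \<Rightarrow> real"
  assumes F: "integrable (leb Om) F"
  shows "(LINT x|leb Om. F x) = (\<Sum>i\<in>idx. LINT x|leb (Et i). F x) + (LINT x|leb Nt. F x)"
    "i \<in> idx \<Longrightarrow> integrable (leb (Et i)) F" "integrable (leb Nt) F"
proof -
  let ?r = "\<lambda>S x. if x \<in> S then F x else 0"
  have iO: "integrable lebesgue (?r Om)" using F by (simp add: Lebesgue_Measure.integrable_restrict_UNIV)
  have sub: "integrable lebesgue (?r S)" if "S \<in> sets lebesgue" "S \<subseteq> Om" for S
  proof -
    have "integrable lebesgue (\<lambda>x. indicator S x *\<^sub>R ?r Om x)" by (rule integrable_mult_indicator[OF that(1) iO])
    moreover have "(\<lambda>x. indicator S x *\<^sub>R ?r Om x) = ?r S" using that(2) by (auto simp: fun_eq_iff indicator_def)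
    ultimately show ?thesis by simp
  qed
  have iE: "integrable lebesgue (?r (Et i))" if "i \<in> idx" for i
    by (rule sub[OF sets_E_thin[OF that] thin_subset(1)[OF that]])
  have iN: "integrable lebesgue (?r Nt)" by (rule sub[OF sets_ref(3) thin_subset(2)])
  show "i \<in> idx \<Longrightarrow> integrable (leb (Et i)) F"
    using iE sets_E_thin by (simp add: Lebesgue_Measure.integrable_restrict_UNIV)
  show "integrable (leb Nt) F"
    using iN by (simp add: Lebesgue_Measure.integrable_restrict_UNIV)
  have "negligible (\<Union>i\<in>idx. S_thin G eps i)" using negligible_S_thin by (intro negligible_Union) auto
  then have "AE x in lebesgue. x \<notin> (\<Union>i\<in>idx. S_thin G eps i)"
    unfolding negligible_iff_null_sets by (rule AE_not_in)
  then have ae: "AE x in lebesgue. ?r Om x = (\<Sum>i\<in>idx. ?r (Et i) x) + ?r Nt x"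
  proof eventually_elim
    case (elim x)
    show ?case
    proof (cases "\<exists>i\<in>idx. x \<in> Et i")
      case True
      then obtain i where i: "i \<in> idx" "x \<in> Et i" by blast
      have "(\<Sum>j\<in>idx. ?r (Et j) x) = (\<Sum>j\<in>idx. if j = i then F x else 0)"
        using disjoint_thin(1)[OF i(1)] i by (intro sum.cong refl) auto
      then show ?thesis using i disjoint_thin(2)[OF i(1)] thin_subset(1)[OF i(1)] by (auto simp: sum.delta)
    next
      case False
      then have "(\<Sum>j\<in>idx. ?r (Et j) x) = 0" by (intro sum.neutral) auto
      moreover have "x \<in> Om \<longleftrightarrow> x \<in> Nt" using False elim by (auto simp: Omega_thin_def)
      ultimately show ?thesis by simp
    qed
  qed
  have "(LINT x|leb Om. F x) = (LINT x|lebesgue. ?r Om x)"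
    by (simp only: Lebesgue_Measure.integral_restrict_UNIV[OF Omega_sets])
  also have "\<dots> = (LINT x|lebesgue. (\<Sum>i\<in>idx. ?r (Et i) x) + ?r Nt x)"
    using ae iO iE iN by (intro integral_cong_AE borel_measurable_add borel_measurable_sum) (auto intro: borel_measurable_integrable)
  also have "\<dots> = (\<Sum>i\<in>idx. LINT x|lebesgue. ?r (Et i) x) + (LINT x|lebesgue. ?r Nt x)"
    using iE iN by (subst Bochner_Integration.integral_add) (auto intro!: Bochner_Integration.integrable_sum Bochner_Integration.integral_sum)
  also have "(\<Sum>i\<in>idx. LINT x|lebesgue. ?r (Et i) x) = (\<Sum>i\<in>idx. LINT x|leb (Et i). F x)"
    by (intro sum.cong refl Lebesgue_Measure.integral_restrict_UNIV sets_E_thin)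
  also have "(LINT x|lebesgue. ?r Nt x) = (LINT x|leb Nt. F x)"
    by (rule Lebesgue_Measure.integral_restrict_UNIV) simp
  finally show "(LINT x|leb Om. F x) = (\<Sum>i\<in>idx. LINT x|leb (Et i). F x) + (LINT x|leb Nt. F x)" .
qed

lemma integral_E_thin:
  fixes F :: "real^3 \<Rightarrow> real"
  assumes "i \<in> idx"
  shows "(LINT x|leb (Et i). F x) = sl i * (thick G i * eps) * (LINT y|leb Er. F (pm i y))"
  using scales_LINT[OF scales_pmap[OF assms] sets_ref(2), of F] by (simp add: pmap_E_ref[OF assms])

lemma integral_N_thin:
  fixes F :: "real^3 \<Rightarrow> real"
  shows "(LINT x|leb Nt. F x) = eps\<^sup>2 * (LINT y|leb Nr. F (nm y))"
  using scales_LINT[OF scales_nmap sets_ref(1), of eps F] eps_pos by (simp add: nmap_N_ref)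

text \<open>Chain rule for the affine map \<open>pmap\<close>. Of the two rescaled components, the
  one along the plate gets a factor with a positive limit, the one across it a factor of order
  \<open>eps\<close>.\<close>

lemma wgrad_E_ref:
  assumes i: "i \<in> idx" and u: "H1 Om u"
  shows "to_E_ref G eps i u = (\<lambda>y. u (pm i y))"
    "L2 Er (\<lambda>y. u (pm i y))" "L2 Er (\<lambda>y. wgrad Om u (pm i y))"
    "AE y in leb Er. wgrad Er (to_E_ref G eps i u) y =
      vector [wgrad Om u (pm i y) $ 1, sl i * sco G i (wgrad Om u (pm i y)), thick G i * eps * tco G i (wgrad Om u (pm i y))]"
proof -
  show t: "to_E_ref G eps i u = (\<lambda>y. u (pm i y))" by (simp add: to_E_ref_def inv_Phi_E[OF i] o_def)
  let ?L = "plin G i (sl i) (thick G i * eps)"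
  have uE: "L2 (Et i) u" by (rule L2_subset[OF thin_subset(1)[OF i] sets_E_thin[OF i] Omega_sets H1_L2[OF u]])
  have wE: "is_weak_grad (Et i) u (wgrad Om u)"
    by (rule weak_grad_subset[OF thin_subset(1)[OF i] sets_E_thin[OF i] Omega_sets weak_grad_wgrad[OF u]])
  note im = pmap_E_ref[OF i, symmetric]
  show L: "L2 Er (\<lambda>y. u (pm i y))" "L2 Er (\<lambda>y. wgrad Om u (pm i y))"
    using uE is_weak_grad_L2[OF wE] unfolding im scales_L2[OF scales_pmap[OF i] sets_ref(2)] by auto
  have d: "det (matrix ?L) \<noteq> 0"
    using slen_pos[OF i] eps_pos G_i[OF i] orient(4)[OF i] by (auto simp: det_plin[OF i])
  have "is_weak_grad Er (\<lambda>y. u (pm i y)) (\<lambda>y. adjoint ?L (wgrad Om u (pm i y)))"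
    by (rule weak_grad_affine[OF linear_plin d sets_ref(2)])
       (use uE wE in \<open>auto simp: pmap_def[abs_def] im\<close>)
  from wgrad_AE[OF open_thin(4) L(1) this] show "AE y in leb Er. wgrad Er (to_E_ref G eps i u) y =
      vector [wgrad Om u (pm i y) $ 1, sl i * sco G i (wgrad Om u (pm i y)), thick G i * eps * tco G i (wgrad Om u (pm i y))]"
    by (simp add: t adjoint_plin)
qed

text \<open>The cross-sectional components are scaled by \<open>eps\<close> and the longitudinal one
  not at all, so in the reference gradient only the former carry a power of
  \<open>eps\<close>.\<close>

lemma wgrad_N_ref:
  assumes u: "H1 Om u"
  shows "to_N_ref eps u = (\<lambda>y. u (nm y))"
    "L2 Nr (\<lambda>y. u (nm y))" "L2 Nr (\<lambda>y. wgrad Om u (nm y))"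
    "is_weak_grad Nr (\<lambda>y. u (nm y)) (\<lambda>y. nm (wgrad Om u (nm y)))"
    "AE y in leb Nr. wgrad Nr (to_N_ref eps u) y = nm (wgrad Om u (nm y))"
proof -
  have e: "eps \<noteq> 0" using eps_pos by simp
  show t: "to_N_ref eps u = (\<lambda>y. u (nm y))" by (simp add: to_N_ref_def inv_Phi_N[OF e] o_def)
  have uN: "L2 Nt u" by (rule L2_subset[OF thin_subset(2) sets_ref(3) Omega_sets H1_L2[OF u]])
  have wN: "is_weak_grad Nt u (wgrad Om u)"
    by (rule weak_grad_subset[OF thin_subset(2) sets_ref(3) Omega_sets weak_grad_wgrad[OF u]])
  note im = nmap_N_ref[symmetric]
  show L: "L2 Nr (\<lambda>y. u (nm y))" "L2 Nr (\<lambda>y. wgrad Om u (nm y))"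
    using uN is_weak_grad_L2[OF wN] unfolding im scales_L2[OF scales_nmap[OF e] sets_ref(1)] by auto
  have d: "det (matrix nm) \<noteq> 0" using e by (simp add: det_nmap)
  have T: "nm = (\<lambda>x. nm x + 0)" by simp
  show w: "is_weak_grad Nr (\<lambda>y. u (nm y)) (\<lambda>y. nm (wgrad Om u (nm y)))"
    using weak_grad_affine[OF linear_nmap d sets_ref(1) T, of u "wgrad Om u"] uN wN by (simp add: im adjoint_nmap)
  from wgrad_AE[OF open_thin(3) L(1) this]
  show "AE y in leb Nr. wgrad Nr (to_N_ref eps u) y = nm (wgrad Om u (nm y))" by (simp add: t)
qed

end

section \<open>Identities on the thin domain\<close>

abbreviation proj23 :: "real^3 \<Rightarrow> real^2" where "proj23 x \<equiv> pt2 (x $ 2) (x $ 3)"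

lemma linear_proj23: "linear proj23"
  by (rule linearI) (auto simp: vec_eq_iff forall_2)

lemma c3_continuous: "continuous_on UNIV c3"
proof (rule continuous_on_vec)
  fix i :: 3
  show "continuous_on UNIV (\<lambda>x. c3 x $ i)" using exhaust_3[of i] by (elim disjE) (simp_all add: continuous_intros)
qed

lemma c3_line: "c3 (y, s) = c3 (y, 0) + s *\<^sub>R axis 2 1"
  by (simp add: vec_eq_iff forall_3 axis_def)

lemma slab_c3: "slab L l = c3 ` (rect L (-1/2) (1/2) \<times> {0<..<l})"
proof -
  have "x \<in> c3 ` (rect L (-1/2) (1/2) \<times> {0<..<l})" if "x \<in> slab L l" for x
    using that by (intro image_eqI[of _ _ "(pt2 (x $ 1) (x $ 3), x $ 2)"]) (auto simp: slab_def rect_def vec_eq_iff forall_3)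
  then show ?thesis by (auto simp: slab_def rect_def)
qed

lemma slab_FTC:
  assumes "smooth F" "0 \<le> l"
  shows "(LINT x|leb (slab L l). grad F x \<bullet> axis 2 1) =
    (LINT y|leb (rect L (-1/2) (1/2)). F (c3 (y, l)) - F (c3 (y, 0)))"
  unfolding slab_c3 by (rule slice_FTC[OF scales_coords(2) c3_continuous c3_line assms(1) rect_borel _ assms(2)]) simp

lemma smooth_sco: "smooth (sco G i)" "smooth (tco G i)"
  using linear_sco[of G i] by (simp_all add: smooth_linear linear_conv_bounded_linear)

lemma grad_sco: "grad (sco G i) x = pt 0 (dir G i)" "grad (tco G i) x = pt 0 (nrm G i)"
  using linear_sco[of G i] unfolding linear_conv_bounded_linear
  by (auto intro!: grad_eqI bounded_linear_imp_has_derivative[THEN has_derivative_eq_rhs] simp: sco_def[abs_def] tco_def[abs_def] inner_commute)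

lemma smooth_affine_real: "smooth f \<Longrightarrow> smooth g \<Longrightarrow> smooth (\<lambda>x. f (c * g x + a))"
  by (rule smooth_compose_real[of f "\<lambda>x. c * g x + a"]) (auto intro: smooth_add smooth_cmult)

lemma grad_affine_real:
  fixes g :: "'a::euclidean_space \<Rightarrow> real"
  assumes "smooth f" "smooth g" shows "grad (\<lambda>x. f (c * g x + a)) x = (c * grad f (c * g x + a)) *\<^sub>R grad g x"
proof -
  have s: "smooth (\<lambda>x. c * g x + a)" by (intro smooth_add smooth_cmult assms smooth_const)
  show ?thesis
    by (simp add: grad_compose_real[OF assms(1) s] grad_add[OF smooth_cmult[OF assms(2)] smooth_const] grad_cmult[OF assms(2)])
qed

lemma test_function_realD:
  assumes "test_function {0<..<L::real} z"
  obtains K where "compact K" "K \<subseteq> {0<..<L}" "\<And>x. x \<notin> K \<Longrightarrow> z x = 0"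
  using assms by (auto simp: test_function_def)

context thin_geometry
begin

lemma sco_line:
  assumes "i \<in> idx"
  shows "pt 0 (dir G i) \<bullet> pt 0 (dir G i) = 1" "pt 0 (nrm G i) \<bullet> pt 0 (dir G i) = 0" "axis 1 1 \<bullet> pt 0 (dir G i) = 0"
  using inner_i[OF assms] by (simp_all add: pt_inner inner_axis' inner_commute)

text \<open>The triangle with apex 0 whose base is the scaled interface of plate \<open>i\<close>
  lies in the convex hull: a point of height h = y . dir is the multiple h/alpha of a point of that
  interface. Its open part is therefore in the interior.\<close>

lemma omega_triangle:
  assumes i: "i \<in> idx" and y: "0 < y \<bullet> dir G i" "y \<bullet> dir G i < alpha G" "2 * alpha G * \<bar>y \<bullet> nrm G i\<bar> < thick G i * (y \<bullet> dir G i)"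
  shows "y \<in> omega G"
proof -
  let ?H = "convex hull ({0} \<union> (\<Union>i\<in>idx. {alpha G *\<^sub>R dir G i + t *\<^sub>R nrm G i |t. \<bar>t\<bar> \<le> thick G i / 2}))"
  let ?T = "{y. 0 < y \<bullet> dir G i} \<inter> {y. y \<bullet> dir G i < alpha G} \<inter> {y. 2 * alpha G * \<bar>y \<bullet> nrm G i\<bar> < thick G i * (y \<bullet> dir G i)}"
  have "open ?T" by (intro open_Int open_Collect_less continuous_intros)
  moreover have "?T \<subseteq> ?H"
  proof
    fix z assume z: "z \<in> ?T"
    define l where "l = z \<bullet> dir G i / alpha G"
    have l: "0 < l" "l \<le> 1" using z G_pos by (auto simp: l_def)
    define t where "t = (z \<bullet> nrm G i) / l"
    have "\<bar>t\<bar> \<le> thick G i / 2"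
      using z l G_pos(2) by (simp add: t_def abs_divide l_def field_simps abs_mult)
    then have h1: "alpha G *\<^sub>R dir G i + t *\<^sub>R nrm G i \<in> ?H" using i by (intro hull_inc) blast
    have h0: "0 \<in> ?H" by (intro hull_inc) simp
    have "(1 - l) *\<^sub>R 0 + l *\<^sub>R (alpha G *\<^sub>R dir G i + t *\<^sub>R nrm G i) \<in> ?H"
      by (rule convexD[OF convex_convex_hull h0 h1]) (use l in auto)
    moreover have "l *\<^sub>R (alpha G *\<^sub>R dir G i + t *\<^sub>R nrm G i) = (z \<bullet> dir G i) *\<^sub>R dir G i + (z \<bullet> nrm G i) *\<^sub>R nrm G i"
      using z l G_pos(2) by (simp add: scaleR_add_right t_def l_def)
    ultimately show "z \<in> ?H" using decompose_2[OF i, of z] by simp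
  qed
  ultimately have "?T \<subseteq> omega G" unfolding omega_def by (rule interior_maximal [rotated])
  then show ?thesis using y by auto
qed

text \<open>\<open>omega_triangle\<close> provides a point of the open set. The normalisation of the
  source in the junction divides by this measure.\<close>

lemma omega_measure_pos: "0 < measure lebesgue (omega G)"
proof -
  have 1: "1 \<in> idx" using G_pos by simp
  have "(alpha G / 2) *\<^sub>R dir G 1 \<in> omega G"
    using G_pos G_i[OF 1] inner_i[OF 1] by (intro omega_triangle[OF 1]) auto
  then have "omega G \<noteq> {}" by auto
  moreover have o: "open (omega G)" by (simp add: omega_def)
  ultimately have "\<not> negligible (omega G)" by (simp add: open_not_negligible)
  moreover have "bounded (omega G)"
  proof -
    have bd: "{alpha G *\<^sub>R dir G i + t *\<^sub>R nrm G i |t. \<bar>t\<bar> \<le> thick G i / 2} \<subseteq> cball 0 (alpha G + thick G i)" if i: "i \<in> idx" for i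
    proof
      fix x assume "x \<in> {alpha G *\<^sub>R dir G i + t *\<^sub>R nrm G i |t. \<bar>t\<bar> \<le> thick G i / 2}"
      then obtain t where t: "x = alpha G *\<^sub>R dir G i + t *\<^sub>R nrm G i" "\<bar>t\<bar> \<le> thick G i / 2" by blast
      have "norm x \<le> norm (alpha G *\<^sub>R dir G i) + norm (t *\<^sub>R nrm G i)" unfolding t(1) by (rule norm_triangle_ineq)
      then show "x \<in> cball 0 (alpha G + thick G i)" using t(2) G_i[OF i] G_pos by simp
    qed
    have "bounded ({0} \<union> (\<Union>i\<in>idx. {alpha G *\<^sub>R dir G i + t *\<^sub>R nrm G i |t. \<bar>t\<bar> \<le> thick G i / 2}))"
      by (intro bounded_Un[THEN iffD2] conjI bounded_UN ballI bounded_subset[OF bounded_cball bd]) auto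
    then show ?thesis
      unfolding omega_def by (rule bounded_subset[OF bounded_convex_hull interior_subset])
  qed
  ultimately show ?thesis
    using o bounded_set_imp_lmeasurable[of "omega G"] by (simp add: negligible_iff_measure zero_less_measure_iff)
qed

end

context thin_domain
begin

text \<open>The dilation carrying the thin plate, of length
  \<open>width G i - alpha G * eps\<close>, onto the full length of the limit rectangle.\<close>

definition "mu i = width G i / (width G i - alpha G * eps)"

lemma mu: assumes "i \<in> idx" shows "1 < mu i" "mu i * sl i = width G i / len G"
proof -
  have w: "width G i - alpha G * eps > 0" using adm assms by (simp add: admissible_eps_def)
  have "0 < alpha G * eps" using G_pos eps_pos by simp
  then show "1 < mu i" using w by (simp add: mu_def field_simps)
  show "mu i * sl i = width G i / len G" using w by (simp add: mu_def slen_def)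
qed

lemma omega_lm [simp]: "omega G \<in> lmeasurable" "omega G \<in> sets lebesgue" "omega G \<in> sets borel"
  using omega_bounded by (auto intro: bounded_set_imp_lmeasurable)

lemma N_ref_c3p: "Nr = c3p ` (I0 \<times> omega G)"
  unfolding N_ref_def c3p_def by force

lemma N_ref_product:
  fixes f :: "real \<Rightarrow> real" and q :: "real^2 \<Rightarrow> real"
  assumes f: "integrable (leb I0) f" and q: "continuous_on UNIV q"
  shows "(LINT y|leb Nr. f (y $ 1) * q (proj23 y)) = (LINT x|leb I0. f x) * (LINT z|leb (omega G). q z)"
    "integrable (leb Nr) (\<lambda>y. f (y $ 1) * q (proj23 y))"
proof -
  have iq: "integrable (leb (omega G)) q"
    by (intro L2_integrable L2_continuous q omega_bounded omega_lm)
  have S: "I0 \<times> omega G \<in> sets lebesgue" using sets_lebesgue_Times[of "I0" "omega G"] by auto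
  note P = lebesgue_product_function[OF f iq]
  show "(LINT y|leb Nr. f (y $ 1) * q (proj23 y)) = (LINT x|leb I0. f x) * (LINT z|leb (omega G). q z)"
    unfolding N_ref_c3p scales_LINT[OF scales_coords(4) S] using P(2) by (simp add: c3p_def pt2_eta)
  show "integrable (leb Nr) (\<lambda>y. f (y $ 1) * q (proj23 y))"
    unfolding N_ref_c3p scales_integrable[OF scales_coords(4) S] using P(1) by (simp add: c3p_def pt2_eta)
qed

text \<open>A function of x_1 alone is no test function on the junction, as it does not vanish at
  the lateral boundary. Cutoffs depending on the cross-section alone repair this; the derivative in
  x_1 never falls on them, so they can be removed by bounded convergence.\<close>

lemma N_ref_parts:
  assumes U: "L2 Nr U" and V: "is_weak_grad Nr U V" and t: "test_function I0 r"
  shows "(LINT y|leb Nr. V y $ 1 * r (y $ 1)) = - (LINT y|leb Nr. U y * grad r (y $ 1))"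
proof -
  have sm: "smooth r" using t by (rule test_function_smooth)
  obtain K where K: "compact K" "K \<subseteq> I0" "\<And>x. x \<notin> K \<Longrightarrow> r x = 0" using test_function_realD[OF t] by metis
  \<comment> \<open>An exhaustion of the cross-section by compact sets: bounded parts at distance at
    least 1/(j+1) from its complement.\<close>
  define C where "C j = {y \<in> cball 0 (real j). \<forall>z. z \<notin> omega G \<longrightarrow> 1 / real (Suc j) \<le> dist y z}" for j
  have C: "compact (C j)" "C j \<subseteq> omega G" for j
  proof -
    have eq: "C j = cball 0 (real j) \<inter> (\<Inter>z\<in>- omega G. {y. 1 / real (Suc j) \<le> dist y z})" by (auto simp: C_def)
    have cl: "closed {y. 1 / real (Suc j) \<le> dist y z}" for z by (intro closed_Collect_le continuous_intros)
    show "compact (C j)" unfolding eq by (intro compact_Int_closed compact_cball closed_INT ballI cl)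
    show "C j \<subseteq> omega G"
    proof
      fix y assume "y \<in> C j"
      then show "y \<in> omega G" by (rule_tac ccontr) (force simp: C_def)
    qed
  qed
  have "\<exists>f. test_function (omega G) f \<and> (\<forall>x. 0 \<le> f x \<and> f x \<le> 1) \<and> (\<forall>x\<in>C j. f x = 1)" for j
    using smooth_Urysohn[OF C(1) omega_bounded(2) C(2)] by metis
  then obtain ch where ch: "\<And>j. test_function (omega G) (ch j)" "\<And>j x. 0 \<le> ch j x" "\<And>j x. ch j x \<le> 1" "\<And>j x. x \<in> C j \<Longrightarrow> ch j x = 1"
    by metis
  have lim: "(\<lambda>j. ch j z) \<longlonglongrightarrow> 1" if z: "z \<in> omega G" for z
  proof -
    obtain e where e: "0 < e" "ball z e \<subseteq> omega G" using omega_bounded(2) z open_contains_ball by blast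
    obtain n where n: "1 / real (Suc n) < e" using nat_approx_posE[OF e(1)] by blast
    have "ch j z = 1" if j: "j \<ge> max n (nat \<lceil>norm z\<rceil>)" for j
    proof (rule ch(4))
      have "1 / real (Suc j) \<le> 1 / real (Suc n)" using j by (simp add: field_simps)
      moreover have "e \<le> dist z w" if "w \<notin> omega G" for w using that e(2) by (force simp: subset_iff)
      moreover have "norm z \<le> real j" using j by linarith
      ultimately show "z \<in> C j" using n by (force simp: C_def)
    qed
    then have "\<forall>\<^sub>F j in sequentially. 1 = ch j z" unfolding eventually_sequentially by metis
    then show ?thesis by (rule Lim_transform_eventually[OF tendsto_const])
  qed
  have sch: "smooth (\<lambda>y. ch j (proj23 y))" for j
    using smooth_affine[OF test_function_smooth[OF ch(1)] linear_proj23, of j 0] by simp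
  have sn: "smooth (\<lambda>y::real^3. r (y $ 1))" by (rule smooth_nth_compose[OF sm])
  have sg: "smooth (\<lambda>y::real^3. grad r (y $ 1))" by (rule smooth_nth_compose[OF smooth_grad_real[OF sm]])
  have Z: "test_function Nr (\<lambda>y. r (y $ 1) * ch j (proj23 y))" for j
  proof -
    obtain K' where K': "compact K'" "K' \<subseteq> omega G" "\<forall>x. x \<notin> K' \<longrightarrow> ch j x = 0" using ch(1)[of j] by (auto simp: test_function_def)
    have "compact ((\<lambda>(a, y). pt a y) ` (K \<times> K'))"
      using linear_continuous_on[OF linear_pt [unfolded linear_conv_bounded_linear]] by (intro compact_continuous_image compact_Times K K') auto
    moreover have "(\<lambda>(a, y). pt a y) ` (K \<times> K') \<subseteq> Nr" using K K' unfolding N_ref_def by force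
    moreover have "r (y $ 1) * ch j (proj23 y) = 0" if "y \<notin> (\<lambda>(a, y). pt a y) ` (K \<times> K')" for y
    proof -
      have "y = (\<lambda>(a, y). pt a y) (y $ 1, proj23 y)" by (simp add: vec_eq_iff forall_3)
      then have "\<not> (y $ 1 \<in> K \<and> proj23 y \<in> K')" using that image_eqI[of y "\<lambda>(a, y). pt a y" "(y $ 1, proj23 y)" "K \<times> K'"] by blast
      then show ?thesis using K(3) K'(3) by auto
    qed
    ultimately show ?thesis unfolding test_function_def using smooth_mult[OF sn sch] by blast
  qed
  have gZ: "grad (\<lambda>y. r (y $ 1) * ch j (proj23 y)) y \<bullet> axis 1 1 = grad r (y $ 1) * ch j (proj23 y)" for j y
  proof -
    have "proj23 (axis 1 1) = 0" by (simp add: vec_eq_iff forall_2 axis_def)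
    then have "grad (\<lambda>y. ch j (proj23 y)) y \<bullet> axis 1 1 = 0"
      using grad_affine[OF test_function_smooth[OF ch(1)] linear_proj23, of j 0 y "axis 1 1"] by simp
    then show ?thesis by (simp add: grad_mult[OF sn sch] inner_add_left grad_nth_compose[OF sm] inner_axis_axis)
  qed
  have b: "bounded Nr" "Nr \<in> sets lebesgue" "Nr \<in> lmeasurable" using bounded_ref by auto
  have T: "L2_tendsto Nr (\<lambda>j y. q (y $ 1) * ch j (proj23 y)) (\<lambda>y. q (y $ 1))" if q: "smooth (\<lambda>y::real^3. q (y $ 1))" for q
  proof -
    obtain B where B: "0 \<le> B" "\<And>y. y \<in> Nr \<Longrightarrow> norm (q (y $ 1)) \<le> B"
      using continuous_bounded_on[OF b(1) smooth_continuous[OF q]] by metis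
    show ?thesis
    proof (rule L2_tendsto_bounded_convergence[OF b(3), where C = B])
      show "(\<lambda>y. q (y $ 1) * ch j (proj23 y)) \<in> mbl Nr" for j
        by (intro continuous_measurable_lebesgue_on smooth_continuous smooth_mult q sch)
      show "(\<lambda>y. q (y $ 1)) \<in> mbl Nr"
        by (intro continuous_measurable_lebesgue_on smooth_continuous q)
      show "norm (q (y $ 1) * ch j (proj23 y)) \<le> B" if "y \<in> Nr" for j y
        using mult_mono[OF B(2)[OF that] ch(3)[of j "proj23 y"]] B(1) ch(2) by (simp add: abs_mult)
      show "AE y in leb Nr. (\<lambda>j. q (y $ 1) * ch j (proj23 y)) \<longlonglongrightarrow> q (y $ 1)"
      proof (rule AE_I2)
        fix y assume "y \<in> space (leb Nr)"
        then have "proj23 y \<in> omega G" by (auto simp: N_ref_def pt2_eta)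
        from tendsto_mult_left[OF lim[OF this], of "q (y $ 1)"]
        show "(\<lambda>j. q (y $ 1) * ch j (proj23 y)) \<longlonglongrightarrow> q (y $ 1)" by simp
      qed
    qed
  qed
  have "(\<lambda>j. LINT y|leb Nr. U y * (grad r (y $ 1) * ch j (proj23 y))) \<longlonglongrightarrow> (LINT y|leb Nr. U y * grad r (y $ 1))"
    by (rule L2_tendsto_mult[OF L2_tendsto_const[OF U] T[OF sg]])
  moreover have "(\<lambda>j. - (LINT y|leb Nr. V y $ 1 * (r (y $ 1) * ch j (proj23 y)))) \<longlonglongrightarrow> - (LINT y|leb Nr. V y $ 1 * r (y $ 1))"
    by (rule tendsto_minus[OF L2_tendsto_mult[OF L2_tendsto_const[OF L2_vec_nth[OF is_weak_grad_L2[OF V]]] T[OF sn]]])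
  moreover have "(LINT y|leb Nr. U y * (grad r (y $ 1) * ch j (proj23 y))) = - (LINT y|leb Nr. V y $ 1 * (r (y $ 1) * ch j (proj23 y)))" for j
    using weak_grad_test[OF V U b(2) Z, of j "axis 1 1"] unfolding gZ by (simp add: cart_eq_inner_axis)
  ultimately show ?thesis using LIMSEQ_unique by fastforce
qed

text \<open>The transition ends at 3/4 of alpha, before the interface at alpha, so the field leaves
  the junction with the constant factor 1. It starts at alpha/2, where the junction is already wide
  enough for the support of \<open>b\<close>.\<close>

definition "stepA \<sigma> = step (4 / alpha G * \<sigma> + (-2))"

lemma smooth_stepA: "smooth stepA"
  unfolding stepA_def[abs_def] by (rule smooth_affine_real[OF smooth_step smooth_id])

lemma stepA: "f \<le> alpha G / 2 \<Longrightarrow> stepA f = 0" "alpha G \<le> f \<Longrightarrow> stepA f = 1" "alpha G \<le> f \<Longrightarrow> grad stepA f = 0"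
proof -
  show "f \<le> alpha G / 2 \<Longrightarrow> stepA f = 0" unfolding stepA_def using G_pos(2) by (intro step_0) (simp add: field_simps)
  have *: "alpha G \<le> f \<Longrightarrow> 1 \<le> 4 / alpha G * f + (-2)" using G_pos(2) by (simp add: field_simps)
  then show "alpha G \<le> f \<Longrightarrow> stepA f = 1" unfolding stepA_def by (intro step_1)
  show "alpha G \<le> f \<Longrightarrow> grad stepA f = 0"
    unfolding stepA_def[abs_def] using grad_affine_real[OF smooth_step smooth_id, of "4 / alpha G" "-2" f] * by (simp add: grad_step_0)
qed

text \<open>The test function equals \<open>f B b\<close> in the plate and decays to \<open>0\<close> inside the junction,
  so that it compares the values of \<open>u\<close> in the plate and in the junction.\<close>

lemma plate_identity:
  assumes i: "i \<in> idx" and u: "L2 Om u" and w: "is_weak_grad Om u g"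
    and z: "test_function I0 f"
    and B: "smooth B" "0 < f0" "f0 < width G i" "\<And>s. s \<le> f0 \<Longrightarrow> B s = 1" "\<And>s. width G i - f0 \<le> s \<Longrightarrow> B s = 0"
    and b: "smooth b" "\<And>t. thick G i / 8 \<le> \<bar>t\<bar> \<Longrightarrow> b t = 0"
    and small: "\<And>y. y \<in> omega G \<Longrightarrow> (eps * (y \<bullet> dir G i) - alpha G * eps) * mu i < f0"
  shows "sl i * thick G i * mu i * (LINT y|leb Er. u (pm i y) * (f (y $ 1) * grad B (width G i / len G * y $ 2) * b (thick G i * y $ 3))) +
      (LINT y|leb Nr. u (nm y) * (f (y $ 1) * grad stepA (sco G i y) * b (tco G i y))) =
    - (sl i * thick G i * (LINT y|leb Er. sco G i (g (pm i y)) * (f (y $ 1) * B (width G i / len G * y $ 2) * b (thick G i * y $ 3)))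
      + eps * (LINT y|leb Nr. sco G i (g (nm y)) * (f (y $ 1) * stepA (sco G i y) * b (tco G i y))))"
proof -
  let ?tC = "LINT y|leb Nr. sco G i (g (nm y)) * (f (y $ 1) * stepA (sco G i y) * b (tco G i y))"
  let ?tB = "LINT y|leb Er. u (pm i y) * (f (y $ 1) * grad B (width G i / len G * y $ 2) * b (thick G i * y $ 3))"
  let ?tA = "LINT y|leb Er. sco G i (g (pm i y)) * (f (y $ 1) * B (width G i / len G * y $ 2) * b (thick G i * y $ 3))"
  note e = eps_pos
  have w': "width G i - alpha G * eps > 0" using adm i by (simp add: admissible_eps_def)
  have sz: "smooth f" using z by (rule test_function_smooth)
  obtain K where K: "compact K" "K \<subseteq> I0" "\<And>x. x \<notin> K \<Longrightarrow> f x = 0" using test_function_realD[OF z] by metis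
  define f1 where "f1 x = f (x $ 1)" for x :: "real^3"
  define f2 where "f2 x = stepA ((1/eps) * sco G i x + 0)" for x
  define f3 where "f3 x = B (mu i * sco G i x + (- alpha G * eps * mu i))" for x
  define f4 where "f4 x = b ((1/eps) * tco G i x + 0)" for x
  define Z where "Z x = f1 x * f4 x * (f2 x * f3 x)" for x
  have s: "smooth f1" "smooth f2" "smooth f3" "smooth f4"
    unfolding f1_def[abs_def] f2_def[abs_def] f3_def[abs_def] f4_def[abs_def]
    by (rule smooth_nth_compose[OF sz], rule smooth_affine_real[OF smooth_stepA smooth_sco(1)],
        rule smooth_affine_real[OF B(1) smooth_sco(1)], rule smooth_affine_real[OF b(1) smooth_sco(2)])
  have sZ: "smooth Z" unfolding Z_def[abs_def] by (intro smooth_mult s)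
  note ln = sco_line[OF i]
  have gf: "grad f1 x \<bullet> pt 0 (dir G i) = 0" "grad f4 x \<bullet> pt 0 (dir G i) = 0"
    "grad f2 x \<bullet> pt 0 (dir G i) = (1/eps) * grad stepA ((1/eps) * sco G i x + 0)"
    "grad f3 x \<bullet> pt 0 (dir G i) = mu i * grad B (mu i * sco G i x + (- alpha G * eps * mu i))" for x
    unfolding f1_def[abs_def] f2_def[abs_def] f3_def[abs_def] f4_def[abs_def]
      grad_nth_compose[OF sz] grad_affine_real[OF smooth_stepA smooth_sco(1)] grad_affine_real[OF B(1) smooth_sco(1)]
      grad_affine_real[OF b(1) smooth_sco(2)] grad_sco
    using ln by simp_all
  have gZ: "grad Z x \<bullet> pt 0 (dir G i) = f1 x * f4 x * ((1/eps) * grad stepA ((1/eps) * sco G i x + 0) * f3 x + f2 x * (mu i * grad B (mu i * sco G i x + (- alpha G * eps * mu i))))" for x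
    unfolding Z_def[abs_def] grad_mult[OF smooth_mult[OF s(1,4)] smooth_mult[OF s(2,3)]] grad_mult[OF s(1,4)] grad_mult[OF s(2,3)]
    by (simp add: inner_add_left gf)
  \<comment> \<open>The position at which the argument of \<open>B\<close> reaches
    \<open>width G i - f0\<close>; beyond it the field vanishes, which keeps its support away from
    the outer side.\<close>
  define M where "M = alpha G * eps + (width G i - f0) / mu i"
  have mu0: "0 < mu i" using mu(1)[OF i] by simp
  have M: "M < width G i"
  proof -
    have "(width G i - f0) / mu i < width G i / mu i" using B(2) mu0 by (simp add: divide_strict_right_mono)
    also have "width G i / mu i = width G i - alpha G * eps" using w' G_i[OF i] by (simp add: mu_def)
    finally show ?thesis by (simp add: M_def)
  qed
  define KZ where "KZ = (\<lambda>(a, s, t). pt a (s *\<^sub>R dir G i + t *\<^sub>R nrm G i)) ` (K \<times> {alpha G * eps / 2..M} \<times> {- (thick G i * eps / 8)..thick G i * eps / 8})"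
  have cKZ: "compact KZ"
  proof -
    have "continuous_on UNIV (\<lambda>(a, s, t). pt a (s *\<^sub>R dir G i + t *\<^sub>R nrm G i))"
    proof (rule continuous_on_vec)
      fix j :: 3
      show "continuous_on UNIV (\<lambda>p. (case p of (a, s, t) \<Rightarrow> pt a (s *\<^sub>R dir G i + t *\<^sub>R nrm G i)) $ j)"
        using exhaust_3[of j] by (elim disjE) (auto simp: case_prod_unfold intro!: continuous_intros)
    qed
    then show ?thesis unfolding KZ_def
      by (intro compact_continuous_image compact_Times K compact_Icc) (rule continuous_on_subset, auto)
  qed
  have KZ_iff: "x \<in> KZ \<longleftrightarrow> x $ 1 \<in> K \<and> sco G i x \<in> {alpha G * eps / 2..M} \<and> tco G i x \<in> {- (thick G i * eps / 8)..thick G i * eps / 8}" for x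
  proof
    assume "x \<in> KZ"
    then show "x $ 1 \<in> K \<and> sco G i x \<in> {alpha G * eps / 2..M} \<and> tco G i x \<in> {- (thick G i * eps / 8)..thick G i * eps / 8}"
      by (auto simp: KZ_def sco_plate[OF i])
  next
    assume "x $ 1 \<in> K \<and> sco G i x \<in> {alpha G * eps / 2..M} \<and> tco G i x \<in> {- (thick G i * eps / 8)..thick G i * eps / 8}"
    then show "x \<in> KZ" unfolding KZ_def
      by (intro image_eqI[of _ _ "(x $ 1, sco G i x, tco G i x)"]) (use decompose[OF i, of x] in auto)
  qed
  have KZ_sub: "x \<in> Et i \<or> x \<in> S_thin G eps i \<or> x \<in> Nt" if x: "x \<in> KZ" for x
  proof -
    have x1: "x $ 1 \<in> I0" using x K by (auto simp: KZ_iff)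
    have d: "0 < thick G i * eps" using G_i[OF i] e by simp
    have t: "\<bar>tco G i x\<bar> \<le> thick G i * eps / 8" using x by (auto simp: KZ_iff abs_le_iff)
    consider "alpha G * eps < sco G i x" | "sco G i x = alpha G * eps" | "sco G i x < alpha G * eps" by linarith
    then show ?thesis
    proof cases
      case 1
      then have "x \<in> Et i" using x x1 t d M unfolding E_thin_iff[OF i] KZ_iff by auto
      then show ?thesis by blast
    next
      case 2
      have "x = pt (x $ 1) ((alpha G * eps) *\<^sub>R dir G i + tco G i x *\<^sub>R nrm G i)" using decompose[OF i, of x] 2 by simp
      moreover have "\<bar>tco G i x\<bar> < thick G i * eps / 2" using t d by linarith
      ultimately have "x \<in> S_thin G eps i" using x1 unfolding S_thin_def by blast
      then show ?thesis by blast
    next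
      case 3
      define y where "y = (sco G i x / eps) *\<^sub>R dir G i + (tco G i x / eps) *\<^sub>R nrm G i"
      have y: "y \<bullet> dir G i = sco G i x / eps" "y \<bullet> nrm G i = tco G i x / eps" using inner_i[OF i] by (simp_all add: y_def inner_add_left)
      have s2: "alpha G * eps / 2 \<le> sco G i x" using x by (auto simp: KZ_iff)
      have "y \<in> omega G"
      proof (rule omega_triangle[OF i])
        have "0 < sco G i x" using s2 G_pos(2) e by (smt (verit) divide_pos_pos mult_pos_pos)
        then show "0 < y \<bullet> dir G i" using e by (simp add: y)
        show "y \<bullet> dir G i < alpha G" using 3 e by (simp add: y field_simps)
        \<comment> \<open>Here the constants meet: |t| at most one eighth of the thickness times
          \<open>eps\<close>, together with s at least half of alpha times \<open>eps\<close>,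
          places the point in the triangle of \<open>omega_triangle\<close>.\<close>
        have "2 * alpha G * \<bar>tco G i x\<bar> \<le> 2 * alpha G * (thick G i * eps / 8)" using t G_pos(2) by (intro mult_left_mono) auto
        also have "\<dots> < thick G i * (alpha G * eps / 2)" using d G_pos(2) G_i(2)[OF i] e by simp
        also have "\<dots> \<le> thick G i * sco G i x" using s2 G_i(2)[OF i] by (intro mult_left_mono) auto
        finally show "2 * alpha G * \<bar>y \<bullet> nrm G i\<bar> < thick G i * (y \<bullet> dir G i)"
          using e by (simp add: y abs_divide divide_strict_right_mono)
      qed
      moreover have "x = pt (x $ 1) (eps *\<^sub>R y)" using decompose[OF i, of x] e by (simp add: y_def scaleR_add_right)
      ultimately have "x \<in> Nt" unfolding N_thin_eq[OF geometry e] using x1 by blast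
      then show ?thesis by blast
    qed
  qed
  have Z0: "Z x = 0" if x: "x \<notin> KZ" for x
  proof -
    consider "x $ 1 \<notin> K" | "sco G i x < alpha G * eps / 2" | "M < sco G i x" | "thick G i * eps / 8 < \<bar>tco G i x\<bar>"
      using x unfolding KZ_iff by (force simp: abs_le_iff not_le)
    then show ?thesis
    proof cases
      case 1 then show ?thesis by (simp add: Z_def f1_def K(3))
    next
      case 2
      then have "f2 x = 0" unfolding f2_def using e by (intro stepA(1)) (simp add: field_simps)
      then show ?thesis by (simp add: Z_def)
    next
      case 3
      then have "(width G i - f0) / mu i < sco G i x - alpha G * eps" by (simp add: M_def)
      then have "f3 x = 0" unfolding f3_def using mu0 by (intro B(5)) (simp add: field_simps)
      then show ?thesis by (simp add: Z_def)
    next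
      case 4
      then have "f4 x = 0" unfolding f4_def using e by (intro b(2)) (simp add: abs_mult field_simps)
      then show ?thesis by (simp add: Z_def)
    qed
  qed
  have "KZ \<subseteq> Om"
  proof
    fix x assume "x \<in> KZ"
    then show "x \<in> Om" using KZ_sub[of x] i unfolding Omega_thin_def by blast
  qed
  then have tZ: "test_function Om Z" unfolding test_function_def using sZ cKZ Z0 by blast
  have gL: "L2 Om (\<lambda>x. sco G i (g x))"
    unfolding sco_def by (rule L2_component[OF is_weak_grad_L2[OF w]])
  have id: "(LINT x|leb Om. u x * (grad Z x \<bullet> pt 0 (dir G i))) = - (LINT x|leb Om. sco G i (g x) * Z x)"
    unfolding sco_def by (rule weak_grad_test[OF w u Omega_sets tZ])
  have split: "(LINT x|leb Om. v x * q x) = sl i * (thick G i * eps) * (LINT y|leb Er. v (pm i y) * q (pm i y)) + eps\<^sup>2 * (LINT y|leb Nr. v (nm y) * q (nm y))"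
    if v: "L2 Om v" and q: "L2 Om q" and q0: "\<And>x. x \<notin> KZ \<Longrightarrow> q x = 0" for v q :: "real^3 \<Rightarrow> real"
  proof -
    have int: "integrable (leb Om) (\<lambda>x. v x * q x)" by (rule L2_integrable_mult[OF v q])
    \<comment> \<open>The support lies in plate \<open>i\<close>, its interface and the junction; up
      to the null interface it misses every other plate.\<close>
    have "(LINT x|leb (Et j). v x * q x) = 0" if j: "j \<in> idx" "j \<noteq> i" for j
    proof (rule integral_eq_zero_AE)
      have "AE x in lebesgue. x \<notin> S_thin G eps i" using negligible_S_thin[OF i] unfolding negligible_iff_null_sets by (rule AE_not_in)
      then have "AE x in lebesgue. x \<in> Et j \<longrightarrow> v x * q x = 0"
      proof eventually_elim
        case (elim x)
        then show ?case using KZ_sub[of x] q0[of x] disjoint_thin(1)[OF j(1) i j(2)] disjoint_thin(2)[OF j(1)] by auto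
      qed
      then show "AE x in leb (Et j). v x * q x = 0" using sets_E_thin[OF j(1)] by (simp add: AE_restrict_space_iff)
    qed
    then have "(\<Sum>j\<in>idx. LINT x|leb (Et j). v x * q x) = (\<Sum>j\<in>idx. if j = i then LINT x|leb (Et i). v x * q x else 0)"
      by (intro sum.cong) auto
    then show ?thesis
      using i unfolding integral_Omega(1)[OF int] integral_E_thin[OF i] integral_N_thin by (simp add: sum.delta)
  qed
  have gq: "L2 Om (\<lambda>x. grad Z x \<bullet> pt 0 (dir G i))" by (rule test_function_L2[OF test_function_grad[OF tZ] Omega_sets])
  have g0: "grad Z x \<bullet> pt 0 (dir G i) = 0" if "x \<notin> KZ" for x using grad_zero_outside[OF cKZ _ that, of Z] Z0 by simp
  have ZL: "L2 Om Z" by (rule test_function_L2[OF tZ Omega_sets])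
  have E_arg: "mu i * sco G i (pm i y) + (- alpha G * eps * mu i) = width G i / len G * y $ 2"
    "(1/eps) * tco G i (pm i y) + 0 = thick G i * y $ 3" for y
    using mu(2)[OF i] e unfolding pmap_coords[OF i] by (simp_all add: algebra_simps) (metis mult.assoc mult.commute times_divide_eq_left)
  have E_A: "stepA ((1/eps) * sco G i (pm i y) + 0) = 1" "grad stepA ((1/eps) * sco G i (pm i y) + 0) = 0" if "y \<in> Er" for y
  proof -
    have "0 \<le> sl i * y $ 2" using slen_pos[OF i] that by (simp add: E_ref_def)
    then have "alpha G \<le> (1/eps) * sco G i (pm i y) + 0" using e unfolding pmap_coords[OF i] by (simp add: field_simps)
    then show "stepA ((1/eps) * sco G i (pm i y) + 0) = 1" "grad stepA ((1/eps) * sco G i (pm i y) + 0) = 0" by (auto simp: stepA)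
  qed
  have N_arg: "sco G i (nm y) = eps * sco G i y" "tco G i (nm y) = eps * tco G i y" for y
    by (simp_all add: sco_def tco_def inner_pt algebra_simps)
  \<comment> \<open>By \<open>small\<close> the argument of \<open>B\<close> stays below
    \<open>f0\<close> in the whole junction, where \<open>B\<close> is constant, so only the
    transition \<open>stepA\<close> is differentiated there.\<close>
  have N_B: "f3 (nm y) = 1" "grad B (mu i * sco G i (nm y) + (- alpha G * eps * mu i)) = 0" if y: "y \<in> Nr" for y
  proof -
    obtain a z where y': "y = pt a z" "z \<in> omega G" using y by (auto simp: N_ref_def)
    have lt: "mu i * sco G i (nm y) + (- alpha G * eps * mu i) < f0"
      using small[OF y'(2)] by (simp add: N_arg y'(1) sco_pt algebra_simps)
    then show "f3 (nm y) = 1" unfolding f3_def by (intro B(4)) simp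
    have "grad B r = 0" if "r < f0" for r
      using grad_eq_on_open[of "{..<f0}" r B "\<lambda>_. 1"] that B(4) by simp
    then show "grad B (mu i * sco G i (nm y) + (- alpha G * eps * mu i)) = 0" using lt .
  qed
  have 1: "(LINT y|leb Er. u (pm i y) * (grad Z (pm i y) \<bullet> pt 0 (dir G i))) =
      mu i * ?tB"
    unfolding integral_mult_right_zero[symmetric]
    by (rule LINT_cong) (simp only: gZ E_arg E_A f1_def f2_def f4_def pmap_coords(1)[OF i], simp)
  have 2: "(LINT y|leb Nr. u (nm y) * (grad Z (nm y) \<bullet> pt 0 (dir G i))) =
      (1/eps) * (LINT y|leb Nr. u (nm y) * (f (y $ 1) * grad stepA (sco G i y) * b (tco G i y)))"
    unfolding integral_mult_right_zero[symmetric]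
    by (rule LINT_cong) (simp only: gZ N_B, use e in \<open>simp add: f1_def f4_def N_arg\<close>)
  have 3: "(LINT y|leb Er. sco G i (g (pm i y)) * Z (pm i y)) =
      ?tA"
    by (rule LINT_cong) (simp only: Z_def f1_def f2_def f3_def f4_def E_arg E_A pmap_coords(1)[OF i], simp)
  have 4: "(LINT y|leb Nr. sco G i (g (nm y)) * Z (nm y)) =
      ?tC"
    by (rule LINT_cong) (simp only: Z_def N_B, use e in \<open>simp add: f1_def f2_def f4_def N_arg\<close>)
  have s1: "(LINT x|leb Om. u x * (grad Z x \<bullet> pt 0 (dir G i))) = sl i * (thick G i * eps) * (LINT y|leb Er. u (pm i y) * (grad Z (pm i y) \<bullet> pt 0 (dir G i))) + eps\<^sup>2 * (LINT y|leb Nr. u (nm y) * (grad Z (nm y) \<bullet> pt 0 (dir G i)))"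
    using split[OF u gq] g0 by blast
  have s2: "(LINT x|leb Om. sco G i (g x) * Z x) = sl i * (thick G i * eps) * (LINT y|leb Er. sco G i (g (pm i y)) * Z (pm i y)) + eps\<^sup>2 * (LINT y|leb Nr. sco G i (g (nm y)) * Z (nm y))"
    using split[OF gL ZL] Z0 by blast
  \<comment> \<open>The derivative of the transition contributes 1/\<open>eps\<close> against the
    junction volume of order \<open>eps\<close> squared. After division by \<open>eps\<close> this
    term has no factor left, whereas the gradient term of the junction keeps one.\<close>
  from id [unfolded s1 s2 1 2 3 4]
  have "eps * (sl i * thick G i * mu i * ?tB +
      (LINT y|leb Nr. u (nm y) * (f (y $ 1) * grad stepA (sco G i y) * b (tco G i y)))) =
    eps * (- (sl i * thick G i * ?tA
      + eps * ?tC))"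
    using e by (simp add: power2_eq_square algebra_simps)
  then show ?thesis using e by (simp only: mult_cancel_left) simp
qed

end

section \<open>Dirichlet face and weak formulation in reference coordinates\<close>

context thin_domain
begin

lemma pmap_alt: "pm i = (\<lambda>y. plin G i (sl i) (thick G i * eps) y + pt 0 ((alpha G * eps) *\<^sub>R dir G i))"
  by (simp add: pmap_def[abs_def])

lemma smooth_pmap: "smooth f \<Longrightarrow> smooth (\<lambda>y. f (pm i y))"
  unfolding pmap_alt by (rule smooth_affine[OF _ linear_plin])

lemma grad_pmap: "smooth f \<Longrightarrow> grad (\<lambda>y. f (pm i y)) y \<bullet> axis 2 1 = sl i * sco G i (grad f (pm i y))"
proof -
  assume f: "smooth f"
  have "plin G i (sl i) (thick G i * eps) (axis 2 1) = sl i *\<^sub>R pt 0 (dir G i)"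
    by (simp add: plin_def vec_eq_iff forall_3 axis_def)
  then show ?thesis
    unfolding pmap_alt grad_affine[OF f linear_plin] by (simp add: sco_def)
qed

lemma tendsto_pmap:
  fixes us :: "nat \<Rightarrow> real^3 \<Rightarrow> 'b::euclidean_space"
  assumes "i \<in> idx" "L2_tendsto (Et i) us u"
  shows "L2_tendsto Er (\<lambda>k y. us k (pm i y)) (\<lambda>y. u (pm i y))"
  using assms(2) unfolding pmap_E_ref[OF assms(1), symmetric] scales_L2_tendsto[OF scales_pmap[OF assms(1)] sets_ref(2)] .

lemma stretch_strip:
  assumes "0 < d"
  shows "{y::real^2. y $ 1 \<in> {0<..<l} \<and> \<bar>y $ 2\<bar> < d / 2} = stretch d ` rect l (-1/2) (1/2)"
proof (intro equalityI subsetI)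
  fix y :: "real^2" assume y: "y \<in> {y. y $ 1 \<in> {0<..<l} \<and> \<bar>y $ 2\<bar> < d / 2}"
  have "y = stretch d (pt2 (y $ 1) (y $ 2 / d))" using assms by (simp add: stretch_def vec_eq_iff forall_2)
  moreover have "pt2 (y $ 1) (y $ 2 / d) \<in> rect l (-1/2) (1/2)"
    using y assms by (auto simp: rect_def field_simps abs_less_iff)
  ultimately show "y \<in> stretch d ` rect l (-1/2) (1/2)" by blast
next
  fix y :: "real^2" assume "y \<in> stretch d ` rect l (-1/2) (1/2)"
  then obtain z where z: "y = stretch d z" "z \<in> rect l (-1/2) (1/2)" by blast
  then have "\<bar>z $ 2\<bar> < 1/2" by (auto simp: rect_def abs_less_iff)
  then have "d * \<bar>z $ 2\<bar> < d * (1/2)" using assms by (intro mult_strict_left_mono)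
  then show "y \<in> {y. y $ 1 \<in> {0<..<l} \<and> \<bar>y $ 2\<bar> < d / 2}"
    using z assms by (simp add: stretch_def rect_def abs_mult)
qed

text \<open>The Dirichlet condition is available through smooth functions whose values on the face
  tend to 0. For these the fundamental theorem on the reference plate, with \<open>B\<close> equal
  to 0 at the interface and to 1 at the face, leaves only the face values.\<close>

lemma face_identity:
  assumes u: "H1_D G eps u" and m: "m = num G"
    and z: "smooth q" and B: "smooth B" "B 0 = 0" "B (width G m) = 1"
  shows "width G m / len G * (LINT y|leb Er. u (pm m y) * (q (y $ 1) * grad B (width G m / len G * y $ 2))) +
    sl m * (LINT y|leb Er. sco G m (wgrad Om u (pm m y)) * (q (y $ 1) * B (width G m / len G * y $ 2))) = 0"
proof -
  let ?tB = "\<lambda>w y. q (y $ 1) * B (w * y $ 2 + 0)"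
  let ?tA = "\<lambda>w y. q (y $ 1) * grad B (w * y $ 2 + 0)"
  have i: "m \<in> idx" using num_mem m by simp
  define w where "w = width G m / len G"
  define p where "p = pm m"
  define c where "c y = pt (y $ 1) (width G m *\<^sub>R dir G m + (y $ 2) *\<^sub>R nrm G m)" for y :: "real^2"
  have d: "0 < thick G m * eps" using G_i[OF i] eps_pos by simp
  obtain us where us: "\<And>k. smooth (us k)" "H1_tendsto Om us u"
    "L2_tendsto {y::real^2. y $ 1 \<in> I0 \<and> \<bar>y $ 2\<bar> < thick G m * eps / 2} (\<lambda>k. us k \<circ> c) (\<lambda>_. 0)"
    using u by (auto simp: H1_D_def Let_def has_trace_def m c_def[abs_def])
  \<comment> \<open>The face in its coordinates (x_1,t) is a stretched copy of the reference strip,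
    which turns the convergence of the traces into convergence on a fixed rectangle.\<close>
  have T: "L2_tendsto (rect (len G) (-1/2) (1/2)) (\<lambda>k y. us k (c (stretch (thick G m * eps) y))) (\<lambda>_. 0)"
    using us(3) scales_L2_tendsto[OF scales_stretch rect_simps(3), of "thick G m * eps" _ _ _ "\<lambda>k. us k \<circ> c" "\<lambda>_. 0"] d G_i(2)[OF i] eps_pos
    unfolding stretch_strip[OF d] by auto
  have pg: "p (c3 (y, len G)) = c (stretch (thick G m * eps) y)" for y
    using G_pos by (simp add: p_def pmap_eq c_def stretch_def c3_def slen_def)
  note H = H1_tendsto_smoothD[OF Omega_sets Omega_bounded thin_subset(1)[OF i] open_thin(1)[OF i] us(1,2)]
  have t1: "L2_tendsto Er (\<lambda>k y. us k (p y)) (\<lambda>y. u (p y))"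
    and t2: "L2_tendsto Er (\<lambda>k y. sco G m (grad (us k) (p y))) (\<lambda>y. sco G m (wgrad Om u (p y)))"
    using tendsto_pmap[OF i H(1)] L2_tendsto_component[OF tendsto_pmap[OF i H(2)]] unfolding p_def sco_def by auto
  have sz: "smooth (\<lambda>y::real^3. q (y $ 1))" by (rule smooth_nth_compose[OF z])
  have sB: "smooth (\<lambda>y::real^3. B (w * y $ 2 + 0))" "smooth (\<lambda>y::real^3. grad B (w * y $ 2 + 0))"
    by (rule smooth_affine_real[OF B(1) smooth_nth], rule smooth_affine_real[OF smooth_grad_real[OF B(1)] smooth_nth])
  have gB: "grad (\<lambda>y::real^3. B (w * y $ 2 + 0)) y \<bullet> axis 2 1 = w * grad B (w * y $ 2 + 0)" for y
    using grad_affine_real[OF B(1) smooth_nth, of w 2 0 y] grad_nth_compose[OF smooth_id, of 2 y] grad_DERIV[OF DERIV_ident, of "y $ 2"]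
    by (simp add: inner_axis_axis)
  have gz: "grad (\<lambda>y::real^3. q (y $ 1)) y \<bullet> axis 2 1 = 0" for y
    by (simp add: grad_nth_compose[OF z] inner_axis_axis)
  define F where "F k y = us k (p y) * (?tB w y)" for k y
  have sp: "smooth (\<lambda>y. us k (p y))" for k unfolding p_def by (rule smooth_pmap[OF us(1)])
  have sF: "smooth (F k)" for k unfolding F_def[abs_def] by (intro smooth_mult sp sz sB)
  have gF: "grad (F k) y \<bullet> axis 2 1 = us k (p y) * (w * (?tA w y)) +
      sl m * (sco G m (grad (us k) (p y)) * (?tB w y))" for k y
    unfolding F_def[abs_def] grad_mult[OF sp smooth_mult[OF sz sB(1)]] grad_mult[OF sz sB(1)]
      inner_add_left inner_scaleR_left gB gz
    using grad_pmap[OF us(1), of k m y, folded p_def] by simp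
  have b: "L2 Er f" if "smooth f" for f :: "real^3 \<Rightarrow> real" by (rule L2_smooth[OF bounded_ref(2) sets_ref(2) that])
  note c1 = L2_tendsto_const[OF b[OF smooth_mult[OF sz sB(2)]]] and c2 = L2_tendsto_const[OF b[OF smooth_mult[OF sz sB(1)]]]
  have i1: "integrable (leb Er) (\<lambda>y. us k (p y) * (?tA w y))" for k
    by (rule L2_integrable_mult[OF L2_tendstoD(1)[OF t1] L2_tendstoD(1)[OF c1]])
  have i2: "integrable (leb Er) (\<lambda>y. sco G m (grad (us k) (p y)) * (?tB w y))" for k
    by (rule L2_integrable_mult[OF L2_tendstoD(1)[OF t2] L2_tendstoD(1)[OF c2]])
  have "w * (LINT y|leb Er. us k (p y) * (?tA w y)) +
      sl m * (LINT y|leb Er. sco G m (grad (us k) (p y)) * (?tB w y)) =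
      (LINT y|leb (rect (len G) (-1/2) (1/2)). us k (c (stretch (thick G m * eps) y)) * q (y $ 1))" for k
  proof -
    have "(LINT y|leb Er. grad (F k) y \<bullet> axis 2 1) =
      (LINT y|leb (rect (len G) (-1/2) (1/2)). us k (c (stretch (thick G m * eps) y)) * q (y $ 1))"
      using slab_FTC[OF sF, of "len G" "len G" k] G_pos B(2,3) by (simp add: E_ref_slab F_def pg w_def)
    moreover have "(LINT y|leb Er. grad (F k) y \<bullet> axis 2 1) =
      w * (LINT y|leb Er. us k (p y) * (?tA w y)) +
      sl m * (LINT y|leb Er. sco G m (grad (us k) (p y)) * (?tB w y))"
      unfolding gF mult.left_commute[of _ w] using i1 i2 by simp
    ultimately show ?thesis by simp
  qed
  moreover have "(\<lambda>k. w * (LINT y|leb Er. us k (p y) * (?tA w y)) +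
      sl m * (LINT y|leb Er. sco G m (grad (us k) (p y)) * (?tB w y))) \<longlonglongrightarrow>
      w * (LINT y|leb Er. u (p y) * (?tA w y)) +
      sl m * (LINT y|leb Er. sco G m (wgrad Om u (p y)) * (?tB w y))"
    by (rule tendsto_add[OF tendsto_mult_left[OF L2_tendsto_mult[OF t1 c1]] tendsto_mult_left[OF L2_tendsto_mult[OF t2 c2]]])
  moreover have "(\<lambda>k. LINT y|leb (rect (len G) (-1/2) (1/2)). us k (c (stretch (thick G m * eps) y)) * q (y $ 1)) \<longlonglongrightarrow>
      (LINT y|leb (rect (len G) (-1/2) (1/2)). 0 * q (y $ 1))"
    by (rule L2_tendsto_mult[OF T L2_tendsto_const[OF L2_smooth[OF rect_simps(2,3) smooth_nth_compose[OF z]]]])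
  ultimately have "w * (LINT y|leb Er. u (p y) * (?tA w y)) +
      sl m * (LINT y|leb Er. sco G m (wgrad Om u (p y)) * (?tB w y)) = (LINT y|leb (rect (len G) (-1/2) (1/2)). 0 * q (y $ 1))"
    using LIMSEQ_unique by fastforce
  then show ?thesis by (simp add: w_def p_def)
qed

lemma kap_thin_E: "i \<in> idx \<Longrightarrow> x \<in> Et i \<Longrightarrow> kap_thin G D eps x = kap D i"
  and src_thin_E: "i \<in> idx \<Longrightarrow> x \<in> Et i \<Longrightarrow> src_thin G D eps x = src D i x"
proof -
  assume i: "i \<in> idx" and x: "x \<in> Et i"
  have o: "x \<notin> Et j" if "j \<in> idx" "j \<noteq> i" for j using disjoint_thin(1)[OF i that(1)] that x by auto
  have N: "x \<notin> Nt" using disjoint_thin(2)[OF i] x by auto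
  have s: "(\<Sum>j\<in>idx. indicator (Et j) x * q j) = q i" for q :: "nat \<Rightarrow> real"
  proof -
    have "(\<Sum>j\<in>idx. indicator (Et j) x * q j) = (\<Sum>j\<in>idx. if j = i then q i else 0)"
      using o x by (intro sum.cong) auto
    then show ?thesis using i by (simp add: sum.delta)
  qed
  show "kap_thin G D eps x = kap D i" "src_thin G D eps x = src D i x" unfolding kap_thin_def src_thin_def s using N by simp_all
qed

lemma kap_thin_N: "x \<in> Nt \<Longrightarrow> kap_thin G D eps x = kapN D"
  and src_thin_N: "x \<in> Nt \<Longrightarrow> src_thin G D eps x = 1 / (eps * measure lebesgue (omega G)) * srcN D x"
proof -
  assume x: "x \<in> Nt"
  have "x \<notin> Et j" if "j \<in> idx" for j using disjoint_thin(2)[OF that] x by auto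
  then have s: "(\<Sum>j\<in>idx. indicator (Et j) x * q j) = 0" for q :: "nat \<Rightarrow> real" by (intro sum.neutral) auto
  show "kap_thin G D eps x = kapN D" "src_thin G D eps x = 1 / (eps * measure lebesgue (omega G)) * srcN D x"
    unfolding kap_thin_def src_thin_def s using x by simp_all
qed

lemma indicator_Om: "A \<in> sets lebesgue \<Longrightarrow> (indicator A :: real^3 \<Rightarrow> real) \<in> mbl Om"
  by (rule measurable_restrict_space1) simp

text \<open>A smooth function vanishing on the Dirichlet face is admissible, its own constant
  sequence being the approximation that the trace requires. A common factor \<open>eps\<close> is
  removed: plate terms keep order 1, diffusion in the junction order \<open>eps\<close>, and the
  source there loses its singular factor.\<close>

lemma weak_form:
  assumes sol: "thin_weak_solution G D eps u" and D: "admissible_coefficients G D" and P: "smooth f"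
    and P0: "\<And>a t. a \<in> I0 \<Longrightarrow> \<bar>t\<bar> < thick G (num G) * eps / 2 \<Longrightarrow> f (pt a (width G (num G) *\<^sub>R dir G (num G) + t *\<^sub>R nrm G (num G))) = 0"
  shows "(\<Sum>i\<in>idx. kap D i * sl i * thick G i * (LINT y|leb Er. wgrad Om u (pm i y) \<bullet> grad f (pm i y))) +
      kapN D * eps * (LINT y|leb Nr. wgrad Om u (nm y) \<bullet> grad f (nm y)) =
    (\<Sum>i\<in>idx. sl i * thick G i * (LINT y|leb Er. src D i (pm i y) * f (pm i y))) +
      (1 / measure lebesgue (omega G)) * (LINT y|leb Nr. srcN D (nm y) * f (nm y))"
proof -
  let ?tB = "\<lambda>m. \<lambda>k. f \<circ> (\<lambda>y. pt (y $ 1) (width G m *\<^sub>R dir G m + (y $ 2) *\<^sub>R nrm G m))"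
  let ?tA = "eps * measure lebesgue (omega G)"
  define m where "m = num G"
  let ?T = "{y::real^2. y $ 1 \<in> I0 \<and> \<bar>y $ 2\<bar> < thick G m * eps / 2}"
  let ?g = "wgrad Om u"
  have H: "H1 Om f" by (rule smooth_H1[OF Omega_bounded Omega_sets P])
  have HD: "H1_D G eps f"
  proof -
    have "L2_tendsto ?T (?tB m) (\<lambda>_. 0)
      = L2_tendsto ?T (\<lambda>k _. 0::real) (\<lambda>_. 0)"
      using P0 by (intro L2_tendsto_cong) (auto simp: m_def)
    then have T: "L2_tendsto ?T (?tB m) (\<lambda>_. 0)"
      by (simp add: L2_tendsto_const)
    have HT: "H1_tendsto Om (\<lambda>k. f) f" unfolding H1_tendsto_def
      using H L2_tendsto_const[OF H1_L2[OF H]] L2_tendsto_const[OF L2_wgrad[OF H]] by blast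
    show ?thesis unfolding H1_D_def Let_def has_trace_def m_def[symmetric] by (intro conjI exI[of _ "\<lambda>k. f"] allI H P T HT)
  qed
  have uH: "H1 Om u" using sol by (simp add: thin_weak_solution_def H1_D_def)
  have eq: "(LINT x|leb Om. kap_thin G D eps x * (?g x \<bullet> wgrad Om f x)) = (LINT x|leb Om. src_thin G D eps x * f x)"
    using sol HD by (auto simp: thin_weak_solution_def Let_def)
  have km: "kap_thin G D eps \<in> mbl Om"
    unfolding kap_thin_def[abs_def]
    by (intro borel_measurable_add borel_measurable_sum borel_measurable_times borel_measurable_const indicator_Om sets_E_thin sets_ref) auto
  have cD: "continuous_on UNIV (srcN D)" "\<And>i. i \<in> idx \<Longrightarrow> continuous_on UNIV (src D i)"
    using D by (auto simp: admissible_coefficients_def)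
  have sm: "src_thin G D eps \<in> mbl Om"
    unfolding src_thin_def[abs_def]
    by (intro borel_measurable_add borel_measurable_sum borel_measurable_times borel_measurable_const indicator_Om sets_E_thin sets_ref continuous_measurable_lebesgue_on cD) auto
  have ind: "\<bar>indicator A x * c\<bar> \<le> \<bar>c\<bar>" for A :: "(real^3) set" and x and c :: real by (auto simp: indicator_def)
  have ik: "integrable (leb Om) (\<lambda>x. kap_thin G D eps x * (?g x \<bullet> wgrad Om f x))"
  proof -
    have "\<bar>kap_thin G D eps x\<bar> \<le> (\<Sum>i\<in>idx. \<bar>kap D i\<bar>) + \<bar>kapN D\<bar>" for x
      unfolding kap_thin_def by (rule order_trans[OF abs_triangle_ineq add_mono[OF order_trans[OF sum_abs sum_mono] ind]]) (rule ind)
    from L2_integrable_inner[OF L2_mult_bounded[OF L2_wgrad[OF uH] km this] L2_wgrad[OF H]] show ?thesis by simp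
  qed
  have iS: "integrable (leb Om) (\<lambda>x. src_thin G D eps x * f x)"
  proof -
    have "\<exists>C. \<forall>x\<in>Om. norm (src D i x) \<le> C" if "i \<in> idx" for i
      using continuous_bounded_on[OF Omega_bounded cD(2)[OF that]] by metis
    then obtain C where C: "\<And>i x. i \<in> idx \<Longrightarrow> x \<in> Om \<Longrightarrow> norm (src D i x) \<le> C i" by metis
    obtain CN where CN: "\<And>x. x \<in> Om \<Longrightarrow> norm (srcN D x) \<le> CN" using continuous_bounded_on[OF Omega_bounded cD(1)] by metis
    have "norm (src_thin G D eps x) \<le> (\<Sum>i\<in>idx. C i) + \<bar>1 / ?tA\<bar> * CN" if x: "x \<in> Om" for x
    proof -
      have "\<bar>indicator Nt x * (1 / ?tA * srcN D x)\<bar> \<le> \<bar>1 / ?tA\<bar> * CN"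
        using CN[OF x] by (intro order_trans[OF ind]) (auto simp: abs_mult intro: mult_left_mono divide_right_mono)
      moreover have "\<bar>indicator (Et i) x * src D i x\<bar> \<le> C i" if "i \<in> idx" for i
        using C[OF that x] by (intro order_trans[OF ind]) simp
      ultimately show ?thesis unfolding src_thin_def real_norm_def
        by (intro order_trans[OF abs_triangle_ineq add_mono[OF order_trans[OF sum_abs sum_mono]]])
    qed
    from L2_bounded[OF bounded_set_imp_lmeasurable[OF Omega_bounded Omega_sets] sm this]
    show ?thesis by (rule L2_integrable_mult[OF _ H1_L2[OF H]])
  qed
  \<comment> \<open>\<open>wgrad\<close> is a choice made on the whole domain; on each open piece
    uniqueness identifies it with the classical gradient.\<close>
  have ae: "AE x in leb S. wgrad Om f x = grad f x" if S: "open S" "S \<subseteq> Om" for S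
  proof (rule weak_grad_unique[OF S(1)])
    have s: "S \<in> sets lebesgue" using S by simp
    show "is_weak_grad S f (wgrad Om f)" by (rule weak_grad_subset[OF S(2) s Omega_sets weak_grad_wgrad[OF H]])
    show "is_weak_grad S f (grad f)" by (rule smooth_weak_grad[OF bounded_subset[OF Omega_bounded S(2)] s P])
  qed
  have L: "(LINT x|leb S. kap_thin G D eps x * (?g x \<bullet> wgrad Om f x)) = (LINT x|leb S. c * (?g x \<bullet> grad f x))"
    if S: "open S" "S \<subseteq> Om" and c: "\<And>x. x \<in> S \<Longrightarrow> kap_thin G D eps x = c" for S c
  proof -
    have s: "S \<in> sets lebesgue" using S by simp
    have g: "L2 S ?g" by (rule L2_subset[OF S(2) s Omega_sets L2_wgrad[OF uH]])
    have "(LINT x|leb S. kap_thin G D eps x * (?g x \<bullet> wgrad Om f x)) = (LINT x|leb S. c * (?g x \<bullet> wgrad Om f x))"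
      by (rule LINT_cong) (simp add: c)
    also have "\<dots> = (LINT x|leb S. c * (?g x \<bullet> grad f x))"
    proof (rule integral_cong_AE)
      show "(\<lambda>x. c * (?g x \<bullet> wgrad Om f x)) \<in> mbl S"
        using L2_integrable_inner[OF g L2_subset[OF S(2) s Omega_sets L2_wgrad[OF H]]] by (intro borel_measurable_times) auto
      show "(\<lambda>x. c * (?g x \<bullet> grad f x)) \<in> mbl S"
        using L2_integrable_inner[OF g L2_grad[OF bounded_subset[OF Omega_bounded S(2)] s P]] by (intro borel_measurable_times) auto
      show "AE x in leb S. c * (?g x \<bullet> wgrad Om f x) = c * (?g x \<bullet> grad f x)" using ae[OF S] by eventually_elim simp
    qed
    finally show ?thesis .
  qed
  let ?F = "\<lambda>x. ?g x \<bullet> grad f x"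
  have K: "(LINT x|leb (Et i). kap_thin G D eps x * (?g x \<bullet> wgrad Om f x)) =
      eps * (kap D i * sl i * thick G i * (LINT y|leb Er. ?F (pm i y)))" if i: "i \<in> idx" for i
    using L[OF open_thin(1)[OF i] thin_subset(1)[OF i] kap_thin_E[OF i]] integral_E_thin[OF i, of ?F] by simp
  have KN: "(LINT x|leb Nt. kap_thin G D eps x * (?g x \<bullet> wgrad Om f x)) =
      eps * (kapN D * eps * (LINT y|leb Nr. ?F (nm y)))"
    using L[OF open_thin(2) thin_subset(2) kap_thin_N] integral_N_thin[of ?F] by (simp add: power2_eq_square)
  have R: "(LINT x|leb (Et i). src_thin G D eps x * f x) =
      eps * (sl i * thick G i * (LINT y|leb Er. src D i (pm i y) * f (pm i y)))" if i: "i \<in> idx" for i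
  proof -
    have "(LINT x|leb (Et i). src_thin G D eps x * f x) = (LINT x|leb (Et i). src D i x * f x)"
      by (rule LINT_cong) (simp add: src_thin_E[OF i])
    then show ?thesis using integral_E_thin[OF i, of "\<lambda>x. src D i x * f x"] by simp
  qed
  have RN: "(LINT x|leb Nt. src_thin G D eps x * f x) =
      eps * ((1 / measure lebesgue (omega G)) * (LINT y|leb Nr. srcN D (nm y) * f (nm y)))"
  proof -
    have "(LINT x|leb Nt. src_thin G D eps x * f x) = (LINT x|leb Nt. 1 / ?tA * (srcN D x * f x))"
      by (rule LINT_cong) (simp add: src_thin_N)
    also have "\<dots> = 1 / ?tA * (LINT x|leb Nt. srcN D x * f x)" by (rule integral_mult_right_zero)
    finally show ?thesis using integral_N_thin[of "\<lambda>x. srcN D x * f x"] eps_pos by (simp add: power2_eq_square)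
  qed
  have "eps * ((\<Sum>i\<in>idx. kap D i * sl i * thick G i * (LINT y|leb Er. ?F (pm i y))) +
      kapN D * eps * (LINT y|leb Nr. ?F (nm y))) =
    eps * ((\<Sum>i\<in>idx. sl i * thick G i * (LINT y|leb Er. src D i (pm i y) * f (pm i y))) +
      (1 / measure lebesgue (omega G)) * (LINT y|leb Nr. srcN D (nm y) * f (nm y)))"
    using eq unfolding integral_Omega(1)[OF ik] integral_Omega(1)[OF iS] KN RN
    by (simp only: K R distrib_left sum_distrib_left cong: sum.cong)
  then show ?thesis using eps_pos by simp
qed

end

section \<open>Passage to the limit\<close>

lemma continuous_stretch: "continuous_on UNIV p \<Longrightarrow> continuous_on UNIV (\<lambda>y. p (stretch a y))"
  by (rule continuous_on_compose2[OF _ linear_continuous_on]) (auto simp: linear_stretch linear_conv_bounded_linear[symmetric])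

context thin_geometry
begin

definition "ratio i = len G / width G i"

lemma ratio: assumes "i \<in> idx" shows "0 < ratio i" "ratio i * width G i = len G" "width G i / len G * ratio i = 1" "width G i / len G = 1 / ratio i"
  using G_pos G_i[OF assms] by (auto simp: ratio_def)

lemma stretch_E_dom: "i \<in> idx \<Longrightarrow> rect (len G) 0 (len G) = stretch (ratio i) ` Dm i"
  by (simp add: E_dom_rect stretch_rect ratio)

lemma E_dom_simps [simp]: "open (Dm i)" "bounded (Dm i)" "Dm i \<in> sets lebesgue" "Dm i \<in> lmeasurable"
  by (simp_all add: E_dom_rect)

text \<open>For cylindrical data the thickness integrates out, and the stretch from the rectangle of
  the hypergraph to the reference square contributes \<open>ratio i\<close>.\<close>

lemma E_ref_to_E_dom:
  fixes f p :: "real^2 \<Rightarrow> real"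
  assumes i: "i \<in> idx" and f: "L2 (rect (len G) 0 (len G)) f" and p: "continuous_on UNIV p" and q: "continuous_on UNIV q"
  shows "(LINT y|leb Er. f (proj12 y) * (p (pd i y) * q (y $ 3))) =
    ratio i * (LINT y|leb (Dm i). f (stretch (ratio i) y) * p y) * (LINT t|leb {-1/2<..<1/2}. q t)"
proof -
  let ?f = "\<lambda>y. f y * p (stretch (width G i / len G) y)"
  have "integrable (leb (rect (len G) 0 (len G))) ?f"
    by (rule L2_integrable_mult[OF f L2_continuous[OF rect_simps(2,3) continuous_stretch[OF p]]])
  from slab_product(2)[OF this q]
  have "(LINT y|leb Er. f (proj12 y) * (p (pd i y) * q (y $ 3))) =
    (LINT y|leb (rect (len G) 0 (len G)). ?f y) * (LINT t|leb {-1/2<..<1/2}. q t)"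
    by (simp add: E_ref_slab stretch_def mult.assoc)
  moreover have "(LINT y|leb (rect (len G) 0 (len G)). ?f y) = ratio i * (LINT y|leb (Dm i). ?f (stretch (ratio i) y))"
    unfolding stretch_E_dom[OF i] using scales_LINT[OF scales_stretch E_dom_simps(3), of "ratio i" i ?f] ratio(1)[OF i] by simp
  moreover have "stretch (width G i / len G) (stretch (ratio i) y) = y" for y
    using G_pos G_i(1)[OF i] by (simp add: stretch_def vec_eq_iff forall_2 ratio_def)
  ultimately show ?thesis by simp
qed

end

locale thin_limit = thin_geometry +
  fixes D :: coefficients and eps :: "nat \<Rightarrow> real" and u :: "nat \<Rightarrow> real^3 \<Rightarrow> real"
    and u0E :: "nat \<Rightarrow> real^2 \<Rightarrow> real" and u0N :: "real \<Rightarrow> real"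
  assumes coefficients: "admissible_coefficients G D"
    and eps_admissible: "\<And>k. admissible_eps G (eps k)"
    and eps_tendsto: "eps \<longlonglongrightarrow> 0"
    and weak_solution: "\<And>k. thin_weak_solution G D (eps k) (u k)"
    and u0E_H1: "\<And>i. i \<in> {1..num G} \<Longrightarrow>
      H1 {y. y $ 1 \<in> {0<..<len G} \<and> y $ 2 \<in> {0<..<len G}} (u0E i)"
    and u0N_L2: "L2 {0<..<len G} u0N"
    and uE_strong: "\<And>i. i \<in> {1..num G} \<Longrightarrow>
      L2_tendsto (E_ref G) (\<lambda>k. to_E_ref G (eps k) i (u k)) (\<lambda>x. u0E i (pt2 (x $ 1) (x $ 2)))"
    and grad_uE_weak: "\<And>i. i \<in> {1..num G} \<Longrightarrow>
      L2_weak_tendsto (E_ref G) (\<lambda>k. wgrad (E_ref G) (to_E_ref G (eps k) i (u k)))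
        (wgrad (E_ref G) (\<lambda>x. u0E i (pt2 (x $ 1) (x $ 2))))"
    and uN_weak:
      "L2_weak_tendsto (N_ref G) (\<lambda>k. to_N_ref (eps k) (u k)) (\<lambda>x. u0N (x $ 1))"
    and grad_perp_uN_strong:
      "L2_tendsto (N_ref G)
         (\<lambda>k x. let v = wgrad (N_ref G) (to_N_ref (eps k) (u k)) x in pt2 (v $ 2) (v $ 3))
         (\<lambda>_. 0)"
begin

abbreviation "pm k \<equiv> pmap G (eps k)"
abbreviation "nm k \<equiv> nmap (eps k)"
abbreviation "sl k \<equiv> slen G (eps k)"
abbreviation "mu k \<equiv> thin_domain.mu G (eps k)"

lemma dom: "thin_domain G (eps k)"
  by (intro thin_domain.intro thin_domain_axioms.intro thin_geometry_axioms eps_admissible)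

abbreviation "Q \<equiv> rect (len G) 0 (len G)"
abbreviation "g k \<equiv> wgrad (Omega_thin G (eps k)) (u k)"

definition "W i = wgrad Q (u0E i)"
text \<open>The limit u^0 in the chart of \<open>E_rect G i\<close>; \<open>lim_g\<close> is its
  gradient, whose second component acquires the factor \<open>ratio i\<close> from the
  stretch.\<close>

definition "lim_u i y = u0E i (stretch (ratio i) y)"
definition "lim_g i y = stretch (ratio i) (W i (stretch (ratio i) y))"

lemma uH: "H1 (Omega_thin G (eps k)) (u k)" and uD: "H1_D G (eps k) (u k)"
  using weak_solution[of k] by (simp_all add: thin_weak_solution_def H1_D_def)

lemma W:
  assumes "i \<in> idx" shows "L2 Q (u0E i)" "is_weak_grad Q (u0E i) (W i)" "L2 Q (\<lambda>y. W i y $ j)"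
proof -
  have "H1 Q (u0E i)" using u0E_H1[OF assms] by (simp add: rect_def)
  then show "L2 Q (u0E i)" and w: "is_weak_grad Q (u0E i) (W i)" unfolding W_def by (rule H1_L2, rule weak_grad_wgrad)
  show "L2 Q (\<lambda>y. W i y $ j)" by (rule L2_vec_nth[OF is_weak_grad_L2[OF w]])
qed

lemma lim_u:
  assumes i: "i \<in> idx" shows "L2 (Dm i) (lim_u i)" "is_weak_grad (Dm i) (lim_u i) (lim_g i)" "L2 (Dm i) (lim_g i)"
proof -
  show "L2 (Dm i) (lim_u i)"
    using W(1)[OF i] ratio(1)[OF i] unfolding stretch_E_dom[OF i] lim_u_def[abs_def] by (subst (asm) scales_L2[OF scales_stretch E_dom_simps(3)]) auto
  show w: "is_weak_grad (Dm i) (lim_u i) (lim_g i)"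
    unfolding lim_u_def[abs_def] lim_g_def[abs_def] E_dom_rect
    by (rule weak_grad_stretch[OF ratio(1)[OF i]]) (use W[OF i] in \<open>simp_all add: ratio(2)[OF i]\<close>)
  show "L2 (Dm i) (lim_g i)" by (rule is_weak_grad_L2[OF w])
qed

lemma slen_tendsto: "(\<lambda>k. sl k i) \<longlonglongrightarrow> width G i / len G"
proof -
  have "(\<lambda>k. (width G i - alpha G * eps k) / len G) \<longlonglongrightarrow> (width G i - alpha G * 0) / len G"
    using G_pos(1) by (intro tendsto_intros eps_tendsto) auto
  then show ?thesis by (simp add: slen_def)
qed

lemma u_tendsto_E:
  assumes i: "i \<in> idx"
  shows "L2_tendsto Er (\<lambda>k y. u k (pm k i y)) (\<lambda>y. u0E i (proj12 y))"
  using uE_strong[OF i] by (simp add: thin_domain.wgrad_E_ref(1)[OF dom i uH])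

text \<open>Testing the weakly convergent gradients with \<open>q\<close> times a basis vector
  isolates one component, which \<open>wgrad_E_ref\<close> rewrites by the gradient on the thin
  domain. The factor \<open>sl k i\<close> stays inside the limit because it belongs to the
  transformed derivative.\<close>

lemma g_tendsto_E:
  assumes i: "i \<in> idx" and q: "L2 Er q"
  shows "(\<lambda>k. LINT y|leb Er. g k (pm k i y) $ 1 * q y) \<longlonglongrightarrow> (LINT y|leb Er. W i (proj12 y) $ 1 * q y)"
    "(\<lambda>k. sl k i * (LINT y|leb Er. sco G i (g k (pm k i y)) * q y)) \<longlonglongrightarrow> (LINT y|leb Er. W i (proj12 y) $ 2 * q y)"
proof -
  have S: "Er \<in> sets lebesgue" "open Er" by (simp_all add: E_ref_slab)
  have pa: "L2 Er (\<lambda>y. q y *\<^sub>R axis j (1::real) :: real^3)" for j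
    by (rule L2_bounded_linear[OF bounded_linear_scaleR_left q])
  have conv: "(LINT y|leb Er. f y \<bullet> (q y *\<^sub>R axis j 1)) = (LINT y|leb Er. f' y $ j * q y)"
    if f: "L2 Er f" and ff: "AE y in leb Er. f y = f' y" for f f' :: "real^3 \<Rightarrow> real^3" and j
  proof (rule integral_cong_AE)
    show "(\<lambda>y. f y \<bullet> (q y *\<^sub>R axis j 1)) \<in> mbl Er"
      by (rule borel_measurable_integrable[OF L2_integrable_inner[OF f pa]])
    show "(\<lambda>y. f' y $ j * q y) \<in> mbl Er"
      by (rule borel_measurable_integrable[OF L2_integrable_mult[OF L2_vec_nth[OF L2_cong_AE[OF S(1) ff f]] q]])
    show "AE y in leb Er. f y \<bullet> (q y *\<^sub>R axis j 1) = f' y $ j * q y"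
      using ff by eventually_elim (simp add: cart_eq_inner_axis)
  qed
  note wk = grad_uE_weak[OF i]
  have L: "L2 Er (wgrad Er (to_E_ref G (eps k) i (u k)))" "L2 Er (wgrad Er (\<lambda>x. u0E i (proj12 x)))" for k
    using wk by (auto simp: L2_weak_tendsto_def)
  have lim: "(\<lambda>k. LINT y|leb Er. wgrad Er (to_E_ref G (eps k) i (u k)) y \<bullet> (q y *\<^sub>R axis j 1)) \<longlonglongrightarrow>
      (LINT y|leb Er. wgrad Er (\<lambda>x. u0E i (proj12 x)) y \<bullet> (q y *\<^sub>R axis j 1))" for j
    using wk pa unfolding L2_weak_tendsto_def by blast
  have "AE y in leb Er. wgrad Er (\<lambda>x. u0E i (proj12 x)) y = vector [W i (proj12 y) $ 1, W i (proj12 y) $ 2, 0]"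
    using weak_grad_cylinder[OF G_pos(1,1) W(1,2)[OF i]] L2_cylinder(1)[OF W(1)[OF i]] S(2) unfolding E_ref_slab by (intro wgrad_AE)
  note l = conv[OF L(2) this] and lk = conv[OF L(1) thin_domain.wgrad_E_ref(4)[OF dom i uH]]
  from lim[of 1] show "(\<lambda>k. LINT y|leb Er. g k (pm k i y) $ 1 * q y) \<longlonglongrightarrow> (LINT y|leb Er. W i (proj12 y) $ 1 * q y)"
    unfolding l lk by simp
  from lim[of 2] show "(\<lambda>k. sl k i * (LINT y|leb Er. sco G i (g k (pm k i y)) * q y)) \<longlonglongrightarrow> (LINT y|leb Er. W i (proj12 y) $ 2 * q y)"
    unfolding l lk by (simp add: mult.assoc)
qed

lemma u_tendsto_N:
  assumes "L2 Nr q"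
  shows "(\<lambda>k. LINT y|leb Nr. u k (nm k y) * q y) \<longlonglongrightarrow> (LINT y|leb Nr. u0N (y $ 1) * q y)"
  using uN_weak assms by (simp add: L2_weak_tendsto_def thin_domain.wgrad_N_ref(1)[OF dom uH])

text \<open>The component along \<open>dir G i\<close>, multiplied by \<open>eps k\<close>, is a
  cross-sectional derivative of the transformed function, hence tends to 0 strongly.\<close>

lemma g_tendsto_N:
  assumes p: "L2 Nr q"
  shows "(\<lambda>k. eps k * (LINT y|leb Nr. sco G i (g k (nm k y)) * q y)) \<longlonglongrightarrow> 0"
proof -
  have S: "Nr \<in> sets lebesgue" by (rule thin_domain.sets_ref(1)[OF dom])
  let ?V = "\<lambda>k. wgrad Nr (to_N_ref (eps k) (u k))"
  have "L2_tendsto Nr (\<lambda>k x. pt2 (?V k x $ 2) (?V k x $ 3) \<bullet> dir G i) (\<lambda>x. 0 \<bullet> dir G i)"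
    by (rule L2_tendsto_component[OF grad_perp_uN_strong [unfolded Let_def]])
  then have "L2_tendsto Nr (\<lambda>k x. eps k * sco G i (g k (nm k x))) (\<lambda>x. 0)"
  proof (rule L2_tendsto_cong_AE[OF S])
    show "AE x in leb Nr. pt2 (?V k x $ 2) (?V k x $ 3) \<bullet> dir G i = eps k * sco G i (g k (nm k x))" for k
      using thin_domain.wgrad_N_ref(5)[OF dom uH, of k] by eventually_elim (simp add: sco_def inner_pt inner_2 algebra_simps)
  qed simp
  from L2_tendsto_mult[OF this L2_tendsto_const[OF p]] show ?thesis by (simp add: mult.assoc)
qed

lemma eps_eventually: "0 < e \<Longrightarrow> \<forall>\<^sub>F k in sequentially. eps k < e"
  by (rule order_tendstoD(2)[OF eps_tendsto])

abbreviation "A \<equiv> thin_domain.stepA G"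

lemma smooth_lin: "smooth f \<Longrightarrow> smooth (\<lambda>s::real. f (a * s + b))"
  by (rule smooth_affine_real[OF _ smooth_id])

text \<open>The limit of \<open>plate_identity\<close>. Every term carries the factor
  \<open>thick G i * c\<close>, where \<open>c\<close> is the mass of the cutoff \<open>b\<close> in
  reference thickness; dividing by it frees the term with \<open>u0N\<close> from the plate, so that
  all plates get the same boundary function.\<close>

lemma trace_identity:
  assumes i: "i \<in> idx" and z: "test_function I0 q"
    and B: "B = (\<lambda>s. 1 - step (3 / width G i * s + (-1)))"
  shows "(LINT y|leb (Dm i). lim_u i y * (q (y $ 1) * grad B (y $ 2))) +
    (LINT y|leb (Dm i). (lim_g i y \<bullet> e2) * (q (y $ 1) * B (y $ 2))) = - (LINT x|leb I0. u0N x * q x)"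
proof -
  let ?tA = "\<lambda>k y. eps k * (y \<bullet> dir G i) - alpha G * eps k"
  \<comment> \<open>\<open>B\<close> falls from 1 to 0 between one third and two thirds of the
    width.\<close>
  define r where "r = width G i / 3"
  have w: "0 < width G i" "0 < thick G i" using G_i[OF i] by auto
  have sB: "smooth B" unfolding B by (intro smooth_diff smooth_const smooth_lin smooth_step)
  have B1: "B s = 1" if "s \<le> r" for s using that w unfolding B r_def by (simp add: step_0 field_simps)
  have B0: "B s = 0" if "width G i - r \<le> s" for s using that w unfolding B r_def by (simp add: step_1 field_simps)
  have d: "0 < r" "r < width G i" using w by (auto simp: r_def)
  define b where "b = bump (- (thick G i / 8)) (thick G i / 8)"
  have sb: "smooth b" and b0: "\<And>t. thick G i / 8 \<le> \<bar>t\<bar> \<Longrightarrow> b t = 0" unfolding b_def by (rule smooth_bump) (auto intro!: bump_0)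
  define c where "c = (LINT t|leb {-1/2<..<1/2::real}. b (thick G i * t))"
  have cb: "continuous_on UNIV (\<lambda>t. b (thick G i * t))" using smooth_continuous[OF smooth_lin[OF sb, of "thick G i" 0]] by simp
  have c: "0 < c" unfolding c_def
  proof (rule integral_continuous_pos[OF _ cb integrable_continuous_interval[OF cb], where x = 0])
    show "0 < b (thick G i * 0)" unfolding b_def using w by (intro bump_pos) simp
    show "0 \<le> b (thick G i * x)" for x unfolding b_def by (rule bump_nonneg)
  qed auto
  obtain R where R: "0 < R" "\<And>y. y \<in> omega G \<Longrightarrow> norm y \<le> R" using thin_domain.omega_bounded(1)[OF dom] bounded_pos by metis
  \<comment> \<open>The first bound on \<open>eps k\<close> gives \<open>mu k i\<close> <= 2, the
    second keeps the height of the junction below r/2; the product is then below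
    \<open>r\<close>.\<close>
  have small: "\<forall>\<^sub>F k in sequentially. \<forall>y\<in>omega G. (?tA k y) * mu k i < r"
  proof -
    have "\<forall>\<^sub>F k in sequentially. eps k < width G i / (2 * alpha G)" "\<forall>\<^sub>F k in sequentially. eps k < r / (2 * R)"
      using w d R G_pos by (auto intro!: eps_eventually)
    then show ?thesis
    proof eventually_elim
      case (elim k)
      interpret T: thin_domain G "eps k" by (rule dom)
      have mu: "1 < T.mu i" "T.mu i \<le> 2" using T.mu(1)[OF i] elim(1) G_pos(2) w T.eps_pos unfolding T.mu_def by (auto simp: field_simps)
      show ?case
      proof
        fix y assume y: "y \<in> omega G"
        have "y \<bullet> dir G i \<le> R" using norm_cauchy_schwarz[of y "dir G i"] R(2)[OF y] G_i(3)[OF i] by simp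
        then have "eps k * (y \<bullet> dir G i) \<le> eps k * R" using T.eps_pos by (intro mult_left_mono) auto
        moreover have "eps k * R < r / 2" using elim(2) R(1) by (simp add: field_simps)
        moreover have "0 < alpha G * eps k" using T.eps_pos G_pos(2) by simp
        ultimately have *: "eps k * (y \<bullet> dir G i) - alpha G * eps k < r / 2" by linarith
        show "(?tA k y) * T.mu i < r"
        proof (cases "eps k * (y \<bullet> dir G i) - alpha G * eps k \<le> 0")
          case True
          then have "(?tA k y) * T.mu i \<le> 0" using mu(1) by (intro mult_nonpos_nonneg) auto
          then show ?thesis using d by simp
        next
          case False
          then have "(?tA k y) * T.mu i \<le> (?tA k y) * 2"
            using mu(2) by (intro mult_left_mono) auto
          then show ?thesis using * by simp
        qed
      qed
    qed
  qed
  define c0 where "c0 = (LINT z|leb (omega G). grad A (z \<bullet> dir G i) * b (z \<bullet> nrm G i))"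
  have sA: "smooth A" by (rule thin_domain.smooth_stepA[OF dom])
  have cq: "continuous_on UNIV (\<lambda>z::real^2. grad A (z \<bullet> dir G i) * b (z \<bullet> nrm G i))"
    by (intro smooth_continuous smooth_mult smooth_compose_real[OF smooth_grad_real[OF sA] smooth_inner] smooth_compose_real[OF sb smooth_inner])
  have co: "sco G i y = proj23 y \<bullet> dir G i" "tco G i y = proj23 y \<bullet> nrm G i" for y by (simp_all add: sco_def tco_def inner_pt inner_2)
  have N: "(LINT y|leb Nr. f (y $ 1) * (p (y $ 1) * grad A (sco G i y) * b (tco G i y))) = (LINT x|leb I0. f x * p x) * c0"
    if "integrable (leb I0) (\<lambda>x. f x * p x)" for f p
    using thin_domain.N_ref_product(1)[OF dom that cq] by (simp add: c0_def co mult.assoc)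
  have sE: "smooth (\<lambda>y::real^3. p (y $ 1) * F (width G i / len G * y $ 2) * b (thick G i * y $ 3))" if "smooth p" "smooth F" for p F
    using smooth_mult[OF smooth_mult[OF smooth_nth_compose[OF that(1), of 1] smooth_nth_compose[OF smooth_lin[OF that(2), of "width G i / len G" 0], of 2]] smooth_nth_compose[OF smooth_lin[OF sb, of "thick G i" 0], of 3]]
    by simp
  have lE: "L2 Er f" if "smooth f" for f :: "real^3 \<Rightarrow> real" by (rule L2_smooth[OF thin_domain.bounded_ref(2)[OF dom] thin_domain.sets_ref(2)[OF dom] that])
  have sN: "smooth (\<lambda>y::real^3. p (y $ 1) * F (sco G i y) * b (tco G i y))" if "smooth p" "smooth F" for p F
    by (intro smooth_mult smooth_nth_compose that smooth_compose_real[OF that(2) smooth_sco(1)] smooth_compose_real[OF sb smooth_sco(2)])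
  have lN: "L2 Nr f" if "smooth f" for f :: "real^3 \<Rightarrow> real" by (rule L2_smooth[OF thin_domain.bounded_ref(1)[OF dom] thin_domain.sets_ref(1)[OF dom] that])
  have dm: "(LINT y|leb Er. f (proj12 y) * (p (y $ 1) * F (width G i / len G * y $ 2) * b (thick G i * y $ 3))) =
      ratio i * (LINT y|leb (Dm i). f (stretch (ratio i) y) * (p (y $ 1) * F (y $ 2))) * c"
    if f: "L2 Q f" and s: "smooth p" "smooth F" for f p F
    using E_ref_to_E_dom[OF i f smooth_continuous[OF smooth_mult[OF smooth_nth_compose[OF s(1), of 1] smooth_nth_compose[OF s(2), of 2]]] cb]
    by (simp add: c_def)
  have z': "smooth q" by (rule test_function_smooth[OF z])
  note sm = sE[OF z' smooth_grad_real[OF sB]] sE[OF z' sB]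
  have PI: "width G i / len G * thick G i * (LINT y|leb Er. U (pm k i y) * (p (y $ 1) * grad B (width G i / len G * y $ 2) * b (thick G i * y $ 3))) +
      (LINT y|leb Nr. U (nm k y) * (p (y $ 1) * grad A (sco G i y) * b (tco G i y))) =
    - (thick G i * (sl k i * (LINT y|leb Er. sco G i (V (pm k i y)) * (p (y $ 1) * B (width G i / len G * y $ 2) * b (thick G i * y $ 3))))
      + eps k * (LINT y|leb Nr. sco G i (V (nm k y)) * (p (y $ 1) * A (sco G i y) * b (tco G i y))))"
    if "L2 (Omega_thin G (eps k)) U" "is_weak_grad (Omega_thin G (eps k)) U V" "test_function I0 p"
      "\<forall>y\<in>omega G. (?tA k y) * mu k i < r" for U V p k
  proof -
    have "sl k i * thick G i * mu k i = width G i / len G * thick G i"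
      using thin_domain.mu(2)[OF dom i, of k] by (metis mult.assoc mult.commute)
    then show ?thesis
      using thin_domain.plate_identity[OF dom i that(1,2,3) sB d B1 B0 sb b0] that(4) by (simp add: mult.assoc mult.left_commute[of "thick G i"])
  qed
  \<comment> \<open>The mass of the transition in the cross-section is not computed. With the
    constant function 1 and gradient 0 in the same identity everything but \<open>c0\<close> is
    explicit, the plate term being evaluated by the fundamental theorem.\<close>
  have c0: "c0 = thick G i * c"
  proof -
    define p where "p = bump (len G / 4) (3 * len G / 4)"
    have sx: "smooth p" unfolding p_def by (rule smooth_bump)
    have tx: "test_function I0 p"
      unfolding test_function_def p_def using G_pos(1)
      by (intro conjI smooth_bump exI[of _ "{len G / 4..3 * len G / 4}"]) (auto intro!: bump_0)
    have ix: "integrable (leb I0) p" by (rule integrable_continuous_interval[OF smooth_continuous[OF sx]])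
    have px: "0 < (LINT x|leb I0. p x)"
      by (rule integral_continuous_pos[OF _ smooth_continuous[OF sx] ix, where x = "len G / 2"])
         (use G_pos in \<open>auto simp: p_def bump_nonneg intro!: bump_pos\<close>)
    obtain k where k: "\<forall>y\<in>omega G. (?tA k y) * mu k i < r"
      using small by (auto simp: eventually_sequentially)
    interpret T: thin_domain G "eps k" by (rule dom)
    have g1: "grad (\<lambda>x::real^3. 1::real) = (\<lambda>_. 0)" by (rule ext) (rule grad_const)
    have one: "is_weak_grad (Omega_thin G (eps k)) (\<lambda>_. 1) (\<lambda>_. 0)"
      using smooth_weak_grad[OF T.Omega_bounded T.Omega_sets smooth_const, of 1] unfolding g1 .
    have "(LINT y|leb (Dm i). p (y $ 1) * grad B (y $ 2)) = (LINT y|leb (Dm i). grad (\<lambda>y. p (y $ 1) * B (y $ 2)) y \<bullet> e2)"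
      by (rule LINT_cong) (simp add: grad_mult[OF smooth_nth_compose[OF sx] smooth_nth_compose[OF sB]] inner_add_left grad_nth_compose[OF sx] grad_nth_compose[OF sB] inner_axis_axis)
    also have "\<dots> = - (LINT x|leb I0. p x)"
      using rect_FTC[OF smooth_mult[OF smooth_nth_compose[OF sx, of 1] smooth_nth_compose[OF sB, of 2]], of 0 "width G i" "len G"] w B0[of "width G i"] B1[of 0] d
      by (simp add: E_dom_rect)
    finally have E: "(LINT y|leb (Dm i). p (y $ 1) * grad B (y $ 2)) = - (LINT x|leb I0. p x)" .
    have "width G i / len G * thick G i * (ratio i * (LINT y|leb (Dm i). p (y $ 1) * grad B (y $ 2)) * c) + (LINT x|leb I0. p x) * c0 = 0"
      using PI[OF _ one tx k] dm[OF L2_smooth[OF rect_simps(2,3) smooth_const[of 1]] sx smooth_grad_real[OF sB]] N[of "\<lambda>_. 1" p] ix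
      by (simp add: L2_smooth T.Omega_bounded sco_def)
    then have "(width G i / len G * ratio i) * (thick G i * c) * (LINT x|leb I0. p x) = c0 * (LINT x|leb I0. p x)"
      unfolding E by (simp add: algebra_simps)
    then show ?thesis using px unfolding ratio(3)[OF i] by simp
  qed
  let ?J = "\<lambda>k. - (thick G i * (sl k i * (LINT y|leb Er. sco G i (g k (pm k i y)) * (q (y $ 1) * B (width G i / len G * y $ 2) * b (thick G i * y $ 3))))
      + eps k * (LINT y|leb Nr. sco G i (g k (nm k y)) * (q (y $ 1) * A (sco G i y) * b (tco G i y))))"
  let ?l1 = "width G i / len G * thick G i * (LINT y|leb Er. u0E i (proj12 y) * (q (y $ 1) * grad B (width G i / len G * y $ 2) * b (thick G i * y $ 3))) +
      (LINT y|leb Nr. u0N (y $ 1) * (q (y $ 1) * grad A (sco G i y) * b (tco G i y)))"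
  let ?l2 = "- (thick G i * (LINT y|leb Er. W i (proj12 y) $ 2 * (q (y $ 1) * B (width G i / len G * y $ 2) * b (thick G i * y $ 3))) + 0)"
  have "(\<lambda>k. width G i / len G * thick G i * (LINT y|leb Er. u k (pm k i y) * (q (y $ 1) * grad B (width G i / len G * y $ 2) * b (thick G i * y $ 3))) +
      (LINT y|leb Nr. u k (nm k y) * (q (y $ 1) * grad A (sco G i y) * b (tco G i y)))) \<longlonglongrightarrow> ?l1"
    by (rule tendsto_add[OF tendsto_mult_left[OF L2_tendsto_mult[OF u_tendsto_E[OF i] L2_tendsto_const[OF lE[OF sm(1)]]]] u_tendsto_N[OF lN[OF sN[OF z' smooth_grad_real[OF sA]]]]])
  moreover have "\<forall>\<^sub>F k in sequentially. width G i / len G * thick G i * (LINT y|leb Er. u k (pm k i y) * (q (y $ 1) * grad B (width G i / len G * y $ 2) * b (thick G i * y $ 3))) +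
      (LINT y|leb Nr. u k (nm k y) * (q (y $ 1) * grad A (sco G i y) * b (tco G i y))) = ?J k"
    using small by eventually_elim (rule PI[OF H1_L2[OF uH] weak_grad_wgrad[OF uH] z])
  ultimately have "?J \<longlonglongrightarrow> ?l1" by (rule Lim_transform_eventually)
  moreover have "?J \<longlonglongrightarrow> ?l2"
    by (rule tendsto_minus[OF tendsto_add[OF tendsto_mult_left[OF g_tendsto_E(2)[OF i lE[OF sm(2)]]] g_tendsto_N[OF lN[OF sN[OF z' sA]]]]])
  ultimately have "?l1 = ?l2" by (rule LIMSEQ_unique)
  then have "(width G i / len G * ratio i) * (thick G i * c) * (LINT y|leb (Dm i). lim_u i y * (q (y $ 1) * grad B (y $ 2))) + (LINT x|leb I0. u0N x * q x) * (thick G i * c) =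
    - (thick G i * c * (ratio i * (LINT y|leb (Dm i). W i (stretch (ratio i) y) $ 2 * (q (y $ 1) * B (y $ 2)))))"
    unfolding dm[OF W(1)[OF i] z' smooth_grad_real[OF sB]] dm[OF W(3)[OF i] z' sB]
      N[OF L2_integrable_mult[OF u0N_L2 L2_smooth[OF _ _ z']], simplified] c0
    by (simp add: lim_u_def algebra_simps)
  moreover have "(LINT y|leb (Dm i). (lim_g i y \<bullet> e2) * (q (y $ 1) * B (y $ 2))) = ratio i * (LINT y|leb (Dm i). W i (stretch (ratio i) y) $ 2 * (q (y $ 1) * B (y $ 2)))"
    by (simp add: lim_g_def stretch_def cart_eq_inner_axis[symmetric] mult.assoc)
  ultimately have "(thick G i * c) * ((LINT y|leb (Dm i). lim_u i y * (q (y $ 1) * grad B (y $ 2))) + (LINT x|leb I0. u0N x * q x)) =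
    (thick G i * c) * - (LINT y|leb (Dm i). (lim_g i y \<bullet> e2) * (q (y $ 1) * B (y $ 2)))"
    unfolding ratio(3)[OF i] by (simp add: algebra_simps)
  moreover have nz: "thick G i * c \<noteq> 0" using w c by simp
  ultimately show ?thesis unfolding mult_left_cancel[OF nz] by linarith
qed

lemma trace_N:
  assumes i: "i \<in> idx"
  shows "has_trace (Dm i) (\<lambda>x. pt2 x 0) I0 (lim_u i) u0N"
proof -
  define B where B: "B = (\<lambda>s. 1 - step (3 / width G i * s + (-1)))"
  have w: "0 < width G i" using G_i[OF i] by auto
  have sB: "smooth B" unfolding B by (intro smooth_diff smooth_const smooth_lin smooth_step)
  show ?thesis
    using lim_u[OF i] trace_identity[OF i _ B] w unfolding E_dom_rect
    by (intro has_trace_rectI[OF w _ _ _ u0N_L2 sB]) (auto simp: side_sign_def B step_0 step_1)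
qed

text \<open>Here \<open>B\<close> vanishes near N and is 1 near the outer side. As
  \<open>face_identity\<close> is exact for every \<open>k\<close>, its limit is Green's formula
  with boundary values 0.\<close>

lemma trace_Ne:
  assumes m: "m = num G"
  shows "has_trace (Dm m) (\<lambda>x. pt2 x (width G m)) I0 (lim_u m) (\<lambda>_. 0)"
proof -
  have i: "m \<in> idx" using num_mem m by simp
  define B where B: "B = (\<lambda>s. step (3 / width G m * s + (-1)))"
  have w: "0 < width G m" using G_i[OF i] by auto
  have sB: "smooth B" unfolding B by (intro smooth_lin smooth_step)
  have lE: "L2 Er f" if "smooth f" for f :: "real^3 \<Rightarrow> real" by (rule L2_smooth[OF thin_domain.bounded_ref(2)[OF dom] thin_domain.sets_ref(2)[OF dom] that])
  have id: "(LINT y|leb (Dm m). lim_u m y * (q (y $ 1) * grad B (y $ 2))) +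
    (LINT y|leb (Dm m). (lim_g m y \<bullet> e2) * (q (y $ 1) * B (y $ 2))) = 0" if z: "test_function I0 q" for q
  proof -
    have z': "smooth q" by (rule test_function_smooth[OF z])
    have sE: "smooth (\<lambda>y::real^3. q (y $ 1) * F (width G m / len G * y $ 2))" if "smooth F" for F
      using smooth_mult[OF smooth_nth_compose[OF z', of 1] smooth_nth_compose[OF smooth_lin[OF that, of "width G m / len G" 0], of 2]] by simp
    have dm: "(LINT y|leb Er. f (proj12 y) * (q (y $ 1) * F (width G m / len G * y $ 2))) =
        ratio m * (LINT y|leb (Dm m). f (stretch (ratio m) y) * (q (y $ 1) * F (y $ 2)))"
      if f: "L2 Q f" and s: "smooth F" for f F
      using E_ref_to_E_dom[OF i f smooth_continuous[OF smooth_mult[OF smooth_nth_compose[OF z', of 1] smooth_nth_compose[OF s, of 2]]], of "\<lambda>_. 1"]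
      by (simp add: measure_restrict_space)
    let ?F = "\<lambda>k. width G m / len G * (LINT y|leb Er. u k (pm k m y) * (q (y $ 1) * grad B (width G m / len G * y $ 2))) +
      sl k m * (LINT y|leb Er. sco G m (g k (pm k m y)) * (q (y $ 1) * B (width G m / len G * y $ 2)))"
    have "?F k = 0" for k
      by (rule thin_domain.face_identity[OF dom uD m z' sB]) (use w in \<open>simp_all add: B step_0 step_1\<close>)
    moreover have "?F \<longlonglongrightarrow> width G m / len G * (LINT y|leb Er. u0E m (proj12 y) * (q (y $ 1) * grad B (width G m / len G * y $ 2))) +
      (LINT y|leb Er. W m (proj12 y) $ 2 * (q (y $ 1) * B (width G m / len G * y $ 2)))"
      by (rule tendsto_add[OF tendsto_mult_left[OF L2_tendsto_mult[OF u_tendsto_E[OF i] L2_tendsto_const[OF lE[OF sE[OF smooth_grad_real[OF sB]]]]]] g_tendsto_E(2)[OF i lE[OF sE[OF sB]]]])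
    ultimately have "width G m / len G * (LINT y|leb Er. u0E m (proj12 y) * (q (y $ 1) * grad B (width G m / len G * y $ 2))) +
      (LINT y|leb Er. W m (proj12 y) $ 2 * (q (y $ 1) * B (width G m / len G * y $ 2))) = 0"
      by (simp add: LIMSEQ_const_iff)
    then have "(width G m / len G * ratio m) * (LINT y|leb (Dm m). lim_u m y * (q (y $ 1) * grad B (y $ 2))) +
      ratio m * (LINT y|leb (Dm m). W m (stretch (ratio m) y) $ 2 * (q (y $ 1) * B (y $ 2))) = 0"
      unfolding dm[OF W(1)[OF i] smooth_grad_real[OF sB]] dm[OF W(3)[OF i] sB] lim_u_def by (simp only: mult.assoc)
    moreover have "(LINT y|leb (Dm m). (lim_g m y \<bullet> e2) * (q (y $ 1) * B (y $ 2))) = ratio m * (LINT y|leb (Dm m). W m (stretch (ratio m) y) $ 2 * (q (y $ 1) * B (y $ 2)))"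
      by (simp add: lim_g_def stretch_def cart_eq_inner_axis[symmetric] mult.assoc)
    ultimately show ?thesis unfolding ratio(3)[OF i] by simp
  qed
  show ?thesis
    using lim_u[OF i] id w unfolding E_dom_rect
    by (intro has_trace_rectI[OF w _ _ _ _ sB]) (auto simp: side_sign_def B step_0 step_1)
qed

end

section \<open>Cutoffs and the gluing of functions given on the plates\<close>

definition cut :: "real \<Rightarrow> real" where "cut t = 1 - step (2 * (t * t) + (-1))"

lemma smooth_cut: "smooth cut"
  unfolding cut_def[abs_def]
  by (intro smooth_diff smooth_const smooth_affine_real[OF smooth_step] smooth_mult smooth_id)

lemma cut_1: "\<bar>t\<bar> \<le> 1/2 \<Longrightarrow> cut t = 1"
proof -
  assume "\<bar>t\<bar> \<le> 1/2"
  then have "\<bar>t\<bar> * \<bar>t\<bar> \<le> (1/2) * (1/2)" by (intro mult_mono) auto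
  then show ?thesis by (simp add: cut_def step_0)
qed

lemma cut_0: "1 \<le> \<bar>t\<bar> \<Longrightarrow> cut t = 0"
proof -
  assume "1 \<le> \<bar>t\<bar>"
  then have "1 * 1 \<le> \<bar>t\<bar> * \<bar>t\<bar>" by (intro mult_mono) auto
  then show ?thesis by (simp add: cut_def step_1)
qed

lemma continuous_compose_L2_tendsto:
  fixes f :: "'b::euclidean_space \<Rightarrow> real" and T :: "'a::euclidean_space \<Rightarrow> 'b"
  assumes S: "S \<in> lmeasurable" and f: "continuous_on UNIV f" and c: "\<And>k. continuous_on UNIV (Ts k)" "continuous_on UNIV T"
    and b: "\<And>k x. x \<in> S \<Longrightarrow> norm (Ts k x) \<le> K" and lim: "\<And>x. x \<in> S \<Longrightarrow> (\<lambda>k. Ts k x) \<longlonglongrightarrow> T x"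
  shows "L2_tendsto S (\<lambda>k x. f (Ts k x)) (\<lambda>x. f (T x))"
proof -
  obtain C where C: "\<And>y. y \<in> cball 0 K \<Longrightarrow> norm (f y) \<le> C" using continuous_bounded_on[OF bounded_cball f] by metis
  show ?thesis
  proof (rule L2_tendsto_bounded_convergence[OF S, where C = C])
    show "(\<lambda>x. f (Ts k x)) \<in> mbl S" for k
      by (intro continuous_measurable_lebesgue_on continuous_on_compose2[OF f c(1)]) simp
    show "(\<lambda>x. f (T x)) \<in> mbl S"
      by (intro continuous_measurable_lebesgue_on continuous_on_compose2[OF f c(2)]) simp
    show "norm (f (Ts k x)) \<le> C" if "x \<in> S" for k x using b[OF that, of k] by (intro C) simp
    show "AE x in leb S. (\<lambda>k. f (Ts k x)) \<longlonglongrightarrow> f (T x)"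
    proof (rule AE_I2)
      fix x assume "x \<in> space (leb S)"
      then have "x \<in> S" by simp
      moreover have "isCont f (T x)" using f by (simp add: continuous_on_eq_continuous_at)
      ultimately show "(\<lambda>k. f (Ts k x)) \<longlonglongrightarrow> f (T x)" using isCont_tendsto_compose lim by blast
    qed
  qed
qed

lemma continuous_plate: "continuous_on UNIV (\<lambda>y::real^'n. pt (a * y $ i) ((b * y $ j) *\<^sub>R z))"
proof (rule continuous_on_vec)
  fix k :: 3
  show "continuous_on UNIV (\<lambda>y::real^'n. pt (a * y $ i) ((b * y $ j) *\<^sub>R z) $ k)"
    using exhaust_3[of k] by (elim disjE) (simp_all add: continuous_intros)
qed

context thin_geometry
begin

text \<open>Both directions are orthogonal to \<open>nrm G i\<close>, hence parallel, and they are
  distinct. This is the one configuration in which the coordinate across plate \<open>i\<close>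
  cannot separate it from plate \<open>j\<close>; the coordinate along plate \<open>i\<close> does,
  being negative on plate \<open>j\<close>.\<close>

lemma opposite_dir:
  assumes i: "i \<in> idx" and j: "j \<in> idx" and ij: "i \<noteq> j" and 0: "dir G j \<bullet> nrm G i = 0"
  shows "dir G j = - dir G i"
proof -
  have d: "dir G j = (dir G j \<bullet> dir G i) *\<^sub>R dir G i" using decompose_2[OF i, of "dir G j"] 0 by simp
  then have "norm (dir G j) = \<bar>dir G j \<bullet> dir G i\<bar> * norm (dir G i)" by (metis norm_scaleR)
  then have "\<bar>dir G j \<bullet> dir G i\<bar> = 1" using G_i(3)[OF i] G_i(3)[OF j] by simp
  moreover have "dir G j \<bullet> dir G i \<noteq> 1"
  proof
    assume "dir G j \<bullet> dir G i = 1"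
    then have "dir G j = dir G i" using d by simp
    moreover have "inj_on (dir G) idx" using geometry by (simp add: hypergraph_geometry_def)
    ultimately show False using ij i j by (auto dest: inj_onD)
  qed
  ultimately have "dir G j \<bullet> dir G i = -1" by linarith
  then show ?thesis using d by simp
qed

text \<open>A minimum over the finitely many pairs of non-parallel directions; the element 1 keeps
  the set nonempty.\<close>

lemma plate_separation:
  assumes "0 < d"
  obtains c where "0 < c"
    "\<And>i j. i \<in> idx \<Longrightarrow> j \<in> idx \<Longrightarrow> dir G j \<bullet> nrm G i \<noteq> 0 \<Longrightarrow> c \<le> d / 8 * \<bar>dir G j \<bullet> nrm G i\<bar>"
proof -
  define S where "S = insert 1 ((\<lambda>(i, j). d / 8 * \<bar>dir G j \<bullet> nrm G i\<bar>) ` {(i, j) \<in> idx \<times> idx. dir G j \<bullet> nrm G i \<noteq> 0})"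
  have "finite {(i, j) \<in> idx \<times> idx. dir G j \<bullet> nrm G i \<noteq> 0}"
    by (rule finite_subset[of _ "idx \<times> idx"]) auto
  then have fin: "finite S" unfolding S_def by (intro finite.insertI finite_imageI)
  have "0 < Min S" using fin assms by (subst Min_gr_iff) (auto simp: S_def)
  moreover have "Min S \<le> d / 8 * \<bar>dir G j \<bullet> nrm G i\<bar>" if "i \<in> idx" "j \<in> idx" "dir G j \<bullet> nrm G i \<noteq> 0" for i j
    by (rule Min_le[OF fin]) (use that in \<open>force simp: S_def\<close>)
  ultimately show ?thesis by (rule that)
qed

end

context thin_domain
begin

text \<open>Coordinates of the limit rectangle on the thin plate. After the dilation the face of the
  plate corresponds exactly to the outer side of the rectangle, so zero boundary values are
  inherited.\<close>

definition "pl i x = pt2 (x $ 1) (mu i * (sco G i x - alpha G * eps))"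

lemma pl:
  fixes q :: "real^2 \<Rightarrow> real" assumes "smooth q"
  shows "smooth (\<lambda>x. q (pl i x))" "grad (\<lambda>x. q (pl i x)) x \<bullet> v = grad q (pl i x) $ 1 * v $ 1 + grad q (pl i x) $ 2 * (mu i * sco G i v)"
proof -
  let ?T = "\<lambda>x::real^3. pt2 (x $ 1) (mu i * sco G i x)"
  have L: "linear ?T"
    by (rule linearI) (auto simp: vec_eq_iff forall_2 algebra_simps linear_add[OF linear_sco(1)] linear_scale[OF linear_sco(1)])
  have T: "pl i = (\<lambda>x. ?T x + pt2 0 (- mu i * (alpha G * eps)))"
    by (auto simp: fun_eq_iff pl_def vec_eq_iff forall_2 algebra_simps)
  show "smooth (\<lambda>x. q (pl i x))" unfolding T by (rule smooth_affine[OF assms L])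
  show "grad (\<lambda>x. q (pl i x)) x \<bullet> v = grad q (pl i x) $ 1 * v $ 1 + grad q (pl i x) $ 2 * (mu i * sco G i v)"
    unfolding T grad_affine[OF assms L] by (simp add: inner_2)
qed

lemma pl_pmap:
  assumes i: "i \<in> idx"
  shows "pl i (pm i y) = pd i y"
  using mu(2)[OF i] by (simp add: pl_def pmap_coords[OF i] vec_eq_iff forall_2 flip: mult.assoc)

text \<open>A globally smooth function: each plate contributes its deviation from the common values
  \<open>h\<close>, cut off at distance \<open>c\<close> from the plane of the plate. The deviation
  vanishes where the coordinate along the plate is small or negative, which covers an opposite plate
  in the same plane; the remaining points of other plates have distance at least \<open>c\<close>
  from that plane.\<close>

definition "glue c h \<psi> x = h (x $ 1) + (\<Sum>i\<in>idx. cut ((1/c) * tco G i x) * (\<psi> i (pl i x) - h (x $ 1)))"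

lemma smooth_glue:
  assumes "smooth h" "\<And>i. i \<in> idx \<Longrightarrow> smooth (q i)" shows "smooth (glue c h q)"
  unfolding glue_def[abs_def]
  by (intro smooth_add smooth_sum smooth_mult smooth_diff smooth_nth_compose assms pl smooth_compose_real[OF smooth_cut] smooth_cmult smooth_sco)

lemma glue:
  assumes c: "0 < c" "\<And>i j. i \<in> idx \<Longrightarrow> j \<in> idx \<Longrightarrow> dir G j \<bullet> nrm G i \<noteq> 0 \<Longrightarrow> c \<le> \<delta> / 8 * \<bar>dir G j \<bullet> nrm G i\<bar>"
    and p: "\<And>i x s. i \<in> idx \<Longrightarrow> s < \<delta> \<Longrightarrow> p i (pt2 x s) = h x"
    and small: "\<And>i. i \<in> idx \<Longrightarrow> thick G i * eps \<le> c" "\<And>i. i \<in> idx \<Longrightarrow> thick G i * eps \<le> \<delta> / 2" "\<And>i. i \<in> idx \<Longrightarrow> mu i \<le> 2"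
      "\<And>y. y \<in> omega G \<Longrightarrow> eps * norm y < \<delta> / 2"
  shows "j \<in> idx \<Longrightarrow> alpha G * eps < sco G j x \<Longrightarrow> \<bar>tco G j x\<bar> < thick G j * eps / 2 \<Longrightarrow> glue c h p x = p j (pl j x)"
    "x \<in> Nt \<Longrightarrow> glue c h p x = h (x $ 1)"
proof -
  have ae: "0 < alpha G * eps" using G_pos eps_pos by simp
  \<comment> \<open>\<open>mu i\<close> <= 2 turns \<open>sco G i x\<close> below \<delta>/2 into a
    dilated coordinate below \<delta>, where plate functions have the common values; negative
    coordinates are included.\<close>
  have low: "p i (pl i x) = h (x $ 1)" if i: "i \<in> idx" and s: "sco G i x < \<delta> / 2" for i x
  proof -
    have d: "0 < \<delta>" using small(2)[OF i] G_i(2)[OF i] eps_pos by (smt (verit) half_gt_zero_iff mult_pos_pos)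
    have "mu i * (sco G i x - alpha G * eps) < \<delta>"
    proof (cases "sco G i x - alpha G * eps \<le> 0")
      case True
      then have "mu i * (sco G i x - alpha G * eps) \<le> 0" using mu(1)[OF i] by (intro mult_nonneg_nonpos) auto
      then show ?thesis using d by simp
    next
      case False
      then have "mu i * (sco G i x - alpha G * eps) \<le> 2 * (sco G i x - alpha G * eps)" using small(3)[OF i] by (intro mult_right_mono) auto
      then show ?thesis using s ae by simp
    qed
    then show ?thesis unfolding pl_def by (rule p[OF i])
  qed
  show "glue c h p x = h (x $ 1)" if x: "x \<in> Nt"
  proof -
    obtain a y where y: "x = pt a (eps *\<^sub>R y)" "y \<in> omega G" using x unfolding N_thin_eq[OF geometry eps_pos] by blast
    have "sco G i x < \<delta> / 2" if i: "i \<in> idx" for i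
    proof -
      have "y \<bullet> dir G i \<le> norm y" using norm_cauchy_schwarz[of y "dir G i"] G_i(3)[OF i] by simp
      then have "eps * (y \<bullet> dir G i) \<le> eps * norm y" using eps_pos by (intro mult_left_mono) auto
      then show ?thesis using small(4)[OF y(2)] by (simp add: y(1) sco_pt)
    qed
    then show ?thesis using low by (simp add: glue_def)
  qed
  assume j: "j \<in> idx" and s: "alpha G * eps < sco G j x" and t: "\<bar>tco G j x\<bar> < thick G j * eps / 2"
  have x: "x = pt (x $ 1) (sco G j x *\<^sub>R dir G j + tco G j x *\<^sub>R nrm G j)" by (rule decompose[OF j])
  have s0: "0 < sco G j x" using s ae by linarith
  have cs: "\<bar>a \<bullet> b\<bar> \<le> 1" if "norm a = 1" "norm b = 1" for a b :: "real^2" using Cauchy_Schwarz_ineq2[of a b] that by simp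
  have le: "\<bar>r * q\<bar> \<le> \<bar>r\<bar>" if "\<bar>q\<bar> \<le> 1" for r q :: real using mult_left_mono[OF that, of "\<bar>r\<bar>"] by (simp add: abs_mult)
  have zero: "cut ((1/c) * tco G i x) * (p i (pl i x) - h (x $ 1)) = 0" if i: "i \<in> idx" "i \<noteq> j" for i
  proof (cases "sco G i x < \<delta> / 2")
    case True then show ?thesis using low[OF i(1)] by simp
  next
    case False
    have si: "sco G i x = sco G j x * (dir G j \<bullet> dir G i) + tco G j x * (nrm G j \<bullet> dir G i)"
      and ti: "tco G i x = sco G j x * (dir G j \<bullet> nrm G i) + tco G j x * (nrm G j \<bullet> nrm G i)"
      by (subst x, simp add: sco_pt inner_add_left)+
    have b1: "\<bar>tco G j x * (nrm G j \<bullet> dir G i)\<bar> \<le> \<bar>tco G j x\<bar>" "\<bar>tco G j x * (nrm G j \<bullet> nrm G i)\<bar> \<le> \<bar>tco G j x\<bar>" "\<bar>sco G j x * (dir G j \<bullet> dir G i)\<bar> \<le> \<bar>sco G j x\<bar>"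
      using G_i[OF j] G_i[OF i(1)] by (auto intro!: le cs)
    have tb: "\<bar>tco G j x\<bar> \<le> \<delta> / 4" "\<bar>tco G j x\<bar> \<le> c / 2" using t small(1,2)[OF j] by auto
    have sb: "\<delta> / 4 \<le> sco G j x" using False si b1 tb s0 by linarith
    \<comment> \<open>For opposite plates \<open>sco G i x\<close> is minus
      \<open>sco G j x\<close>, hence negative, against the present case.\<close>
    have q: "dir G j \<bullet> nrm G i \<noteq> 0"
    proof
      assume "dir G j \<bullet> nrm G i = 0"
      then have d: "dir G j = - dir G i" by (rule opposite_dir[OF i(1) j i(2)])
      then have "dir G i = - dir G j" by simp
      then have "dir G j \<bullet> dir G i = -1" "nrm G j \<bullet> dir G i = 0" using inner_i[OF j] by auto
      then show False using si s0 False sb tb(1) by simp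
    qed
    \<comment> \<open>The position along plate \<open>j\<close> contributes at least 2 c to the
      coordinate across plate \<open>i\<close>, and the thickness of plate \<open>j\<close> takes
      back at most c/2.\<close>
    have "2 * c \<le> \<delta> / 4 * \<bar>dir G j \<bullet> nrm G i\<bar>" using c(2)[OF i(1) j q] by simp
    also have "\<dots> \<le> sco G j x * \<bar>dir G j \<bullet> nrm G i\<bar>" using sb by (intro mult_right_mono) auto
    also have "\<dots> = \<bar>sco G j x * (dir G j \<bullet> nrm G i)\<bar>" using s0 by (simp add: abs_mult)
    finally have "c \<le> \<bar>tco G i x\<bar>" using ti b1 tb(2) c(1) by linarith
    then have "1 \<le> \<bar>(1/c) * tco G i x\<bar>" using c(1) by (simp add: abs_mult field_simps)
    then show ?thesis by (simp add: cut_0)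
  qed
  have one: "cut ((1/c) * tco G j x) = 1"
  proof (rule cut_1)
    have "\<bar>tco G j x\<bar> \<le> c / 2" using t small(1)[OF j] by simp
    then show "\<bar>(1/c) * tco G j x\<bar> \<le> 1/2" using c(1) by (simp add: abs_mult field_simps)
  qed
  have "(\<Sum>i\<in>idx. cut ((1/c) * tco G i x) * (p i (pl i x) - h (x $ 1))) = (\<Sum>i\<in>idx. if i = j then p j (pl j x) - h (x $ 1) else 0)"
    using zero one by (intro sum.cong refl) auto
  then show "glue c h p x = p j (pl j x)" using j by (simp add: glue_def sum.delta)
qed

text \<open>On the junction the glued function depends on x_1 alone, so only the longitudinal
  derivative of \<open>u\<close> meets it; since h' is a test function, \<open>N_ref_parts\<close>
  produces no boundary terms at the ends of N. The factors are grouped as in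
  \<open>g_tendsto_E\<close>.\<close>

lemma glued_weak_form:
  assumes sol: "thin_weak_solution G D eps u" and D: "admissible_coefficients G D"
    and h: "smooth h" "test_function I0 (grad h)" and sq: "\<And>i. i \<in> idx \<Longrightarrow> smooth (q i)"
    and c: "0 < c" "\<And>i j. i \<in> idx \<Longrightarrow> j \<in> idx \<Longrightarrow> dir G j \<bullet> nrm G i \<noteq> 0 \<Longrightarrow> c \<le> \<delta> / 8 * \<bar>dir G j \<bullet> nrm G i\<bar>"
    and q: "\<And>i x s. i \<in> idx \<Longrightarrow> s < \<delta> \<Longrightarrow> q i (pt2 x s) = h x"
    and q0: "\<And>x. q (num G) (pt2 x (width G (num G))) = 0"
    and small: "\<And>i. i \<in> idx \<Longrightarrow> thick G i * eps \<le> c" "\<And>i. i \<in> idx \<Longrightarrow> thick G i * eps \<le> \<delta> / 2" "\<And>i. i \<in> idx \<Longrightarrow> mu i \<le> 2"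
      "\<And>y. y \<in> omega G \<Longrightarrow> eps * norm y < \<delta> / 2"
  shows "(\<Sum>i\<in>idx. kap D i * thick G i * (sl i * (LINT y|leb Er. wgrad Om u (pm i y) $ 1 * grad (q i) (pd i y) $ 1) +
        mu i * (sl i * (LINT y|leb Er. sco G i (wgrad Om u (pm i y)) * grad (q i) (pd i y) $ 2)))) +
      kapN D * (eps * - (LINT y|leb Nr. u (nm y) * grad (grad h) (y $ 1))) =
    (\<Sum>i\<in>idx. sl i * thick G i * (LINT y|leb Er. src D i (pm i y) * q i (pd i y))) +
      (1 / measure lebesgue (omega G)) * (LINT y|leb Nr. srcN D (nm y) * h (y $ 1))"
proof -
  let ?tA = "\<lambda>F i. LINT y|leb Er. wgrad Om u (pm i y) \<bullet> grad F (pm i y)"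
  define F where "F = glue c h q"
  have sP: "smooth F" unfolding F_def by (rule smooth_glue[OF h(1) sq])
  have Pj: "F x = q j (pl j x)" if "j \<in> idx" "alpha G * eps < sco G j x" "\<bar>tco G j x\<bar> < thick G j * eps / 2" for j x
    unfolding F_def by (rule glue(1)[where \<delta> = \<delta>]) (use c q small that in blast)+
  have PN: "F x = h (x $ 1)" if "x \<in> Nt" for x
    unfolding F_def by (rule glue(2)[where \<delta> = \<delta>]) (use c q small that in blast)+
  have uH: "H1 Om u" using sol by (simp add: thin_weak_solution_def H1_D_def)
  have face: "F (pt a (width G (num G) *\<^sub>R dir G (num G) + t *\<^sub>R nrm G (num G))) = 0"
    if "\<bar>t\<bar> < thick G (num G) * eps / 2" for a t
  proof -
    let ?x = "pt a (width G (num G) *\<^sub>R dir G (num G) + t *\<^sub>R nrm G (num G))"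
    have w: "alpha G * eps < width G (num G)" using adm num_mem by (simp add: admissible_eps_def)
    have "F ?x = q (num G) (pl (num G) ?x)" using that w by (intro Pj num_mem) (simp_all add: sco_plate[OF num_mem])
    moreover have "pl (num G) ?x = pt2 a (width G (num G))" using w by (simp add: pl_def mu_def sco_plate[OF num_mem])
    ultimately show ?thesis by (simp add: q0)
  qed
  have PE: "F (pm i y) = q i (pd i y)"
    and gE: "grad F (pm i y) \<bullet> v = grad (q i) (pd i y) $ 1 * v $ 1 + grad (q i) (pd i y) $ 2 * (mu i * sco G i v)"
    if i: "i \<in> idx" and y: "y \<in> Er" for i y v
  proof -
    have x: "pm i y \<in> Et i" using y pmap_E_ref[OF i] by blast
    have eq: "F z = q i (pl i z)" if "z \<in> Et i" for z using that by (intro Pj i) (auto simp: E_thin_iff[OF i])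
    show "F (pm i y) = q i (pd i y)" using eq[OF x] by (simp add: pl_pmap[OF i])
    have "grad F (pm i y) = grad (\<lambda>z. q i (pl i z)) (pm i y)" by (rule grad_eq_on_open[OF open_thin(1)[OF i] x eq])
    then show "grad F (pm i y) \<bullet> v = grad (q i) (pd i y) $ 1 * v $ 1 + grad (q i) (pd i y) $ 2 * (mu i * sco G i v)"
      by (simp add: pl(2)[OF sq[OF i]] pl_pmap[OF i])
  qed
  have xN: "nm y \<in> Nt" if "y \<in> Nr" for y using that nmap_N_ref by blast
  have gN: "v \<bullet> grad F (nm y) = v $ 1 * grad h (y $ 1)" if "y \<in> Nr" for y v
  proof -
    have "grad F (nm y) = grad (\<lambda>x. h (x $ 1)) (nm y)" by (rule grad_eq_on_open[OF open_thin(2) xN[OF that] PN])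
    then show ?thesis by (simp add: grad_nth_compose[OF h(1)] inner_axis)
  qed
  have NN: "(LINT y|leb Nr. wgrad Om u (nm y) \<bullet> grad F (nm y)) = - (LINT y|leb Nr. u (nm y) * grad (grad h) (y $ 1))"
  proof -
    have "(LINT y|leb Nr. wgrad Om u (nm y) \<bullet> grad F (nm y)) = (LINT y|leb Nr. nm (wgrad Om u (nm y)) $ 1 * grad h (y $ 1))"
      by (rule LINT_cong) (simp add: gN)
    also have "\<dots> = - (LINT y|leb Nr. u (nm y) * grad (grad h) (y $ 1))"
      by (rule N_ref_parts[OF wgrad_N_ref(2,4)[OF uH] h(2)])
    finally show ?thesis .
  qed
  have EE: "(?tA F i) =
      (LINT y|leb Er. wgrad Om u (pm i y) $ 1 * grad (q i) (pd i y) $ 1) +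
      mu i * (LINT y|leb Er. sco G i (wgrad Om u (pm i y)) * grad (q i) (pd i y) $ 2)" if i: "i \<in> idx" for i
  proof -
    have sg: "smooth (\<lambda>z. grad (q i) z $ j)" for j unfolding cart_eq_inner_axis by (rule smooth_grad[OF sq[OF i]])
    have l: "L2 Er (\<lambda>y. grad (q i) (pd i y) $ j)" for j
    proof (rule L2_smooth[OF bounded_ref(2) sets_ref(2)])
      have "linear (\<lambda>y::real^3. pd i y)" by (rule linearI) (auto simp: vec_eq_iff forall_2 algebra_simps)
      from smooth_affine[OF sg this, of 0] show "smooth (\<lambda>y::real^3. grad (q i) (pd i y) $ j)" by simp
    qed
    note L = wgrad_E_ref(3)[OF i uH]
    have i1: "integrable (leb Er) (\<lambda>y. wgrad Om u (pm i y) $ 1 * grad (q i) (pd i y) $ 1)"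
      by (rule L2_integrable_mult[OF L2_vec_nth[OF L] l])
    have i2: "integrable (leb Er) (\<lambda>y. sco G i (wgrad Om u (pm i y)) * grad (q i) (pd i y) $ 2)"
      unfolding sco_def by (rule L2_integrable_mult[OF L2_component[OF L] l])
    have "(?tA F i) =
      (LINT y|leb Er. wgrad Om u (pm i y) $ 1 * grad (q i) (pd i y) $ 1 +
        mu i * (sco G i (wgrad Om u (pm i y)) * grad (q i) (pd i y) $ 2))"
      by (rule LINT_cong) (subst inner_commute, simp add: gE[OF i])
    then show ?thesis using i1 i2 by simp
  qed
  have FE: "(LINT y|leb Er. src D i (pm i y) * F (pm i y)) = (LINT y|leb Er. src D i (pm i y) * q i (pd i y))"
    if i: "i \<in> idx" for i by (rule LINT_cong) (simp add: PE[OF i])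
  have FN: "(LINT y|leb Nr. srcN D (nm y) * F (nm y)) = (LINT y|leb Nr. srcN D (nm y) * h (y $ 1))"
    by (rule LINT_cong) (simp add: PN xN)
  have E1: "(\<Sum>i\<in>idx. kap D i * sl i * thick G i * (?tA F i)) =
    (\<Sum>i\<in>idx. kap D i * thick G i * (sl i * (LINT y|leb Er. wgrad Om u (pm i y) $ 1 * grad (q i) (pd i y) $ 1) +
        mu i * (sl i * (LINT y|leb Er. sco G i (wgrad Om u (pm i y)) * grad (q i) (pd i y) $ 2))))"
    by (rule sum.cong[OF refl], subst EE, assumption) (simp only: algebra_simps)
  have E2: "(\<Sum>i\<in>idx. sl i * thick G i * (LINT y|leb Er. src D i (pm i y) * F (pm i y))) =
    (\<Sum>i\<in>idx. sl i * thick G i * (LINT y|leb Er. src D i (pm i y) * q i (pd i y)))"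
    by (rule sum.cong[OF refl], subst FE, assumption) simp
  from weak_form[OF sol D sP face, unfolded E1 E2 NN FN] show ?thesis by (simp only: mult.assoc)
qed

end

section \<open>The limit equation for glued test functions\<close>

lemma norm_pt_le: "norm (pt a y) \<le> \<bar>a\<bar> + norm y"
proof -
  have "pt a y = a *\<^sub>R axis 1 1 + pt 0 y" by (simp add: vec_eq_iff forall_3 axis_def)
  then have "norm (pt a y) \<le> norm (a *\<^sub>R axis 1 1 :: real^3) + norm (pt 0 y)" by (metis norm_triangle_ineq)
  then show ?thesis by (simp add: norm_eq_sqrt_inner[of "pt 0 y"] norm_eq_sqrt_inner[of y] pt_inner)
qed

lemma tendsto_pt:
  assumes "(z \<longlongrightarrow> z0) F" shows "((\<lambda>k. pt a (z k)) \<longlongrightarrow> pt a z0) F"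
proof (rule vec_tendstoI)
  fix i :: 3
  show "((\<lambda>k. pt a (z k) $ i) \<longlongrightarrow> pt a z0 $ i) F"
    using exhaust_3[of i] assms by (elim disjE) (auto intro: tendsto_vec_nth)
qed

context thin_limit
begin

lemma mu_tendsto: assumes i: "i \<in> idx" shows "(\<lambda>k. mu k i) \<longlonglongrightarrow> 1"
proof -
  have "(\<lambda>k. width G i / (width G i - alpha G * eps k)) \<longlonglongrightarrow> width G i / (width G i - alpha G * 0)"
    using G_i(1)[OF i] by (intro tendsto_intros eps_tendsto) auto
  then show ?thesis using G_i(1)[OF i] by (simp add: thin_domain.mu_def[OF dom])
qed

lemma eps_bound: obtains K where "0 < K" "\<And>k. \<bar>eps k\<bar> \<le> K"
  using eps_tendsto[THEN convergentI, THEN convergent_imp_Bseq, THEN BseqD] by force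

text \<open>The maps from the reference domains converge pointwise and stay in a fixed ball, so
  bounded convergence applies; in the limit the images collapse onto the rectangle and onto
  N.\<close>

lemma src_tendsto:
  fixes f :: "real^3 \<Rightarrow> real"
  assumes f: "continuous_on UNIV f"
  shows "i \<in> idx \<Longrightarrow> L2_tendsto Er (\<lambda>k y. f (pm k i y)) (\<lambda>y. f (pt (y $ 1) ((width G i / len G * y $ 2) *\<^sub>R dir G i)))"
    "L2_tendsto Nr (\<lambda>k y. f (nm k y)) (\<lambda>y. f (pt (y $ 1) 0))"
proof -
  obtain K where K: "0 < K" "\<And>k. \<bar>eps k\<bar> \<le> K" using eps_bound by blast
  show "L2_tendsto Er (\<lambda>k y. f (pm k i y)) (\<lambda>y. f (pt (y $ 1) ((width G i / len G * y $ 2) *\<^sub>R dir G i)))" if i: "i \<in> idx"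
  proof (rule continuous_compose_L2_tendsto[OF thin_domain.sets_ref(5)[OF dom] f])
    show "continuous_on UNIV (pm k i)" for k
      unfolding pmap_def[abs_def] using linear_plin
      by (intro continuous_intros linear_continuous_on) (simp add: linear_conv_bounded_linear)
    show "continuous_on UNIV (\<lambda>y. pt (y $ 1) ((width G i / len G * y $ 2) *\<^sub>R dir G i))"
      using continuous_plate[of 1 1 "width G i / len G" 2 "dir G i"] by simp
    show "norm (pm k i y) \<le> len G + (width G i + thick G i * K)" if y: "y \<in> Er" for k y
    proof -
      have d: "0 < thick G i * eps k" using G_i(2)[OF i] thin_domain.eps_pos[OF dom] by simp
      have E: "pm k i y \<in> E_thin G (eps k) i" using y thin_domain.pmap_E_ref[OF dom i] by blast
      let ?x = "pm k i y"
      have "0 < alpha G * eps k" using G_pos thin_domain.eps_pos[OF dom] by simp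
      then have b: "\<bar>?x $ 1\<bar> \<le> len G" "\<bar>sco G i ?x\<bar> \<le> width G i" "\<bar>tco G i ?x\<bar> \<le> thick G i * eps k"
        using E d unfolding thin_domain.E_thin_iff[OF dom i] by auto
      have "thick G i * eps k \<le> thick G i * K" using K(2)[of k] G_i(2)[OF i] by (intro mult_left_mono) auto
      moreover have "norm ?x \<le> \<bar>?x $ 1\<bar> + norm (sco G i ?x *\<^sub>R dir G i + tco G i ?x *\<^sub>R nrm G i)"
        by (subst decompose[OF i, of ?x]) (rule norm_pt_le)
      moreover have "norm (sco G i ?x *\<^sub>R dir G i + tco G i ?x *\<^sub>R nrm G i) \<le> \<bar>sco G i ?x\<bar> + \<bar>tco G i ?x\<bar>"
        using norm_triangle_ineq[of "sco G i ?x *\<^sub>R dir G i" "tco G i ?x *\<^sub>R nrm G i"] G_i[OF i] by simp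
      ultimately show ?thesis using b by linarith
    qed
    show "(\<lambda>k. pm k i y) \<longlonglongrightarrow> pt (y $ 1) ((width G i / len G * y $ 2) *\<^sub>R dir G i)" for y
    proof -
      have "(\<lambda>k. (alpha G * eps k + sl k i * y $ 2) *\<^sub>R dir G i + (thick G i * eps k * y $ 3) *\<^sub>R nrm G i) \<longlonglongrightarrow>
        (alpha G * 0 + width G i / len G * y $ 2) *\<^sub>R dir G i + (thick G i * 0 * y $ 3) *\<^sub>R nrm G i"
        by (intro tendsto_intros eps_tendsto slen_tendsto)
      then show ?thesis unfolding pmap_eq by (intro tendsto_pt) simp
    qed
  qed
  obtain R where R: "\<And>y. y \<in> Nr \<Longrightarrow> norm y \<le> R" using thin_domain.bounded_ref(1)[OF dom] by (auto simp: bounded_iff)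
  show "L2_tendsto Nr (\<lambda>k y. f (nm k y)) (\<lambda>y. f (pt (y $ 1) 0))"
  proof (rule continuous_compose_L2_tendsto[OF thin_domain.sets_ref(4)[OF dom] f])
    show "continuous_on UNIV (nm k)" for k
      using linear_nmap by (intro linear_continuous_on) (simp add: linear_conv_bounded_linear)
    show "continuous_on UNIV (\<lambda>y::real^3. pt (y $ 1) 0)"
      using continuous_plate[of 1 1 0 2 0] by simp
    have pn: "nmap e y = pt (y $ 1) (e *\<^sub>R proj23 y)" for e y by (simp add: vec_eq_iff forall_3)
    show "norm (nm k y) \<le> R + K * (R + R)" if y: "y \<in> Nr" for k y
    proof -
      have b: "\<bar>y $ j\<bar> \<le> R" for j using R[OF y] component_le_norm_cart[of y j] by linarith
      have "norm (proj23 y) \<le> R + R"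
        using norm_le_l1_cart[of "proj23 y"] b[of 2] b[of 3] by (simp add: sum_2)
      then have "\<bar>eps k\<bar> * norm (proj23 y) \<le> K * (R + R)" using K by (intro mult_mono) auto
      then show ?thesis using norm_pt_le[of "y $ 1" "eps k *\<^sub>R proj23 y"] b[of 1] by (simp add: pn)
    qed
    show "(\<lambda>k. nm k y) \<longlonglongrightarrow> pt (y $ 1) 0" for y
    proof -
      have "(\<lambda>k. eps k *\<^sub>R proj23 y) \<longlonglongrightarrow> 0 *\<^sub>R proj23 y" by (intro tendsto_intros eps_tendsto)
      then show ?thesis unfolding pn by (intro tendsto_pt) simp
    qed
  qed
qed

text \<open>Gluing is possible for small \<open>eps\<close> only, so the two sides agree eventually,
  which suffices for the limits. Diffusion in the junction is \<open>eps k\<close> times a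
  convergent sequence and disappears.\<close>

lemma limit_equation_glued:
  assumes h: "smooth h" "test_function I0 (grad h)" and sq: "\<And>i. i \<in> idx \<Longrightarrow> smooth (q i)"
    and d: "0 < d" and q: "\<And>i x s. i \<in> idx \<Longrightarrow> s < d \<Longrightarrow> q i (pt2 x s) = h x"
    and q0: "\<And>x. q (num G) (pt2 x (width G (num G))) = 0"
  shows "(\<Sum>i\<in>idx. thick G i * (kap D i * (LINT y|leb (Dm i). lim_g i y \<bullet> grad (q i) y))) =
    (LINT x|leb I0. srcN D (pt x 0) * h x) +
    (\<Sum>i\<in>idx. thick G i * (LINT y|leb (Dm i). src D i (chart G i y) * q i y))"
proof -
  let ?tB = "1 / measure lebesgue (omega G)"
  let ?tA = "LINT y|leb Nr. srcN D (pt (y $ 1) 0) * h (y $ 1)"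
  have cD: "continuous_on UNIV (srcN D)" "\<And>i. i \<in> idx \<Longrightarrow> continuous_on UNIV (src D i)"
    using coefficients by (auto simp: admissible_coefficients_def)
  obtain c where c: "0 < c"
    "\<And>i j. i \<in> idx \<Longrightarrow> j \<in> idx \<Longrightarrow> dir G j \<bullet> nrm G i \<noteq> 0 \<Longrightarrow> c \<le> d / 8 * \<bar>dir G j \<bullet> nrm G i\<bar>"
    using plate_separation[OF d] by blast
  obtain R where R: "0 < R" "\<And>y. y \<in> omega G \<Longrightarrow> norm y \<le> R" using thin_domain.omega_bounded(1)[OF dom] bounded_pos by metis
  have ev: "\<forall>\<^sub>F k in sequentially. \<forall>i\<in>idx. thick G i * eps k \<le> c \<and> thick G i * eps k \<le> d / 2 \<and> mu k i \<le> 2"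
  proof (intro eventually_ball_finite finite_atLeastAtMost ballI)
    fix i assume i: "i \<in> idx"
    have t: "(\<lambda>k. thick G i * eps k) \<longlonglongrightarrow> thick G i * 0" by (intro tendsto_intros eps_tendsto)
    have "\<forall>\<^sub>F k in sequentially. thick G i * eps k < c" "\<forall>\<^sub>F k in sequentially. thick G i * eps k < d / 2"
      by (rule order_tendstoD(2)[OF t], use c(1) d in simp)+
    moreover have "\<forall>\<^sub>F k in sequentially. mu k i < 2" by (rule order_tendstoD(2)[OF mu_tendsto[OF i]]) simp
    ultimately show "\<forall>\<^sub>F k in sequentially. thick G i * eps k \<le> c \<and> thick G i * eps k \<le> d / 2 \<and> mu k i \<le> 2"
      by eventually_elim simp
  qed
  have evR: "\<forall>\<^sub>F k in sequentially. eps k < d / (2 * R)" using d R by (intro eps_eventually) simp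
  let ?P = "\<lambda>i y. pd i y"
  let ?L = "\<lambda>k. (\<Sum>i\<in>idx. kap D i * thick G i * (sl k i * (LINT y|leb Er. g k (pm k i y) $ 1 * grad (q i) (?P i y) $ 1) +
        mu k i * (sl k i * (LINT y|leb Er. sco G i (g k (pm k i y)) * grad (q i) (?P i y) $ 2)))) +
      kapN D * (eps k * - (LINT y|leb Nr. u k (nm k y) * grad (grad h) (y $ 1)))"
  let ?R = "\<lambda>k. (\<Sum>i\<in>idx. sl k i * thick G i * (LINT y|leb Er. src D i (pm k i y) * q i (?P i y))) +
      ?tB * (LINT y|leb Nr. srcN D (nm k y) * h (y $ 1))"
  have LR: "\<forall>\<^sub>F k in sequentially. ?L k = ?R k" using ev evR
  proof eventually_elim
    case (elim k)
    have sm: "eps k * norm y < d / 2" if y: "y \<in> omega G" for y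
    proof -
      have "eps k * norm y \<le> eps k * R" using R(2)[OF y] thin_domain.eps_pos[OF dom, of k] by (intro mult_left_mono) auto
      also have "\<dots> < d / 2" using elim(2) R(1) by (simp add: field_simps)
      finally show ?thesis .
    qed
    show ?case
      by (rule thin_domain.glued_weak_form[OF dom weak_solution coefficients h sq c(1)]) (use c(2) q q0 elim sm in blast)+
  qed
  have bE: "bounded Er" "Er \<in> sets lebesgue" and bN: "bounded Nr" "Nr \<in> sets lebesgue"
    using thin_domain.bounded_ref[OF dom] thin_domain.sets_ref[OF dom] by auto
  have cg: "continuous_on UNIV (\<lambda>y. grad (q i) y $ j)" if "i \<in> idx" for i j
    using continuous_grad[OF sq[OF that]] by (intro continuous_on_component)
  have cP: "continuous_on UNIV (\<lambda>y::real^3. f (?P i y))" if "continuous_on UNIV f" for f :: "real^2 \<Rightarrow> real" and i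
  proof -
    have "linear (?P i)" by (rule linearI) (auto simp: vec_eq_iff forall_2 algebra_simps)
    then show ?thesis using that by (intro continuous_on_compose2[OF that linear_continuous_on]) (auto simp: linear_conv_bounded_linear)
  qed
  have dm: "(LINT y|leb Er. f (proj12 y) * p (?P i y)) = ratio i * (LINT y|leb (Dm i). f (stretch (ratio i) y) * p y)"
    if i: "i \<in> idx" and f: "L2 Q f" and p: "continuous_on UNIV p" for i f p
    using E_ref_to_E_dom[OF i f p, of "\<lambda>_. 1"] by (simp add: measure_restrict_space)
  have "?L \<longlonglongrightarrow> (\<Sum>i\<in>idx. kap D i * thick G i * (width G i / len G * (LINT y|leb Er. W i (proj12 y) $ 1 * grad (q i) (?P i y) $ 1) +
        1 * (LINT y|leb Er. W i (proj12 y) $ 2 * grad (q i) (?P i y) $ 2))) +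
      kapN D * (0 * - (LINT y|leb Nr. u0N (y $ 1) * grad (grad h) (y $ 1)))"
    by (intro tendsto_add tendsto_sum tendsto_mult_left tendsto_mult[OF slen_tendsto] tendsto_mult[OF mu_tendsto] tendsto_mult[OF eps_tendsto] tendsto_minus
        g_tendsto_E u_tendsto_N L2_continuous bE bN cP cg smooth_continuous smooth_nth_compose smooth_grad_real h)
  moreover have "?R \<longlonglongrightarrow> (\<Sum>i\<in>idx. width G i / len G * thick G i * (LINT y|leb Er. src D i (pt (y $ 1) ((width G i / len G * y $ 2) *\<^sub>R dir G i)) * q i (?P i y))) +
      ?tB * ?tA"
    by (intro tendsto_add tendsto_sum tendsto_mult_left tendsto_mult_right tendsto_mult[OF tendsto_mult_right[OF slen_tendsto]] L2_tendsto_mult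
        src_tendsto L2_tendsto_const L2_continuous bE bN cP smooth_continuous[OF sq] smooth_continuous smooth_nth_compose h cD)
  ultimately have eq: "(\<Sum>i\<in>idx. kap D i * thick G i * (width G i / len G * (LINT y|leb Er. W i (proj12 y) $ 1 * grad (q i) (?P i y) $ 1) +
        1 * (LINT y|leb Er. W i (proj12 y) $ 2 * grad (q i) (?P i y) $ 2))) +
      kapN D * (0 * - (LINT y|leb Nr. u0N (y $ 1) * grad (grad h) (y $ 1))) =
    (\<Sum>i\<in>idx. width G i / len G * thick G i * (LINT y|leb Er. src D i (pt (y $ 1) ((width G i / len G * y $ 2) *\<^sub>R dir G i)) * q i (?P i y))) +
      ?tB * ?tA"
    by (rule LIMSEQ_unique[OF Lim_transform_eventually[OF _ LR]])
  have T1: "kap D i * thick G i * (width G i / len G * (LINT y|leb Er. W i (proj12 y) $ 1 * grad (q i) (?P i y) $ 1) +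
        1 * (LINT y|leb Er. W i (proj12 y) $ 2 * grad (q i) (?P i y) $ 2)) = thick G i * (kap D i * (LINT y|leb (Dm i). lim_g i y \<bullet> grad (q i) y))"
    if i: "i \<in> idx" for i
  proof -
    note lg = L2_continuous[OF E_dom_simps(2,3) cg[OF i]]
    have "(LINT y|leb (Dm i). lim_g i y \<bullet> grad (q i) y) =
      (LINT y|leb (Dm i). lim_g i y $ 1 * grad (q i) y $ 1) + (LINT y|leb (Dm i). lim_g i y $ 2 * grad (q i) y $ 2)"
      unfolding inner_2 by (rule Bochner_Integration.integral_add; rule L2_integrable_mult[OF L2_vec_nth[OF lim_u(3)[OF i]] lg])
    also have "\<dots> = (LINT y|leb (Dm i). W i (stretch (ratio i) y) $ 1 * grad (q i) y $ 1) + ratio i * (LINT y|leb (Dm i). W i (stretch (ratio i) y) $ 2 * grad (q i) y $ 2)"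
      by (simp add: lim_g_def stretch_def mult.assoc)
    finally show ?thesis
      unfolding dm[OF i W(3)[OF i] cg[OF i]] by (simp only: mult.assoc[symmetric] ratio(3)[OF i]) (simp add: algebra_simps)
  qed
  have T2: "width G i / len G * thick G i * (LINT y|leb Er. src D i (pt (y $ 1) ((width G i / len G * y $ 2) *\<^sub>R dir G i)) * q i (?P i y)) =
      thick G i * (LINT y|leb (Dm i). src D i (chart G i y) * q i y)" if i: "i \<in> idx" for i
  proof -
    let ?f = "\<lambda>y::real^2. src D i (pt (y $ 1) ((width G i / len G * y $ 2) *\<^sub>R dir G i))"
    have "L2 Q ?f" using continuous_plate[of 1 1 "width G i / len G" 2 "dir G i"]
      by (intro L2_continuous rect_simps continuous_on_compose2[OF cD(2)[OF i]]) auto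
    from dm[OF i this smooth_continuous[OF sq[OF i]]]
    have "(LINT y|leb Er. src D i (pt (y $ 1) ((width G i / len G * y $ 2) *\<^sub>R dir G i)) * q i (?P i y)) =
      ratio i * (LINT y|leb (Dm i). src D i (pt (y $ 1) ((width G i / len G * (ratio i * y $ 2)) *\<^sub>R dir G i)) * q i y)"
      by (simp add: stretch_def)
    also have "\<dots> = ratio i * (LINT y|leb (Dm i). src D i (chart G i y) * q i y)"
      using G_pos G_i(1)[OF i] by (simp add: chart_def ratio_def)
    finally have I: "(LINT y|leb Er. src D i (pt (y $ 1) ((width G i / len G * y $ 2) *\<^sub>R dir G i)) * q i (?P i y)) =
      ratio i * (LINT y|leb (Dm i). src D i (chart G i y) * q i y)" .
    have "width G i / len G * thick G i * (ratio i * J) = (width G i / len G * ratio i) * (thick G i * J)" for J by (simp only: ac_simps)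
    then show ?thesis unfolding I by (simp only: ratio(3)[OF i] mult_1_left)
  qed
  \<comment> \<open>The limit integrand is constant on cross-sections; integration over the junction
    produces the area of \<open>omega G\<close>, which the normalisation of the source
    cancels.\<close>
  have T3: "?tB * ?tA = (LINT x|leb I0. srcN D (pt x 0) * h x)"
  proof -
    have "continuous_on UNIV (\<lambda>x. srcN D (pt x 0) * h x)"
    proof (rule continuous_on_mult[OF continuous_on_compose2[OF cD(1)] smooth_continuous[OF h(1)]])
      show "continuous_on UNIV (\<lambda>x. pt x 0)"
      proof (rule continuous_on_vec)
        fix i :: 3
        show "continuous_on UNIV (\<lambda>x. pt x 0 $ i)" using exhaust_3[of i] by (elim disjE) (simp_all add: continuous_intros)
      qed
    qed auto
    from thin_domain.N_ref_product(1)[OF dom integrable_continuous_interval[OF this], of "\<lambda>_. 1"]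
    show ?thesis using omega_measure_pos thin_domain.omega_lm[OF dom] by (simp add: measure_restrict_space)
  qed
  show ?thesis using eq unfolding T3 by (simp only: T1 T2 cong: sum.cong)
qed

end

section \<open>Approximation of test functions\<close>

lemma l2n_support:
  assumes "R \<in> sets lebesgue" "S \<in> sets lebesgue" "L2 R z" "L2 S f" "0 \<le> c"
    and "\<And>x. x \<in> R \<inter> S \<Longrightarrow> norm (z x) \<le> c * norm (f x)" "\<And>x. x \<in> R - S \<Longrightarrow> z x = 0"
  shows "l2n R z \<le> c * l2n S f"
proof -
  have m: "R \<inter> S \<in> sets lebesgue" using assms(1,2) by (rule sets.Int)
  have "(LINT x|leb R. (norm (z x))\<^sup>2) = (LINT x|leb (R \<inter> S). (norm (z x))\<^sup>2)"
    using assms(7) by (intro LINT_subset m assms(1)) auto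
  then have "l2n R z = l2n (R \<inter> S) z" by (simp add: l2n_def)
  also have "\<dots> \<le> c * l2n (R \<inter> S) f"
  proof (rule l2n_le_bound[OF L2_subset[OF _ m assms(1,3)] L2_subset[OF _ m assms(2,4)] assms(5)])
    show "AE x in leb (R \<inter> S). norm (z x) \<le> c * norm (f x)" using assms(6) by (intro AE_I2) simp
  qed auto
  also have "\<dots> \<le> c * l2n S f" by (intro mult_left_mono l2n_subset m assms) auto
  finally show ?thesis .
qed

lemma grad_cut_0: "1 \<le> \<bar>t\<bar> \<Longrightarrow> grad cut t = 0"
proof -
  assume t: "1 \<le> \<bar>t\<bar>"
  then have "1 * 1 \<le> \<bar>t\<bar> * \<bar>t\<bar>" by (intro mult_mono) auto
  then have "1 \<le> 2 * (t * t) + (-1)" by simp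
  then have 0: "grad step (2 * (t * t) + (-1)) = 0" by (simp add: grad_step_0)
  have s: "smooth (\<lambda>t::real. t * t)" by (intro smooth_mult smooth_id)
  show ?thesis
    unfolding cut_def[abs_def] grad_diff[OF smooth_const smooth_affine_real[OF smooth_step s]] grad_affine_real[OF smooth_step s] 0 by simp
qed

lemma grad_cut_bounded: obtains C where "0 \<le> C" "\<And>t. \<bar>grad cut t\<bar> \<le> C"
proof -
  obtain C where C: "0 \<le> C" "\<And>t. t \<in> {-1..1} \<Longrightarrow> \<bar>grad cut t\<bar> \<le> C"
    using test_function_real_bounded_grad[OF smooth_cut, of "{-1..1}"] by (metis bounded_closed_interval)
  have "\<bar>grad cut t\<bar> \<le> C" for t
    using C(2)[of t] C(1) grad_cut_0[of t] by (cases "\<bar>t\<bar> \<le> 1") (auto simp: abs_le_iff)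
  with C(1) show ?thesis by (rule that)
qed

lemma cut_abs: "\<bar>cut t\<bar> \<le> 1" using step_bounds[of "2 * (t * t) + (-1)"] by (simp add: cut_def)

lemma smooth_cut_side: "smooth (\<lambda>y::real^2. cut ((1/d) * y $ 2 + a))"
  by (rule smooth_affine_real[OF smooth_cut smooth_nth])

text \<open>The product rule costs C/d times the norm of \<open>f\<close> in the strip, and
  \<open>rect_trace_bounds\<close> estimates that norm by sqrt(d) times the trace plus d times the
  gradient. Only the trace term keeps a negative power of \<open>d\<close>.\<close>

lemma cut_bound:
  assumes f: "smooth f" and d: "0 < d" and q: "q = p + d" and s0: "s0 \<in> {p..q}" and R: "R \<in> sets lebesgue" "bounded R"
    and sub: "\<And>y. y \<in> R \<Longrightarrow> y \<notin> rect L p q \<Longrightarrow> d \<le> \<bar>y $ 2 - s0\<bar>"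
    and z: "z = (\<lambda>y. cut ((1/d) * y $ 2 + - (s0/d)) * f y)" and C: "0 \<le> C" "\<And>t. \<bar>grad cut t\<bar> \<le> C"
    and r: "r = l2n {0<..<L} (\<lambda>x. f (pt2 x s0))"
  shows "smooth z" "l2n R z \<le> 2 * sqrt d * r + 2 * d * l2n (rect L p q) (grad f)"
    "l2n R (grad z) \<le> (1 + 2 * C) * l2n (rect L p q) (grad f) + C / d * (2 * sqrt d * r)"
proof -
  let ?S = "rect L p q" and ?b = "\<lambda>y::real^2. cut ((1/d) * y $ 2 + - (s0/d))"
  note sc = smooth_cut_side[of d "- (s0/d)"]
  show sz: "smooth z" unfolding z by (rule smooth_mult[OF sc f])
  have arg: "1 \<le> \<bar>(1/d) * y $ 2 + - (s0/d)\<bar>" if "y \<in> R - ?S" for y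
  proof -
    have "(1/d) * y $ 2 + - (s0/d) = (y $ 2 - s0) / d" by (simp add: diff_divide_distrib)
    then show ?thesis using sub[of y] that d by simp
  qed
  have LS: "L2 ?S f" "L2 ?S (grad f)" "L2 ?S (\<lambda>x. grad f x \<bullet> e2)" by (simp_all add: L2_smooth L2_grad L2_component f)
  define A where "A = l2n ?S (grad f)"
  have G: "l2n ?S (\<lambda>x. grad f x \<bullet> e2) \<le> A"
  proof -
    have "norm (v \<bullet> e2) \<le> 1 * norm v" for v :: "real^2" using component_le_norm_cart[of v 2] by (simp add: cart_eq_inner_axis)
    then show ?thesis using l2n_le_bound[OF LS(3,2), of 1] by (simp add: A_def)
  qed
  have nn: "0 \<le> r" "0 \<le> A" by (simp_all add: r A_def)
  have fS: "l2n ?S f \<le> 2 * sqrt d * r + 2 * d * A"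
  proof (rule power2_le_imp_le)
    have "(l2n ?S f)\<^sup>2 \<le> 2 * d * r\<^sup>2 + 2 * d\<^sup>2 * (l2n ?S (\<lambda>x. grad f x \<bullet> e2))\<^sup>2"
      using rect_trace_bounds(1)[OF f _ s0, of L] d by (simp add: q r)
    also have "\<dots> \<le> 2 * d * r\<^sup>2 + 2 * d\<^sup>2 * A\<^sup>2"
      using G d by (intro add_left_mono mult_left_mono power_mono) auto
    \<comment> \<open>The inequality 2 x^2 + 2 y^2 <= (2 x + 2 y)^2 for the nonnegative numbers x =
      sqrt(d) r and y = d A.\<close>
    also have "\<dots> \<le> (2 * sqrt d * r + 2 * d * A)\<^sup>2"
    proof -
      have "0 \<le> sqrt d * r * (d * A)" using d nn by simp
      moreover have "0 \<le> d * r\<^sup>2" "0 \<le> d\<^sup>2 * A\<^sup>2" using d by auto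
      moreover have "(2 * sqrt d * r + 2 * d * A)\<^sup>2 = 4 * ((sqrt d)\<^sup>2 * r\<^sup>2) + 8 * (sqrt d * r * (d * A)) + 4 * (d\<^sup>2 * A\<^sup>2)"
        by (simp add: power2_sum power_mult_distrib algebra_simps)
      moreover have "(sqrt d)\<^sup>2 = d" using d by simp
      ultimately show ?thesis by (simp add: mult.assoc)
    qed
    finally show "(l2n ?S f)\<^sup>2 \<le> (2 * sqrt d * r + 2 * d * A)\<^sup>2" .
    show "0 \<le> 2 * sqrt d * r + 2 * d * A" using d nn by simp
  qed
  have "l2n R z \<le> 1 * l2n ?S f"
  proof (rule l2n_support[OF R(1) rect_simps(3) L2_smooth[OF R(2,1) sz] LS(1)])
    show "norm (z y) \<le> 1 * norm (f y)" for y
      using mult_right_mono[OF cut_abs, of "norm (f y)" "(1/d) * y $ 2 + - (s0/d)"] by (simp add: z abs_mult)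
    show "z y = 0" if "y \<in> R - ?S" for y unfolding z using cut_0[OF arg[OF that]] by simp
  qed simp
  then show "l2n R z \<le> 2 * sqrt d * r + 2 * d * l2n ?S (grad f)" using fS by (simp add: A_def)
  have gc: "grad ?b y = ((1/d) * grad cut ((1/d) * y $ 2 + - (s0/d))) *\<^sub>R e2" for y
    using grad_affine_real[OF smooth_cut smooth_nth, of "1/d" 2 "- (s0/d)" y] grad_nth_compose[OF smooth_id, of 2 y] grad_DERIV[OF DERIV_ident, of "y $ 2"]
    by simp
  have gz: "grad z y = ?b y *\<^sub>R grad f y + f y *\<^sub>R grad ?b y" for y unfolding z by (rule grad_mult[OF sc f])
  have L1: "L2 R (\<lambda>y. ?b y *\<^sub>R grad f y)" and L2': "L2 R (\<lambda>y. f y *\<^sub>R grad ?b y)"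
    by (intro L2_continuous R continuous_intros smooth_continuous sc f continuous_grad)+
  have "l2n R (grad z) \<le> l2n R (\<lambda>y. ?b y *\<^sub>R grad f y) + l2n R (\<lambda>y. f y *\<^sub>R grad ?b y)"
    using l2n_triangle[OF L1 L2'] by (simp add: gz[abs_def])
  also have "l2n R (\<lambda>y. ?b y *\<^sub>R grad f y) \<le> 1 * A" unfolding A_def
  proof (rule l2n_support[OF R(1) rect_simps(3) L1 LS(2)])
    show "norm (?b y *\<^sub>R grad f y) \<le> 1 * norm (grad f y)" for y
      using mult_right_mono[OF cut_abs, of "norm (grad f y)" "(1/d) * y $ 2 + - (s0/d)"] by simp
    show "?b y *\<^sub>R grad f y = 0" if "y \<in> R - ?S" for y using cut_0[OF arg[OF that]] by simp
  qed simp
  also have "l2n R (\<lambda>y. f y *\<^sub>R grad ?b y) \<le> C / d * l2n ?S f"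
  proof (rule l2n_support[OF R(1) rect_simps(3) L2' LS(1)])
    show "norm (f y *\<^sub>R grad ?b y) \<le> C / d * norm (f y)" for y
      unfolding gc using mult_right_mono[OF C(2), of "\<bar>f y\<bar> / d" "(1/d) * y $ 2 + - (s0/d)"] d
      by (simp add: abs_mult field_simps)
    show "f y *\<^sub>R grad ?b y = 0" if "y \<in> R - ?S" for y unfolding gc using grad_cut_0[OF arg[OF that]] by simp
  qed (use C d in simp)
  also have "C / d * l2n ?S f \<le> C / d * (2 * sqrt d * r + 2 * d * A)" using fS C d by (intro mult_left_mono) auto
  also have "\<dots> = C / d * (2 * sqrt d * r) + 2 * C * A" using d by (simp add: distrib_left)
  finally show "l2n R (grad z) \<le> (1 + 2 * C) * l2n ?S (grad f) + C / d * (2 * sqrt d * r)"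
    by (simp add: A_def algebra_simps)
qed

text \<open>The strips shrink to a side disjoint from the open rectangle, so their indicators tend
  to 0 pointwise and \<open>v\<close> dominates. The offset \<open>p\<close> places the strip at
  whichever of the two sides is \<open>s0\<close>.\<close>

lemma strip_vanishes:
  fixes v :: "real^2 \<Rightarrow> 'b::euclidean_space"
  assumes l: "0 < l" and v: "L2 (rect L 0 l) v" and p: "p = (\<lambda>n. if s0 = 0 then 0 else l - l / real (Suc n))"
  shows "(\<lambda>n. l2n (rect L (p n) (p n + l / real (Suc n))) v) \<longlonglongrightarrow> 0"
proof -
  let ?S = "\<lambda>n. rect L (p n) (p n + l / real (Suc n))"
  have sub: "?S n \<subseteq> rect L 0 l" for n
  proof -
    have "l / real (Suc n) \<le> l" using l by (simp add: field_simps)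
    then show ?thesis using l by (auto simp: rect_def p split: if_splits)
  qed
  have "L2_tendsto (rect L 0 l) (\<lambda>n y. indicat_real (?S n) y *\<^sub>R v y) (\<lambda>_. 0)"
  proof (rule L2_tendsto_dominated[OF v])
    show "(\<lambda>y. indicat_real (?S n) y *\<^sub>R v y) \<in> mbl (rect L 0 l)" for n
      by (intro borel_measurable_scaleR L2_meas[OF v] measurable_restrict_space1 borel_measurable_indicator rect_simps)
    show "AE y in leb (rect L 0 l). (\<lambda>n. indicat_real (?S n) y *\<^sub>R v y) \<longlonglongrightarrow> 0"
    proof (rule AE_I2)
      fix y assume "y \<in> space (leb (rect L 0 l))"
      then have y: "0 < y $ 2" "y $ 2 < l" by (auto simp: rect_def)
      have "(\<lambda>n. l / real (Suc n)) \<longlonglongrightarrow> 0"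
        using tendsto_mult_right_zero[OF LIMSEQ_inverse_real_of_nat, of l] by (simp add: divide_inverse)
      moreover have "0 < (if s0 = 0 then y $ 2 else l - y $ 2)" using y by simp
      ultimately have "\<forall>\<^sub>F n in sequentially. l / real (Suc n) < (if s0 = 0 then y $ 2 else l - y $ 2)" by (rule order_tendstoD(2))
      then have "\<forall>\<^sub>F n in sequentially. 0 = indicat_real (?S n) y *\<^sub>R v y"
        by eventually_elim (auto simp: rect_def p split: if_splits)
      then show "(\<lambda>n. indicat_real (?S n) y *\<^sub>R v y) \<longlonglongrightarrow> 0" by (rule Lim_transform_eventually[OF tendsto_const])
    qed
  qed (auto simp: indicator_def)
  from L2_tendsto_norm[OF this] have "(\<lambda>n. l2n (rect L 0 l) (\<lambda>y. indicat_real (?S n) y *\<^sub>R v y)) \<longlonglongrightarrow> 0" by simp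
  moreover have "l2n (rect L 0 l) (\<lambda>y. indicat_real (?S n) y *\<^sub>R v y) = l2n (?S n) v" for n
  proof -
    have "(LINT y|leb (rect L 0 l). (norm (indicat_real (?S n) y *\<^sub>R v y))\<^sup>2) = (LINT y|leb (?S n). (norm (indicat_real (?S n) y *\<^sub>R v y))\<^sup>2)"
      by (rule LINT_subset[OF sub]) (auto simp: indicator_def)
    also have "\<dots> = (LINT y|leb (?S n). (norm (v y))\<^sup>2)" by (rule LINT_cong) simp
    finally show ?thesis by (simp add: l2n_def)
  qed
  ultimately show ?thesis by simp
qed

text \<open>A sequence in $H^1$ whose traces on a side tend to zero may be localised to a thin strip along
  that side at the cost of an arbitrarily small norm: in the strip of width $\delta$ the factor $1/\delta$
  from the cutoff is absorbed by the Poincare inequality.\<close>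

lemma cut_small:
  assumes l: "0 < l" and d: "\<And>k. smooth (d k)" and v: "L2_tendsto (rect L 0 l) (\<lambda>k. grad (d k)) v"
    and tr: "L2_tendsto {0<..<L} (\<lambda>k x. d k (pt2 x s0)) (\<lambda>_. 0)" and e: "0 < e"
    and s0: "s0 = 0 \<or> s0 = l \<and> r = l"
  obtains a where "0 < a" "a \<le> l"
    "\<forall>\<^sub>F k in sequentially. l2n (rect L 0 r) (\<lambda>y. cut ((1/a) * y $ 2 + - (s0/a)) * d k y) \<le> e \<and>
      l2n (rect L 0 r) (grad (\<lambda>y. cut ((1/a) * y $ 2 + - (s0/a)) * d k y)) \<le> e"
proof -
  obtain C where C: "0 \<le> C" "\<And>t. \<bar>grad cut t\<bar> \<le> C" using grad_cut_bounded by blast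
  define M where "M = 1 + 2 * C"
  have M: "1 \<le> M" using C by (simp add: M_def)
  \<comment> \<open>Small enough for the gradient terms, which are at most 4 f and 2 f M, to stay
    below e/2; the other half of the tolerance is left to the trace.\<close>
  define f where "f = e / (8 * M)"
  have f: "0 < f" "f \<le> e / 8" "M * f = e / 8" using M e by (auto simp: f_def field_simps)
  define p where "p = (\<lambda>n. if s0 = 0 then 0 else l - l / real (Suc n))"
  let ?S = "\<lambda>n. rect L (p n) (p n + l / real (Suc n))"
  have "(\<lambda>n. l / real (Suc n)) \<longlonglongrightarrow> 0"
    using tendsto_mult_right_zero[OF LIMSEQ_inverse_real_of_nat, of l] by (simp add: divide_inverse)
  then have "\<forall>\<^sub>F n in sequentially. l / real (Suc n) < 1" by (rule order_tendstoD(2)) simp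
  moreover have "\<forall>\<^sub>F n in sequentially. l2n (?S n) v < f"
    by (rule order_tendstoD(2)[OF strip_vanishes[OF l L2_tendstoD(2)[OF v] p_def] f(1)])
  ultimately have "\<forall>\<^sub>F n in sequentially. l / real (Suc n) < 1 \<and> l2n (?S n) v < f" by eventually_elim simp
  then obtain n where n: "l / real (Suc n) < 1" "l2n (?S n) v < f" by (auto simp: eventually_sequentially)
  \<comment> \<open>The width is fixed by the limit gradient alone and \<open>k\<close> grows
    afterwards, so negative powers of \<open>a\<close> only multiply traces that tend to 0.\<close>
  define a where "a = l / real (Suc n)"
  have a: "0 < a" "a \<le> 1" "a \<le> l" using l n by (auto simp: a_def field_simps)
  define P where "P = p n"
  have Ps: "s0 \<in> {P..P + a}" "0 \<le> P" "P + a \<le> l" using s0 a by (auto simp: P_def p_def a_def)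
  let ?S = "rect L P (P + a)"
  have vS: "l2n ?S v < f" using n by (simp add: P_def a_def)
  have sub: "?S \<subseteq> rect L 0 l" using Ps by (auto simp: rect_def)
  define q where "q k = l2n {0<..<L} (\<lambda>x. d k (pt2 x s0))" for k
  have q: "q \<longlonglongrightarrow> 0" using L2_tendsto_norm[OF tr] by (simp add: q_def[abs_def])
  have gv: "(\<lambda>k. l2n (rect L 0 l) (\<lambda>x. grad (d k) x - v x)) \<longlonglongrightarrow> 0" by (rule L2_tendstoD(3)[OF v])
  have t1: "(\<lambda>k. 2 * sqrt a * q k) \<longlonglongrightarrow> 0" by (rule tendsto_mult_right_zero[OF q])
  then have t2: "(\<lambda>k. C / a * (2 * sqrt a * q k)) \<longlonglongrightarrow> 0" by (rule tendsto_mult_right_zero)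
  have e2: "0 < e / 2" using e by simp
  have "\<forall>\<^sub>F k in sequentially. l2n (rect L 0 r) (\<lambda>y. cut ((1/a) * y $ 2 + - (s0/a)) * d k y) \<le> e \<and>
      l2n (rect L 0 r) (grad (\<lambda>y. cut ((1/a) * y $ 2 + - (s0/a)) * d k y)) \<le> e"
    using order_tendstoD(2)[OF t1 e2] order_tendstoD(2)[OF t2 e2] order_tendstoD(2)[OF gv f(1)]
  proof eventually_elim
    case (elim k)
    have out: "a \<le> \<bar>y $ 2 - s0\<bar>" if "y \<in> rect L 0 r" "y \<notin> ?S" for y
      using that s0 a by (auto simp: rect_def P_def p_def a_def split: if_splits)
    let ?z = "\<lambda>y. cut ((1/a) * y $ 2 + - (s0/a)) * d k y"
    have b: "l2n (rect L 0 r) ?z \<le> 2 * sqrt a * q k + 2 * a * l2n ?S (grad (d k))"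
      by (rule cut_bound(2)[OF d a(1) refl Ps(1) rect_simps(3,2) _ refl C q_def]) (erule (1) out)
    have b': "l2n (rect L 0 r) (grad ?z) \<le> (1 + 2 * C) * l2n ?S (grad (d k)) + C / a * (2 * sqrt a * q k)"
      by (rule cut_bound(3)[OF d a(1) refl Ps(1) rect_simps(3,2) _ refl C q_def]) (erule (1) out)
    have G: "l2n ?S (grad (d k)) \<le> 2 * f"
    proof -
      have LS: "L2 ?S (grad (d k))" "L2 ?S v"
        by (rule L2_subset[OF sub rect_simps(3,3)], rule L2_tendstoD[OF v])+
      have "l2n ?S (grad (d k)) \<le> l2n ?S (\<lambda>x. grad (d k) x - v x) + l2n ?S v" using l2n_triangle[OF L2_diff[OF LS] LS(2)] by simp
      also have "l2n ?S (\<lambda>x. grad (d k) x - v x) \<le> l2n (rect L 0 l) (\<lambda>x. grad (d k) x - v x)"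
        by (rule l2n_subset[OF sub rect_simps(3,3) L2_diff[OF L2_tendstoD(1,2)[OF v]]])
      finally show ?thesis using elim vS by simp
    qed
    have "2 * a * l2n ?S (grad (d k)) \<le> 2 * 1 * (2 * f)" using a G by (intro mult_mono) auto
    then have 1: "2 * a * l2n ?S (grad (d k)) \<le> e / 2" using f by simp
    have "M * l2n ?S (grad (d k)) \<le> M * (2 * f)" using M G by (intro mult_left_mono) auto
    then have 2: "M * l2n ?S (grad (d k)) \<le> e / 2" using f e by simp
    show ?case using b b' 1 2 [unfolded M_def] elim(1,2) by linarith
  qed
  with a(1,3) show ?thesis by (rule that)
qed

text \<open>A retraction that collapses a zone of width \<delta> to 0 and is the identity beyond 2
  \<delta>. Composing with it makes a function independent of s near N and, unlike multiplication by
  a cutoff, keeps first derivatives bounded.\<close>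

definition ret :: "real \<Rightarrow> real \<Rightarrow> real" where "ret \<delta> s = s * step ((1/\<delta>) * s + (-1))"

lemma smooth_ret: "smooth (ret d)"
  unfolding ret_def[abs_def] by (intro smooth_mult smooth_id smooth_affine_real[OF smooth_step])

lemma ret:
  assumes "0 < d" shows "s \<le> d \<Longrightarrow> ret d s = 0" "2 * d \<le> s \<Longrightarrow> ret d s = s" "0 \<le> s \<Longrightarrow> 0 \<le> ret d s" "0 \<le> s \<Longrightarrow> ret d s \<le> s"
proof -
  show "s \<le> d \<Longrightarrow> ret d s = 0" "2 * d \<le> s \<Longrightarrow> ret d s = s"
    using assms by (simp_all add: ret_def step_0 step_1 field_simps)
  show "0 \<le> s \<Longrightarrow> 0 \<le> ret d s" "0 \<le> s \<Longrightarrow> ret d s \<le> s"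
    using step_bounds by (simp_all add: ret_def mult_left_le)
qed

lemma grad_ret_1: "0 < d \<Longrightarrow> 2 * d < s \<Longrightarrow> grad (ret d) s = 1"
  using grad_eq_on_open[of "{2 * d<..}" s "ret d" "\<lambda>s. s"] grad_DERIV[OF DERIV_ident, of s] by (simp add: ret(2))

text \<open>The factor 1/\<delta> from \<open>step\<close> acts only for s between \<delta> and 2
  \<delta>, where the factor s compensates it. The bound does not depend on \<delta>, as bounded
  convergence of the gradients requires.\<close>

lemma grad_ret_bounded: obtains C where "0 \<le> C" "\<And>d s. 0 < d \<Longrightarrow> \<bar>grad (ret d) s\<bar> \<le> C"
proof -
  obtain C where C: "C \<ge> 0" "\<And>x. \<bar>grad step x\<bar> \<le> C" using grad_step_bounded by blast
  have "\<bar>grad (ret d) s\<bar> \<le> 1 + 2 * C" if d: "0 < d" for d s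
  proof -
    let ?a = "(1/d) * s + (-1)"
    have g: "grad (ret d) s = s * ((1/d) * grad step ?a) + step ?a"
      unfolding ret_def[abs_def] grad_mult[OF smooth_id smooth_affine_real[OF smooth_step smooth_id]] grad_affine_real[OF smooth_step smooth_id]
      using grad_DERIV[OF DERIV_ident, of s] by simp
    have "\<bar>s * ((1/d) * grad step ?a)\<bar> \<le> 2 * C"
    proof (cases "?a \<le> 0 \<or> 1 \<le> ?a")
      case True then show ?thesis using C by (simp add: grad_step_0)
    next
      case False
      then have "\<bar>s * (1/d)\<bar> \<le> 2" using d by (simp add: field_simps)
      then have "\<bar>s * (1/d)\<bar> * \<bar>grad step ?a\<bar> \<le> 2 * C" using C by (intro mult_mono) auto
      then show ?thesis by (simp add: abs_mult)
    qed
    then show ?thesis using g step_bounds[of ?a] by linarith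
  qed
  with C(1) show ?thesis by (intro that[of "1 + 2 * C"]) auto
qed

text \<open>The retraction at both ends of (0,L): first at L by reflection, then at 0. A function of
  x_1 composed with it has a derivative with compact support in (0,L).\<close>

definition ret2 :: "real \<Rightarrow> real \<Rightarrow> real \<Rightarrow> real" where "ret2 L \<delta> x = ret \<delta> (-1 * ret \<delta> (-1 * x + L) + L)"

lemma smooth_ret2: "smooth (ret2 L d)"
  unfolding ret2_def[abs_def] by (rule smooth_affine_real[OF smooth_ret smooth_affine_real[OF smooth_ret smooth_id]])

lemma ret2:
  assumes "0 < d" "3 * d \<le> L"
  shows "x \<le> d \<Longrightarrow> ret2 L d x = 0" "L - d \<le> x \<Longrightarrow> ret2 L d x = L" "2 * d \<le> x \<Longrightarrow> x \<le> L - 2 * d \<Longrightarrow> ret2 L d x = x"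
    "0 \<le> x \<Longrightarrow> x \<le> L \<Longrightarrow> 0 \<le> ret2 L d x" "0 \<le> x \<Longrightarrow> x \<le> L \<Longrightarrow> ret2 L d x \<le> L"
proof -
  show "x \<le> d \<Longrightarrow> ret2 L d x = 0" "L - d \<le> x \<Longrightarrow> ret2 L d x = L" "2 * d \<le> x \<Longrightarrow> x \<le> L - 2 * d \<Longrightarrow> ret2 L d x = x"
    using assms by (simp_all add: ret2_def ret)
  assume x: "0 \<le> x" "x \<le> L"
  then have "0 \<le> ret d (-1 * x + L)" "ret d (-1 * x + L) \<le> -1 * x + L" using assms by (auto intro!: ret)
  then have "0 \<le> -1 * ret d (-1 * x + L) + L" "-1 * ret d (-1 * x + L) + L \<le> L" using x by auto
  then show "0 \<le> ret2 L d x" "ret2 L d x \<le> L" unfolding ret2_def using ret(3,4)[OF assms(1)] order_trans by blast+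
qed

lemma grad_ret2:
  assumes "0 < d" "3 * d \<le> L" and C: "0 \<le> C" "\<And>s. \<bar>grad (ret d) s\<bar> \<le> C"
  shows "2 * d < x \<Longrightarrow> x < L - 2 * d \<Longrightarrow> grad (ret2 L d) x = 1" "\<bar>grad (ret2 L d) x\<bar> \<le> C * C"
proof -
  show "2 * d < x \<Longrightarrow> x < L - 2 * d \<Longrightarrow> grad (ret2 L d) x = 1"
    using grad_eq_on_open[of "{2 * d<..<L - 2 * d}" x "ret2 L d" "\<lambda>s. s"] grad_DERIV[OF DERIV_ident, of x] by (simp add: ret2(3)[OF assms(1,2)])
  have "grad (ret2 L d) x = grad (ret d) (-1 * ret d (-1 * x + L) + L) * grad (ret d) (-1 * x + L)"
    unfolding ret2_def[abs_def] grad_affine_real[OF smooth_ret smooth_affine_real[OF smooth_ret smooth_id]] grad_affine_real[OF smooth_ret smooth_id]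
    using grad_DERIV[OF DERIV_ident, of x] by simp
  then show "\<bar>grad (ret2 L d) x\<bar> \<le> C * C" using C by (simp add: abs_mult mult_mono)
qed

lemma grad_pt2_compose:
  assumes q: "smooth q" and X: "smooth X" and Y: "smooth Y"
  shows "smooth (\<lambda>y::real^2. q (pt2 (X (y $ 1)) (Y (y $ 2))))"
    "grad (\<lambda>y::real^2. q (pt2 (X (y $ 1)) (Y (y $ 2)))) y =
      pt2 (grad q (pt2 (X (y $ 1)) (Y (y $ 2))) $ 1 * grad X (y $ 1)) (grad q (pt2 (X (y $ 1)) (Y (y $ 2))) $ 2 * grad Y (y $ 2))"
proof -
  let ?tA = "\<lambda>v. (grad (\<lambda>y. X (y $ 1)) y \<bullet> v) *\<^sub>R axis 1 1 + (grad (\<lambda>y. Y (y $ 2)) y \<bullet> v) *\<^sub>R axis 2 1"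
  let ?T = "\<lambda>y::real^2. pt2 (X (y $ 1)) (Y (y $ 2))"
  have sX: "smooth (\<lambda>y::real^2. X (y $ 1))" and sY: "smooth (\<lambda>y::real^2. Y (y $ 2))" by (rule smooth_nth_compose X Y)+
  show "smooth (\<lambda>y. q (?T y))"
  proof (rule smooth_compose[OF q])
    fix b :: "real^2"
    have "(\<lambda>y. ?T y \<bullet> b) = (\<lambda>y. b $ 1 * X (y $ 1) + b $ 2 * Y (y $ 2))" by (simp add: fun_eq_iff inner_2 mult.commute)
    then show "smooth (\<lambda>y. ?T y \<bullet> b)" by (simp add: smooth_add smooth_cmult sX sY)
  qed
  have T: "?T = (\<lambda>y. X (y $ 1) *\<^sub>R axis 1 1 + Y (y $ 2) *\<^sub>R axis 2 1)" by (simp add: fun_eq_iff vec_eq_iff forall_2 axis_def)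
  have "(?T has_derivative (\<lambda>v. (grad (\<lambda>y. X (y $ 1)) y \<bullet> v) *\<^sub>R axis 1 1 + (grad (\<lambda>y. Y (y $ 2)) y \<bullet> v) *\<^sub>R axis 2 1)) (at y)"
    unfolding T by (intro has_derivative_add has_derivative_scaleR_left smooth_has_grad sX sY)
  from has_derivative_compose[OF this smooth_has_grad[OF q]]
  have "((\<lambda>y. q (?T y)) has_derivative (\<lambda>v. grad q (?T y) \<bullet> (?tA v))) (at y)" .
  moreover have "grad q (?T y) \<bullet> (?tA v) =
      pt2 (grad q (?T y) $ 1 * grad X (y $ 1)) (grad q (?T y) $ 2 * grad Y (y $ 2)) \<bullet> v" for v
    by (simp add: grad_nth_compose[OF X] grad_nth_compose[OF Y] inner_2 axis_def algebra_simps)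
  ultimately show "grad (\<lambda>y. q (?T y)) y = pt2 (grad q (?T y) $ 1 * grad X (y $ 1)) (grad q (?T y) $ 2 * grad Y (y $ 2))"
    by (intro grad_eqI) simp
qed

context thin_limit
begin

text \<open>The limit equation in chart coordinates with the test function, its gradient and its
  common trace as three independent arguments; in this form it is stable under separate L2
  convergence of the three.\<close>

definition "limit_eq p q h \<longleftrightarrow>
  (\<Sum>i\<in>idx. thick G i * (kap D i * (LINT y|leb (Dm i). lim_g i y \<bullet> q i y))) =
    (LINT x|leb I0. srcN D (pt x 0) * h x) +
    (\<Sum>i\<in>idx. thick G i * (LINT y|leb (Dm i). src D i (chart G i y) * p i y))"

lemma src_L2: "L2 I0 (\<lambda>x. srcN D (pt x 0))" "i \<in> idx \<Longrightarrow> L2 (Dm i) (\<lambda>y. src D i (chart G i y))"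
proof -
  have cD: "continuous_on UNIV (srcN D)" "\<And>i. i \<in> idx \<Longrightarrow> continuous_on UNIV (src D i)"
    using coefficients by (auto simp: admissible_coefficients_def)
  have "continuous_on UNIV (\<lambda>x. pt x 0)"
  proof (rule continuous_on_vec)
    fix i :: 3
    show "continuous_on UNIV (\<lambda>x. pt x 0 $ i)" using exhaust_3[of i] by (elim disjE) (simp_all add: continuous_intros)
  qed
  then show "L2 I0 (\<lambda>x. srcN D (pt x 0))"
    by (intro L2_continuous continuous_on_compose2[OF cD(1)]) auto
  have "continuous_on UNIV (\<lambda>y::real^2. chart G i y)"
    unfolding chart_def using continuous_plate[of 1 1 1 2 "dir G i"] by simp
  then show "i \<in> idx \<Longrightarrow> L2 (Dm i) (\<lambda>y. src D i (chart G i y))"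
    by (intro L2_continuous continuous_on_compose2[OF cD(2)]) auto
qed

lemma limit_eq_closed:
  assumes eq: "\<And>k. limit_eq (ps k) (qs k) (hs k)"
    and p: "\<And>i. i \<in> idx \<Longrightarrow> L2_tendsto (Dm i) (\<lambda>k. ps k i) (p i)"
    and q: "\<And>i. i \<in> idx \<Longrightarrow> L2_tendsto (Dm i) (\<lambda>k. qs k i) (q i)"
    and h: "L2_tendsto I0 hs h"
  shows "limit_eq p q h"
proof -
  have "(\<lambda>k. \<Sum>i\<in>idx. thick G i * (kap D i * (LINT y|leb (Dm i). lim_g i y \<bullet> qs k i y))) \<longlonglongrightarrow>
      (\<Sum>i\<in>idx. thick G i * (kap D i * (LINT y|leb (Dm i). lim_g i y \<bullet> q i y)))"
    by (intro tendsto_sum tendsto_mult_left L2_tendsto_inner L2_tendsto_const lim_u(3) q)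
  moreover have "(\<lambda>k. (LINT x|leb I0. srcN D (pt x 0) * hs k x) +
      (\<Sum>i\<in>idx. thick G i * (LINT y|leb (Dm i). src D i (chart G i y) * ps k i y))) \<longlonglongrightarrow>
      (LINT x|leb I0. srcN D (pt x 0) * h x) +
      (\<Sum>i\<in>idx. thick G i * (LINT y|leb (Dm i). src D i (chart G i y) * p i y))"
    by (intro tendsto_add tendsto_sum tendsto_mult_left L2_tendsto_mult L2_tendsto_const src_L2 h p)
  ultimately show ?thesis using eq unfolding limit_eq_def by (simp add: LIMSEQ_unique)
qed

text \<open>Composition with \<open>ret2\<close> in x_1 and \<open>ret\<close> in s yields functions
  admissible in \<open>limit_equation_glued\<close>. At every point of the open rectangle they and
  their gradients eventually agree with the original ones, and they stay bounded.\<close>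

lemma limit_eq_matched:
  assumes h: "smooth h" and sq: "\<And>i. i \<in> idx \<Longrightarrow> smooth (q i)"
    and q: "\<And>i x. i \<in> idx \<Longrightarrow> q i (pt2 x 0) = h x"
    and q0: "\<And>x. q (num G) (pt2 x (width G (num G))) = 0"
  shows "limit_eq q (\<lambda>i. grad (q i)) h"
proof -
  \<comment> \<open>A third of the shorter side leaves room for the collapsed zones:
    \<open>ret2\<close> needs 3 d <= \<open>len G\<close>, and the outer side must lie beyond 2 d to
    keep the value 0 there.\<close>
  define r where "r = min (len G) (width G (num G)) / 3"
  have r: "0 < r" "3 * r \<le> len G" "3 * r \<le> width G (num G)" using G_pos G_i(1)[OF num_mem] by (auto simp: r_def)
  define d where "d k = r / real (Suc k)" for k
  have d: "0 < d k" "3 * d k \<le> len G" "3 * d k \<le> width G (num G)" for k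
  proof -
    have "d k \<le> r" using r(1) by (simp add: d_def field_simps)
    then show "3 * d k \<le> len G" "3 * d k \<le> width G (num G)" using r by linarith+
    show "0 < d k" using r by (simp add: d_def)
  qed
  have dlim: "d \<longlonglongrightarrow> 0"
    using tendsto_mult_right_zero[OF LIMSEQ_inverse_real_of_nat, of r] by (simp add: d_def[abs_def] divide_inverse)
  define X where "X k = ret2 (len G) (d k)" for k
  define Y where "Y k = ret (d k)" for k
  have sX: "smooth (X k)" and sY: "smooth (Y k)" for k unfolding X_def Y_def by (rule smooth_ret2, rule smooth_ret)
  let ?T = "\<lambda>k y. pt2 (X k (y $ 1)) (Y k (y $ 2))"
  obtain C where C: "0 \<le> C" "\<And>d s. 0 < d \<Longrightarrow> \<bar>grad (ret d) s\<bar> \<le> C" using grad_ret_bounded by blast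
  have gX: "\<bar>grad (X k) x\<bar> \<le> C * C" for k x unfolding X_def using grad_ret2(2)[OF d(1,2) C(1) C(2)[OF d(1)]] .
  have gY: "\<bar>grad (Y k) x\<bar> \<le> C" for k x unfolding Y_def using C(2)[OF d(1)] .
  have eq: "limit_eq (\<lambda>i y. q i (?T k y)) (\<lambda>i. grad (\<lambda>y. q i (?T k y))) (\<lambda>x. h (X k x))" for k
    unfolding limit_eq_def
  proof (rule limit_equation_glued[OF smooth_compose_real[OF h sX] _ grad_pt2_compose(1)[OF sq sX sY] d(1)])
    show "test_function I0 (grad (\<lambda>x. h (X k x)))"
      unfolding test_function_def
    proof (intro conjI exI[of _ "{d k..len G - d k}"] allI impI)
      show "smooth (grad (\<lambda>x. h (X k x)))" by (rule smooth_grad_real[OF smooth_compose_real[OF h sX]])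
      show "grad (\<lambda>x. h (X k x)) x = 0" if "x \<notin> {d k..len G - d k}" for x
      proof (cases "x < d k")
        case True
        then show ?thesis using grad_eq_on_open[of "{..<d k}" x "\<lambda>x. h (X k x)" "\<lambda>_. h 0"] by (simp add: X_def ret2(1)[OF d(1,2)])
      next
        case False
        then show ?thesis using that grad_eq_on_open[of "{len G - d k<..}" x "\<lambda>x. h (X k x)" "\<lambda>_. h (len G)"] by (simp add: X_def ret2(2)[OF d(1,2)])
      qed
    qed (use d(1)[of k] in auto)
    show "q i (?T k (pt2 x s)) = h (X k x)" if "i \<in> idx" "s < d k" for i x s
      using that by (simp add: Y_def ret(1)[OF d(1)] q)
    show "q (num G) (?T k (pt2 x (width G (num G)))) = 0" for x
      using d(1,3)[of k] by (simp add: Y_def ret(2)[OF d(1)] q0)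
  qed
  have evX: "\<forall>\<^sub>F k in sequentially. X k x = x \<and> grad (X k) x = 1" if x: "0 < x" "x < len G" for x
  proof -
    have "0 < min x (len G - x) / 2" using x by simp
    from order_tendstoD(2)[OF dlim this] show ?thesis
    proof eventually_elim
      case (elim k)
      then have "2 * d k < x" "x < len G - 2 * d k" by auto
      then show ?case unfolding X_def using ret2(3)[OF d(1,2)] grad_ret2(1)[OF d(1,2) C(1) C(2)[OF d(1)]] by auto
    qed
  qed
  have evY: "\<forall>\<^sub>F k in sequentially. Y k x = x \<and> grad (Y k) x = 1" if x: "0 < x" for x
  proof -
    have "0 < x / 2" using x by simp
    from order_tendstoD(2)[OF dlim this] show ?thesis
      by eventually_elim (auto simp: Y_def ret(2)[OF d(1)] grad_ret_1[OF d(1)])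
  qed
  have X01: "0 \<le> X k x \<and> X k x \<le> len G" if "0 < x" "x < len G" for k x
    unfolding X_def using that ret2(4,5)[OF d(1,2)] by auto
  show ?thesis
  proof (rule limit_eq_closed[OF eq])
    show "L2_tendsto I0 (\<lambda>k x. h (X k x)) h"
    proof -
      obtain B where B: "\<And>x. x \<in> {0..len G} \<Longrightarrow> norm (h x) \<le> B" using continuous_bounded_on[OF bounded_closed_interval smooth_continuous[OF h]] by metis
      show ?thesis
      proof (rule L2_tendsto_bounded_convergence[where C = B])
        show "norm (h (X k x)) \<le> B" if "x \<in> I0" for k x using X01[of x k] that by (intro B) auto
        show "AE x in leb I0. (\<lambda>k. h (X k x)) \<longlonglongrightarrow> h x"
        proof (rule AE_I2)
          fix x assume "x \<in> space (leb I0)"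
          then have "\<forall>\<^sub>F k in sequentially. X k x = x \<and> grad (X k) x = 1" by (intro evX) auto
          then have "\<forall>\<^sub>F k in sequentially. h x = h (X k x)" by eventually_elim simp
          then show "(\<lambda>k. h (X k x)) \<longlonglongrightarrow> h x" by (rule Lim_transform_eventually[OF tendsto_const])
        qed
      qed (auto intro!: continuous_measurable_lebesgue_on smooth_continuous[OF smooth_compose_real[OF h sX]] smooth_continuous[OF h])
    qed
    fix i assume i: "i \<in> idx"
    let ?B = "cbox (pt2 0 0) (pt2 (len G) (width G i))"
    obtain B where B: "0 \<le> B" "\<And>x. x \<in> ?B \<Longrightarrow> norm (q i x) \<le> B" using continuous_bounded_on[OF bounded_cbox smooth_continuous[OF sq[OF i]]] by metis
    obtain B' where B': "0 \<le> B'" "\<And>x. x \<in> ?B \<Longrightarrow> norm (grad (q i) x) \<le> B'" using continuous_bounded_on[OF bounded_cbox continuous_grad[OF sq[OF i]]] by metis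
    have TB: "?T k y \<in> ?B" if "y \<in> Dm i" for k y
    proof -
      have y: "0 < y $ 1" "y $ 1 < len G" "0 < y $ 2" "y $ 2 < width G i" using that by (auto simp: E_dom_def)
      have "0 \<le> Y k (y $ 2)" "Y k (y $ 2) \<le> y $ 2" unfolding Y_def using ret(3,4)[OF d(1)] y by auto
      then show ?thesis using X01[OF y(1,2)] y by (auto simp: mem_box_cart forall_2)
    qed
    have ev: "\<forall>\<^sub>F k in sequentially. ?T k y = y \<and> grad (X k) (y $ 1) = 1 \<and> grad (Y k) (y $ 2) = 1" if "y \<in> space (leb (Dm i))" for y
    proof -
      have "0 < y $ 1" "y $ 1 < len G" "0 < y $ 2" using that by (auto simp: E_dom_def)
      from evX[OF this(1,2)] evY[OF this(3)] show ?thesis by eventually_elim (simp add: pt2_eta)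
    qed
    show "L2_tendsto (Dm i) (\<lambda>k y. q i (?T k y)) (q i)"
    proof (rule L2_tendsto_bounded_convergence[OF E_dom_simps(4), where C = B])
      show "norm (q i (?T k y)) \<le> B" if "y \<in> Dm i" for k y using B(2)[OF TB[OF that]] .
      show "AE y in leb (Dm i). (\<lambda>k. q i (?T k y)) \<longlonglongrightarrow> q i y"
      proof (rule AE_I2)
        fix y assume "y \<in> space (leb (Dm i))"
        from ev[OF this] have "\<forall>\<^sub>F k in sequentially. q i y = q i (?T k y)" by eventually_elim simp
        then show "(\<lambda>k. q i (?T k y)) \<longlonglongrightarrow> q i y" by (rule Lim_transform_eventually[OF tendsto_const])
      qed
    qed (intro continuous_measurable_lebesgue_on smooth_continuous grad_pt2_compose(1) sq i sX sY)+
    note g = grad_pt2_compose(2)[OF sq[OF i] sX sY]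
    show "L2_tendsto (Dm i) (\<lambda>k. grad (\<lambda>y. q i (?T k y))) (grad (q i))"
    proof (rule L2_tendsto_bounded_convergence[OF E_dom_simps(4), where C = "B' * (C * C) + B' * C"])
      show "norm (grad (\<lambda>y. q i (?T k y)) y) \<le> B' * (C * C) + B' * C" if "y \<in> Dm i" for k y
      proof -
        have n: "norm (pt2 a b) \<le> \<bar>a\<bar> + \<bar>b\<bar>" for a b using norm_le_l1_cart[of "pt2 a b"] by (simp add: sum_2)
        have c: "\<bar>grad (q i) (?T k y) $ j\<bar> \<le> B'" for j
          using component_le_norm_cart[of "grad (q i) (?T k y)" j] B'(2)[OF TB[OF that], of k] by linarith
        show ?thesis unfolding g
          by (rule order_trans[OF n add_mono]; unfold abs_mult; intro mult_mono c gX gY) (use B'(1) in auto)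
      qed
      show "AE y in leb (Dm i). (\<lambda>k. grad (\<lambda>y. q i (?T k y)) y) \<longlonglongrightarrow> grad (q i) y"
      proof (rule AE_I2)
        fix y assume "y \<in> space (leb (Dm i))"
        from ev[OF this] have "\<forall>\<^sub>F k in sequentially. grad (q i) y = grad (\<lambda>y. q i (?T k y)) y"
          by eventually_elim (simp add: g pt2_eta)
        then show "(\<lambda>k. grad (\<lambda>y. q i (?T k y)) y) \<longlonglongrightarrow> grad (q i) y" by (rule Lim_transform_eventually[OF tendsto_const])
      qed
    qed (intro continuous_measurable_lebesgue_on continuous_grad grad_pt2_compose(1) sq i sX sY)+
  qed
qed

text \<open>Smooth approximations that have the right traces only in the limit are corrected to
  agree exactly on N and to vanish exactly on the outer side. By \<open>cut_small\<close> the
  corrections cost arbitrarily little in H1, and \<open>limit_eq\<close> is closed.\<close>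

lemma limit_eq_trace:
  assumes tr: "\<And>i. i \<in> idx \<Longrightarrow> has_trace (Dm i) (\<lambda>x. pt2 x 0) I0 (q i) h"
    and tre: "has_trace (Dm (num G)) (\<lambda>x. pt2 x (width G (num G))) I0 (q (num G)) (\<lambda>_. 0)"
  shows "limit_eq q (\<lambda>i. wgrad (Dm i) (q i)) h"
proof -
  define m where "m = num G"
  have m: "m \<in> idx" unfolding m_def by (rule num_mem)
  define w where "w = width G m"
  have w: "0 < w" using G_i(1)[OF m] by (simp add: w_def)
  let ?W = "\<lambda>i. wgrad (Dm i) (q i)"
  have "\<forall>i\<in>idx. \<exists>us. (\<forall>k. smooth (us k)) \<and> H1_tendsto (Dm i) us (q i) \<and> L2_tendsto I0 (\<lambda>k. us k \<circ> (\<lambda>x. pt2 x 0)) h"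
    using tr by (simp add: has_trace_def)
  then obtain a where a: "\<And>i k. i \<in> idx \<Longrightarrow> smooth (a i k)" "\<And>i. i \<in> idx \<Longrightarrow> H1_tendsto (Dm i) (a i) (q i)"
    "\<And>i. i \<in> idx \<Longrightarrow> L2_tendsto I0 (\<lambda>k. a i k \<circ> (\<lambda>x. pt2 x 0)) h"
    using bchoice[of "idx" "\<lambda>i us. (\<forall>k. smooth (us k)) \<and> H1_tendsto (Dm i) us (q i) \<and> L2_tendsto I0 (\<lambda>k. us k \<circ> (\<lambda>x. pt2 x 0)) h"] by blast
  obtain b where b: "\<And>k. smooth (b k)" "H1_tendsto (Dm m) b (q m)" "L2_tendsto I0 (\<lambda>k. b k \<circ> (\<lambda>x. pt2 x w)) (\<lambda>_. 0)"
    using tre unfolding has_trace_def m_def w_def by blast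
  have a0: "L2_tendsto (Dm i) (a i) (q i)" "L2_tendsto (Dm i) (\<lambda>k. grad (a i k)) (?W i)" if "i \<in> idx" for i
    by (rule H1_tendsto_smoothD[OF E_dom_simps(3,2) subset_refl E_dom_simps(1) a(1)[OF that] a(2)[OF that]])+
  have b0: "L2_tendsto (Dm m) b (q m)" "L2_tendsto (Dm m) (\<lambda>k. grad (b k)) (?W m)"
    by (rule H1_tendsto_smoothD[OF E_dom_simps(3,2) subset_refl E_dom_simps(1) b(1,2)])+
  define K where "K s = 1 - step ((3 / w) * s + (-1))" for s
  have sK: "smooth K" unfolding K_def[abs_def] by (intro smooth_diff smooth_const smooth_lin smooth_step)
  have K: "K 0 = 1" "K w = 0" using w by (simp_all add: K_def step_0 step_1)
  \<comment> \<open>On plate m the sequence \<open>a m\<close> has good traces on N and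
    \<open>b\<close> on the outer side. Both converge to the same function, so blending them by
    \<open>K\<close> keeps the limit although \<open>K\<close> gets differentiated.\<close>
  define c where "c k y = b k y + K (y $ 2) * (a m k y - b k y)" for k y
  have sK': "smooth (\<lambda>y::real^2. K (y $ 2))" by (rule smooth_nth_compose[OF sK])
  have sab: "smooth (\<lambda>y. a m k y - b k y)" for k by (intro smooth_diff a b m)
  have sc: "smooth (c k)" for k unfolding c_def[abs_def] by (intro smooth_add smooth_mult sK' sab b)
  have gc: "grad (c k) y = grad (b k) y + (K (y $ 2) *\<^sub>R (grad (a m k) y - grad (b k) y) + grad K (y $ 2) *\<^sub>R ((a m k y - b k y) *\<^sub>R e2))" for k y
    unfolding c_def[abs_def] grad_add[OF b(1) smooth_mult[OF sK' sab]] grad_mult[OF sK' sab] grad_diff[OF a(1)[OF m] b(1)] grad_nth_compose[OF sK]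
    by (simp add: mult.commute)
  have mb: "L2_tendsto (Dm m) (\<lambda>k y. F (y $ 2) *\<^sub>R us k y) (\<lambda>y. F (y $ 2) *\<^sub>R v y)" if F: "smooth F" and us: "L2_tendsto (Dm m) us v"
    for F :: "real \<Rightarrow> real" and us and v :: "real^2 \<Rightarrow> 'z::euclidean_space"
  proof -
    obtain C where "\<And>y. y \<in> Dm m \<Longrightarrow> norm (F (y $ 2)) \<le> C"
      using continuous_bounded_on[OF E_dom_simps(2) smooth_continuous[OF smooth_nth_compose[OF F, of 2]]] by metis
    then show ?thesis
      by (intro L2_tendsto_mult_bounded[OF us] continuous_measurable_lebesgue_on smooth_continuous smooth_nth_compose F) auto
  qed
  have c0: "L2_tendsto (Dm m) c (q m)" "L2_tendsto (Dm m) (\<lambda>k. grad (c k)) (?W m)"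
  proof -
    note d = L2_tendsto_diff[OF a0(1)[OF m] b0(1)] and d' = L2_tendsto_diff[OF a0(2)[OF m] b0(2)]
    show "L2_tendsto (Dm m) c (q m)"
      using L2_tendsto_add[OF b0(1) mb[OF sK d]] by (simp add: c_def[abs_def])
    have "bounded_linear (\<lambda>x::real. x *\<^sub>R e2)" by (rule bounded_linear_scaleR_left)
    from L2_tendsto_bounded_linear(1)[OF this d]
    have "L2_tendsto (Dm m) (\<lambda>k y. (a m k y - b k y) *\<^sub>R e2) (\<lambda>y. 0)" by simp
    from L2_tendsto_add[OF b0(2) L2_tendsto_add[OF mb[OF sK d'] mb[OF smooth_grad_real[OF sK] this]]]
    show "L2_tendsto (Dm m) (\<lambda>k. grad (c k)) (?W m)" by (simp add: gc[abs_def])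
  qed
  have ch: "c k (pt2 x 0) = a m k (pt2 x 0)" "c k (pt2 x w) = b k (pt2 x w)" for k x by (simp_all add: c_def K)
  \<comment> \<open>What \<open>limit_eq_matched\<close> accepts, within tolerance \<open>e\<close>
    of the given data.\<close>
  define near where "near e p hh \<longleftrightarrow> smooth hh \<and> (\<forall>i\<in>idx. smooth (p i) \<and> (\<forall>x. p i (pt2 x 0) = hh x) \<and>
      l2n (Dm i) (\<lambda>y. p i y - q i y) \<le> e \<and> l2n (Dm i) (\<lambda>y. grad (p i) y - ?W i y) \<le> e) \<and>
      (\<forall>x. p m (pt2 x w) = 0) \<and> l2n I0 (\<lambda>x. hh x - h x) \<le> e" for e p hh
  have step: "\<exists>p hh. near e p hh" if e: "0 < e" for e
  proof -
    define f where "f i k y = (if i = m then c k y else a i k y)" for i k y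
    \<comment> \<open>The corrections: plate m is pulled to 0 at its outer side, every other plate
      to the values of plate m on N. Plate m keeps its values on N, which therefore serve as the
      common ones.\<close>
    define d where "d i k y = (if i = m then - c k y else a m k y - a i k y)" for i k y
    define s where "s i = (if i = m then w else 0)" for i
    have sf: "smooth (f i k)" if "i \<in> idx" for i k using sc a(1)[OF that] by (cases "i = m") (simp_all add: f_def[abs_def])
    have sd: "smooth (d i k)" if "i \<in> idx" for i k
      using smooth_minus[OF sc] smooth_diff[OF a(1)[OF m] a(1)[OF that]] by (cases "i = m") (simp_all add: d_def[abs_def])
    have f0: "L2_tendsto (Dm i) (f i) (q i)" "L2_tendsto (Dm i) (\<lambda>k. grad (f i k)) (?W i)" if "i \<in> idx" for i
      using c0 a0[OF that] by (cases "i = m"; simp add: f_def[abs_def])+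
    let ?z = "\<lambda>t i k y. cut ((1/t) * y $ 2 + - (s i/t)) * d i k y"
    let ?ok = "\<lambda>t i. 0 < t \<and> t \<le> w \<and> (\<forall>\<^sub>F k in sequentially. l2n (Dm i) (?z t i k) \<le> e / 2 \<and> l2n (Dm i) (grad (?z t i k)) \<le> e / 2)"
    have ex: "\<exists>t. ?ok t i" if i: "i \<in> idx" for i
    proof -
      \<comment> \<open>The correction on plate \<open>i\<close> involves \<open>a m\<close>, whose
        convergence is known on the rectangle of plate m; the strip has to lie in both
        rectangles.\<close>
      define l where "l = min (width G i) w"
      have l: "0 < l" "l \<le> w" using w G_i(1)[OF i] by (auto simp: l_def)
      have sub: "rect (len G) 0 l \<subseteq> Dm i" "rect (len G) 0 l \<subseteq> Dm m" by (auto simp: l_def w_def rect_def E_dom_def)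
      have "\<exists>v. L2_tendsto (rect (len G) 0 l) (\<lambda>k. grad (d i k)) v"
      proof (cases "i = m")
        case True
        have "L2_tendsto (rect (len G) 0 l) (\<lambda>k. grad (c k)) (?W m)" by (rule L2_tendsto_subset[OF sub(2) rect_simps(3) E_dom_simps(3) c0(2)])
        moreover have "grad (\<lambda>y. - c k y) = (\<lambda>x. - grad (c k) x)" for k by (rule ext) (use grad_cmult[OF sc, of "-1"] in simp)
        ultimately show ?thesis
          using True L2_tendsto_minus[of "rect (len G) 0 l" "\<lambda>k. grad (c k)" "?W m"] by (simp add: d_def[abs_def]) blast
      next
        case False
        have "L2_tendsto (rect (len G) 0 l) (\<lambda>k x. grad (a m k) x - grad (a i k) x) (\<lambda>x. ?W m x - ?W i x)"
          by (rule L2_tendsto_diff[OF L2_tendsto_subset[OF sub(2) rect_simps(3) E_dom_simps(3) a0(2)[OF m]] L2_tendsto_subset[OF sub(1) rect_simps(3) E_dom_simps(3) a0(2)[OF i]]])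
        moreover have "grad (\<lambda>y. a m k y - a i k y) = (\<lambda>x. grad (a m k) x - grad (a i k) x)" for k
          by (rule ext) (rule grad_diff[OF a(1)[OF m] a(1)[OF i]])
        ultimately show ?thesis using False by (simp add: d_def[abs_def]) blast
      qed
      then obtain v where v: "L2_tendsto (rect (len G) 0 l) (\<lambda>k. grad (d i k)) v" by blast
      have T: "L2_tendsto I0 (\<lambda>k x. d i k (pt2 x (s i))) (\<lambda>_. 0)"
        using L2_tendsto_minus[OF b(3)] L2_tendsto_diff[OF a(3)[OF m] a(3)[OF i]] by (cases "i = m") (simp_all add: d_def[abs_def] s_def ch o_def)
      have r: "s i = 0 \<or> s i = l \<and> width G i = l" by (auto simp: s_def l_def w_def)
      have e2: "0 < e / 2" using e by simp
      obtain t where "0 < t" "t \<le> l"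
        "\<forall>\<^sub>F k in sequentially. l2n (rect (len G) 0 (width G i)) (?z t i k) \<le> e / 2 \<and> l2n (rect (len G) 0 (width G i)) (grad (?z t i k)) \<le> e / 2"
        by (rule cut_small[OF l(1) sd[OF i] v T e2 r])
      then show ?thesis using l unfolding E_dom_rect by (intro exI[of _ t]) auto
    qed
    define t where "t i = (SOME r. ?ok r i)" for i
    have ok: "?ok (t i) i" if "i \<in> idx" for i
      unfolding t_def by (rule someI_ex[OF ex[OF that]])
    then have t: "\<And>i. i \<in> idx \<Longrightarrow> 0 < t i" "\<And>i. i \<in> idx \<Longrightarrow> t i \<le> w"
      "\<And>i. i \<in> idx \<Longrightarrow> \<forall>\<^sub>F k in sequentially. l2n (Dm i) (?z (t i) i k) \<le> e / 2 \<and> l2n (Dm i) (grad (?z (t i) i k)) \<le> e / 2" by blast+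
    have e2: "0 < e / 2" using e by simp
    have "\<forall>\<^sub>F k in sequentially. \<forall>i\<in>idx. (l2n (Dm i) (?z (t i) i k) \<le> e / 2 \<and> l2n (Dm i) (grad (?z (t i) i k)) \<le> e / 2) \<and>
        l2n (Dm i) (\<lambda>y. f i k y - q i y) < e / 2 \<and> l2n (Dm i) (\<lambda>y. grad (f i k) y - ?W i y) < e / 2"
      by (intro eventually_ball_finite finite_atLeastAtMost ballI eventually_conj t(3) order_tendstoD(2)[OF L2_tendstoD(3)[OF f0(1)] e2] order_tendstoD(2)[OF L2_tendstoD(3)[OF f0(2)] e2])
    moreover have "\<forall>\<^sub>F k in sequentially. l2n I0 (\<lambda>x. (a m k \<circ> (\<lambda>x. pt2 x 0)) x - h x) < e"
      by (rule order_tendstoD(2)[OF L2_tendstoD(3)[OF a(3)[OF m]] e])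
    ultimately have "\<forall>\<^sub>F k in sequentially. (\<forall>i\<in>idx. (l2n (Dm i) (?z (t i) i k) \<le> e / 2 \<and> l2n (Dm i) (grad (?z (t i) i k)) \<le> e / 2) \<and>
        l2n (Dm i) (\<lambda>y. f i k y - q i y) < e / 2 \<and> l2n (Dm i) (\<lambda>y. grad (f i k) y - ?W i y) < e / 2) \<and>
        l2n I0 (\<lambda>x. (a m k \<circ> (\<lambda>x. pt2 x 0)) x - h x) < e"
      by (rule eventually_conj)
    from eventually_happens'[OF sequentially_bot this] obtain k where k: "\<And>i. i \<in> idx \<Longrightarrow> l2n (Dm i) (?z (t i) i k) \<le> e / 2 \<and> l2n (Dm i) (grad (?z (t i) i k)) \<le> e / 2 \<and>
        l2n (Dm i) (\<lambda>y. f i k y - q i y) < e / 2 \<and> l2n (Dm i) (\<lambda>y. grad (f i k) y - ?W i y) < e / 2"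
        "l2n I0 (\<lambda>x. (a m k \<circ> (\<lambda>x. pt2 x 0)) x - h x) < e"
      by blast
    define p where "p i y = f i k y + ?z (t i) i k y" for i y
    have sz: "smooth (?z (t i) i k)" if "i \<in> idx" for i by (rule smooth_mult[OF smooth_cut_side sd[OF that]])
    have sp: "smooth (p i)" if "i \<in> idx" for i unfolding p_def[abs_def] by (rule smooth_add[OF sf[OF that] sz[OF that]])
    have sh: "smooth (\<lambda>x. a m k (pt2 x 0))"
    proof -
      have "linear (\<lambda>x::real. pt2 x 0)" by (rule linearI) (auto simp: vec_eq_iff forall_2)
      from smooth_affine[OF a(1)[OF m] this, of k 0] show ?thesis by simp
    qed
    \<comment> \<open>For plate m the bound \<open>t m\<close> <= w makes the cutoff at the outer
      side vanish on N, so its correction does not disturb the common values.\<close>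
    have zero: "p i (pt2 x 0) = a m k (pt2 x 0)" if i: "i \<in> idx" for i x
    proof (cases "i = m")
      case True
      have "1 \<le> \<bar>(1/t m) * 0 + - (w/t m)\<bar>" using t(1,2)[OF m] w by simp
      then show ?thesis using True cut_0 by (simp add: p_def f_def s_def ch)
    next
      case False then show ?thesis by (simp add: p_def f_def d_def s_def cut_1)
    qed
    have top: "p m (pt2 x w) = 0" for x by (simp add: p_def f_def d_def s_def cut_1)
    have close: "l2n (Dm i) (\<lambda>y. p i y - q i y) \<le> e \<and> l2n (Dm i) (\<lambda>y. grad (p i) y - ?W i y) \<le> e" if i: "i \<in> idx" for i
    proof
      have z: "L2 (Dm i) (?z (t i) i k)" "L2 (Dm i) (grad (?z (t i) i k))"
        by (rule L2_smooth[OF E_dom_simps(2,3) sz[OF i]], rule L2_grad[OF E_dom_simps(2,3) sz[OF i]])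
      have "l2n (Dm i) (\<lambda>y. (f i k y - q i y) + ?z (t i) i k y) \<le> l2n (Dm i) (\<lambda>y. f i k y - q i y) + l2n (Dm i) (?z (t i) i k)"
        by (rule l2n_triangle[OF L2_diff[OF L2_tendstoD(1,2)[OF f0(1)[OF i]]] z(1)])
      then show "l2n (Dm i) (\<lambda>y. p i y - q i y) \<le> e" using k(1)[OF i] by (simp add: p_def algebra_simps)
      have G: "l2n (Dm i) (\<lambda>y. (grad (f i k) y - ?W i y) + grad (?z (t i) i k) y) \<le> l2n (Dm i) (\<lambda>y. grad (f i k) y - ?W i y) + l2n (Dm i) (grad (?z (t i) i k))"
        by (rule l2n_triangle[OF L2_diff[OF L2_tendstoD(1,2)[OF f0(2)[OF i]]] z(2)])
      have eq: "(\<lambda>y. grad (p i) y - ?W i y) = (\<lambda>y. (grad (f i k) y - ?W i y) + grad (?z (t i) i k) y)"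
        unfolding p_def[abs_def] grad_add[OF sf[OF i] sz[OF i]] by (simp add: fun_eq_iff)
      from G k(1)[OF i] show "l2n (Dm i) (\<lambda>y. grad (p i) y - ?W i y) \<le> e" unfolding eq by linarith
    qed
    show ?thesis unfolding near_def
      using sh sp zero top close k(2) by (intro exI[of _ p] exI[of _ "\<lambda>x. a m k (pt2 x 0)"]) (auto simp: o_def)
  qed
  have "\<exists>ph. near (inverse (real (Suc n))) (fst ph) (snd ph)" for n
    using step[of "inverse (real (Suc n))"] by fastforce
  then obtain P where "\<And>n. near (inverse (real (Suc n))) (fst (P n)) (snd (P n))" by metis
  then have P: "\<And>n. smooth (snd (P n))" "\<And>n i. i \<in> idx \<Longrightarrow> smooth (fst (P n) i)"
    "\<And>n i x. i \<in> idx \<Longrightarrow> fst (P n) i (pt2 x 0) = snd (P n) x"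
    "\<And>n i. i \<in> idx \<Longrightarrow> l2n (Dm i) (\<lambda>y. fst (P n) i y - q i y) \<le> inverse (real (Suc n))"
    "\<And>n i. i \<in> idx \<Longrightarrow> l2n (Dm i) (\<lambda>y. grad (fst (P n) i) y - ?W i y) \<le> inverse (real (Suc n))"
    "\<And>n x. fst (P n) m (pt2 x w) = 0" "\<And>n. l2n I0 (\<lambda>x. snd (P n) x - h x) \<le> inverse (real (Suc n))"
    unfolding near_def by blast+
  note lim = LIMSEQ_inverse_real_of_nat
  show ?thesis
  proof (rule limit_eq_closed[where ps = "\<lambda>n. fst (P n)" and hs = "\<lambda>n. snd (P n)" and qs = "\<lambda>n i. grad (fst (P n) i)"])
    show "limit_eq (fst (P n)) (\<lambda>i. grad (fst (P n) i)) (snd (P n))" for n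
      by (rule limit_eq_matched[OF P(1,2,3)]) (use P(6) in \<open>simp_all add: m_def w_def\<close>)
    show "L2_tendsto (Dm i) (\<lambda>n. fst (P n) i) (q i)" if i: "i \<in> idx" for i
      by (rule L2_tendsto_squeeze[OF L2_smooth[OF E_dom_simps(2,3) P(2)[OF i]] L2_tendstoD(2)[OF a0(1)[OF i]] P(4)[OF i] lim])
    show "L2_tendsto (Dm i) (\<lambda>n. grad (fst (P n) i)) (?W i)" if i: "i \<in> idx" for i
      by (rule L2_tendsto_squeeze[OF L2_grad[OF E_dom_simps(2,3) P(2)[OF i]] L2_tendstoD(2)[OF a0(2)[OF i]] P(5)[OF i] lim])
    show "L2_tendsto I0 (\<lambda>n. snd (P n)) h"
      by (rule L2_tendsto_squeeze[OF L2_smooth[OF _ _ P(1)] L2_tendstoD(2)[OF a(3)[OF m]] P(7) lim]) simp_all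
  qed
qed

end

section \<open>Existence and uniqueness for the limit problem\<close>

text \<open>The approximating sequence is kept; only the name of its limit changes.\<close>

lemma has_trace_cong_AE:
  assumes O: "open X" "bounded X" and t: "has_trace X c T u h" and ae: "AE x in leb X. u x = u' x"
  shows "has_trace X c T u' h" "H1 X u'"
proof -
  have m: "X \<in> sets lebesgue" using O by simp
  obtain us where us: "\<And>k. smooth (us k)" "H1_tendsto X us u" "L2_tendsto T (\<lambda>k. us k \<circ> c) h"
    using t by (auto simp: has_trace_def)
  note H = H1_tendsto_smoothD[OF m O(2) subset_refl O(1) us(1,2)]
  have "H1_tendsto X us u'"
    by (rule H1_tendsto_smoothI(1)[OF O us(1) L2_tendsto_cong_AE[OF m H(1) _ ae] H(2)]) simp
  then show "has_trace X c T u' h" "H1 X u'"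
    unfolding has_trace_def using us by (blast, simp add: H1_tendsto_def)
qed

lemma has_trace_diff:
  assumes O: "open X" "bounded X" and u: "has_trace X c T u h" and v: "has_trace X c T v k"
  shows "has_trace X c T (\<lambda>x. u x - v x) (\<lambda>x. h x - k x)" "H1 X (\<lambda>x. u x - v x)"
proof -
  have m: "X \<in> sets lebesgue" using O by simp
  obtain us where us: "\<And>k. smooth (us k)" "H1_tendsto X us u" "L2_tendsto T (\<lambda>k. us k \<circ> c) h"
    using u by (auto simp: has_trace_def)
  obtain vs where vs: "\<And>k. smooth (vs k)" "H1_tendsto X vs v" "L2_tendsto T (\<lambda>k. vs k \<circ> c) k"
    using v by (auto simp: has_trace_def)
  note HU = H1_tendsto_smoothD[OF m O(2) subset_refl O(1) us(1,2)] and HV = H1_tendsto_smoothD[OF m O(2) subset_refl O(1) vs(1,2)]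
  have s: "smooth (\<lambda>x. us n x - vs n x)" for n by (rule smooth_diff[OF us(1) vs(1)])
  have "grad (\<lambda>x. us n x - vs n x) = (\<lambda>x. grad (us n) x - grad (vs n) x)" for n by (rule ext) (rule grad_diff[OF us(1) vs(1)])
  then have H: "H1_tendsto X (\<lambda>n x. us n x - vs n x) (\<lambda>x. u x - v x)"
    using L2_tendsto_diff[OF HU(2) HV(2)] by (intro H1_tendsto_smoothI(1)[OF O s L2_tendsto_diff[OF HU(1) HV(1)]]) simp
  have t: "L2_tendsto T (\<lambda>n. (\<lambda>x. us n x - vs n x) \<circ> c) (\<lambda>x. h x - k x)"
    using L2_tendsto_diff[OF us(3) vs(3)] by (simp add: o_def)
  show "has_trace X c T (\<lambda>x. u x - v x) (\<lambda>x. h x - k x)"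
    unfolding has_trace_def by (intro exI[of _ "\<lambda>n x. us n x - vs n x"] conjI allI s H t)
  show "H1 X (\<lambda>x. u x - v x)" using H by (simp add: H1_tendsto_def)
qed

text \<open>The bounds for smooth functions survive the limit along the sequence that defines the
  trace.\<close>

lemma has_trace_rect_bounds:
  assumes l: "0 \<le> l" and s0: "s0 \<in> {0..l}" and t: "has_trace (rect L 0 l) (\<lambda>x. pt2 x s0) {0<..<L} u h"
  shows "(l2n (rect L 0 l) u)\<^sup>2 \<le> 2 * l * (l2n {0<..<L} h)\<^sup>2 + 2 * l\<^sup>2 * (l2n (rect L 0 l) (wgrad (rect L 0 l) u))\<^sup>2"
    "l * (l2n {0<..<L} h)\<^sup>2 \<le> 2 * (l2n (rect L 0 l) u)\<^sup>2 + 2 * l\<^sup>2 * (l2n (rect L 0 l) (wgrad (rect L 0 l) u))\<^sup>2"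
proof -
  let ?R = "rect L 0 l"
  obtain us where us: "\<And>k. smooth (us k)" "H1_tendsto ?R us u" "L2_tendsto {0<..<L} (\<lambda>k. us k \<circ> (\<lambda>x. pt2 x s0)) h"
    using t by (auto simp: has_trace_def)
  note H = H1_tendsto_smoothD[OF rect_simps(3,2) subset_refl rect_simps(1) us(1,2)]
  have n: "(\<lambda>k. l2n ?R (us k)) \<longlonglongrightarrow> l2n ?R u" "(\<lambda>k. l2n ?R (grad (us k))) \<longlonglongrightarrow> l2n ?R (wgrad ?R u)"
    "(\<lambda>k. l2n {0<..<L} (\<lambda>x. us k (pt2 x s0))) \<longlonglongrightarrow> l2n {0<..<L} h"
    using L2_tendsto_norm[OF H(1)] L2_tendsto_norm[OF H(2)] L2_tendsto_norm[OF us(3)] by (simp_all add: o_def)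
  have G: "(l2n ?R (\<lambda>x. grad (us k) x \<bullet> e2))\<^sup>2 \<le> (l2n ?R (grad (us k)))\<^sup>2" for k
  proof (rule power_mono)
    have "norm (v \<bullet> e2) \<le> 1 * norm v" for v :: "real^2" using component_le_norm_cart[of v 2] by (simp add: cart_eq_inner_axis)
    then show "l2n ?R (\<lambda>x. grad (us k) x \<bullet> e2) \<le> l2n ?R (grad (us k))"
      using l2n_le_bound[OF L2_component[OF L2_tendstoD(1)[OF H(2)], where b = e2] L2_tendstoD(1)[OF H(2)], where C = 1] by simp
  qed simp
  have G': "2 * l\<^sup>2 * (l2n ?R (\<lambda>x. grad (us k) x \<bullet> e2))\<^sup>2 \<le> 2 * l\<^sup>2 * (l2n ?R (grad (us k)))\<^sup>2" for k
    by (rule mult_left_mono[OF G]) simp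
  have b: "(l2n ?R (us k))\<^sup>2 \<le> 2 * l * (l2n {0<..<L} (\<lambda>x. us k (pt2 x s0)))\<^sup>2 + 2 * l\<^sup>2 * (l2n ?R (grad (us k)))\<^sup>2"
    "l * (l2n {0<..<L} (\<lambda>x. us k (pt2 x s0)))\<^sup>2 \<le> 2 * (l2n ?R (us k))\<^sup>2 + 2 * l\<^sup>2 * (l2n ?R (grad (us k)))\<^sup>2" for k
    using rect_trace_bounds[OF us(1) l s0, of L k] G'[of k] by simp_all
  show "(l2n ?R u)\<^sup>2 \<le> 2 * l * (l2n {0<..<L} h)\<^sup>2 + 2 * l\<^sup>2 * (l2n ?R (wgrad ?R u))\<^sup>2"
    by (rule LIMSEQ_le[OF tendsto_power[OF n(1)] tendsto_add[OF tendsto_mult_left[OF tendsto_power[OF n(3)]] tendsto_mult_left[OF tendsto_power[OF n(2)]]]])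
       (use b(1) in blast)
  show "l * (l2n {0<..<L} h)\<^sup>2 \<le> 2 * (l2n ?R u)\<^sup>2 + 2 * l\<^sup>2 * (l2n ?R (wgrad ?R u))\<^sup>2"
    by (rule LIMSEQ_le[OF tendsto_mult_left[OF tendsto_power[OF n(3)]] tendsto_add[OF tendsto_mult_left[OF tendsto_power[OF n(1)]] tendsto_mult_left[OF tendsto_power[OF n(2)]]]])
       (use b(2) in blast)
qed

context thin_geometry
begin

lemma chart_nth: "chart G i y $ 1 = y $ 1" by (simp add: chart_def)

lemma inv_chart:
  assumes i: "i \<in> idx" and y: "y \<in> Dm i" shows "inv_into (Dm i) (chart G i) (chart G i y) = y"
proof (rule inv_into_f_f[OF inj_onI y])
  fix y z assume "chart G i y = chart G i z"
  then have "y $ 1 = z $ 1" "sco G i (chart G i y) = sco G i (chart G i z)" by (metis chart_nth, simp)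
  then show "y = z" using inner_i(1)[OF i] by (simp add: chart_def sco_pt vec_eq_iff forall_2)
qed

text \<open>The chart is an isometry because \<open>dir G i\<close> is a unit vector.\<close>

lemma tgrad_inner:
  assumes i: "i \<in> idx" and y: "y \<in> Dm i"
  shows "tgrad G i u (chart G i y) \<bullet> tgrad G i f (chart G i y) = wgrad (Dm i) (u \<circ> chart G i) y \<bullet> wgrad (Dm i) (f \<circ> chart G i) y"
  unfolding tgrad_def Let_def inv_chart[OF i y] using inner_i(1)[OF i] by (simp add: pt_inner inner_2[of "wgrad (Dm i) (u \<circ> chart G i) y"])

lemma limit_equation_alt:
  "limit_equation G D u f \<longleftrightarrow>
  (\<Sum>i\<in>idx. thick G i * (kap D i * (LINT y|leb (Dm i). wgrad (Dm i) (u \<circ> chart G i) y \<bullet> wgrad (Dm i) (f \<circ> chart G i) y))) =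
    (LINT x|leb I0. srcN D (pt x 0) * common_trace G f x) +
    (\<Sum>i\<in>idx. thick G i * (LINT y|leb (Dm i). src D i (chart G i y) * f (chart G i y)))"
proof -
  let ?tB = "\<lambda>i. LINT y|leb (Dm i). wgrad (Dm i) (u \<circ> chart G i) y \<bullet> wgrad (Dm i) (f \<circ> chart G i) y"
  let ?tA = "\<lambda>i. \<lambda>x. kap D i * (tgrad G i u x \<bullet> tgrad G i f x)"
  have "surf_integral G i (?tA i) =
      kap D i * (?tB i)" if i: "i \<in> idx" for i
  proof -
    have "surf_integral G i (?tA i) =
      (LINT y|leb (Dm i). kap D i * (wgrad (Dm i) (u \<circ> chart G i) y \<bullet> wgrad (Dm i) (f \<circ> chart G i) y))"
      unfolding surf_integral_def by (rule LINT_cong) (simp only: tgrad_inner[OF i])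
    then show ?thesis by simp
  qed
  then have 1: "(\<Sum>i\<in>idx. thick G i * surf_integral G i (?tA i)) =
    (\<Sum>i\<in>idx. thick G i * (kap D i * (?tB i)))"
    by (intro sum.cong) auto
  have 2: "vector [x, 0, 0] = pt x 0" for x :: real by (simp add: vec_eq_iff forall_3)
  show ?thesis by (simp only: limit_equation_def 1 2) (simp only: surf_integral_def)
qed

lemma common_trace: "f \<in> limit_space G \<Longrightarrow> i \<in> idx \<Longrightarrow> trace_on_N G i f (common_trace G f)"
proof -
  assume "f \<in> limit_space G" and i: "i \<in> idx"
  then have "\<exists>h. \<forall>i\<in>idx. trace_on_N G i f h" by (simp add: limit_space_def)
  then have "\<forall>i\<in>idx. trace_on_N G i f (common_trace G f)" unfolding common_trace_def by (rule someI_ex)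
  then show ?thesis using i by blast
qed

text \<open>The difference of two solutions is an admissible test function, so its gradient vanishes
  on every plate. The value 0 then spreads from the outer side over plate m, from plate m to the
  common trace on N, and from N to the remaining plates.\<close>

lemma limit_solution_unique:
  assumes D: "admissible_coefficients G D" and u: "limit_weak_solution G D u" and v: "limit_weak_solution G D v" and i: "i \<in> idx"
  shows "AE_on_E G i (\<lambda>x. v x = u x)"
proof -
  define f where "f x = u x - v x" for x
  let ?h = "\<lambda>x. common_trace G u x - common_trace G v x"
  let ?d = "\<lambda>u i. wgrad (Dm i) (u \<circ> chart G i)"
  have L: "u \<in> limit_space G" "v \<in> limit_space G" "trace_on_Ne G (num G) u (\<lambda>_. 0)" "trace_on_Ne G (num G) v (\<lambda>_. 0)"
    using u v by (auto simp: limit_weak_solution_def)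
  have fc: "f \<circ> chart G j = (\<lambda>y. (u \<circ> chart G j) y - (v \<circ> chart G j) y)" for j by (simp add: f_def fun_eq_iff)
  have tN: "has_trace (Dm j) (\<lambda>x. pt2 x 0) I0 (f \<circ> chart G j) ?h" "H1 (Dm j) (f \<circ> chart G j)"
    if j: "j \<in> idx" for j
    unfolding fc by (rule has_trace_diff[OF E_dom_simps(1,2) common_trace[OF L(1) j, unfolded trace_on_N_def] common_trace[OF L(2) j, unfolded trace_on_N_def]])+
  have fL: "f \<in> limit_space G" unfolding limit_space_def H1_E_def trace_on_N_def using tN by blast
  have tE: "has_trace (Dm (num G)) (\<lambda>x. pt2 x (width G (num G))) I0 (f \<circ> chart G (num G)) (\<lambda>x. 0 - 0)"
    unfolding fc by (rule has_trace_diff[OF E_dom_simps(1,2) L(3,4) [unfolded trace_on_Ne_def]])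
  then have fE: "trace_on_Ne G (num G) f (\<lambda>_. 0)" by (simp add: trace_on_Ne_def)
  have "limit_equation G D u f" "limit_equation G D v f" using u v fL fE by (auto simp: limit_weak_solution_def)
  then have "(\<Sum>j\<in>idx. thick G j * (kap D j * (LINT y|leb (Dm j). ?d u j y \<bullet> ?d f j y))) -
      (\<Sum>j\<in>idx. thick G j * (kap D j * (LINT y|leb (Dm j). ?d v j y \<bullet> ?d f j y))) = 0"
    unfolding limit_equation_alt by simp
  moreover have "thick G j * (kap D j * (LINT y|leb (Dm j). ?d u j y \<bullet> ?d f j y)) - thick G j * (kap D j * (LINT y|leb (Dm j). ?d v j y \<bullet> ?d f j y)) =
      thick G j * (kap D j * (l2n (Dm j) (?d f j))\<^sup>2)" if j: "j \<in> idx" for j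
  proof -
    have H: "H1 (Dm j) (u \<circ> chart G j)" "H1 (Dm j) (v \<circ> chart G j)" using L j by (auto simp: limit_space_def H1_E_def)
    note l = L2_wgrad[OF H(1)] L2_wgrad[OF H(2)] L2_wgrad[OF tN(2)[OF j]]
    \<comment> \<open>\<open>wgrad\<close> is a choice and not literally linear; linearity holds
      almost everywhere.\<close>
    have ae: "AE y in leb (Dm j). ?d f j y = ?d u j y - ?d v j y"
      using weak_grad_diff[OF E_dom_simps(3) H1_L2[OF H(1)] H1_L2[OF H(2)] weak_grad_wgrad[OF H(1)] weak_grad_wgrad[OF H(2)]] H1_L2[OF tN(2)[OF j]]
      unfolding fc by (intro wgrad_AE[OF E_dom_simps(1)])
    have "(LINT y|leb (Dm j). ?d u j y \<bullet> ?d f j y) - (LINT y|leb (Dm j). ?d v j y \<bullet> ?d f j y) =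
      (LINT y|leb (Dm j). (?d u j y - ?d v j y) \<bullet> ?d f j y)"
      unfolding inner_diff_left by (rule Bochner_Integration.integral_diff[OF L2_integrable_inner[OF l(1,3)] L2_integrable_inner[OF l(2,3)], symmetric])
    also have "\<dots> = (LINT y|leb (Dm j). (norm (?d f j y))\<^sup>2)"
    proof (rule integral_cong_AE)
      show "(\<lambda>y. (?d u j y - ?d v j y) \<bullet> ?d f j y) \<in> mbl (Dm j)"
        by (rule borel_measurable_integrable[OF L2_integrable_inner[OF L2_diff[OF l(1,2)] l(3)]])
      show "(\<lambda>y. (norm (?d f j y))\<^sup>2) \<in> mbl (Dm j)"
        by (rule borel_measurable_integrable[OF L2_int[OF l(3)]])
      show "AE y in leb (Dm j). (?d u j y - ?d v j y) \<bullet> ?d f j y = (norm (?d f j y))\<^sup>2"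
        using ae by eventually_elim (simp add: power2_norm_eq_inner)
    qed
    finally show ?thesis by (simp add: l2n_power2 flip: right_diff_distrib)
  qed
  ultimately have "(\<Sum>j\<in>idx. thick G j * (kap D j * (l2n (Dm j) (?d f j))\<^sup>2)) = 0"
    by (simp add: sum_subtractf[symmetric])
  moreover have pos: "0 < thick G j" "0 < kap D j" if "j \<in> idx" for j
    using G_i(2)[OF that] D that by (auto simp: admissible_coefficients_def)
  moreover have "0 \<le> thick G j * (kap D j * (l2n (Dm j) (?d f j))\<^sup>2)" if "j \<in> idx" for j
    using pos[OF that] by simp
  ultimately have "\<forall>j\<in>idx. thick G j * (kap D j * (l2n (Dm j) (?d f j))\<^sup>2) = 0"
    using sum_nonneg_eq_0_iff[OF finite_atLeastAtMost, of 1 "num G" "\<lambda>j. thick G j * (kap D j * (l2n (Dm j) (?d f j))\<^sup>2)"] by blast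
  then have d0: "l2n (Dm j) (?d f j) = 0" if "j \<in> idx" for j using pos[OF that] that by fastforce
  note w = G_i(1)[OF num_mem]
  have "(l2n (Dm (num G)) (f \<circ> chart G (num G)))\<^sup>2 \<le> 0"
    using has_trace_rect_bounds(1)[of "width G (num G)" "width G (num G)" "len G" "f \<circ> chart G (num G)" "\<lambda>_. 0"] tE d0[OF num_mem] w
    by (simp add: E_dom_rect)
  then have "l2n (Dm (num G)) (f \<circ> chart G (num G)) = 0" by simp
  then have "width G (num G) * (l2n I0 ?h)\<^sup>2 \<le> 0"
    using has_trace_rect_bounds(2)[of "width G (num G)" 0 "len G" "f \<circ> chart G (num G)" ?h] tN(1)[OF num_mem] d0[OF num_mem] w
    by (simp add: E_dom_rect)
  then have "l2n I0 ?h = 0" using w by (simp add: mult_le_0_iff)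
  then have "(l2n (Dm i) (f \<circ> chart G i))\<^sup>2 \<le> 0"
    using has_trace_rect_bounds(1)[of "width G i" 0 "len G" "f \<circ> chart G i" ?h] tN(1)[OF i] d0[OF i] G_i(1)[OF i]
    by (simp add: E_dom_rect)
  then have "l2n (Dm i) (f \<circ> chart G i) = 0" by simp
  from l2n_eq_0[OF H1_L2[OF tN(2)[OF i]] this] show ?thesis
    unfolding AE_on_E_def by eventually_elim (simp add: f_def)
qed

end

context thin_limit
begin

text \<open>In the chart of each plate \<open>u0\<close> equals \<open>lim_u\<close> almost
  everywhere and inherits its traces and its gradient; the common trace is
  \<open>u0N\<close>.\<close>

lemma limit_solution:
  assumes u0: "\<And>i. i \<in> idx \<Longrightarrow>
      AE_on_E G i (\<lambda>x. u0 x = u0E i (pt2 (x $ 1) (len G / width G i * (rot G i *v x) $ 2)))"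
  shows "limit_weak_solution G D u0"
proof -
  have ae: "AE y in leb (Dm i). lim_u i y = (u0 \<circ> chart G i) y" if i: "i \<in> idx" for i
    using u0[OF i] unfolding AE_on_E_def
    by eventually_elim (simp add: lim_u_def stretch_def chart_nth rot_chart[OF i] ratio_def)
  have tN: "has_trace (Dm i) (\<lambda>x. pt2 x 0) I0 (u0 \<circ> chart G i) u0N" "H1 (Dm i) (u0 \<circ> chart G i)" if i: "i \<in> idx" for i
    by (rule has_trace_cong_AE[OF E_dom_simps(1,2) trace_N[OF i] ae[OF i]])+
  have L: "u0 \<in> limit_space G" unfolding limit_space_def H1_E_def trace_on_N_def using tN by blast
  have E: "trace_on_Ne G (num G) u0 (\<lambda>_. 0)"
    unfolding trace_on_Ne_def by (rule has_trace_cong_AE[OF E_dom_simps(1,2) trace_Ne[OF refl] ae[OF num_mem]])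
  have "limit_equation G D u0 f" if f: "f \<in> limit_space G" and fE: "trace_on_Ne G (num G) f (\<lambda>_. 0)" for f
  proof -
    let ?d = "\<lambda>i. wgrad (Dm i) (f \<circ> chart G i)"
    have "limit_eq (\<lambda>i. f \<circ> chart G i) ?d (common_trace G f)"
      by (rule limit_eq_trace[OF common_trace[OF f, unfolded trace_on_N_def] fE [unfolded trace_on_Ne_def]])
    moreover have "(LINT y|leb (Dm i). lim_g i y \<bullet> ?d i y) = (LINT y|leb (Dm i). wgrad (Dm i) (u0 \<circ> chart G i) y \<bullet> ?d i y)" if i: "i \<in> idx" for i
    proof (rule integral_cong_AE)
      have H: "H1 (Dm i) (f \<circ> chart G i)" using f i by (auto simp: limit_space_def H1_E_def)
      show "(\<lambda>y. lim_g i y \<bullet> ?d i y) \<in> mbl (Dm i)"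
        by (rule borel_measurable_integrable[OF L2_integrable_inner[OF lim_u(3)[OF i] L2_wgrad[OF H]]])
      show "(\<lambda>y. wgrad (Dm i) (u0 \<circ> chart G i) y \<bullet> ?d i y) \<in> mbl (Dm i)"
        by (rule borel_measurable_integrable[OF L2_integrable_inner[OF L2_wgrad[OF tN(2)[OF i]] L2_wgrad[OF H]]])
      have "is_weak_grad (Dm i) (u0 \<circ> chart G i) (lim_g i)"
        by (rule weak_grad_cong_AE[OF E_dom_simps(3) ae[OF i] _ lim_u(1,2)[OF i]]) simp
      from wgrad_AE[OF E_dom_simps(1) H1_L2[OF tN(2)[OF i]] this]
      show "AE y in leb (Dm i). lim_g i y \<bullet> ?d i y = wgrad (Dm i) (u0 \<circ> chart G i) y \<bullet> ?d i y" by eventually_elim simp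
    qed
    then have "(\<Sum>i\<in>idx. thick G i * (kap D i * (LINT y|leb (Dm i). lim_g i y \<bullet> ?d i y))) =
      (\<Sum>i\<in>idx. thick G i * (kap D i * (LINT y|leb (Dm i). wgrad (Dm i) (u0 \<circ> chart G i) y \<bullet> ?d i y)))"
      by (intro sum.cong refl) simp
    ultimately show ?thesis unfolding limit_equation_alt limit_eq_def by simp
  qed
  then show ?thesis using L E by (auto simp: limit_weak_solution_def)
qed

end

theorem mainTheorem8:
  fixes G :: hypergraph and D :: coefficients
    and \<epsilon> :: "nat \<Rightarrow> real"
    and u :: "nat \<Rightarrow> real^3 \<Rightarrow> real"
    and u0E :: "nat \<Rightarrow> real^2 \<Rightarrow> real" and u0N :: "real \<Rightarrow> real"
    and u0 :: "real^3 \<Rightarrow> real"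
  assumes geometry: "hypergraph_geometry G"
    and coefficients: "admissible_coefficients G D"
    and eps_admissible: "\<And>k. admissible_eps G (\<epsilon> k)"
    and eps_tendsto: "\<epsilon> \<longlonglongrightarrow> 0"
    and weak_solution: "\<And>k. thin_weak_solution G D (\<epsilon> k) (u k)"
    and u0E_H1: "\<And>i. i \<in> {1..num G} \<Longrightarrow>
      H1 {y. y $ 1 \<in> {0<..<len G} \<and> y $ 2 \<in> {0<..<len G}} (u0E i)"
    and u0N_L2: "L2 {0<..<len G} u0N"
    and uE_strong: "\<And>i. i \<in> {1..num G} \<Longrightarrow>
      L2_tendsto (E_ref G) (\<lambda>k. to_E_ref G (\<epsilon> k) i (u k)) (\<lambda>x. u0E i (pt2 (x $ 1) (x $ 2)))"
    and grad_uE_weak: "\<And>i. i \<in> {1..num G} \<Longrightarrow>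
      L2_weak_tendsto (E_ref G) (\<lambda>k. wgrad (E_ref G) (to_E_ref G (\<epsilon> k) i (u k)))
        (wgrad (E_ref G) (\<lambda>x. u0E i (pt2 (x $ 1) (x $ 2))))"
    and uN_weak:
      "L2_weak_tendsto (N_ref G) (\<lambda>k. to_N_ref (\<epsilon> k) (u k)) (\<lambda>x. u0N (x $ 1))"
    and grad_perp_uN_strong:
      "L2_tendsto (N_ref G)
         (\<lambda>k x. let v = wgrad (N_ref G) (to_N_ref (\<epsilon> k) (u k)) x in pt2 (v $ 2) (v $ 3))
         (\<lambda>_. 0)"
    and d3_uE_strong: "\<And>i. i \<in> {1..num G} \<Longrightarrow>
      L2_tendsto (E_ref G) (\<lambda>k x. wgrad (E_ref G) (to_E_ref G (\<epsilon> k) i (u k)) x $ 3) (\<lambda>_. 0)"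
    and u0_def: "\<And>i. i \<in> {1..num G} \<Longrightarrow>
      AE_on_E G i (\<lambda>x. u0 x = u0E i (pt2 (x $ 1) (len G / width G i * (rot G i *v x) $ 2)))"
  shows "u0 \<in> limit_space G \<and> trace_on_Ne G (num G) u0 (\<lambda>_. 0) \<and>
    (\<forall>\<phi>\<in>limit_space G. trace_on_Ne G (num G) \<phi> (\<lambda>_. 0) \<longrightarrow> limit_equation G D u0 \<phi>) \<and>
    (\<forall>v. limit_weak_solution G D v \<longrightarrow> (\<forall>i\<in>{1..num G}. AE_on_E G i (\<lambda>x. v x = u0 x)))"
proof -
  interpret thin_limit G D \<epsilon> u u0E u0N
    by (intro thin_limit.intro thin_geometry.intro thin_limit_axioms.intro)
       (rule assms; assumption?)+
  have s: "limit_weak_solution G D u0" by (rule limit_solution [OF u0_def])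
  then have "\<forall>v. limit_weak_solution G D v \<longrightarrow> (\<forall>i\<in>{1..num G}. AE_on_E G i (\<lambda>x. v x = u0 x))"
    using limit_solution_unique [OF coefficients s] by blast
  with s show ?thesis unfolding limit_weak_solution_def by blast
qed

end
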